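(* Let $n\ge1$, $B_1\subset\mathbb{R}^n$ and $s\in(0,1)$. For $m\in\mathbb{N}=\{0,1,2,\dots\}$ let $\{h_{m,l}\}_{0\le l\le l_m}$ denote the spherical harmonics of degree $m$ on $\partial B_1$. Consider the mapping $A_0$ defined by $$L^2(B_3\setminus\overline{B}_2)\ni f\mapsto r_{B_1}u\in L^2(B_1),$$ where $u$ is the solution of $(-\Delta)^su=0$ in $B_1$ with $u=\chi_{B_3\setminus\overline{B}_2}f$ in $\mathbb{R}^n\setminus\overline{B}_1$, and $r_{B_1}$ denotes the restriction to the unit ball. Then there exists an orthonormal basis $\{f_{m,k,l}\}_{m,k\in\mathbb{N},\,0\le l\le l_m}$ of $L^2(B_3\setminus\overline{B}_2)$ of the form $$f_{m,k,l}(x)=g_{m,k}(|x|)\,h_{m,l}(x/|x|)$$ such that, for constants $C,c>0$ which only depend on $n,s$, $$\|A_0f_{m,k,l}\|_{L^2(B_1)}\le C e^{-c(m+k)}\qquad\text{for all } m,k\in\mathbb{N},\ 0\le l\le l_m.$$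
   Context: $B_r$ is the open ball of radius $r$ centred at $0$ in $\mathbb{R}^n$. For each $m$, $\{h_{m,l}\}_{0\le l\le l_m}$ is an $L^2(\partial B_1)$-orthonormal basis of the space of restrictions to $\partial B_1$ of homogeneous harmonic polynomials of degree $m$ (in dimension $n=1$ these spaces are nontrivial only for $m=0,1$, and for other $m$ the index set for $l$ is empty). $(-\Delta)^s$ is the fractional Laplacian on $\mathbb{R}^n$ (Fourier multiplier $|\xi|^{2s}$). The solution $u$ with exterior data $f\in L^2(B_3\setminus\overline{B}_2)$ is $u=E_0f+v$, where $E_0f$ is the extension of $f$ by zero to $\mathbb{R}^n$ and $v\in\widetilde{H}^s(B_1)$ (the closure of $C_c^\infty(B_1)$ in $H^s(\mathbb{R}^n)$) is the unique weak solution of $(-\Delta)^sv=-((-\Delta)^sE_0f)|_{B_1}$ in $B_1$; the right-hand side is smooth on $\overline{B}_1$ because $E_0f$ is supported in $\overline{B}_3\setminus B_2$. *)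

theory Defs
  imports "HOL-Analysis.Analysis"
begin

section \<open>Square-integrable functions and orthonormal bases\<close>

text \<open>
  Elements of \<open>L\<^sup>2\<close> are represented by functions; equality is equality almost everywhere.
  Functions are complex-valued throughout.
\<close>

definition L2 :: "'a measure \<Rightarrow> ('a \<Rightarrow> complex) set" where
  "L2 M = {f \<in> borel_measurable M. integrable M (\<lambda>x. (norm (f x))\<^sup>2)}"

definition L2_inner :: "'a measure \<Rightarrow> ('a \<Rightarrow> complex) \<Rightarrow> ('a \<Rightarrow> complex) \<Rightarrow> complex" where
  "L2_inner M f g = (LINT x|M. f x * cnj (g x))"

definition L2_norm :: "'a measure \<Rightarrow> ('a \<Rightarrow> complex) \<Rightarrow> real" where
  "L2_norm M f = sqrt (LINT x|M. (norm (f x))\<^sup>2)"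

text \<open>Hilbert-space basis of a subspace \<open>V\<close> of \<open>L\<^sup>2(M)\<close>: orthonormal, with span dense in \<open>V\<close>.\<close>

definition orthonormal_basis ::
    "'a measure \<Rightarrow> ('a \<Rightarrow> complex) set \<Rightarrow> 'i set \<Rightarrow> ('i \<Rightarrow> 'a \<Rightarrow> complex) \<Rightarrow> bool" where
  "orthonormal_basis M V I e \<longleftrightarrow>
     (\<forall>i\<in>I. e i \<in> V) \<and>
     (\<forall>i\<in>I. \<forall>j\<in>I. L2_inner M (e i) (e j) = (if i = j then 1 else 0)) \<and>
     (\<forall>f\<in>V. \<forall>\<epsilon>>0. \<exists>J c. finite J \<and> J \<subseteq> I \<and>
        L2_norm M (\<lambda>x. f x - (\<Sum>j\<in>J. c j * e j x)) < \<epsilon>)"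


section \<open>Spherical harmonics\<close>

text \<open>
  Surface measure on the unit sphere of an \<open>n\<close>-dimensional space, by polar coordinates: the
  measure of \<open>A\<close> is \<open>n\<close> times the Lebesgue measure of the cone \<open>{t x | 0 < t < 1, x \<in> A}\<close>.
  For \<open>n = 1\<close> this is counting measure on the two unit vectors.
\<close>

definition sphere_measure :: "'a::euclidean_space measure" where
  "sphere_measure = scale_measure (of_nat DIM('a))
     (distr (restrict_space lborel (ball 0 1 - {0})) (restrict_space borel (sphere 0 1)) sgn)"

definition laplacian :: "('a::euclidean_space \<Rightarrow> complex) \<Rightarrow> 'a \<Rightarrow> complex" where
  "laplacian p x =
     (\<Sum>b\<in>Basis. frechet_derivative (\<lambda>y. frechet_derivative p (at y) b) (at x) b)"

definition harmonic_homogeneous_polys :: "nat \<Rightarrow> ('a::euclidean_space \<Rightarrow> complex) set" where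
  "harmonic_homogeneous_polys m =
     {p. polynomial_function p \<and> (\<forall>t x. p (t *\<^sub>R x) = t ^ m *\<^sub>R p x) \<and> (\<forall>x. laplacian p x = 0)}"

text \<open>Functions on the sphere; their values off the sphere are irrelevant.\<close>

definition spherical_harmonics :: "nat \<Rightarrow> ('a::euclidean_space \<Rightarrow> complex) set" where
  "spherical_harmonics m =
     {f. \<exists>p \<in> harmonic_homogeneous_polys m. \<forall>x \<in> sphere 0 1. f x = p x}"


section \<open>Fourier transform, Sobolev spaces and the fractional Laplacian\<close>

definition fourier :: "('a::euclidean_space \<Rightarrow> complex) \<Rightarrow> 'a \<Rightarrow> complex" where
  "fourier w \<xi> =
     of_real ((2 * pi) powr (- (real DIM('a) / 2))) * (LINT x|lborel. cis (- (x \<bullet> \<xi>)) * w x)"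

text \<open>
  The Fourier-Plancherel transform of \<open>w \<in> L\<^sup>2\<close> is the \<open>L\<^sup>2\<close>-limit of the transforms of the
  truncations of \<open>w\<close> to balls; it is determined up to null sets.
\<close>

definition has_fourier_L2 ::
    "('a::euclidean_space \<Rightarrow> complex) \<Rightarrow> ('a \<Rightarrow> complex) \<Rightarrow> bool" where
  "has_fourier_L2 w W \<longleftrightarrow> W \<in> L2 lborel \<and>
     ((\<lambda>R. L2_norm lborel (\<lambda>\<xi>. fourier (\<lambda>x. indicator (ball 0 R) x * w x) \<xi> - W \<xi>))
        \<longlongrightarrow> 0) at_top"

definition fourier_L2 :: "('a::euclidean_space \<Rightarrow> complex) \<Rightarrow> 'a \<Rightarrow> complex" where
  "fourier_L2 w = (SOME W. has_fourier_L2 w W)"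

definition Hs :: "real \<Rightarrow> ('a::euclidean_space \<Rightarrow> complex) set" where
  "Hs s = {w \<in> L2 lborel.
     integrable lborel (\<lambda>\<xi>. (1 + (norm \<xi>)\<^sup>2) powr s * (norm (fourier_L2 w \<xi>))\<^sup>2)}"

definition Hs_norm :: "real \<Rightarrow> ('a::euclidean_space \<Rightarrow> complex) \<Rightarrow> real" where
  "Hs_norm s w =
     sqrt (LINT \<xi>|lborel. (1 + (norm \<xi>)\<^sup>2) powr s * (norm (fourier_L2 w \<xi>))\<^sup>2)"

primrec Ck :: "nat \<Rightarrow> ('a::euclidean_space \<Rightarrow> complex) \<Rightarrow> bool" where
  "Ck 0 f \<longleftrightarrow> continuous_on UNIV f"
| "Ck (Suc k) f \<longleftrightarrow> (\<forall>x. f differentiable (at x)) \<and>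
     (\<forall>b\<in>Basis. Ck k (\<lambda>x. frechet_derivative f (at x) b))"

definition test_functions :: "'a::euclidean_space set \<Rightarrow> ('a \<Rightarrow> complex) set" where
  "test_functions \<Omega> =
     {\<phi>. (\<forall>k. Ck k \<phi>) \<and> compact (closure {x. \<phi> x \<noteq> 0}) \<and> closure {x. \<phi> x \<noteq> 0} \<subseteq> \<Omega>}"

text \<open>The closure of the test functions on \<open>\<Omega>\<close> in \<open>H\<^sup>s\<close> of the whole space.\<close>

definition Hs_tilde :: "real \<Rightarrow> 'a::euclidean_space set \<Rightarrow> ('a \<Rightarrow> complex) set" where
  "Hs_tilde s \<Omega> =
     {v \<in> Hs s. \<forall>\<epsilon>>0. \<exists>\<phi> \<in> test_functions \<Omega>. Hs_norm s (\<lambda>x. v x - \<phi> x) < \<epsilon>}"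

text \<open>
  For \<open>w \<in> L\<^sup>2\<close>, the tempered distribution obtained from \<open>w\<close> by the Fourier multiplier
  \<open>|\<xi>|\<close> to the power \<open>2s\<close>, applied to a test function \<open>\<phi>\<close>. With the unitary normalization of
  the transform, the inverse transform in the pairing is shifted onto \<open>\<phi>\<close>, and the inverse
  transform of \<open>\<phi>\<close> at \<open>\<xi>\<close> is \<open>fourier \<phi> (- \<xi>)\<close>. The pairing is bilinear.
\<close>

definition frac_laplacian ::
    "real \<Rightarrow> ('a::euclidean_space \<Rightarrow> complex) \<Rightarrow> ('a \<Rightarrow> complex) \<Rightarrow> complex" where
  "frac_laplacian s w \<phi> =
     (LINT \<xi>|lborel. of_real (norm \<xi> powr (2 * s)) * fourier_L2 w \<xi> * fourier \<phi> (- \<xi>))"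


section \<open>The exterior value problem\<close>

definition annulus :: "'a::euclidean_space set" where
  "annulus = ball 0 3 - cball 0 2"

definition extend_zero :: "('a::euclidean_space \<Rightarrow> complex) \<Rightarrow> 'a \<Rightarrow> complex" where
  "extend_zero f = (\<lambda>x. if x \<in> annulus then f x else 0)"

definition is_correction ::
    "real \<Rightarrow> ('a::euclidean_space \<Rightarrow> complex) \<Rightarrow> ('a \<Rightarrow> complex) \<Rightarrow> bool" where
  "is_correction s f v \<longleftrightarrow> v \<in> Hs_tilde s (ball 0 1) \<and>
     (\<forall>\<phi> \<in> test_functions (ball 0 1).
        frac_laplacian s v \<phi> = - frac_laplacian s (extend_zero f) \<phi>)"

text \<open>The correction is unique up to null sets.\<close>

definition solution :: "real \<Rightarrow> ('a::euclidean_space \<Rightarrow> complex) \<Rightarrow> 'a \<Rightarrow> complex" where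
  "solution s f = (let v = (SOME v. is_correction s f v) in (\<lambda>x. extend_zero f x + v x))"

definition A0 :: "real \<Rightarrow> ('a::euclidean_space \<Rightarrow> complex) \<Rightarrow> 'a \<Rightarrow> complex" where
  "A0 s f = restrict (solution s f) (ball 0 1)"

end

theory Submission
  imports Defs "HOL-Probability.Characteristic_Functions"
begin

text \<open>
  The correction of the zero extension of \<open>f\<close> solves a linear problem in the unit ball. Since \<open>f\<close> lives in
  the annulus, the right-hand side of that problem is, up to a constant, the smooth function
  \<open>x \<mapsto> \<integral> f(y) |x - y| powr (-n - 2s) dy\<close> (\<open>frac_laplacian_kernel\<close>). On test functions of the ball the
  energy with multiplier \<open>|\<xi>| powr (2s)\<close> controls the \<open>L\<^sup>2\<close> norm (\<open>fractional_Poincare\<close>), so the problem is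
  solved by minimisation (\<open>L2_Riesz_representation\<close>), and every correction is bounded in \<open>L\<^sup>2\<close> by a constant
  times the supremum over the ball of that function (\<open>A0_bound\<close>). What remains is to find an orthonormal
  basis of the prescribed form whose kernel integrals are exponentially small.

  The basis is \<open>f\<^bsub>m,k,l\<^esub>(x) = q\<^sub>k(|x|) h\<^bsub>m,l\<^esub>(x/|x|)\<close>, where the \<open>q\<^sub>k\<close> are the orthonormal polynomials on
  \<open>(2,3)\<close> for the weight \<open>r ^ (n - 1)\<close>; the same \<open>q\<^sub>k\<close> serve every \<open>m\<close>. Its kernel integrals are estimated in
  two ways. Both replace the kernel by a truncated binomial series of \<open>(1 + w) powr (-n/2 - s)\<close> with
  \<open>|w| \<le> 4/5\<close>, chosen so that the basis function is orthogonal to the truncation: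

  \<^item> with \<open>|x - y|\<^sup>2 = (|x|\<^sup>2 + |y|\<^sup>2)(1 + w)\<close>, the first \<open>m\<close> terms are polynomials of degree below \<open>m\<close> in
    \<open>y/|y|\<close>, to which \<open>h\<^bsub>m,l\<^esub>\<close> is orthogonal (\<open>kernel_decay_degree\<close>);
  \<^item> expanding about \<open>|y| = 5/2\<close> with the direction of \<open>y\<close> fixed, about \<open>k/2\<close> terms are polynomials of
    degree below \<open>k\<close> in \<open>|y|\<close>, to which \<open>q\<^sub>k\<close> is orthogonal (\<open>kernel_decay_radial\<close>).

  The errors are \<open>O((8/9)\<^sup>m)\<close> and \<open>O((8/9) powr (k/2))\<close>, and the smaller of the two decays exponentially in
  \<open>m + k\<close>.

  That the family is an orthonormal basis (\<open>annulus_product_basis\<close>) rests on polar coordinates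
  (\<open>polar_integral\<close>), on the orthogonality of a spherical harmonic to all polynomials of lower degree, and on
  density. Orthogonality is obtained by integrating by parts against a Gaussian on the whole space, which
  takes the place of Green's formula in the ball (\<open>gaussian_Green_identity\<close>). Density follows from the
  Stone-Weierstrass theorem, because on the sphere every polynomial is a sum of harmonic ones
  (\<open>Fischer_decomposition\<close>).

  The Fourier analysis grows out of a single identity, the pairing of two transforms against a Gaussian
  (\<open>gaussian_fourier_pairing\<close>). Letting the Gaussian widen gives Plancherel's theorem; integrating over its
  width gives the kernel of the fractional Laplacian, because \<open>|\<xi>| powr (2s)\<close> is a superposition of the
  functions \<open>1 - exp (-t |\<xi>|\<^sup>2)\<close> (\<open>subordination_symbol\<close>).
\<close>

section \<open>Square-integrable functions\<close>

lemma L2_measurable: "f \<in> L2 M \<Longrightarrow> f \<in> borel_measurable M"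
  by (simp add: L2_def)

lemma L2_integrable: "f \<in> L2 M \<Longrightarrow> integrable M (\<lambda>x. (norm (f x))\<^sup>2)"
  by (simp add: L2_def)

lemma L2_dominated:
  assumes "f \<in> borel_measurable M" "integrable M h" "\<And>x. x \<in> space M \<Longrightarrow> (norm (f x))\<^sup>2 \<le> h x"
  shows "f \<in> L2 M"
proof -
  have "integrable M (\<lambda>x. (norm (f x))\<^sup>2)"
    using assms by (intro Bochner_Integration.integrable_bound[OF assms(2)])
      (auto intro!: AE_I2 intro: order_trans[OF _ abs_ge_self])
  then show ?thesis using assms by (simp add: L2_def)
qed

lemma L2_dominated_norm:
  assumes "f \<in> borel_measurable M" "g \<in> L2 M" "\<And>x. x \<in> space M \<Longrightarrow> norm (f x) \<le> C * norm (g x)"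
  shows "f \<in> L2 M"
  using assms(1)
proof (rule L2_dominated)
  show "integrable M (\<lambda>x. C\<^sup>2 * (norm (g x))\<^sup>2)"
    using L2_integrable[OF assms(2)] by simp
  show "(norm (f x))\<^sup>2 \<le> C\<^sup>2 * (norm (g x))\<^sup>2" if "x \<in> space M" for x
    using power_mono[OF assms(3)[OF that], of 2] by (simp add: power_mult_distrib)
qed

lemma L2_zero: "(\<lambda>x. 0) \<in> L2 M"
  by (simp add: L2_def)

lemma L2_add:
  assumes "f \<in> L2 M" "g \<in> L2 M" shows "(\<lambda>x. f x + g x) \<in> L2 M"
proof (rule L2_dominated)
  show "(\<lambda>x. f x + g x) \<in> borel_measurable M"
    using assms[THEN L2_measurable] by simp
  show "integrable M (\<lambda>x. 2 * (norm (f x))\<^sup>2 + 2 * (norm (g x))\<^sup>2)"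
    using assms[THEN L2_integrable] by simp
  show "(norm (f x + g x))\<^sup>2 \<le> 2 * (norm (f x))\<^sup>2 + 2 * (norm (g x))\<^sup>2" for x
  proof -
    have "(norm (f x + g x))\<^sup>2 \<le> (norm (f x) + norm (g x))\<^sup>2"
      by (intro power_mono norm_triangle_ineq) simp
    also have "\<dots> \<le> 2 * (norm (f x))\<^sup>2 + 2 * (norm (g x))\<^sup>2"
      using sum_squares_bound[of "norm (f x)" "norm (g x)"] by (simp add: power2_sum)
    finally show ?thesis .
  qed
qed

lemma L2_cmult: "f \<in> L2 M \<Longrightarrow> (\<lambda>x. c * f x) \<in> L2 M"
  by (auto simp: L2_def norm_mult power_mult_distrib)

lemma L2_diff:
  assumes "f \<in> L2 M" "g \<in> L2 M" shows "(\<lambda>x. f x - g x) \<in> L2 M"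
  using L2_add[OF assms(1) L2_cmult[OF assms(2), of "-1"]] by simp

lemma L2_sum: "finite J \<Longrightarrow> (\<And>j. j \<in> J \<Longrightarrow> f j \<in> L2 M) \<Longrightarrow> (\<lambda>x. \<Sum>j\<in>J. f j x) \<in> L2 M"
  by (induction J rule: finite_induct) (auto intro: L2_zero L2_add)

lemma cnj_measurable [measurable (raw)]:
  "f \<in> borel_measurable M \<Longrightarrow> (\<lambda>x. cnj (f x)) \<in> borel_measurable M"
  by (rule measurable_compose[OF _ borel_measurable_continuous_onI]) (auto intro: continuous_intros)

lemma L2_cnj: "f \<in> L2 M \<Longrightarrow> (\<lambda>x. cnj (f x)) \<in> L2 M"
  by (auto simp: L2_def cnj_measurable)

lemma L2_cong:
  assumes "f \<in> L2 M" "\<And>x. x \<in> space M \<Longrightarrow> f x = g x" shows "g \<in> L2 M"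
proof -
  have "g \<in> borel_measurable M" using L2_measurable[OF assms(1)] assms(2)
    by (subst measurable_cong[where g = f]) auto
  moreover have "integrable M (\<lambda>x. (norm (g x))\<^sup>2)" using L2_integrable[OF assms(1)] assms(2)
    by (subst Bochner_Integration.integrable_cong[where g = "\<lambda>x. (norm (f x))\<^sup>2"]) auto
  ultimately show ?thesis by (simp add: L2_def)
qed

lemma L2_mult_integrable:
  fixes f g :: "'a \<Rightarrow> complex"
  assumes "f \<in> L2 M" "g \<in> L2 M"
  shows "integrable M (\<lambda>x. f x * g x)" "integrable M (\<lambda>x. f x * cnj (g x))"
    "integrable M (\<lambda>x. norm (f x) * norm (g x))"
proof -
  have 1: "integrable M (\<lambda>x. (norm (f x))\<^sup>2 + (norm (g x))\<^sup>2)"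
    using assms[THEN L2_integrable] by simp
  have *: "norm (f x) * norm (g x) \<le> (norm (f x))\<^sup>2 + (norm (g x))\<^sup>2" for x
    using sum_squares_bound[of "norm (f x)" "norm (g x)"]
      mult_nonneg_nonneg[OF norm_ge_zero[of "f x"] norm_ge_zero[of "g x"]] by linarith
  note [measurable] = assms[THEN L2_measurable]
  show "integrable M (\<lambda>x. f x * g x)" "integrable M (\<lambda>x. f x * cnj (g x))"
    "integrable M (\<lambda>x. norm (f x) * norm (g x))"
    by (rule Bochner_Integration.integrable_bound[OF 1]; simp add: norm_mult * AE_I2 cnj_measurable)+
qed

lemma L2_norm_nonneg: "L2_norm M f \<ge> 0"
  by (simp add: L2_norm_def)

lemma L2_norm_power2: "(L2_norm M f)\<^sup>2 = (LINT x|M. (norm (f x))\<^sup>2)"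
  by (simp add: L2_norm_def)

lemma L2_norm_cong: "(\<And>x. x \<in> space M \<Longrightarrow> norm (f x) = norm (g x)) \<Longrightarrow> L2_norm M f = L2_norm M g"
  by (simp add: L2_norm_def cong: Bochner_Integration.integral_cong)

lemma L2_norm_cong_AE:
  assumes "f \<in> borel_measurable M" "g \<in> borel_measurable M" "AE x in M. f x = g x"
  shows "L2_norm M f = L2_norm M g"
  unfolding L2_norm_def
  by (rule arg_cong[where f=sqrt], rule integral_cong_AE) (use assms in auto)

lemma L2_norm_mono:
  assumes "g \<in> L2 M" "\<And>x. x \<in> space M \<Longrightarrow> norm (f x) \<le> norm (g x)" "f \<in> borel_measurable M"
  shows "L2_norm M f \<le> L2_norm M g"
proof -
  have f: "f \<in> L2 M" using L2_dominated_norm[OF assms(3,1), of 1] assms(2) by simp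
  show ?thesis unfolding L2_norm_def
    using L2_integrable[OF f] L2_integrable[OF assms(1)] assms(2)
    by (intro real_sqrt_le_mono integral_mono) (auto intro: power_mono)
qed

lemma L2_norm_cmult: "L2_norm M (\<lambda>x. c * f x) = norm c * L2_norm M f"
  by (simp add: L2_norm_def norm_mult power_mult_distrib real_sqrt_mult)

lemma L2_norm_zero: "L2_norm M (\<lambda>x. 0) = 0"
  by (simp add: L2_norm_def)

lemma L2_norm_minus_commute: "L2_norm M (\<lambda>x. f x - g x) = L2_norm M (\<lambda>x. g x - f x)"
  by (rule L2_norm_cong) (simp add: norm_minus_commute)

lemma L2_norm_eq_0:
  assumes "f \<in> L2 M" "L2_norm M f = 0" shows "AE x in M. f x = 0"
proof -
  have "(LINT x|M. (norm (f x))\<^sup>2) = 0" using assms(2) by (simp add: L2_norm_def)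
  then show ?thesis
    using integral_nonneg_eq_0_iff_AE[OF L2_integrable[OF assms(1)]] by simp
qed

lemma L2_Cauchy_Schwarz_abs:
  assumes "f \<in> L2 M" "g \<in> L2 M"
  shows "(LINT x|M. norm (f x) * norm (g x)) \<le> L2_norm M f * L2_norm M g"
proof -
  define a b I where "a = L2_norm M f" and "b = L2_norm M g"
    and "I = (LINT x|M. norm (f x) * norm (g x))"
  have ab: "a \<ge> 0" "b \<ge> 0" by (simp_all add: a_def b_def L2_norm_nonneg)
  \<comment> \<open>The arithmetic-geometric mean inequality with weights; the choice \<open>t = b / a\<close> is optimal.\<close>
  have *: "I \<le> (t * a\<^sup>2 + b\<^sup>2 / t) / 2" if "t > 0" for t
  proof -
    have "I \<le> (LINT x|M. (t * (norm (f x))\<^sup>2 + (norm (g x))\<^sup>2 / t) / 2)"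
      unfolding I_def
    proof (rule integral_mono)
      show "integrable M (\<lambda>x. (t * (norm (f x))\<^sup>2 + (norm (g x))\<^sup>2 / t) / 2)"
        using assms[THEN L2_integrable] by simp
      fix x
      have "0 \<le> (sqrt t * norm (f x) - norm (g x) / sqrt t)\<^sup>2" by simp
      also have "\<dots> = t * (norm (f x))\<^sup>2 + (norm (g x))\<^sup>2 / t - 2 * (norm (f x) * norm (g x))"
        using that by (simp add: power2_diff power_mult_distrib power_divide)
      finally show "norm (f x) * norm (g x) \<le> (t * (norm (f x))\<^sup>2 + (norm (g x))\<^sup>2 / t) / 2" by simp
    qed (rule L2_mult_integrable[OF assms])
    also have "\<dots> = (t * a\<^sup>2 + b\<^sup>2 / t) / 2"
      using assms[THEN L2_integrable] by (simp add: a_def b_def L2_norm_power2)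
    finally show ?thesis .
  qed
  consider "a = 0" | "b = 0" | "a > 0" "b > 0" using ab by fastforce
  then have "I \<le> a * b"
  proof cases
    case 1
    with L2_norm_eq_0[OF assms(1)] have "AE x in M. f x = 0" by (simp add: a_def)
    then have "I = 0" unfolding I_def by (intro integral_eq_zero_AE) auto
    with ab show ?thesis by simp
  next
    case 2
    with L2_norm_eq_0[OF assms(2)] have "AE x in M. g x = 0" by (simp add: b_def)
    then have "I = 0" unfolding I_def by (intro integral_eq_zero_AE) auto
    with ab show ?thesis by simp
  next
    case 3
    with *[of "b / a"] show ?thesis by (simp add: power2_eq_square field_simps)
  qed
  then show ?thesis by (simp add: I_def a_def b_def)
qed

lemma L2_Cauchy_Schwarz:
  assumes "f \<in> L2 M" "g \<in> L2 M"
  shows "norm (L2_inner M f g) \<le> L2_norm M f * L2_norm M g"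
proof -
  have "norm (L2_inner M f g) \<le> (LINT x|M. norm (f x * cnj (g x)))"
    unfolding L2_inner_def by (rule integral_norm_bound)
  then show ?thesis using L2_Cauchy_Schwarz_abs[OF assms] by (simp add: norm_mult)
qed

lemma L2_norm_triangle:
  assumes "f \<in> L2 M" "g \<in> L2 M"
  shows "L2_norm M (\<lambda>x. f x + g x) \<le> L2_norm M f + L2_norm M g"
proof (rule power2_le_imp_le)
  have "(L2_norm M (\<lambda>x. f x + g x))\<^sup>2
      \<le> (LINT x|M. (norm (f x))\<^sup>2 + 2 * (norm (f x) * norm (g x)) + (norm (g x))\<^sup>2)"
    unfolding L2_norm_power2
  proof (rule integral_mono)
    fix x
    have "(norm (f x + g x))\<^sup>2 \<le> (norm (f x) + norm (g x))\<^sup>2"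
      by (intro power_mono norm_triangle_ineq) simp
    then show "(norm (f x + g x))\<^sup>2 \<le> (norm (f x))\<^sup>2 + 2 * (norm (f x) * norm (g x)) + (norm (g x))\<^sup>2"
      by (simp add: power2_sum)
  qed (use assms[THEN L2_integrable] L2_integrable[OF L2_add[OF assms]] L2_mult_integrable[OF assms]
      in auto)
  also have "\<dots> = (L2_norm M f)\<^sup>2 + 2 * (LINT x|M. norm (f x) * norm (g x)) + (L2_norm M g)\<^sup>2"
    using assms[THEN L2_integrable] L2_mult_integrable[OF assms] by (simp add: L2_norm_power2)
  also have "\<dots> \<le> (L2_norm M f + L2_norm M g)\<^sup>2"
    using L2_Cauchy_Schwarz_abs[OF assms] by (simp add: power2_sum)
  finally show "(L2_norm M (\<lambda>x. f x + g x))\<^sup>2 \<le> (L2_norm M f + L2_norm M g)\<^sup>2" .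
qed (simp add: L2_norm_nonneg)

lemma L2_norm_diff_triangle:
  assumes "f \<in> L2 M" "g \<in> L2 M" "h \<in> L2 M"
  shows "L2_norm M (\<lambda>x. f x - h x) \<le> L2_norm M (\<lambda>x. f x - g x) + L2_norm M (\<lambda>x. g x - h x)"
  using L2_norm_triangle[OF L2_diff[OF assms(1,2)] L2_diff[OF assms(2,3)]] by simp

lemma L2_norm_reverse_triangle:
  assumes "f \<in> L2 M" "g \<in> L2 M"
  shows "\<bar>L2_norm M f - L2_norm M g\<bar> \<le> L2_norm M (\<lambda>x. f x - g x)"
  using L2_norm_triangle[OF L2_diff[OF assms] assms(2)] L2_norm_triangle[OF L2_diff[OF assms(2,1)] assms(1)]
    L2_norm_minus_commute[of M f g] by simp

lemma L2_norm_sum: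
  assumes "finite J" "\<And>j. j \<in> J \<Longrightarrow> f j \<in> L2 M"
  shows "L2_norm M (\<lambda>x. \<Sum>j\<in>J. f j x) \<le> (\<Sum>j\<in>J. L2_norm M (f j))"
  using assms
proof (induction J rule: finite_induct)
  case empty show ?case by (simp add: L2_norm_zero)
next
  case (insert j J)
  then show ?case
    using L2_norm_triangle[of "f j" M "\<lambda>x. \<Sum>j\<in>J. f j x"] L2_sum[of J f M] by simp
qed

lemma L2_norm_tendsto:
  assumes "\<And>n. f n \<in> L2 M" "g \<in> L2 M" "(\<lambda>n. L2_norm M (\<lambda>x. f n x - g x)) \<longlonglongrightarrow> 0"
  shows "(\<lambda>n. L2_norm M (f n)) \<longlonglongrightarrow> L2_norm M g"
proof -
  have "(\<lambda>n. L2_norm M (f n) - L2_norm M g) \<longlonglongrightarrow> 0"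
    by (rule tendsto_rabs_zero_cancel, rule tendsto_sandwich[OF _ _ tendsto_const assms(3)])
      (auto intro!: always_eventually L2_norm_reverse_triangle assms)
  then show ?thesis by (simp add: LIM_zero_iff)
qed

lemma L2_inner_add_left:
  assumes "f \<in> L2 M" "g \<in> L2 M" "h \<in> L2 M"
  shows "L2_inner M (\<lambda>x. f x + g x) h = L2_inner M f h + L2_inner M g h"
  using assms by (simp add: L2_inner_def distrib_right L2_mult_integrable)

lemma L2_inner_add_right:
  assumes "f \<in> L2 M" "g \<in> L2 M" "h \<in> L2 M"
  shows "L2_inner M h (\<lambda>x. f x + g x) = L2_inner M h f + L2_inner M h g"
  using assms by (simp add: L2_inner_def distrib_left L2_mult_integrable)

lemma L2_inner_diff_left:
  assumes "f \<in> L2 M" "g \<in> L2 M" "h \<in> L2 M"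
  shows "L2_inner M (\<lambda>x. f x - g x) h = L2_inner M f h - L2_inner M g h"
  using assms by (simp add: L2_inner_def left_diff_distrib L2_mult_integrable)

lemma L2_inner_cmult_left: "L2_inner M (\<lambda>x. c * f x) h = c * L2_inner M f h"
  by (simp add: L2_inner_def mult.assoc)

lemma L2_inner_cmult_right: "L2_inner M h (\<lambda>x. c * f x) = cnj c * L2_inner M h f"
  by (simp add: L2_inner_def mult.assoc mult.left_commute[of _ "cnj c"])

lemma L2_inner_cnj: "L2_inner M g f = cnj (L2_inner M f g)"
proof -
  have "(\<lambda>x. g x * cnj (f x)) = (\<lambda>x. cnj (f x * cnj (g x)))" by (simp add: mult.commute)
  then show ?thesis unfolding L2_inner_def by (simp only: Bochner_Integration.integral_cnj)
qed

lemma L2_inner_self: "L2_inner M f f = of_real ((L2_norm M f)\<^sup>2)"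
proof -
  have "L2_inner M f f = (LINT x|M. of_real ((norm (f x))\<^sup>2))"
    unfolding L2_inner_def by (simp only: complex_norm_square)
  then show ?thesis by (simp only: L2_norm_power2 integral_complex_of_real)
qed

lemma L2_inner_tendsto_left:
  assumes "\<And>n. f n \<in> L2 M" "g \<in> L2 M" "(\<lambda>n. L2_norm M (\<lambda>x. f n x - g x)) \<longlonglongrightarrow> 0" "h \<in> L2 M"
  shows "(\<lambda>n. L2_inner M (f n) h) \<longlonglongrightarrow> L2_inner M g h"
proof -
  have "(\<lambda>n. L2_inner M (f n) h - L2_inner M g h) \<longlonglongrightarrow> 0"
  proof (rule Lim_null_comparison)
    show "\<forall>\<^sub>F n in sequentially. norm (L2_inner M (f n) h - L2_inner M g h)
       \<le> L2_norm M (\<lambda>x. f n x - g x) * L2_norm M h"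
      using assms L2_Cauchy_Schwarz[OF L2_diff[OF assms(1,2)] assms(4)]
      by (simp add: L2_inner_diff_left)
    show "(\<lambda>n. L2_norm M (\<lambda>x. f n x - g x) * L2_norm M h) \<longlonglongrightarrow> 0"
      using tendsto_mult_left_zero[OF assms(3)] .
  qed
  then show ?thesis by (simp add: LIM_zero_iff)
qed

lemma L2_parallelogram:
  assumes "f \<in> L2 M" "g \<in> L2 M"
  shows "(L2_norm M (\<lambda>x. f x - g x))\<^sup>2 = 2 * (L2_norm M f)\<^sup>2 + 2 * (L2_norm M g)\<^sup>2 - (L2_norm M (\<lambda>x. f x + g x))\<^sup>2"
proof -
  have "(L2_norm M (\<lambda>x. f x - g x))\<^sup>2 + (L2_norm M (\<lambda>x. f x + g x))\<^sup>2
     = (LINT x|M. (norm (f x - g x))\<^sup>2 + (norm (f x + g x))\<^sup>2)"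
    using L2_integrable[OF L2_add[OF assms]] L2_integrable[OF L2_diff[OF assms]]
    by (simp add: L2_norm_power2)
  also have "\<dots> = (LINT x|M. 2 * (norm (f x))\<^sup>2 + 2 * (norm (g x))\<^sup>2)"
    by (intro Bochner_Integration.integral_cong) (simp_all add: dot_square_norm[symmetric] inner_simps inner_commute)
  also have "\<dots> = 2 * (L2_norm M f)\<^sup>2 + 2 * (L2_norm M g)\<^sup>2"
    using assms[THEN L2_integrable] by (simp add: L2_norm_power2)
  finally show ?thesis by simp
qed

lemma L2_norm_add_cmult_power2:
  assumes "f \<in> L2 M" "g \<in> L2 M"
  shows "(L2_norm M (\<lambda>x. f x + c * g x))\<^sup>2
    = (L2_norm M f)\<^sup>2 + 2 * Re (cnj c * L2_inner M f g) + (norm c)\<^sup>2 * (L2_norm M g)\<^sup>2"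
proof -
  have "complex_of_real ((L2_norm M (\<lambda>x. f x + c * g x))\<^sup>2)
      = L2_inner M (\<lambda>x. f x + c * g x) (\<lambda>x. f x + c * g x)"
    by (simp only: L2_inner_self)
  also have "\<dots> = L2_inner M f f + (cnj c * L2_inner M f g + cnj (cnj c * L2_inner M f g))
      + (c * cnj c) * L2_inner M g g"
    using assms L2_cmult[OF assms(2), of c] L2_add[OF assms(1) L2_cmult[OF assms(2), of c]]
    by (simp add: L2_inner_add_left L2_inner_add_right L2_inner_cmult_left L2_inner_cmult_right
         L2_inner_cnj[of M g f] distrib_left)
  also have "\<dots> = of_real ((L2_norm M f)\<^sup>2 + 2 * Re (cnj c * L2_inner M f g) + (norm c)\<^sup>2 * (L2_norm M g)\<^sup>2)"
    by (simp only: complex_add_cnj L2_inner_self complex_norm_square[symmetric]) simp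
  finally show ?thesis by (simp only: of_real_eq_iff)
qed

section \<open>Completeness and representation of functionals\<close>

lemma L2_nn_integral:
  assumes "f \<in> L2 M"
  shows "(\<integral>\<^sup>+x. ennreal ((norm (f x))\<^sup>2) \<partial>M) = ennreal ((L2_norm M f)\<^sup>2)"
  unfolding L2_norm_power2 by (rule nn_integral_eq_integral[OF L2_integrable[OF assms]]) simp

lemma L2_norm_le_nn_integral:
  assumes "f \<in> borel_measurable M" "(\<integral>\<^sup>+x. ennreal ((norm (f x))\<^sup>2) \<partial>M) \<le> ennreal (B\<^sup>2)" "B \<ge> 0"
  shows "f \<in> L2 M \<and> L2_norm M f \<le> B"
proof -
  have i: "integrable M (\<lambda>x. (norm (f x))\<^sup>2)"
    using assms by (intro integrableI_nonneg) (auto simp: less_top[symmetric] top_unique)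
  then have L: "f \<in> L2 M" using assms by (simp add: L2_def)
  have "ennreal ((L2_norm M f)\<^sup>2) \<le> ennreal (B\<^sup>2)" using L2_nn_integral[OF L] assms by simp
  then have "(L2_norm M f)\<^sup>2 \<le> B\<^sup>2" by simp
  with L assms(3) show ?thesis by (auto intro: power2_le_imp_le)
qed

text \<open>A subsequence with summable increments has a square-integrable sum of increments, so it converges almost
  everywhere; by Fatou's lemma its pointwise limit is the limit in norm of the whole sequence.\<close>

lemma L2_complete:
  fixes F :: "nat \<Rightarrow> 'a \<Rightarrow> complex"
  assumes L: "\<And>n. F n \<in> L2 M"
    and Cauchy: "\<And>\<epsilon>. \<epsilon> > 0 \<Longrightarrow> \<exists>N. \<forall>m\<ge>N. \<forall>n\<ge>N. L2_norm M (\<lambda>x. F m x - F n x) < \<epsilon>"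
  shows "\<exists>G\<in>L2 M. (\<lambda>n. L2_norm M (\<lambda>x. F n x - G x)) \<longlonglongrightarrow> 0"
proof -
  have "\<forall>k. \<exists>N. \<forall>m\<ge>N. \<forall>n\<ge>N. L2_norm M (\<lambda>x. F m x - F n x) < (1/2)^k"
    using Cauchy by simp
  then obtain N where N: "\<And>k m n. m \<ge> N k \<Longrightarrow> n \<ge> N k \<Longrightarrow> L2_norm M (\<lambda>x. F m x - F n x) < (1/2)^k"
    by metis
  define r where "r k = (\<Sum>i\<le>k. N i) + k" for k
  have rN: "r k \<ge> N k" for k
    unfolding r_def by (simp add: member_le_sum trans_le_add1)
  have rS: "r (Suc k) \<ge> N k" for k
    using member_le_sum[of k "{..Suc k}" N] unfolding r_def by simp
  have rk: "r k \<ge> k" for k by (simp add: r_def)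
  note [measurable] = L[THEN L2_measurable]
  define D where "D k x = norm (F (r (Suc k)) x - F (r k) x)" for k x
  have DL: "(\<lambda>x. complex_of_real (D k x)) \<in> L2 M" for k
    unfolding D_def by (rule L2_dominated_norm[OF _ L2_diff[OF L L], where C=1]) auto
  have D2: "L2_norm M (\<lambda>x. complex_of_real (D k x)) \<le> (1/2)^k" for k
  proof -
    have "L2_norm M (\<lambda>x. complex_of_real (D k x)) = L2_norm M (\<lambda>x. F (r (Suc k)) x - F (r k) x)"
      by (rule L2_norm_cong) (simp add: D_def)
    then show ?thesis using N[OF rS[of k] rN[of k]] by simp
  qed
  have S: "(\<integral>\<^sup>+x. ennreal ((\<Sum>k<n. D k x)\<^sup>2) \<partial>M) \<le> ennreal (2\<^sup>2)" for n
  proof -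
    have "L2_norm M (\<lambda>x. complex_of_real (\<Sum>k<n. D k x)) \<le> (\<Sum>k<n. (1/2)^k)"
      unfolding of_real_sum by (intro order_trans[OF L2_norm_sum sum_mono] DL D2) auto
    also have "\<dots> \<le> 2" by (simp add: sum_gp_strict)
    finally have 1: "L2_norm M (\<lambda>x. complex_of_real (\<Sum>k<n. D k x)) \<le> 2" .
    have 2: "(\<lambda>x. complex_of_real (\<Sum>k<n. D k x)) \<in> L2 M"
      using L2_sum[of "{..<n}" "\<lambda>k x. complex_of_real (D k x)" M] DL by simp
    have "(\<integral>\<^sup>+x. ennreal ((\<Sum>k<n. D k x)\<^sup>2) \<partial>M) = ennreal ((L2_norm M (\<lambda>x. complex_of_real (\<Sum>k<n. D k x)))\<^sup>2)"
      unfolding L2_nn_integral[OF 2, symmetric] norm_of_real power2_abs ..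
    also have "\<dots> \<le> ennreal (2\<^sup>2)" by (intro ennreal_leI power_mono 1 L2_norm_nonneg)
    finally show ?thesis .
  qed
  have [measurable]: "D k \<in> borel_measurable M" for k unfolding D_def by simp
  have D0: "D k x \<ge> 0" for k x by (simp add: D_def)
  have "(\<integral>\<^sup>+x. (SUP n. ennreal ((\<Sum>k<n. D k x)\<^sup>2)) \<partial>M) = (SUP n. \<integral>\<^sup>+x. ennreal ((\<Sum>k<n. D k x)\<^sup>2) \<partial>M)"
    by (rule nn_integral_monotone_convergence_SUP)
      (auto simp: incseq_def le_fun_def intro!: ennreal_leI power_mono sum_mono2 sum_nonneg D0)
  also have "\<dots> \<le> ennreal (2\<^sup>2)" by (rule SUP_least) (rule S)
  finally have "(\<integral>\<^sup>+x. (SUP n. ennreal ((\<Sum>k<n. D k x)\<^sup>2)) \<partial>M) \<noteq> \<infinity>" by (auto simp: top_unique)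
  then have "AE x in M. (SUP n. ennreal ((\<Sum>k<n. D k x)\<^sup>2)) \<noteq> \<infinity>"
    by (intro nn_integral_PInf_AE) auto
  then have conv: "AE x in M. convergent (\<lambda>k. F (r k) x)"
  proof eventually_elim
    case (elim x)
    then obtain b where b: "b \<ge> 0" "(SUP n. ennreal ((\<Sum>k<n. D k x)\<^sup>2)) = ennreal b"
      by (metis ennreal_cases infinity_ennreal_def)
    have "ennreal ((\<Sum>k<n. D k x)\<^sup>2) \<le> ennreal b" for n
      unfolding b(2)[symmetric] by (rule SUP_upper) simp
    then have "(\<Sum>k<n. D k x)\<^sup>2 \<le> b" for n using b by simp
    then have "(\<Sum>k<n. D k x) \<le> sqrt b" for n by (rule real_le_rsqrt)
    then have "summable (\<lambda>k. D k x)" by (intro summableI_nonneg_bounded[where x = "sqrt b"] D0)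
    then have "summable (\<lambda>k. F (r (Suc k)) x - F (r k) x)"
      unfolding D_def by (rule summable_norm_cancel)
    then have "convergent (\<lambda>n. \<Sum>k<n. F (r (Suc k)) x - F (r k) x)"
      by (simp add: summable_iff_convergent)
    then have "convergent (\<lambda>n. F (r n) x - F (r 0) x)" by (subst (asm) sum_lessThan_telescope)
    from convergent_add[OF this convergent_const[of "F (r 0) x"]] show ?case by simp
  qed
  define G where "G x = lim (\<lambda>k. F (r k) x)" for x
  have [measurable]: "G \<in> borel_measurable M" unfolding G_def by measurable
  have lim: "AE x in M. (\<lambda>k. F (r k) x) \<longlonglongrightarrow> G x"
    using conv by eventually_elim (simp add: G_def convergent_LIMSEQ_iff)
  have bound: "(\<lambda>x. F n x - G x) \<in> L2 M \<and> L2_norm M (\<lambda>x. F n x - G x) \<le> (1/2)^k" if "n \<ge> N k" for n k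
  proof (rule L2_norm_le_nn_integral)
    have "(\<integral>\<^sup>+x. ennreal ((norm (F n x - G x))\<^sup>2) \<partial>M)
      = (\<integral>\<^sup>+x. liminf (\<lambda>j. ennreal ((norm (F n x - F (r j) x))\<^sup>2)) \<partial>M)"
    proof (rule nn_integral_cong_AE, use lim in eventually_elim)
      case (elim x)
      have "(\<lambda>j. (norm (F n x - F (r j) x))\<^sup>2) \<longlonglongrightarrow> (norm (F n x - G x))\<^sup>2"
        by (intro tendsto_intros elim)
      from lim_imp_Liminf[OF sequentially_bot tendsto_ennrealI[OF this]] show ?case by simp
    qed
    also have "\<dots> \<le> liminf (\<lambda>j. \<integral>\<^sup>+x. ennreal ((norm (F n x - F (r j) x))\<^sup>2) \<partial>M)"
      by (rule nn_integral_liminf) simp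
    also have "\<dots> \<le> ennreal (((1/2)^k)\<^sup>2)"
    proof (rule Liminf_le)
      show "\<forall>\<^sub>F j in sequentially. (\<integral>\<^sup>+x. ennreal ((norm (F n x - F (r j) x))\<^sup>2) \<partial>M) \<le> ennreal (((1/2)^k)\<^sup>2)"
        using eventually_ge_at_top[of "N k"]
      proof eventually_elim
        case (elim j)
        then have "r j \<ge> N k" using rk[of j] by simp
        from N[OF that this] show ?case unfolding L2_nn_integral[OF L2_diff[OF L L]]
          by (intro ennreal_leI power_mono) (auto simp: L2_norm_nonneg)
      qed
    qed simp
    finally show "(\<integral>\<^sup>+x. ennreal ((norm (F n x - G x))\<^sup>2) \<partial>M) \<le> ennreal (((1/2)^k)\<^sup>2)" .
  qed auto
  have "(\<lambda>x. F (N 0) x - (F (N 0) x - G x)) \<in> L2 M"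
    by (rule L2_diff[OF L]) (use bound[of 0 "N 0"] in simp)
  then have "G \<in> L2 M" by simp
  moreover have "(\<lambda>n. L2_norm M (\<lambda>x. F n x - G x)) \<longlonglongrightarrow> 0"
  proof (rule LIMSEQ_I)
    fix e :: real assume "e > 0"
    then obtain k where k: "(1/2)^k < e" using real_arch_pow_inv[of e "1/2"] by auto
    show "\<exists>no. \<forall>n\<ge>no. norm (L2_norm M (\<lambda>x. F n x - G x) - 0) < e"
    proof (intro exI allI impI)
      fix n assume "n \<ge> N k"
      with bound[OF this] k show "norm (L2_norm M (\<lambda>x. F n x - G x) - 0) < e"
        by (simp add: L2_norm_nonneg)
    qed
  qed
  ultimately show ?thesis by blast
qed


text \<open>The vector \<open>u\<close> is the limit of a minimising sequence of \<open>\<parallel>T f\<parallel>\<^sup>2 - 2 Re (l f)\<close>: the parallelogram law makes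
  such a sequence Cauchy, and varying it in the direction \<open>g\<close> yields the equation. Parametrising the subspace
  by \<open>T\<close> lets \<open>l\<close> be given on test functions, without first showing that it factors through \<open>T\<close>.\<close>

lemma L2_Riesz_representation:
  fixes T :: "('b \<Rightarrow> complex) \<Rightarrow> 'a \<Rightarrow> complex" and l :: "('b \<Rightarrow> complex) \<Rightarrow> complex"
  assumes zero: "(\<lambda>_. 0) \<in> X"
    and lin: "\<And>f g c. f \<in> X \<Longrightarrow> g \<in> X \<Longrightarrow> (\<lambda>x. f x + c * g x) \<in> X"
    and T: "\<And>f. f \<in> X \<Longrightarrow> T f \<in> L2 M"
    and Tlin: "\<And>f g c x. f \<in> X \<Longrightarrow> g \<in> X \<Longrightarrow> T (\<lambda>x. f x + c * g x) x = T f x + c * T g x"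
    and l: "\<And>f g c. f \<in> X \<Longrightarrow> g \<in> X \<Longrightarrow> l (\<lambda>x. f x + c * g x) = l f + cnj c * l g"
    and bounded: "\<And>f. f \<in> X \<Longrightarrow> norm (l f) \<le> B * L2_norm M (T f)"
  shows "\<exists>u\<in>L2 M. (\<exists>f. (\<forall>n. f n \<in> X) \<and> (\<lambda>n. L2_norm M (\<lambda>x. T (f n) x - u x)) \<longlonglongrightarrow> 0)
            \<and> (\<forall>g\<in>X. L2_inner M u (T g) = l g)"
proof -
  define J where "J f = (L2_norm M (T f))\<^sup>2 - 2 * Re (l f)" for f
  have J_bound: "J f \<ge> - (B\<^sup>2)" if "f \<in> X" for f
  proof -
    have "Re (l f) \<le> B * L2_norm M (T f)"
      using complex_Re_le_cmod[of "l f"] bounded[OF that] by linarith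
    moreover have "0 \<le> (L2_norm M (T f) - B)\<^sup>2" by simp
    ultimately show ?thesis by (simp add: J_def power2_diff algebra_simps)
  qed
  define d where "d = Inf (J ` X)"
  have bdd: "bdd_below (J ` X)" using J_bound by (auto intro!: bdd_belowI2)
  have d_le: "d \<le> J f" if "f \<in> X" for f unfolding d_def by (rule cInf_lower[OF _ bdd]) (use that in auto)
  have "\<exists>f\<in>X. J f < d + inverse (real (Suc n))" for n
    using cInf_lessD[of "J ` X" "d + inverse (real (Suc n))"] zero unfolding d_def by fastforce
  then obtain f where f: "\<And>n. f n \<in> X" "\<And>n. J (f n) < d + inverse (real (Suc n))" by metis
  have J_expand: "J (\<lambda>x. f x + c * g x)
      = J f + 2 * Re (cnj c * (L2_inner M (T f) (T g) - l g)) + (norm c)\<^sup>2 * (L2_norm M (T g))\<^sup>2"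
    if "f \<in> X" "g \<in> X" for f g c
  proof -
    have "L2_norm M (T (\<lambda>x. f x + c * g x)) = L2_norm M (\<lambda>x. T f x + c * T g x)"
      by (rule L2_norm_cong) (simp add: Tlin that)
    then show ?thesis
      by (simp add: J_def L2_norm_add_cmult_power2 T that l algebra_simps)
  qed
  have cauchy: "(L2_norm M (\<lambda>x. T (f m) x - T (f n) x))\<^sup>2 \<le> 2 * inverse (real (Suc m)) + 2 * inverse (real (Suc n))" for m n
  proof -
    define h where "h x = 0 + (1/2) * (f m x + 1 * f n x)" for x
    \<comment> \<open>The midpoint is reached from zero because \<open>lin\<close> only offers combinations \<open>f + c * g\<close>.\<close>
    have h: "h \<in> X" unfolding h_def by (intro lin zero f)
    have Tz: "T (\<lambda>_. 0) x = 0" for x using Tlin[OF zero zero, of 1 x] by simp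
    have lz: "l (\<lambda>_. 0) = 0" using l[OF zero zero, of 1] by simp
    have Th: "T h x = (1/2) * (T (f m) x + T (f n) x)" for x
    proof -
      have "T h x = T (\<lambda>_. 0) x + (1/2) * T (\<lambda>x. f m x + 1 * f n x) x"
        unfolding h_def by (rule Tlin) (intro zero lin f)+
      then show ?thesis by (simp add: Tz Tlin[OF f(1) f(1), of m 1 n, simplified])
    qed
    have lh: "l h = (1/2) * (l (f m) + l (f n))"
    proof -
      have "l h = l (\<lambda>_. 0) + cnj (1/2) * l (\<lambda>x. f m x + 1 * f n x)"
        unfolding h_def by (rule l) (intro zero lin f)+
      then show ?thesis by (simp add: lz l[OF f(1) f(1), of m 1 n, simplified])
    qed
    have "L2_norm M (T h) = (1/2) * L2_norm M (\<lambda>x. T (f m) x + T (f n) x)"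
      using L2_norm_cmult[of M "1/2" "\<lambda>x. T (f m) x + T (f n) x"] unfolding Th[abs_def] by simp
    then have *: "L2_norm M (\<lambda>x. T (f m) x + T (f n) x) = 2 * L2_norm M (T h)" by simp
    have "4 * (L2_norm M (T h))\<^sup>2 = (L2_norm M (\<lambda>x. T (f m) x + T (f n) x))\<^sup>2"
      unfolding * by (simp add: power_mult_distrib)
    then have "4 * J h = (L2_norm M (\<lambda>x. T (f m) x + T (f n) x))\<^sup>2 - 4 * Re (l (f m) + l (f n))"
      by (simp add: J_def lh field_simps)
    with L2_parallelogram[OF T T, OF f(1) f(1), of m n]
    have "(L2_norm M (\<lambda>x. T (f m) x - T (f n) x))\<^sup>2 = 2 * J (f m) + 2 * J (f n) - 4 * J h"
      by (simp add: J_def)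
    then show ?thesis using f(2)[of m] f(2)[of n] d_le[OF h] by linarith
  qed
  have "\<exists>u\<in>L2 M. (\<lambda>n. L2_norm M (\<lambda>x. T (f n) x - u x)) \<longlonglongrightarrow> 0"
  proof (rule L2_complete[OF T[OF f(1)]])
    fix e :: real assume "e > 0"
    then obtain N where N: "inverse (real (Suc N)) < e\<^sup>2 / 4" using reals_Archimedean[of "e\<^sup>2/4"] by auto
    show "\<exists>N. \<forall>m\<ge>N. \<forall>n\<ge>N. L2_norm M (\<lambda>x. T (f m) x - T (f n) x) < e"
    proof (intro exI allI impI)
      fix m n assume "m \<ge> N" "n \<ge> N"
      then have "inverse (real (Suc m)) \<le> inverse (real (Suc N))" "inverse (real (Suc n)) \<le> inverse (real (Suc N))"
        by (simp_all add: field_simps)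
      with N cauchy[of m n] have "(L2_norm M (\<lambda>x. T (f m) x - T (f n) x))\<^sup>2 < e\<^sup>2" by linarith
      then show "L2_norm M (\<lambda>x. T (f m) x - T (f n) x) < e"
        using \<open>e > 0\<close> by (simp add: power2_less_imp_less)
    qed
  qed
  then obtain u where u: "u \<in> L2 M" "(\<lambda>n. L2_norm M (\<lambda>x. T (f n) x - u x)) \<longlonglongrightarrow> 0" by blast
  have "L2_inner M u (T g) = l g" if g: "g \<in> X" for g
  proof -
    define w where "w = L2_inner M u (T g) - l g"
    define b where "b = (L2_norm M (T g))\<^sup>2"
    have quad: "0 \<le> 2 * Re (cnj c * w) + (norm c)\<^sup>2 * b" for c
    proof (rule LIMSEQ_le)
      show "(\<lambda>n. - inverse (real (Suc n))) \<longlonglongrightarrow> 0"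
        using tendsto_minus[OF LIMSEQ_inverse_real_of_nat] by simp
      show "(\<lambda>n. 2 * Re (cnj c * (L2_inner M (T (f n)) (T g) - l g)) + (norm c)\<^sup>2 * b)
          \<longlonglongrightarrow> 2 * Re (cnj c * w) + (norm c)\<^sup>2 * b"
        unfolding w_def
        by (intro tendsto_intros L2_inner_tendsto_left T f u g)
      have "- inverse (real (Suc n)) \<le> 2 * Re (cnj c * (L2_inner M (T (f n)) (T g) - l g)) + (norm c)\<^sup>2 * b" for n
        using d_le[OF lin[OF f(1)[of n] g, of c]] f(2)[of n] unfolding J_expand[OF f(1) g] b_def by linarith
      then show "\<exists>N. \<forall>n\<ge>N. - inverse (real (Suc n)) \<le> 2 * Re (cnj c * (L2_inner M (T (f n)) (T g) - l g)) + (norm c)\<^sup>2 * b"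
        by blast
    qed
    have b0: "b \<ge> 0" by (simp add: b_def)
    \<comment> \<open>Testing with a small negative multiple of \<open>w\<close> contradicts minimality unless \<open>w = 0\<close>.\<close>
    define t where "t = 1 / (1 + b)"
    have t: "t > 0" "t * b < 2" using b0 by (simp_all add: t_def field_simps)
    have "0 \<le> 2 * Re (cnj (- (of_real t * w)) * w) + (norm (- (of_real t * w)))\<^sup>2 * b" by (rule quad)
    also have "Re (cnj (- (of_real t * w)) * w) = - (t * (norm w)\<^sup>2)"
      by (simp add: cmod_power2) (simp add: power2_eq_square algebra_simps)
    also have "(norm (- (of_real t * w)))\<^sup>2 = t\<^sup>2 * (norm w)\<^sup>2"
      by (simp add: norm_mult power_mult_distrib)
    also have "2 * - (t * (norm w)\<^sup>2) + t\<^sup>2 * (norm w)\<^sup>2 * b = t * (norm w)\<^sup>2 * (t * b - 2)"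
      by (simp add: power2_eq_square algebra_simps)
    finally have "(norm w)\<^sup>2 = 0" using t by (auto simp: zero_le_mult_iff mult_le_0_iff)
    then show ?thesis by (simp add: w_def)
  qed
  with u f(1) show ?thesis by blast
qed

section \<open>Density of continuous functions with compact support\<close>

lemma L2_norm_dominated_convergence:
  fixes F :: "nat \<Rightarrow> 'a \<Rightarrow> complex"
  assumes "\<And>n. F n \<in> borel_measurable M" "G \<in> borel_measurable M" "h \<in> L2 M"
    "\<And>n x. x \<in> space M \<Longrightarrow> norm (F n x) \<le> norm (h x)"
    "AE x in M. (\<lambda>n. F n x) \<longlonglongrightarrow> G x" "\<And>x. x \<in> space M \<Longrightarrow> norm (G x) \<le> norm (h x)"
  shows "(\<lambda>n. L2_norm M (\<lambda>x. F n x - G x)) \<longlonglongrightarrow> 0"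
proof -
  have "(\<lambda>n. LINT x|M. (norm (F n x - G x))\<^sup>2) \<longlonglongrightarrow> (LINT x|M. 0)"
  proof (rule integral_dominated_convergence)
    show "AE x in M. (\<lambda>n. (norm (F n x - G x))\<^sup>2) \<longlonglongrightarrow> 0"
      using assms(5)
    proof eventually_elim
      case (elim x)
      have "(\<lambda>n. (norm (F n x - G x))\<^sup>2) \<longlonglongrightarrow> (norm (G x - G x))\<^sup>2"
        by (intro tendsto_intros elim)
      then show ?case by simp
    qed
    show "integrable M (\<lambda>x. 4 * (norm (h x))\<^sup>2)" using L2_integrable[OF assms(3)] by simp
    show "AE x in M. norm ((norm (F n x - G x))\<^sup>2) \<le> 4 * (norm (h x))\<^sup>2" for n
    proof (rule AE_I2)
      fix x assume x: "x \<in> space M"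
      have "norm (F n x - G x) \<le> 2 * norm (h x)"
        using norm_triangle_ineq4[of "F n x" "G x"] assms(4,6)[OF x] by (smt (verit))
      from power_mono[OF this, of 2] show "norm ((norm (F n x - G x))\<^sup>2) \<le> 4 * (norm (h x))\<^sup>2"
        by (simp add: power_mult_distrib)
    qed
  qed (use assms in auto)
  then show ?thesis unfolding L2_norm_def by (auto intro: tendsto_eq_intros)
qed

lemma ball_borel [measurable]: "ball (a::'a::metric_space) r \<in> sets borel" "cball a r \<in> sets borel"
  by auto

lemma L2_truncation_tendsto:
  fixes w :: "'a::euclidean_space \<Rightarrow> complex"
  assumes "w \<in> L2 lborel" 
  shows "(\<lambda>n. L2_norm lborel (\<lambda>x. indicator (ball 0 (real n)) x * w x - w x)) \<longlonglongrightarrow> 0"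
proof (rule L2_norm_dominated_convergence[OF _ _ assms])
  have [measurable]: "w \<in> borel_measurable borel" using L2_measurable[OF assms] by simp
  show "(\<lambda>x. indicator (ball 0 (real n)) x * w x) \<in> borel_measurable lborel" for n by measurable
  show "w \<in> borel_measurable lborel" by measurable
  show "norm (indicator (ball 0 (real n)) x * w x) \<le> norm (w x)" for n x
    by (simp split: split_indicator)
  show "AE x in lborel. (\<lambda>n. indicator (ball 0 (real n)) x * w x) \<longlonglongrightarrow> w x"
  proof (rule AE_I2)
    fix x :: 'a
    have "\<forall>\<^sub>F n in sequentially. norm x < real n"
      using reals_Archimedean2[of "norm x"] by (metis eventually_at_top_dense filterlim_at_top_dense filterlim_real_sequentially)
    then have "\<forall>\<^sub>F n in sequentially. indicator (ball 0 (real n)) x * w x = w x"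
      by eventually_elim simp
    then show "(\<lambda>n. indicator (ball 0 (real n)) x * w x) \<longlonglongrightarrow> w x" by (rule tendsto_eventually)
  qed
qed simp

lemma L2_bounded_support:
  fixes f :: "'a::euclidean_space \<Rightarrow> complex"
  assumes "f \<in> borel_measurable lborel" "\<And>x. norm (f x) \<le> N" "\<And>x. norm x > R \<Longrightarrow> f x = 0"
  shows "f \<in> L2 lborel" "integrable lborel f"
proof -
  have N: "N \<ge> 0" using assms(2)[of 0] norm_ge_zero order_trans by blast
  have i: "integrable lborel (\<lambda>x::'a. c * indicator (cball 0 R) x :: real)" for c
    by (rule integrable_mult_right) (auto intro!: integrable_real_indicator simp: emeasure_lborel_cball_finite intro!: emeasure_bounded_finite)
  show "f \<in> L2 lborel"
  proof (rule L2_dominated[OF assms(1) i])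
    show "(norm (f x))\<^sup>2 \<le> N\<^sup>2 * indicator (cball 0 R) x" for x
      using power_mono[OF assms(2)[of x], of 2] assms(3)[of x] by (auto split: split_indicator simp: not_le)
  qed
  show "integrable lborel f"
  proof (rule Bochner_Integration.integrable_bound[OF i[of N] assms(1)])
    show "AE x in lborel. norm (f x) \<le> norm (N * indicator (cball 0 R) x)"
      using assms(2,3) N by (intro AE_I2) (auto split: split_indicator simp: not_le)
  qed
qed

lemma L2_bounded_approx:
  fixes w :: "'a::euclidean_space \<Rightarrow> complex"
  assumes w: "w \<in> L2 lborel" and e: "e > 0"
  shows "\<exists>N>0. \<exists>v. v \<in> borel_measurable lborel \<and> (\<forall>x. norm (v x) \<le> N) \<and> (\<forall>x. norm x > N \<longrightarrow> v x = 0)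
           \<and> L2_norm lborel (\<lambda>x. w x - v x) < e"
proof -
  have [measurable]: "w \<in> borel_measurable borel" using L2_measurable[OF w] by simp
  define v where "v n x = indicator (cball 0 (real n)) x * (if norm (w x) \<le> real n then w x else 0)" for n x
  have [measurable]: "v n \<in> borel_measurable lborel" for n unfolding v_def by measurable
  have "(\<lambda>n. L2_norm lborel (\<lambda>x. v n x - w x)) \<longlonglongrightarrow> 0"
  proof (rule L2_norm_dominated_convergence[OF _ _ w])
    show "AE x in lborel. (\<lambda>n. v n x) \<longlonglongrightarrow> w x"
    proof (rule AE_I2)
      fix x :: 'a
      have "\<forall>\<^sub>F n in sequentially. max (norm x) (norm (w x)) < real n"
        by (metis eventually_at_top_dense filterlim_at_top_dense filterlim_real_sequentially)
      then have "\<forall>\<^sub>F n in sequentially. v n x = w x"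
        by eventually_elim (simp add: v_def)
      then show "(\<lambda>n. v n x) \<longlonglongrightarrow> w x" by (rule tendsto_eventually)
    qed
  qed (auto simp: v_def split: split_indicator)
  then have "\<forall>\<^sub>F n in sequentially. L2_norm lborel (\<lambda>x. v n x - w x) < e"
    using e by (rule order_tendstoD)
  then have "\<forall>\<^sub>F n in sequentially. L2_norm lborel (\<lambda>x. v n x - w x) < e \<and> n > 0"
    using eventually_gt_at_top[of 0] by eventually_elim simp
  then obtain n where n: "L2_norm lborel (\<lambda>x. v n x - w x) < e" "n > 0"
    by (auto simp: eventually_sequentially)
  show ?thesis
  proof (intro exI[of _ "real n"] exI[of _ "v n"] conjI allI impI)
    show "L2_norm lborel (\<lambda>x. w x - v n x) < e" using n L2_norm_minus_commute[of lborel w "v n"] by simp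
  qed (use n in \<open>auto simp: v_def split: split_indicator\<close>)
qed

text \<open>A Borel function is almost everywhere a limit of continuous functions. Once the function has been made
  bounded with bounded support, its approximants may be cut off in value and in space, and dominated
  convergence applies.\<close>

lemma L2_continuous_approx:
  fixes w :: "'a::euclidean_space \<Rightarrow> complex"
  assumes w: "w \<in> L2 lborel" and e: "e > 0"
  shows "\<exists>\<phi> R. continuous_on UNIV \<phi> \<and> (\<forall>x. norm x > R \<longrightarrow> \<phi> x = 0) \<and> L2_norm lborel (\<lambda>x. w x - \<phi> x) < e"
proof -
  obtain N v where N: "N > 0" and v [measurable]: "v \<in> borel_measurable lborel"
    and v1: "\<And>x. norm (v x) \<le> N" "\<And>x. norm x > N \<Longrightarrow> v x = 0"
    and wv: "L2_norm lborel (\<lambda>x. w x - v x) < e / 2"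
    using L2_bounded_approx[OF w, of "e/2"] e by auto
  have "v \<in> borel_measurable lebesgue" using v by (simp add: measurable_completion)
  then have "v measurable_on UNIV"
    using lebesgue_measurable_imp_measurable_on[of v UNIV] by (simp add: lebesgue_on_UNIV_eq)
  then obtain Z g where Z: "negligible Z" and g: "\<And>n. continuous_on UNIV (g n)"
    "\<And>x. x \<notin> Z \<Longrightarrow> (\<lambda>n. g n x) \<longlonglongrightarrow> v x"
    unfolding measurable_on_def by auto
  define cut where "cut x = max 0 (min 1 (N + 1 - norm x))" for x :: 'a
  define \<phi> where "\<phi> n x = of_real (cut x * (N / max N (norm (g n x)))) * g n x" for n x
  have c: "continuous_on UNIV (\<phi> n)" for n
    unfolding \<phi>_def cut_def using g(1)[of n] N by (intro continuous_intros) auto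
  have cut: "0 \<le> cut x" "cut x \<le> 1" "norm x > N + 1 \<Longrightarrow> cut x = 0" "norm x \<le> N \<Longrightarrow> cut x = 1" for x
    by (auto simp: cut_def)
  have \<phi>N: "norm (\<phi> n x) \<le> N" for n x
  proof -
    have "norm (\<phi> n x) = cut x * (N * (norm (g n x) / max N (norm (g n x))))"
      using cut[of x] N unfolding \<phi>_def norm_mult norm_of_real abs_mult by simp
    also have "\<dots> \<le> 1 * (N * 1)"
      using cut[of x] N by (intro mult_mono) (auto simp: divide_le_eq_1)
    finally show ?thesis by simp
  qed
  have \<phi>0: "norm x > N + 1 \<Longrightarrow> \<phi> n x = 0" for n x using cut(3)[of x] by (simp add: \<phi>_def)
  have [measurable]: "\<phi> n \<in> borel_measurable borel" for n
    using borel_measurable_continuous_onI[OF c[of n]] by simp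
  define h :: "'a \<Rightarrow> complex" where "h x = of_real N * indicator (cball 0 (N+1)) x" for x
  have h: "h \<in> L2 lborel" 
    by (rule L2_bounded_support[of _ N "N+1"]) (use N in \<open>auto simp: h_def [abs_def] split: split_indicator\<close>)
  have "(\<lambda>n. L2_norm lborel (\<lambda>x. \<phi> n x - v x)) \<longlonglongrightarrow> 0"
  proof (rule L2_norm_dominated_convergence[OF _ _ h])
    show "norm (\<phi> n x) \<le> norm (h x)" for n x
      using \<phi>N[of n x] \<phi>0[of x n] N by (auto simp: h_def split: split_indicator)
    show "norm (v x) \<le> norm (h x)" for x
      using v1[of x] N by (auto simp: h_def split: split_indicator)
    have "AE x in lebesgue. x \<notin> Z" using Z by (simp add: negligible_iff_null_sets AE_not_in)
    then have "AE x in lebesgue. (\<lambda>n. \<phi> n x) \<longlonglongrightarrow> v x"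
    proof eventually_elim
      case (elim x)
      have "(\<lambda>n. \<phi> n x) \<longlonglongrightarrow> of_real (cut x * (N / max N (norm (v x)))) * v x"
        unfolding \<phi>_def using N by (intro tendsto_intros g elim) auto
      also have "of_real (cut x * (N / max N (norm (v x)))) * v x = v x"
      proof (cases "norm x \<le> N")
        case True
        then show ?thesis using cut(4)[of x] v1(1)[of x] N by (simp add: max_absorb1)
      qed (use v1(2)[of x] in auto)
      finally show ?case .
    qed
    then show "AE x in lborel. (\<lambda>n. \<phi> n x) \<longlonglongrightarrow> v x"
      by (simp add: AE_completion_iff)
  qed auto
  then have "\<forall>\<^sub>F n in sequentially. L2_norm lborel (\<lambda>x. \<phi> n x - v x) < e / 2"
    using e by (intro order_tendstoD) auto
  then obtain n where n: "L2_norm lborel (\<lambda>x. \<phi> n x - v x) < e / 2"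
    by (auto simp: eventually_sequentially)
  have vL: "v \<in> L2 lborel" by (rule L2_bounded_support[OF v v1])
  have \<phi>L: "\<phi> n \<in> L2 lborel" by (rule L2_bounded_support[OF _ \<phi>N \<phi>0]) auto
  have "L2_norm lborel (\<lambda>x. w x - \<phi> n x) < e"
    using L2_norm_diff_triangle[OF w vL \<phi>L] wv n L2_norm_minus_commute[of lborel v "\<phi> n"] by simp
  with c \<phi>0 show ?thesis by blast
qed


section \<open>Integrals over product spaces\<close>

lemma integrable_pair_product:
  fixes f :: "'a \<Rightarrow> complex" and g :: "'b \<Rightarrow> complex"
  assumes "sigma_finite_measure M1" "sigma_finite_measure M2" 
    and f: "integrable M1 f" and g: "integrable M2 g"
  shows "integrable (M1 \<Otimes>\<^sub>M M2) (\<lambda>p. f (fst p) * g (snd p))"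
    "(LINT p|(M1 \<Otimes>\<^sub>M M2). f (fst p) * g (snd p)) = (LINT x|M1. f x) * (LINT y|M2. g y)"
proof -
  interpret A: sigma_finite_measure M1 by fact
  interpret B: sigma_finite_measure M2 by fact
  interpret pair_sigma_finite M1 M2 ..
  have [measurable]: "f \<in> borel_measurable M1" "g \<in> borel_measurable M2" using f g by auto
  show i: "integrable (M1 \<Otimes>\<^sub>M M2) (\<lambda>p. f (fst p) * g (snd p))"
    unfolding integrable_iff_bounded
  proof
    have "(\<integral>\<^sup>+ p. ennreal (norm (f (fst p) * g (snd p))) \<partial>(M1 \<Otimes>\<^sub>M M2))
        = (\<integral>\<^sup>+x. \<integral>\<^sup>+y. ennreal (norm (f x)) * ennreal (norm (g y)) \<partial>M2 \<partial>M1)"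
      by (subst B.nn_integral_fst[symmetric]) (auto simp: norm_mult ennreal_mult)
    also have "\<dots> = (\<integral>\<^sup>+x. ennreal (norm (f x)) \<partial>M1) * (\<integral>\<^sup>+y. ennreal (norm (g y)) \<partial>M2)"
      by (simp add: nn_integral_cmult nn_integral_multc)
    also have "\<dots> < \<infinity>" using f g by (simp add: integrable_iff_bounded ennreal_mult_less_top)
    finally show "(\<integral>\<^sup>+ p. ennreal (norm (f (fst p) * g (snd p))) \<partial>(M1 \<Otimes>\<^sub>M M2)) < \<infinity>" .
  qed measurable
  show "(LINT p|(M1 \<Otimes>\<^sub>M M2). f (fst p) * g (snd p)) = (LINT x|M1. f x) * (LINT y|M2. g y)"
    by (subst integral_fst'[OF i, symmetric]) simp
qed

lemma integral_norm_le_nn_integral: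
  fixes f :: "'a \<Rightarrow> complex"
  shows "ennreal (norm (integral\<^sup>L M f)) \<le> (\<integral>\<^sup>+x. ennreal (norm (f x)) \<partial>M)"
  by (cases "integrable M f") (auto simp: not_integrable_integral_eq intro: integral_norm_bound_ennreal)

section \<open>Gaussians\<close>

lemma cis_measurable [measurable (raw)]:
  "f \<in> borel_measurable M \<Longrightarrow> (\<lambda>x. cis (f x)) \<in> borel_measurable M"
  by (rule measurable_compose[OF _ borel_measurable_continuous_onI]) (auto intro!: continuous_intros)

text \<open>A rescaling of the characteristic function of the standard normal distribution.\<close>

lemma gaussian_FT_real:
  fixes c z :: real assumes c: "c > 0"
  shows "integrable lborel (\<lambda>x::real. cis (z * x) * of_real (exp (- (c * x\<^sup>2))))"
    "(LINT x|lborel. cis (z * x) * of_real (exp (- (c * x\<^sup>2)))) = of_real (sqrt (pi / c) * exp (- (z\<^sup>2 / (4 * c))))"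
proof -
  define a where "a = sqrt (2 * c)"
  have a: "a > 0" "a\<^sup>2 = 2 * c" using c by (auto simp: a_def)
  define f where "f x = std_normal_density x *\<^sub>R exp (\<i> * complex_of_real (z / a * x))" for x
  have I: "(LINT x|lborel. f x) = of_real (exp (- ((z / a)\<^sup>2) / 2))"
    using fun_cong[OF char_std_normal_distribution, of "z / a"]
    unfolding char_def f_def by (subst (asm) integral_density) (auto simp: normal_density_nonneg)
  have i: "integrable lborel f"
  proof (rule Bochner_Integration.integrable_bound[OF integrable_normal_density[of 1 0, OF zero_less_one]])
    show "f \<in> borel_measurable lborel" unfolding f_def by measurable
    show "AE x in lborel. norm (f x) \<le> norm (std_normal_density x)"
      by (intro AE_I2) (simp add: f_def del: of_real_mult of_real_divide)
  qed
  have e: "f (0 + a * x) = of_real (1 / sqrt (2 * pi)) * (cis (z * x) * of_real (exp (- (c * x\<^sup>2))))" for x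
    using a by (simp add: f_def std_normal_density_def cis_conv_exp power_mult_distrib scaleR_conv_of_real
        del: of_real_mult)
  have 2: "integrable lborel (\<lambda>x. of_real (1 / sqrt (2 * pi)) * (cis (z * x) * of_real (exp (- (c * x\<^sup>2)))))"
    using lborel_integrable_real_affine[OF i, of a 0] a unfolding e by simp
  have "integrable lborel (\<lambda>x. complex_of_real (sqrt (2 * pi)) * (of_real (1 / sqrt (2 * pi)) * (cis (z * x) * of_real (exp (- (c * x\<^sup>2))))))"
    by (rule integrable_mult_right) (rule 2)
  then show "integrable lborel (\<lambda>x::real. cis (z * x) * of_real (exp (- (c * x\<^sup>2))))"
    by (simp only: mult.assoc[symmetric] of_real_mult[symmetric]) simp
  have "of_real (exp (- ((z / a)\<^sup>2) / 2)) = of_real (a / sqrt (2 * pi)) * (LINT x|lborel. cis (z * x) * of_real (exp (- (c * x\<^sup>2))))"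
    unfolding I[symmetric] using a
    by (subst lborel_integral_real_affine[of a _ 0]) (auto simp: e scaleR_conv_of_real simp del: add_0_left)
  then have "(LINT x|lborel. cis (z * x) * of_real (exp (- (c * x\<^sup>2)))) = of_real (sqrt (2 * pi) / a) * of_real (exp (- ((z / a)\<^sup>2) / 2))"
    using a by (simp add: field_simps)
  also have "sqrt (2 * pi) / a = sqrt (pi / c)"
    using c by (simp add: a_def real_sqrt_divide real_sqrt_mult)
  also have "- ((z / a)\<^sup>2) / 2 = - (z\<^sup>2 / (4 * c))"
    using a by (simp add: power_divide)
  finally show "(LINT x|lborel. cis (z * x) * of_real (exp (- (c * x\<^sup>2)))) = of_real (sqrt (pi / c) * exp (- (z\<^sup>2 / (4 * c))))"
    by simp
qed

lemma norm_power2_Basis: "(norm x)\<^sup>2 = (\<Sum>b\<in>Basis. (x \<bullet> b)\<^sup>2)"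
  by (subst power2_norm_eq_inner, subst euclidean_inner) (simp add: power2_eq_square)

lemma gaussian_FT:
  fixes z :: "'a::euclidean_space" assumes c: "c > 0"
  shows "integrable lborel (\<lambda>x. cis (z \<bullet> x) * of_real (exp (- (c * (norm x)\<^sup>2))))"
    "(LINT x|lborel. cis (z \<bullet> x) * of_real (exp (- (c * (norm x)\<^sup>2))))
       = of_real (sqrt (pi / c) ^ DIM('a) * exp (- ((norm z)\<^sup>2 / (4 * c))))"
proof -
  interpret product_sigma_finite "\<lambda>_::'a. lborel :: real measure" ..
  let ?F = "\<lambda>x::'a. cis (z \<bullet> x) * of_real (exp (- (c * (norm x)\<^sup>2)))"
  let ?E = "\<lambda>f::'a \<Rightarrow> real. (\<Sum>b\<in>Basis. f b *\<^sub>R b)"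
  let ?g = "\<lambda>b x::real. cis ((z \<bullet> b) * x) * complex_of_real (exp (- (c * x\<^sup>2)))"
  have eq: "?F (?E f) = (\<Prod>b\<in>Basis. ?g b (f b))" for f
  proof -
    have 1: "z \<bullet> ?E f = (\<Sum>b\<in>Basis. (z \<bullet> b) * f b)"
      by (simp add: inner_sum_right mult.commute)
    have 2: "(norm (?E f))\<^sup>2 = (\<Sum>b\<in>Basis. (f b)\<^sup>2)"
      by (simp add: norm_power2_Basis)
    have 3: "cis (\<Sum>b\<in>A. h b) = (\<Prod>b\<in>A. cis (h b))" if "finite A" for h and A :: "'a set"
      using that by (induction A rule: finite_induct) (auto simp: cis_mult[symmetric])
    show ?thesis unfolding 1 2
      by (simp add: 3 sum_distrib_left exp_sum sum_negf[symmetric] prod.distrib)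
  qed
  have [measurable]: "?E \<in> (\<Pi>\<^sub>M b\<in>Basis. lborel) \<rightarrow>\<^sub>M borel" by measurable
  have i: "integrable (\<Pi>\<^sub>M b\<in>Basis. lborel) (\<lambda>f. \<Prod>b\<in>Basis. ?g b (f b))"
    by (rule product_integrable_prod) (auto intro: gaussian_FT_real c)
  show "integrable lborel ?F"
    by (subst lborel_eq, subst integrable_distr_eq) (auto simp: eq intro!: i)
  have "(LINT x|lborel. ?F x) = (LINT f|(\<Pi>\<^sub>M b\<in>Basis. lborel). (\<Prod>b\<in>Basis. ?g b (f b)))"
    by (subst lborel_eq, subst integral_distr) (auto simp: eq)
  also have "\<dots> = (\<Prod>b\<in>Basis. LINT x|lborel. ?g b x)"
    by (rule product_integral_prod) (auto intro: gaussian_FT_real c)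
  also have "\<dots> = (\<Prod>b\<in>Basis. of_real (sqrt (pi / c) * exp (- ((z \<bullet> b)\<^sup>2 / (4 * c)))))"
    by (simp only: gaussian_FT_real[OF c])
  also have "\<dots> = of_real (sqrt (pi / c) ^ DIM('a) * (\<Prod>b\<in>Basis. exp (- ((z \<bullet> b)\<^sup>2 / (4 * c)))))"
    by (simp only: of_real_prod[symmetric] prod.distrib prod_constant)
  also have "(\<Prod>b\<in>Basis. exp (- ((z \<bullet> b)\<^sup>2 / (4 * c)))) = exp (- ((norm z)\<^sup>2 / (4 * c)))"
    by (simp add: exp_sum[symmetric] sum_negf sum_divide_distrib[symmetric] norm_power2_Basis)
  finally show "(LINT x|lborel. ?F x) = of_real (sqrt (pi / c) ^ DIM('a) * exp (- ((norm z)\<^sup>2 / (4 * c))))" .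
qed

lemma gaussian_integrable:
  "c > 0 \<Longrightarrow> integrable lborel (\<lambda>x::'a::euclidean_space. exp (- (c * (norm x)\<^sup>2)))"
  using integrable_norm[OF gaussian_FT(1)[of c 0]] by (simp add: norm_mult)

text \<open>The fundamental solution of the heat equation.\<close>

definition heat_kernel :: "real \<Rightarrow> 'a::euclidean_space \<Rightarrow> real" where
  "heat_kernel t z = (1 / sqrt (4 * pi * t)) ^ DIM('a) * exp (- ((norm z)\<^sup>2 / (4 * t)))"

lemma heat_kernel_nonneg: "t > 0 \<Longrightarrow> heat_kernel t z \<ge> 0"
  by (simp add: heat_kernel_def)

lemma heat_kernel_le: "t > 0 \<Longrightarrow> heat_kernel t (z::'a::euclidean_space) \<le> (1 / sqrt (4 * pi * t)) ^ DIM('a)"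
  by (simp add: heat_kernel_def mult_left_le)

lemma heat_kernel_measurable [measurable]: "heat_kernel t \<in> borel_measurable borel"
  unfolding heat_kernel_def by measurable

lemma heat_kernel_minus: "heat_kernel t (x - y) = heat_kernel t (y - x)"
  by (simp add: heat_kernel_def norm_minus_commute)

lemma heat_kernel_integral:
  assumes t: "t > 0"
  shows "integrable lborel (heat_kernel t :: 'a::euclidean_space \<Rightarrow> real)"
    "(LINT z|lborel. heat_kernel t (z::'a)) = 1"
proof -
  have c: "1 / (4 * t) > 0" using t by simp
  show "integrable lborel (heat_kernel t :: 'a \<Rightarrow> real)"
    unfolding heat_kernel_def using gaussian_integrable[OF c, where 'a='a] by simp
  have "complex_of_real (LINT z|lborel. exp (- (1 / (4 * t) * (norm (z::'a))\<^sup>2))) = of_real (sqrt (4 * pi * t) ^ DIM('a))"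
    using gaussian_FT(2)[OF c, of "0::'a"] t by (simp add: mult_ac)
  then have "(LINT z|lborel. exp (- (1 / (4 * t) * (norm (z::'a))\<^sup>2))) = sqrt (4 * pi * t) ^ DIM('a)"
    by (simp only: of_real_eq_iff)
  then show "(LINT z|lborel. heat_kernel t (z::'a)) = 1"
    unfolding heat_kernel_def using t by (simp add: power_divide)
qed

lemma nn_integral_lborel_translate:
  fixes x :: "'a::euclidean_space"
  assumes [measurable]: "F \<in> borel_measurable borel"
  shows "(\<integral>\<^sup>+y. F (x + y) \<partial>lborel) = (\<integral>\<^sup>+y. F y \<partial>lborel)"
proof -
  have eq: "distr lborel borel (\<lambda>y. x + y) = lborel" using lborel_affine[of 1 x] by (simp add: density_1)
  have "(\<integral>\<^sup>+y. F (x + y) \<partial>lborel) = (\<integral>\<^sup>+y. F y \<partial>distr lborel borel (\<lambda>y. x + y))"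
    by (subst nn_integral_distr) auto
  then show ?thesis unfolding eq .
qed

lemma nn_integral_heat_kernel:
  fixes x :: "'a::euclidean_space"
  assumes t: "t > 0"
  shows "(\<integral>\<^sup>+y. ennreal (heat_kernel t (x - y)) \<partial>lborel) = 1"
proof -
  have "(\<integral>\<^sup>+y. ennreal (heat_kernel t (x - y)) \<partial>lborel) = (\<integral>\<^sup>+y. ennreal (heat_kernel t (- x + y)) \<partial>lborel)"
    by (simp add: heat_kernel_minus[of t x])
  also have "\<dots> = (\<integral>\<^sup>+y. ennreal (heat_kernel t (y::'a)) \<partial>lborel)"
    by (rule nn_integral_lborel_translate) measurable
  also have "\<dots> = ennreal (LINT y|lborel. heat_kernel t (y::'a))"
    by (rule nn_integral_eq_integral) (use t in \<open>auto simp: heat_kernel_integral heat_kernel_nonneg\<close>)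
  finally show ?thesis using t by (simp add: heat_kernel_integral)
qed

section \<open>The Fourier transform of integrable functions\<close>

lemma integrable_cis_mult:
  fixes w :: "'a \<Rightarrow> complex"
  assumes "integrable M w" "f \<in> borel_measurable M" shows "integrable M (\<lambda>x. cis (f x) * w x)"
  by (rule Bochner_Integration.integrable_bound[OF assms(1)]) (use assms in \<open>auto simp: norm_mult\<close>)

lemma fourier_add_cmult:
  fixes v w :: "'a::euclidean_space \<Rightarrow> complex"
  assumes "integrable lborel v" "integrable lborel w"
  shows "fourier (\<lambda>x. v x + c * w x) \<xi> = fourier v \<xi> + c * fourier w \<xi>"
proof -
  have "(LINT x|lborel. cis (- (x \<bullet> \<xi>)) * (v x + c * w x))
     = (LINT x|lborel. cis (- (x \<bullet> \<xi>)) * v x + c * (cis (- (x \<bullet> \<xi>)) * w x))"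
    by (simp add: algebra_simps)
  also have "\<dots> = (LINT x|lborel. cis (- (x \<bullet> \<xi>)) * v x) + c * (LINT x|lborel. cis (- (x \<bullet> \<xi>)) * w x)"
    using assms by (simp add: integrable_cis_mult)
  finally show ?thesis by (simp add: fourier_def algebra_simps)
qed

lemma fourier_diff:
  fixes v w :: "'a::euclidean_space \<Rightarrow> complex"
  assumes "integrable lborel v" "integrable lborel w"
  shows "fourier (\<lambda>x. v x - w x) \<xi> = fourier v \<xi> - fourier w \<xi>"
  using fourier_add_cmult[OF assms, of "-1"] by simp

lemma fourier_zero: "fourier (\<lambda>x. 0) \<xi> = 0"
  by (simp add: fourier_def)

lemma fourier_cnj: "fourier (\<lambda>x. cnj (w x)) (- \<xi>) = cnj (fourier w \<xi>)"
proof -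
  have "(LINT x|lborel. cis (- (x \<bullet> - \<xi>)) * cnj (w x)) = (LINT x|lborel. cnj (cis (- (x \<bullet> \<xi>)) * w x))"
    by (simp add: cis_cnj)
  then show ?thesis unfolding fourier_def by (simp only: Bochner_Integration.integral_cnj) simp
qed

lemma fourier_measurable [measurable]:
  assumes "integrable lborel (w :: 'a::euclidean_space \<Rightarrow> complex)"
  shows "fourier w \<in> borel_measurable borel"
proof -
  have [measurable]: "w \<in> borel_measurable borel" using assms by auto
  show ?thesis unfolding fourier_def[abs_def] by measurable
qed

definition fourier_const :: "'a::euclidean_space itself \<Rightarrow> real" where
  "fourier_const _ = (2 * pi) powr (- (real DIM('a) / 2))"

lemma fourier_const_square: "(fourier_const TYPE('a::euclidean_space))\<^sup>2 = (1 / (2 * pi)) ^ DIM('a)"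
  unfolding fourier_const_def power2_eq_square
  by (simp add: powr_add[symmetric] powr_minus powr_realpow power_one_over inverse_eq_divide)

lemma fourier_bound:
  "norm (fourier w (\<xi>::'a::euclidean_space)) \<le> fourier_const TYPE('a) * (LINT x|lborel. norm (w x))"
proof -
  have "norm (LINT x|lborel. cis (- (x \<bullet> \<xi>)) * w x) \<le> (LINT x|lborel. norm (cis (- (x \<bullet> \<xi>)) * w x))"
    by (rule integral_norm_bound)
  then show ?thesis by (simp add: fourier_def fourier_const_def norm_mult mult_left_mono)
qed

lemma sigma_finite_lborel_pair: "sigma_finite_measure (lborel \<Otimes>\<^sub>M (lborel :: 'a::euclidean_space measure) :: ('b::euclidean_space \<times> 'a) measure)"
  by (simp add: lborel_prod sigma_finite_lborel)

text \<open>By Fubini's theorem, integrating the exponentials in the two transforms against the Gaussian leaves the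
  heat kernel.\<close>

lemma gaussian_fourier_pairing:
  fixes w \<phi> :: "'a::euclidean_space \<Rightarrow> complex"
  assumes w: "integrable lborel w" and \<phi>: "integrable lborel \<phi>" and t: "t > 0"
  shows "(LINT \<xi>|lborel. of_real (exp (- (t * (norm \<xi>)\<^sup>2))) * (fourier w \<xi> * fourier \<phi> (- \<xi>)))
    = (LINT p|(lborel \<Otimes>\<^sub>M lborel). of_real (heat_kernel t (fst p - snd p)) * (\<phi> (fst p) * w (snd p)))"
proof -
  define M where "M = (lborel \<Otimes>\<^sub>M lborel :: ('a \<times> 'a) measure)"
  interpret M: sigma_finite_measure M unfolding M_def by (rule sigma_finite_lborel_pair)
  interpret P: pair_sigma_finite "lborel :: 'a measure" M ..
  have [measurable]: "w \<in> borel_measurable borel" "\<phi> \<in> borel_measurable borel" using w \<phi> by auto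
  have [measurable]: "fst \<in> M \<rightarrow>\<^sub>M borel" "snd \<in> M \<rightarrow>\<^sub>M borel" unfolding M_def by measurable
  define K where "K p = \<phi> (fst p) * w (snd p)" for p
  have K: "integrable M K"
    unfolding M_def K_def by (rule integrable_pair_product) (auto simp: sigma_finite_lborel \<phi> w)
  have [measurable]: "K \<in> borel_measurable M" using K by auto
  have prod: "fourier w \<xi> * fourier \<phi> (- \<xi>) = of_real ((1 / (2 * pi)) ^ DIM('a)) * (LINT p|M. cis ((fst p - snd p) \<bullet> \<xi>) * K p)" for \<xi>
  proof -
    have "(LINT x|lborel. cis (- (x \<bullet> - \<xi>)) * \<phi> x) * (LINT x|lborel. cis (- (x \<bullet> \<xi>)) * w x)
       = (LINT p|M. (cis (- (fst p \<bullet> - \<xi>)) * \<phi> (fst p)) * (cis (- (snd p \<bullet> \<xi>)) * w (snd p)))"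
      unfolding M_def using w \<phi>
      by (intro integrable_pair_product(2)[symmetric]) (auto simp: sigma_finite_lborel intro!: integrable_cis_mult)
    also have "\<dots> = (LINT p|M. cis ((fst p - snd p) \<bullet> \<xi>) * K p)"
    proof (rule Bochner_Integration.integral_cong[OF refl])
      fix p :: "'a \<times> 'a"
      have "cis (- (fst p \<bullet> - \<xi>)) * cis (- (snd p \<bullet> \<xi>)) = cis ((fst p - snd p) \<bullet> \<xi>)"
        by (simp add: cis_mult inner_diff_left)
      then show "(cis (- (fst p \<bullet> - \<xi>)) * \<phi> (fst p)) * (cis (- (snd p \<bullet> \<xi>)) * w (snd p)) = cis ((fst p - snd p) \<bullet> \<xi>) * K p"
        by (simp add: K_def algebra_simps)
    qed
    finally show ?thesis
      unfolding fourier_def fourier_const_square[symmetric] fourier_const_def power2_eq_square by (simp add: algebra_simps)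
  qed
  define H where "H \<xi> p = complex_of_real (exp (- (t * (norm \<xi>)\<^sup>2))) * (cis ((fst p - snd p) \<bullet> \<xi>) * K p)" for \<xi> :: 'a and p
  have H: "integrable (lborel \<Otimes>\<^sub>M M) (\<lambda>(\<xi>, p). H \<xi> p)"
  proof (rule Bochner_Integration.integrable_bound)
    show "integrable (lborel \<Otimes>\<^sub>M M) (\<lambda>q. complex_of_real (exp (- (t * (norm (fst q :: 'a))\<^sup>2))) * K (snd q))"
      by (rule integrable_pair_product) (auto simp: sigma_finite_lborel gaussian_integrable t K M.sigma_finite_measure_axioms)
    show "(\<lambda>(\<xi>, p). H \<xi> p) \<in> borel_measurable (lborel \<Otimes>\<^sub>M M)"
      unfolding H_def by measurable
  qed (auto simp: H_def norm_mult split_beta)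
  have "(LINT \<xi>|lborel. of_real (exp (- (t * (norm \<xi>)\<^sup>2))) * (fourier w \<xi> * fourier \<phi> (- \<xi>)))
     = of_real ((1 / (2 * pi)) ^ DIM('a)) * (LINT \<xi>|lborel. LINT p|M. H \<xi> p)"
  proof -
    have "(LINT p|M. H \<xi> p) = of_real (exp (- (t * (norm \<xi>)\<^sup>2))) * (LINT p|M. cis ((fst p - snd p) \<bullet> \<xi>) * K p)" for \<xi>
      unfolding H_def by (rule integral_mult_right_zero)
    then show ?thesis unfolding prod by (simp add: mult.left_commute)
  qed
  also have "(LINT \<xi>|lborel. LINT p|M. H \<xi> p) = (LINT p|M. LINT \<xi>|lborel. H \<xi> p)"
    by (rule P.Fubini_integral[OF H, symmetric])
  also have "\<dots> = (LINT p|M. of_real (sqrt (pi / t) ^ DIM('a) * exp (- ((norm (fst p - snd p))\<^sup>2 / (4 * t)))) * K p)"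
  proof (rule Bochner_Integration.integral_cong[OF refl])
    fix p :: "'a \<times> 'a"
    have "(LINT \<xi>|lborel. H \<xi> p) = (LINT \<xi>|lborel. (cis ((fst p - snd p) \<bullet> \<xi>) * complex_of_real (exp (- (t * (norm \<xi>)\<^sup>2)))) * K p)"
      by (simp add: H_def mult_ac)
    then show "(LINT \<xi>|lborel. H \<xi> p) = of_real (sqrt (pi / t) ^ DIM('a) * exp (- ((norm (fst p - snd p))\<^sup>2 / (4 * t)))) * K p"
      using gaussian_FT(2)[OF t, of "fst p - snd p"] by simp
  qed
  also have "of_real ((1 / (2 * pi)) ^ DIM('a)) * \<dots> = (LINT p|M. of_real (heat_kernel t (fst p - snd p)) * K p)"
  proof -
    have "1 / (2 * pi) * sqrt (pi / t) = 1 / sqrt (4 * pi * t)"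
      using t by (simp add: real_sqrt_mult real_sqrt_divide field_simps)
    then have "(1 / (2 * pi)) ^ DIM('a) * sqrt (pi / t) ^ DIM('a) = (1 / sqrt (4 * pi * t)) ^ DIM('a)"
      by (metis power_mult_distrib)
    then have "of_real ((1 / (2 * pi)) ^ DIM('a)) * (of_real (sqrt (pi / t) ^ DIM('a) * e) * (k :: complex))
       = of_real ((1 / sqrt (4 * pi * t)) ^ DIM('a) * e) * k" for e k
      by (metis (no_types) mult.assoc of_real_mult)
    then show ?thesis
      by (simp only: integral_mult_right_zero[symmetric] heat_kernel_def)
  qed
  finally show ?thesis unfolding M_def K_def .
qed


section \<open>Plancherel's theorem\<close>

text \<open>Schur's test: the heat kernel has mass one in each variable, so the bound of \<open>|w x| |w y|\<close> by the mean of
  the squares bounds the double integral by the square of the norm.\<close>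

lemma fourier_gaussian_le:
  fixes w :: "'a::euclidean_space \<Rightarrow> complex"
  assumes w1: "integrable lborel w" and w2: "w \<in> L2 lborel" and t: "t > 0"
  shows "(\<integral>\<^sup>+\<xi>. ennreal (exp (- (t * (norm \<xi>)\<^sup>2)) * (norm (fourier w \<xi>))\<^sup>2) \<partial>lborel) \<le> ennreal ((L2_norm lborel w)\<^sup>2)"
proof -
  have [measurable]: "w \<in> borel_measurable borel" using w1 by auto
  note [measurable] = fourier_measurable[OF w1]
  define B where "B = fourier_const TYPE('a) * (LINT x|lborel. norm (w x))"
  let ?G = "\<lambda>\<xi>. exp (- (t * (norm \<xi>)\<^sup>2)) * (norm (fourier w \<xi>))\<^sup>2"
  have i: "integrable lborel ?G"
  proof (rule Bochner_Integration.integrable_bound)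
    show "integrable lborel (\<lambda>\<xi>::'a. B\<^sup>2 * exp (- (t * (norm \<xi>)\<^sup>2)))"
      using gaussian_integrable[OF t, where 'a='a] by simp
    show "AE \<xi> in lborel. norm (?G \<xi>) \<le> norm (B\<^sup>2 * exp (- (t * (norm \<xi>)\<^sup>2)))"
      using fourier_bound[of w] by (intro AE_I2) (auto simp: B_def intro!: mult_right_mono power_mono)
  qed measurable
  let ?k = "\<lambda>x y. ennreal (heat_kernel t (x - y :: 'a))"
  let ?n = "\<lambda>x. ennreal ((norm (w x))\<^sup>2)"
  define h where "h = ennreal (1/2)"
  have k2: "(\<integral>\<^sup>+y. ?k x y \<partial>lborel) = 1" for x
    by (rule nn_integral_heat_kernel[OF t])
  have k1: "(\<integral>\<^sup>+x. ?k x y \<partial>lborel) = 1" for y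
    using nn_integral_heat_kernel[OF t, of y] by (simp add: heat_kernel_minus[of t y])
  have "complex_of_real (LINT \<xi>|lborel. ?G \<xi>)
      = (LINT \<xi>|lborel. of_real (exp (- (t * (norm \<xi>)\<^sup>2))) * (fourier w \<xi> * fourier (\<lambda>x. cnj (w x)) (- \<xi>)))"
    unfolding fourier_cnj complex_norm_square[symmetric] of_real_mult[symmetric] integral_complex_of_real ..
  also have "\<dots> = (LINT p|(lborel \<Otimes>\<^sub>M lborel). of_real (heat_kernel t (fst p - snd p)) * (cnj (w (fst p)) * w (snd p)))"
    by (rule gaussian_fourier_pairing) (use w1 t in auto)
  finally have eq: "complex_of_real (LINT \<xi>|lborel. ?G \<xi>)
     = (LINT p|(lborel \<Otimes>\<^sub>M lborel). complex_of_real (heat_kernel t (fst p - snd p)) * (cnj (w (fst p)) * w (snd p)))" .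
  have "ennreal (LINT \<xi>|lborel. ?G \<xi>)
     = ennreal (norm (LINT p|(lborel \<Otimes>\<^sub>M lborel). complex_of_real (heat_kernel t (fst p - snd p)) * (cnj (w (fst p)) * w (snd p))))"
    unfolding eq[symmetric] norm_of_real by (simp add: integral_nonneg_AE)
  also have "\<dots> \<le> (\<integral>\<^sup>+p. ennreal (norm (complex_of_real (heat_kernel t (fst p - snd p)) * (cnj (w (fst p)) * w (snd p)))) \<partial>(lborel \<Otimes>\<^sub>M lborel))"
    by (rule integral_norm_le_nn_integral)
  also have "\<dots> = (\<integral>\<^sup>+x. \<integral>\<^sup>+y. ?k x y * ennreal (norm (w x) * norm (w y)) \<partial>lborel \<partial>lborel)"
    by (subst lborel.nn_integral_fst[symmetric])
      (use t in \<open>auto simp: norm_mult ennreal_mult heat_kernel_nonneg intro!: nn_integral_cong\<close>)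
  also have "\<dots> \<le> (\<integral>\<^sup>+x. \<integral>\<^sup>+y. ?k x y * (h * (?n x + ?n y)) \<partial>lborel \<partial>lborel)"
  proof (intro nn_integral_mono mult_left_mono)
    fix x y
    have "norm (w x) * norm (w y) \<le> (1/2) * ((norm (w x))\<^sup>2 + (norm (w y))\<^sup>2)"
      using sum_squares_bound[of "norm (w x)" "norm (w y)"] by simp
    then have "ennreal (norm (w x) * norm (w y)) \<le> ennreal ((1/2) * ((norm (w x))\<^sup>2 + (norm (w y))\<^sup>2))"
      by (rule ennreal_leI)
    also have "\<dots> = h * (?n x + ?n y)"
      unfolding h_def by (subst ennreal_mult) (simp_all add: ennreal_plus)
    finally show "ennreal (norm (w x) * norm (w y)) \<le> h * (?n x + ?n y)" .
  qed simp
  also have "\<dots> = h * ((\<integral>\<^sup>+x. \<integral>\<^sup>+y. ?k x y * ?n x \<partial>lborel \<partial>lborel) + (\<integral>\<^sup>+x. \<integral>\<^sup>+y. ?k x y * ?n y \<partial>lborel \<partial>lborel))"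
    by (simp add: distrib_left nn_integral_add nn_integral_cmult mult.left_commute[of _ h])
  also have "(\<integral>\<^sup>+x. \<integral>\<^sup>+y. ?k x y * ?n y \<partial>lborel \<partial>lborel) = (\<integral>\<^sup>+y. \<integral>\<^sup>+x. ?k x y * ?n y \<partial>lborel \<partial>lborel)"
    by (rule lborel_pair.Fubini'[symmetric]) measurable
  also have "h * ((\<integral>\<^sup>+x. \<integral>\<^sup>+y. ?k x y * ?n x \<partial>lborel \<partial>lborel) + \<dots>) = h * (ennreal ((L2_norm lborel w)\<^sup>2) + ennreal ((L2_norm lborel w)\<^sup>2))"
    using k1 k2 L2_nn_integral[OF w2] by (simp add: nn_integral_multc)
  also have "\<dots> = ennreal ((L2_norm lborel w)\<^sup>2)"
  proof -
    have "h * (ennreal a + ennreal a) = ennreal a" if "a \<ge> 0" for a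
      unfolding h_def ennreal_plus[OF that that, symmetric] by (subst ennreal_mult[symmetric]) (use that in auto)
    then show ?thesis by simp
  qed
  finally show ?thesis
    by (subst nn_integral_eq_integral[OF i]) auto
qed

text \<open>The Gaussian factor increases to one as \<open>t\<close> tends to zero, and Fatou's lemma passes to the limit.\<close>

lemma fourier_L2_le:
  fixes w :: "'a::euclidean_space \<Rightarrow> complex"
  assumes w1: "integrable lborel w" and w2: "w \<in> L2 lborel"
  shows "fourier w \<in> L2 lborel \<and> L2_norm lborel (fourier w) \<le> L2_norm lborel w"
proof (rule L2_norm_le_nn_integral)
  note [measurable] = fourier_measurable[OF w1]
  have lim: "(\<lambda>n. exp (- (inverse (real (Suc n)) * (norm \<xi>)\<^sup>2)) * (norm (fourier w \<xi>))\<^sup>2) \<longlonglongrightarrow> (norm (fourier w \<xi>))\<^sup>2" for \<xi>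
  proof -
    have "(\<lambda>n. exp (- (inverse (real (Suc n)) * (norm \<xi>)\<^sup>2)) * (norm (fourier w \<xi>))\<^sup>2) \<longlonglongrightarrow> exp (- (0 * (norm \<xi>)\<^sup>2)) * (norm (fourier w \<xi>))\<^sup>2"
      by (intro tendsto_intros LIMSEQ_inverse_real_of_nat)
    then show ?thesis by simp
  qed
  have "(\<integral>\<^sup>+\<xi>. ennreal ((norm (fourier w \<xi>))\<^sup>2) \<partial>lborel)
     = (\<integral>\<^sup>+\<xi>. liminf (\<lambda>n. ennreal (exp (- (inverse (real (Suc n)) * (norm \<xi>)\<^sup>2)) * (norm (fourier w \<xi>))\<^sup>2)) \<partial>lborel)"
    using lim_imp_Liminf[OF sequentially_bot tendsto_ennrealI[OF lim]] by simp
  also have "\<dots> \<le> liminf (\<lambda>n. \<integral>\<^sup>+\<xi>. ennreal (exp (- (inverse (real (Suc n)) * (norm \<xi>)\<^sup>2)) * (norm (fourier w \<xi>))\<^sup>2) \<partial>lborel)"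
    by (rule nn_integral_liminf) measurable
  also have "\<dots> \<le> ennreal ((L2_norm lborel w)\<^sup>2)"
    by (rule Liminf_le) (auto intro!: always_eventually fourier_gaussian_le assms)
  finally show "(\<integral>\<^sup>+\<xi>. ennreal ((norm (fourier w \<xi>))\<^sup>2) \<partial>lborel) \<le> ennreal ((L2_norm lborel w)\<^sup>2)" .
qed (use fourier_measurable[OF w1] L2_norm_nonneg in auto)

lemma heat_kernel_rescale:
  assumes "t > 0"
  shows "sqrt (4 * t) ^ DIM('a) * heat_kernel t (- (sqrt (4 * t) *\<^sub>R z)) = heat_kernel (1/4) (z :: 'a::euclidean_space)"
proof -
  have "sqrt (4 * t) ^ DIM('a) * (1 / sqrt (4 * pi * t)) ^ DIM('a) = (1 / sqrt pi) ^ DIM('a)"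
  proof -
    have "sqrt (4 * t) * (1 / sqrt (4 * pi * t)) = 1 / sqrt pi"
      using assms by (simp add: real_sqrt_mult)
    then show ?thesis by (metis power_mult_distrib)
  qed
  then show ?thesis using assms
    by (simp add: heat_kernel_def power_mult_distrib mult.assoc[symmetric])
qed

lemma integral_heat_kernel_rescale:
  fixes \<phi> :: "'a::euclidean_space \<Rightarrow> complex"
  assumes t: "t > 0" and [measurable]: "\<phi> \<in> borel_measurable borel"
  shows "(LINT y|lborel. of_real (heat_kernel t (x - y)) * \<phi> y)
     = (LINT z|lborel. of_real (heat_kernel (1/4) z) * \<phi> (x + sqrt (4 * t) *\<^sub>R z))"
proof -
  define a where "a = sqrt (4 * t)"
  have a: "a > 0" using t by (simp add: a_def)
  have "(LINT y|lborel. of_real (heat_kernel t (x - y)) * \<phi> y)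
     = (LINT y|density (distr lborel borel (\<lambda>z. x + a *\<^sub>R z)) (\<lambda>_. ennreal (\<bar>a\<bar> ^ DIM('a))). of_real (heat_kernel t (x - y)) * \<phi> y)"
    using lborel_affine[of a x] a by simp
  also have "\<dots> = (LINT z|lborel. of_real (a ^ DIM('a) * heat_kernel t (- (a *\<^sub>R z))) * \<phi> (x + a *\<^sub>R z))"
    using a by (subst integral_density) (auto simp: integral_distr scaleR_conv_of_real mult.assoc)
  also have "\<dots> = (LINT z|lborel. of_real (heat_kernel (1/4) z) * \<phi> (x + a *\<^sub>R z))"
    unfolding a_def heat_kernel_rescale[OF t] ..
  finally show ?thesis by (simp add: a_def)
qed

text \<open>The missing inequality. As \<open>t\<close> tends to zero the heat kernel concentrates at the origin; for a continuous
  function with compact support the smoothed functions converge pointwise and stay bounded, so the double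
  integral tends to the square of the norm.\<close>

lemma Plancherel_continuous:
  fixes \<phi> :: "'a::euclidean_space \<Rightarrow> complex"
  assumes c: "continuous_on UNIV \<phi>" and R: "\<And>x. norm x > R \<Longrightarrow> \<phi> x = 0"
  shows "\<phi> \<in> L2 lborel" "integrable lborel \<phi>" "L2_norm lborel (fourier \<phi>) = L2_norm lborel \<phi>"
proof -
  have [measurable]: "\<phi> \<in> borel_measurable borel" by (rule borel_measurable_continuous_onI[OF c])
  have "compact (\<phi> ` cball 0 R)"
    by (rule compact_continuous_image[OF continuous_on_subset[OF c]]) auto
  then obtain N0 where N0: "\<forall>x\<in>cball 0 R. norm (\<phi> x) \<le> N0"
    by (auto simp: dest!: compact_imp_bounded simp: bounded_iff)
  define N where "N = max N0 0"
  have N: "norm (\<phi> x) \<le> N" for x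
    using bspec[OF N0, of x] R[of x] by (cases "norm x \<le> R") (auto simp: N_def)
  show L: "\<phi> \<in> L2 lborel" and I: "integrable lborel \<phi>"
    by (rule L2_bounded_support[OF _ N R]; simp)+
  note F = fourier_L2_le[OF I L]
  have N0: "N \<ge> 0" by (simp add: N_def)
  define t where "t n = inverse (real (Suc n))" for n
  have t: "t n > 0" for n by (simp add: t_def)
  have t0: "t \<longlonglongrightarrow> 0" unfolding t_def by (rule LIMSEQ_inverse_real_of_nat)
  define A where "A n x = (LINT z|lborel. of_real (heat_kernel (1/4) z) * \<phi> (x + sqrt (4 * t n) *\<^sub>R z))" for n x
  have A_lim: "(\<lambda>n. A n x) \<longlonglongrightarrow> \<phi> x" for x
  proof -
    have "(\<lambda>n. A n x) \<longlonglongrightarrow> (LINT z|lborel. of_real (heat_kernel (1/4) (z::'a)) * \<phi> x)"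
      unfolding A_def
    proof (rule integral_dominated_convergence)
      show "integrable lborel (\<lambda>z::'a. N * heat_kernel (1/4) z)"
        using heat_kernel_integral(1)[of "1/4", where 'a='a] by simp
      show "AE z in lborel. norm (of_real (heat_kernel (1/4) z) * \<phi> (x + sqrt (4 * t n) *\<^sub>R z)) \<le> N * heat_kernel (1/4) z" for n
        using N by (intro AE_I2) (simp add: norm_mult heat_kernel_nonneg mult.commute[of N] mult_left_mono)
      show "AE z in lborel. (\<lambda>n. of_real (heat_kernel (1/4) z) * \<phi> (x + sqrt (4 * t n) *\<^sub>R z)) \<longlonglongrightarrow> of_real (heat_kernel (1/4) z) * \<phi> x"
      proof (rule AE_I2)
        fix z
        have "(\<lambda>n. x + sqrt (4 * t n) *\<^sub>R z) \<longlonglongrightarrow> x + sqrt (4 * 0) *\<^sub>R z"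
          by (intro tendsto_intros t0)
        then have "(\<lambda>n. \<phi> (x + sqrt (4 * t n) *\<^sub>R z)) \<longlonglongrightarrow> \<phi> x"
          using c by (intro isCont_tendsto_compose[of x \<phi>]) (auto simp: continuous_on_eq_continuous_at)
        then show "(\<lambda>n. of_real (heat_kernel (1/4) z) * \<phi> (x + sqrt (4 * t n) *\<^sub>R z)) \<longlonglongrightarrow> of_real (heat_kernel (1/4) z) * \<phi> x"
          by (intro tendsto_intros)
      qed
    qed measurable
    then show ?thesis by (simp add: heat_kernel_integral)
  qed
  have A_bound: "norm (A n x) \<le> N" for n x
  proof -
    have "norm (A n x) \<le> (LINT z|lborel. N * heat_kernel (1/4) (z::'a))"
      unfolding A_def
    proof (rule order_trans[OF integral_norm_bound integral_mono_AE'])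
    qed (use N N0 heat_kernel_integral(1)[of "1/4", where 'a='a] in \<open>auto intro!: AE_I2 mult_nonneg_nonneg simp: norm_mult heat_kernel_nonneg mult.commute[of N] mult_left_mono\<close>)
    then show ?thesis by (simp add: heat_kernel_integral)
  qed
  have pair: "complex_of_real (LINT \<xi>|lborel. exp (- (t n * (norm \<xi>)\<^sup>2)) * (norm (fourier \<phi> \<xi>))\<^sup>2) = (LINT x|lborel. cnj (\<phi> x) * A n x)" for n
  proof -
    have i: "integrable (lborel \<Otimes>\<^sub>M lborel) (\<lambda>p. of_real (heat_kernel (t n) (fst p - snd p)) * (cnj (\<phi> (fst p)) * \<phi> (snd p)))"
    proof (rule Bochner_Integration.integrable_bound)
      show "integrable (lborel \<Otimes>\<^sub>M lborel) (\<lambda>p. of_real ((1 / sqrt (4 * pi * t n)) ^ DIM('a)) * (cnj (\<phi> (fst p)) * \<phi> (snd p)))"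
        using integrable_pair_product(1)[of lborel lborel "\<lambda>x. cnj (\<phi> x)" \<phi>] I by (intro integrable_mult_right) (auto simp: sigma_finite_lborel)
      show "AE p in lborel \<Otimes>\<^sub>M lborel. norm (of_real (heat_kernel (t n) (fst p - snd p)) * (cnj (\<phi> (fst p)) * \<phi> (snd p)))
        \<le> norm (of_real ((1 / sqrt (4 * pi * t n)) ^ DIM('a)) * (cnj (\<phi> (fst p)) * \<phi> (snd p)))"
        unfolding norm_mult norm_of_real
        by (intro AE_I2 mult_right_mono) (use t[of n] in \<open>auto simp: heat_kernel_le heat_kernel_nonneg\<close>)
    qed measurable
    have "complex_of_real (LINT \<xi>|lborel. exp (- (t n * (norm \<xi>)\<^sup>2)) * (norm (fourier \<phi> \<xi>))\<^sup>2)
        = (LINT \<xi>|lborel. of_real (exp (- (t n * (norm \<xi>)\<^sup>2))) * (fourier \<phi> \<xi> * fourier (\<lambda>x. cnj (\<phi> x)) (- \<xi>)))"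
      unfolding fourier_cnj complex_norm_square[symmetric] of_real_mult[symmetric] integral_complex_of_real ..
    also have "\<dots> = (LINT p|(lborel \<Otimes>\<^sub>M lborel). of_real (heat_kernel (t n) (fst p - snd p)) * (cnj (\<phi> (fst p)) * \<phi> (snd p)))"
      by (rule gaussian_fourier_pairing) (use I t in auto)
    also have "\<dots> = (LINT x|lborel. LINT y|lborel. of_real (heat_kernel (t n) (x - y)) * (cnj (\<phi> x) * \<phi> y))"
      by (subst lborel_pair.integral_fst'[OF i, symmetric]) simp
    also have "\<dots> = (LINT x|lborel. cnj (\<phi> x) * (LINT y|lborel. of_real (heat_kernel (t n) (x - y)) * \<phi> y))"
      by (simp add: mult.left_commute)
    also have "\<dots> = (LINT x|lborel. cnj (\<phi> x) * A n x)"
      unfolding A_def by (subst integral_heat_kernel_rescale[OF t]) auto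
    finally show ?thesis .
  qed
  have "(\<lambda>n. LINT x|lborel. cnj (\<phi> x) * A n x) \<longlonglongrightarrow> (LINT x|lborel. cnj (\<phi> x) * \<phi> x)"
  proof (rule integral_dominated_convergence)
    show "integrable lborel (\<lambda>x. N * norm (\<phi> x))" using I by simp
    show "AE x in lborel. norm (cnj (\<phi> x) * A n x) \<le> N * norm (\<phi> x)" for n
      using A_bound by (intro AE_I2) (simp add: norm_mult mult.commute[of N] mult_left_mono)
    show "AE x in lborel. (\<lambda>n. cnj (\<phi> x) * A n x) \<longlonglongrightarrow> cnj (\<phi> x) * \<phi> x"
      by (intro AE_I2 tendsto_intros A_lim)
  qed (unfold A_def, measurable)
  also have "(LINT x|lborel. cnj (\<phi> x) * \<phi> x) = of_real ((L2_norm lborel \<phi>)\<^sup>2)"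
    using L2_inner_self[of lborel \<phi>] by (simp add: L2_inner_def mult.commute)
  finally have lim: "(\<lambda>n. LINT \<xi>|lborel. exp (- (t n * (norm \<xi>)\<^sup>2)) * (norm (fourier \<phi> \<xi>))\<^sup>2) \<longlonglongrightarrow> (L2_norm lborel \<phi>)\<^sup>2"
    unfolding pair[symmetric] by (simp only: tendsto_of_real_iff)
  have le: "(LINT \<xi>|lborel. exp (- (t n * (norm \<xi>)\<^sup>2)) * (norm (fourier \<phi> \<xi>))\<^sup>2) \<le> (L2_norm lborel (fourier \<phi>))\<^sup>2" for n
    unfolding L2_norm_power2
  proof (rule integral_mono_AE')
    show "integrable lborel (\<lambda>\<xi>. (norm (fourier \<phi> \<xi>))\<^sup>2)" using F L2_integrable by blast
  qed (use t[of n] in \<open>auto intro!: AE_I2 mult_left_le_one_le\<close>)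
  have "(L2_norm lborel \<phi>)\<^sup>2 \<le> (L2_norm lborel (fourier \<phi>))\<^sup>2"
    by (rule LIMSEQ_le_const2[OF lim]) (use le in blast)
  then have "L2_norm lborel \<phi> \<le> L2_norm lborel (fourier \<phi>)"
    by (rule power2_le_imp_le) (rule L2_norm_nonneg)
  with F show "L2_norm lborel (fourier \<phi>) = L2_norm lborel \<phi>" by simp
qed

text \<open>Both sides are continuous in \<open>w\<close> by the contraction estimate, and they agree on a dense set.\<close>

lemma Plancherel_L1_L2:
  fixes w :: "'a::euclidean_space \<Rightarrow> complex"
  assumes w1: "integrable lborel w" and w2: "w \<in> L2 lborel"
  shows "L2_norm lborel (fourier w) = L2_norm lborel w"
proof -
  have "\<forall>n. \<exists>\<phi> R. continuous_on UNIV \<phi> \<and> (\<forall>x. norm x > R \<longrightarrow> \<phi> x = 0) \<and> L2_norm lborel (\<lambda>x. w x - \<phi> x) < inverse (real (Suc n))"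
    using L2_continuous_approx[OF w2] by simp
  then obtain \<phi> R where \<phi>: "\<And>n. continuous_on UNIV (\<phi> n)" "\<And>n x. norm x > R n \<Longrightarrow> \<phi> n x = 0"
    "\<And>n. L2_norm lborel (\<lambda>x. w x - \<phi> n x) < inverse (real (Suc n))" by metis
  have P: "\<phi> n \<in> L2 lborel" "integrable lborel (\<phi> n)" "L2_norm lborel (fourier (\<phi> n)) = L2_norm lborel (\<phi> n)" for n
    using Plancherel_continuous[of "\<phi> n" "R n"] \<phi>(1,2) by blast+
  have lim: "(\<lambda>n. L2_norm lborel (\<lambda>x. \<phi> n x - w x)) \<longlonglongrightarrow> 0"
    by (rule tendsto_sandwich[OF _ _ tendsto_const LIMSEQ_inverse_real_of_nat])
      (use less_imp_le[OF \<phi>(3)] in \<open>auto simp: L2_norm_nonneg L2_norm_minus_commute[of _ "\<phi> _"] simp del: of_nat_Suc\<close>)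
  have "L2_norm lborel (\<lambda>\<xi>. fourier (\<phi> n) \<xi> - fourier w \<xi>) \<le> L2_norm lborel (\<lambda>x. \<phi> n x - w x)" for n
    using fourier_L2_le[of "\<lambda>x. \<phi> n x - w x"] P(1,2)[of n] assms L2_diff[OF P(1) w2, of n]
    by (simp add: fourier_diff[OF P(2) w1, abs_def])
  then have limF: "(\<lambda>n. L2_norm lborel (\<lambda>\<xi>. fourier (\<phi> n) \<xi> - fourier w \<xi>)) \<longlonglongrightarrow> 0"
    by (intro tendsto_sandwich[OF _ _ tendsto_const lim]) (auto simp: L2_norm_nonneg)
  have "(\<lambda>n. L2_norm lborel (fourier (\<phi> n))) \<longlonglongrightarrow> L2_norm lborel (fourier w)"
    by (rule L2_norm_tendsto[OF _ _ limF]) (use fourier_L2_le P w1 w2 in blast)+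
  moreover have "(\<lambda>n. L2_norm lborel (fourier (\<phi> n))) \<longlonglongrightarrow> L2_norm lborel w"
    unfolding P(3) by (rule L2_norm_tendsto[OF P(1) w2 lim])
  ultimately show ?thesis by (rule LIMSEQ_unique)
qed


lemma L2_truncation:
  fixes w :: "'a::euclidean_space \<Rightarrow> complex"
  assumes w: "w \<in> L2 lborel"
  shows "(\<lambda>x. indicator (ball 0 R) x * w x) \<in> L2 lborel"
    "integrable lborel (\<lambda>x. indicator (ball 0 R) x * w x)"
proof -
  have [measurable]: "w \<in> borel_measurable borel" using L2_measurable[OF w] by simp
  show "(\<lambda>x. indicator (ball 0 R) x * w x) \<in> L2 lborel"
    by (rule L2_dominated_norm[OF _ w, of _ 1]) (auto split: split_indicator)
  have "(\<lambda>x. indicator (ball 0 R) x :: complex) \<in> L2 (lborel :: 'a measure)"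
    by (rule L2_bounded_support[of _ 1 R]) (auto split: split_indicator)
  then show "integrable lborel (\<lambda>x. indicator (ball 0 R) x * w x)"
    using L2_mult_integrable(1) w by blast
qed

lemma fourier_isometry_diff:
  fixes v w :: "'a::euclidean_space \<Rightarrow> complex"
  assumes "integrable lborel v" "v \<in> L2 lborel" "integrable lborel w" "w \<in> L2 lborel"
  shows "L2_norm lborel (\<lambda>\<xi>. fourier v \<xi> - fourier w \<xi>) = L2_norm lborel (\<lambda>x. v x - w x)"
  using Plancherel_L1_L2[of "\<lambda>x. v x - w x"] assms L2_diff[of v lborel w]
  by (simp add: fourier_diff[OF assms(1,3), abs_def])

lemma fourier_in_L2: "integrable lborel w \<Longrightarrow> w \<in> L2 lborel \<Longrightarrow> fourier w \<in> L2 lborel"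
  using fourier_L2_le by blast

lemma L2_norm_convergent_imp_Cauchy:
  assumes "\<And>n. F n \<in> L2 M" "G \<in> L2 M" "(\<lambda>n. L2_norm M (\<lambda>x. F n x - G x)) \<longlonglongrightarrow> 0" "\<epsilon> > 0"
  shows "\<exists>N. \<forall>m\<ge>N. \<forall>n\<ge>N. L2_norm M (\<lambda>x. F m x - F n x) < \<epsilon>"
proof -
  obtain N where N: "\<And>n. n \<ge> N \<Longrightarrow> L2_norm M (\<lambda>x. F n x - G x) < \<epsilon> / 2"
    using order_tendstoD(2)[OF assms(3), of "\<epsilon>/2"] assms(4) by (auto simp: eventually_sequentially)
  have "L2_norm M (\<lambda>x. F m x - F n x) < \<epsilon>" if "m \<ge> N" "n \<ge> N" for m n
    using L2_norm_diff_triangle[OF assms(1,2,1), of m n] N[OF that(1)] N[OF that(2)]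
      L2_norm_minus_commute[of M "F n" G] by simp
  then show ?thesis by blast
qed

text \<open>The transforms of the truncations to balls of integer radius form a Cauchy sequence by isometry. Other
  radii follow since the truncation error decreases with the radius.\<close>

lemma has_fourier_L2_exists:
  fixes w :: "'a::euclidean_space \<Rightarrow> complex"
  assumes w: "w \<in> L2 lborel"
  shows "\<exists>W. has_fourier_L2 w W"
proof -
  define u where "u R x = indicator (ball 0 R) x * w x" for R x
  note u = L2_truncation[OF w, folded u_def]
  note lim = L2_truncation_tendsto[OF w, folded u_def]
  have "\<exists>W\<in>L2 lborel. (\<lambda>n. L2_norm lborel (\<lambda>\<xi>. fourier (u (real n)) \<xi> - W \<xi>)) \<longlonglongrightarrow> 0"
  proof (rule L2_complete)
    show "fourier (u (real n)) \<in> L2 lborel" for n by (rule fourier_in_L2[OF u(2,1)])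
    show "\<exists>N. \<forall>m\<ge>N. \<forall>n\<ge>N. L2_norm lborel (\<lambda>\<xi>. fourier (u (real m)) \<xi> - fourier (u (real n)) \<xi>) < \<epsilon>" if "\<epsilon> > 0" for \<epsilon>
      unfolding fourier_isometry_diff[OF u(2,1) u(2,1)]
      by (rule L2_norm_convergent_imp_Cauchy[OF u(1) w lim that])
  qed
  then obtain W where W: "W \<in> L2 lborel" "(\<lambda>n. L2_norm lborel (\<lambda>\<xi>. fourier (u (real n)) \<xi> - W \<xi>)) \<longlonglongrightarrow> 0" by blast
  have "((\<lambda>R. L2_norm lborel (\<lambda>\<xi>. fourier (u R) \<xi> - W \<xi>)) \<longlongrightarrow> 0) at_top"
  proof (rule tendstoI)
    fix e :: real assume e: "e > 0"
    have "\<forall>\<^sub>F n in sequentially. L2_norm lborel (\<lambda>\<xi>. fourier (u (real n)) \<xi> - W \<xi>) < e / 2 \<and> L2_norm lborel (\<lambda>x. u (real n) x - w x) < e / 2"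
      using order_tendstoD(2)[OF W(2), of "e/2"] order_tendstoD(2)[OF lim, of "e/2"] e
      by (auto intro: eventually_conj)
    then obtain n where n: "L2_norm lborel (\<lambda>\<xi>. fourier (u (real n)) \<xi> - W \<xi>) < e / 2" "L2_norm lborel (\<lambda>x. u (real n) x - w x) < e / 2"
      by (auto simp: eventually_sequentially)
    show "\<forall>\<^sub>F R in at_top. dist (L2_norm lborel (\<lambda>\<xi>. fourier (u R) \<xi> - W \<xi>)) 0 < e"
      using eventually_ge_at_top[of "real n"]
    proof eventually_elim
      case (elim R)
      have "L2_norm lborel (\<lambda>x. u R x - u (real n) x) \<le> L2_norm lborel (\<lambda>x. u (real n) x - w x)"
        by (rule L2_norm_mono[OF L2_diff[OF u(1) w]])
          (use elim L2_measurable[OF L2_diff[OF u(1) u(1)]] in \<open>auto simp: u_def split: split_indicator\<close>)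
      moreover have "L2_norm lborel (\<lambda>\<xi>. fourier (u R) \<xi> - W \<xi>)
         \<le> L2_norm lborel (\<lambda>\<xi>. fourier (u R) \<xi> - fourier (u (real n)) \<xi>) + L2_norm lborel (\<lambda>\<xi>. fourier (u (real n)) \<xi> - W \<xi>)"
        by (intro L2_norm_diff_triangle fourier_in_L2 u W)
      ultimately show ?case
        using n by (simp add: fourier_isometry_diff[OF u(2,1) u(2,1)] L2_norm_nonneg)
    qed
  qed
  with W(1) show ?thesis unfolding has_fourier_L2_def u_def by blast
qed

lemma fourier_L2_spec: "w \<in> L2 lborel \<Longrightarrow> has_fourier_L2 w (fourier_L2 w)"
  unfolding fourier_L2_def using someI_ex[OF has_fourier_L2_exists] by blast

lemma fourier_L2_in_L2: "w \<in> L2 lborel \<Longrightarrow> fourier_L2 w \<in> L2 lborel"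
  using fourier_L2_spec unfolding has_fourier_L2_def by blast

lemma fourier_L2_tendsto:
  fixes w :: "'a::euclidean_space \<Rightarrow> complex"
  assumes "w \<in> L2 lborel"
  shows "(\<lambda>n. L2_norm lborel (\<lambda>\<xi>. fourier (\<lambda>x. indicator (ball 0 (real n)) x * w x) \<xi> - fourier_L2 w \<xi>)) \<longlonglongrightarrow> 0"
  using filterlim_compose[OF conjunct2[OF fourier_L2_spec[OF assms, unfolded has_fourier_L2_def]] filterlim_real_sequentially] .

lemma L2_norm_diff_tendsto:
  assumes "\<And>n. f n \<in> L2 M" "g \<in> L2 M" "h \<in> L2 M" "(\<lambda>n. L2_norm M (\<lambda>x. f n x - g x)) \<longlonglongrightarrow> 0"
  shows "(\<lambda>n. L2_norm M (\<lambda>x. f n x - h x)) \<longlonglongrightarrow> L2_norm M (\<lambda>x. g x - h x)"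
proof (rule L2_norm_tendsto)
  show "(\<lambda>n. L2_norm M (\<lambda>x. f n x - h x - (g x - h x))) \<longlonglongrightarrow> 0"
    using assms(4) by simp
qed (intro L2_diff assms)+

text \<open>The Fourier-Plancherel transform is an arbitrary choice within its class modulo null sets. This distance
  identity determines it, and all its further properties are derived from here.\<close>

lemma fourier_L2_fourier_isometry:
  fixes w :: "'a::euclidean_space \<Rightarrow> complex"
  assumes w: "w \<in> L2 lborel" and u: "integrable lborel u" "u \<in> L2 lborel"
  shows "L2_norm lborel (\<lambda>\<xi>. fourier_L2 w \<xi> - fourier u \<xi>) = L2_norm lborel (\<lambda>x. w x - u x)"
proof (rule LIMSEQ_unique)
  define w' where "w' n x = indicator (ball 0 (real n)) x * w x" for n x
  note w' = L2_truncation[OF w, of "real _", folded w'_def]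
  show "(\<lambda>n. L2_norm lborel (\<lambda>\<xi>. fourier (w' n) \<xi> - fourier u \<xi>)) \<longlonglongrightarrow> L2_norm lborel (\<lambda>\<xi>. fourier_L2 w \<xi> - fourier u \<xi>)"
    by (rule L2_norm_diff_tendsto[OF fourier_in_L2[OF w'(2,1)] fourier_L2_in_L2[OF w] fourier_in_L2[OF u]
        fourier_L2_tendsto[OF w, folded w'_def]])
  show "(\<lambda>n. L2_norm lborel (\<lambda>\<xi>. fourier (w' n) \<xi> - fourier u \<xi>)) \<longlonglongrightarrow> L2_norm lborel (\<lambda>x. w x - u x)"
    unfolding fourier_isometry_diff[OF w'(2,1) u]
    by (rule L2_norm_diff_tendsto[OF w'(1) w u(2) L2_truncation_tendsto[OF w, folded w'_def]])
qed

lemma Plancherel: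
  fixes w :: "'a::euclidean_space \<Rightarrow> complex"
  assumes "w \<in> L2 lborel"
  shows "L2_norm lborel (fourier_L2 w) = L2_norm lborel w"
  using fourier_L2_fourier_isometry[OF assms, of "\<lambda>x. 0"] by (simp add: L2_zero fourier_zero)

lemma fourier_L2_eq_fourier:
  fixes w :: "'a::euclidean_space \<Rightarrow> complex"
  assumes "integrable lborel w" "w \<in> L2 lborel"
  shows "AE \<xi> in lborel. fourier_L2 w \<xi> = fourier w \<xi>"
  using L2_norm_eq_0[OF L2_diff[OF fourier_L2_in_L2 fourier_in_L2], of w w] assms
    fourier_L2_fourier_isometry[OF assms(2,1,2)] by (simp add: L2_norm_zero)

text \<open>The criterion by which a function is recognised as the transform of \<open>w\<close>.\<close>

lemma fourier_L2_limit:
  fixes w :: "'a::euclidean_space \<Rightarrow> complex"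
  assumes w: "w \<in> L2 lborel" and W: "W \<in> L2 lborel" and u: "\<And>n. integrable lborel (u n)" "\<And>n. u n \<in> L2 lborel"
    and lim: "(\<lambda>n. L2_norm lborel (\<lambda>x. u n x - w x)) \<longlonglongrightarrow> 0"
      "(\<lambda>n. L2_norm lborel (\<lambda>\<xi>. fourier (u n) \<xi> - W \<xi>)) \<longlonglongrightarrow> 0"
  shows "AE \<xi> in lborel. fourier_L2 w \<xi> = W \<xi>"
proof -
  note L = fourier_in_L2[OF u] fourier_L2_in_L2[OF w]
  have "(\<lambda>n. L2_norm lborel (\<lambda>\<xi>. fourier (u n) \<xi> - fourier_L2 w \<xi>)) \<longlonglongrightarrow> L2_norm lborel (\<lambda>\<xi>. W \<xi> - fourier_L2 w \<xi>)"
    by (rule L2_norm_diff_tendsto[OF L(1) W L(2) lim(2)])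
  moreover have "(\<lambda>n. L2_norm lborel (\<lambda>\<xi>. fourier (u n) \<xi> - fourier_L2 w \<xi>)) \<longlonglongrightarrow> 0"
    using lim(1) unfolding L2_norm_minus_commute[of _ "fourier _"] L2_norm_minus_commute[of _ "u _"]
      fourier_L2_fourier_isometry[OF w u] .
  ultimately have "L2_norm lborel (\<lambda>\<xi>. W \<xi> - fourier_L2 w \<xi>) = 0" by (rule LIMSEQ_unique)
  from L2_norm_eq_0[OF L2_diff[OF W L(2)] this] show ?thesis by eventually_elim simp
qed

lemma fourier_L2_diff_fourier:
  fixes w :: "'a::euclidean_space \<Rightarrow> complex"
  assumes w: "w \<in> L2 lborel" and u: "integrable lborel u" "u \<in> L2 lborel"
  shows "AE \<xi> in lborel. fourier_L2 (\<lambda>x. w x - u x) \<xi> = fourier_L2 w \<xi> - fourier u \<xi>"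
proof (rule fourier_L2_limit)
  define w' where "w' n x = indicator (ball 0 (real n)) x * w x" for n x
  note w' = L2_truncation[OF w, of "real _", folded w'_def]
  show "(\<lambda>n. L2_norm lborel (\<lambda>x. (w' n x - u x) - (w x - u x))) \<longlonglongrightarrow> 0"
    using L2_truncation_tendsto[OF w, folded w'_def] by simp
  show "(\<lambda>n. L2_norm lborel (\<lambda>\<xi>. fourier (\<lambda>x. w' n x - u x) \<xi> - (fourier_L2 w \<xi> - fourier u \<xi>))) \<longlonglongrightarrow> 0"
    using fourier_L2_tendsto[OF w, folded w'_def] by (simp add: fourier_diff[OF w'(2) u(1)])
  show "integrable lborel (\<lambda>x. w' n x - u x)" "(\<lambda>x. w' n x - u x) \<in> L2 lborel" for n
    using w' u by (auto intro: L2_diff)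
qed (intro L2_diff w u fourier_L2_in_L2 fourier_in_L2)+


section \<open>Integrating derivatives over the whole space\<close>

lemma integral_lborel_translate:
  fixes F :: "'a::euclidean_space \<Rightarrow> complex"
  assumes "integrable lborel F"
  shows "integrable lborel (\<lambda>x. F (a + x))" "(LINT x|lborel. F (a + x)) = (LINT x|lborel. F x)"
proof -
  have eq: "distr lborel borel (\<lambda>y. a + y) = lborel" using lborel_affine[of 1 a] by (simp add: density_1)
  have [measurable]: "F \<in> borel_measurable borel" using assms by auto
  show "integrable lborel (\<lambda>x. F (a + x))"
    using assms integrable_distr_eq[of "\<lambda>y. a + y" lborel borel F] unfolding eq by simp
  show "(LINT x|lborel. F (a + x)) = (LINT x|lborel. F x)"
    using integral_distr[of "\<lambda>y. a + y" lborel borel F] unfolding eq by simp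
qed

text \<open>The difference quotients have integral zero by translation invariance, and by the mean value theorem \<open>H\<close>
  dominates them. This serves as integration by parts, for test functions and for Gaussians alike.\<close>

lemma integral_directional_derivative_eq_0:
  fixes F :: "'a::euclidean_space \<Rightarrow> complex"
  assumes F: "integrable lborel F" and D: "\<And>x. (F has_derivative D x) (at x)"
    and [measurable]: "(\<lambda>x. D x b) \<in> borel_measurable borel"
    and H: "integrable lborel H" "\<And>x \<tau>. 0 \<le> \<tau> \<Longrightarrow> \<tau> \<le> 1 \<Longrightarrow> norm (D (x + \<tau> *\<^sub>R b) b) \<le> H x"
  shows "(LINT x|lborel. D x b) = 0"
proof (rule LIMSEQ_unique)
  define t where "t n = inverse (real (Suc n))" for n
  have t: "0 < t n" "t n \<le> 1" for n by (simp_all add: t_def inverse_le_1_iff)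
  have t0: "t \<longlonglongrightarrow> 0" unfolding t_def by (rule LIMSEQ_inverse_real_of_nat)
  define q where "q n x = (F (t n *\<^sub>R b + x) - F x) /\<^sub>R t n" for n x
  have [measurable]: "F \<in> borel_measurable borel" using F by auto
  have vd: "((\<lambda>\<tau>. F (x + \<tau> *\<^sub>R b)) has_vector_derivative D (x + \<tau> *\<^sub>R b) b) (at \<tau>)" for x \<tau>
  proof -
    have "((\<lambda>\<tau>. F (x + \<tau> *\<^sub>R b)) has_derivative (\<lambda>h. D (x + \<tau> *\<^sub>R b) (h *\<^sub>R b))) (at \<tau>)"
      by (rule has_derivative_compose[OF _ D]) (auto intro!: derivative_eq_intros)
    then show ?thesis unfolding has_vector_derivative_def
      by (simp add: linear_scale[OF has_derivative_linear[OF D]])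
  qed
  show "(\<lambda>n. LINT x|lborel. q n x) \<longlonglongrightarrow> (LINT x|lborel. D x b)"
  proof (rule integral_dominated_convergence[OF _ _ H(1)])
    show "AE x in lborel. norm (q n x) \<le> H x" for n
    proof (rule AE_I2)
      fix x
      have "norm (F (x + t n *\<^sub>R b) - F (x + 0 *\<^sub>R b)) \<le> H x * norm (t n - 0)"
      proof (rule differentiable_bound[where S = "{0..t n}"])
        show "((\<lambda>\<tau>. F (x + \<tau> *\<^sub>R b)) has_derivative (\<lambda>h. h *\<^sub>R D (x + \<tau> *\<^sub>R b) b)) (at \<tau> within {0..t n})" for \<tau>
          using vd[of x \<tau>] unfolding has_vector_derivative_def by (rule has_derivative_at_withinI)
        show "onorm (\<lambda>h. h *\<^sub>R D (x + \<tau> *\<^sub>R b) b) \<le> H x" if "\<tau> \<in> {0..t n}" for \<tau>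
        proof (rule onorm_bound)
          have d: "norm (D (x + \<tau> *\<^sub>R b) b) \<le> H x" using H(2)[of \<tau> x] that t(2)[of n] by simp
          then show "0 \<le> H x" by (rule order_trans[OF norm_ge_zero])
          show "norm (h *\<^sub>R D (x + \<tau> *\<^sub>R b) b) \<le> H x * norm h" for h
            using mult_right_mono[OF d, of "norm h"] by (simp add: mult.commute)
        qed
      qed (use t[of n] in auto)
      moreover have "norm (q n x) = norm (F (x + t n *\<^sub>R b) - F x) / t n"
        using t(1)[of n] unfolding q_def norm_scaleR by (simp add: add.commute divide_inverse_commute)
      ultimately show "norm (q n x) \<le> H x"
        using t(1)[of n] by (simp add: pos_divide_le_eq)
    qed
    show "AE x in lborel. (\<lambda>n. q n x) \<longlonglongrightarrow> D x b"
    proof (rule AE_I2)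
      fix x
      have "((\<lambda>y. norm (F (x + y *\<^sub>R b) - F x - y *\<^sub>R D x b) / norm y) \<longlongrightarrow> 0) (at 0)"
        using vd[of x 0] unfolding has_vector_derivative_def has_derivative_iff_norm by simp
      moreover have "filterlim t (at 0) sequentially"
        using t0 t(1) by (auto simp: filterlim_at less_imp_neq[symmetric])
      ultimately have "(\<lambda>n. norm (F (x + t n *\<^sub>R b) - F x - t n *\<^sub>R D x b) / norm (t n)) \<longlonglongrightarrow> 0"
        by (rule filterlim_compose)
      moreover have "norm (F (x + t n *\<^sub>R b) - F x - t n *\<^sub>R D x b) / norm (t n) = norm (q n x - D x b)" for n
      proof -
        have "F (x + t n *\<^sub>R b) - F x - t n *\<^sub>R D x b = t n *\<^sub>R (q n x - D x b)"
          using t(1)[of n] by (simp add: q_def scaleR_diff_right add.commute)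
        then show ?thesis using t(1)[of n] by simp
      qed
      ultimately show "(\<lambda>n. q n x) \<longlonglongrightarrow> D x b"
        by (simp add: tendsto_norm_zero_iff LIM_zero_iff)
    qed
  qed (auto simp: q_def)
  have "(LINT x|lborel. q n x) = 0" for n
    using integral_lborel_translate[OF F, of "t n *\<^sub>R b"] F by (simp add: q_def)
  then show "(\<lambda>n. LINT x|lborel. q n x) \<longlonglongrightarrow> 0" by simp
qed

section \<open>Test functions\<close>

lemma Ck_linear:
  "Ck k f \<Longrightarrow> Ck k g \<Longrightarrow> Ck k (\<lambda>x. f x + c * g x)"
proof (induction k arbitrary: f g)
  case 0 then show ?case by (auto intro!: continuous_intros)
next
  case (Suc k)
  have d: "((\<lambda>x. f x + c * g x) has_derivative (\<lambda>h. frechet_derivative f (at x) h + c * frechet_derivative g (at x) h)) (at x)" for x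
    using Suc.prems by (intro derivative_intros) (auto simp: frechet_derivative_works[symmetric])
  have "frechet_derivative (\<lambda>x. f x + c * g x) (at x) = (\<lambda>h. frechet_derivative f (at x) h + c * frechet_derivative g (at x) h)" for x
    by (rule frechet_derivative_at[symmetric, OF d])
  moreover have "(\<lambda>x. f x + c * g x) differentiable at x" for x using d by (auto simp: differentiable_def)
  ultimately show ?case using Suc by simp
qed

lemma Ck_cnj: "Ck k f \<Longrightarrow> Ck k (\<lambda>x. cnj (f x))"
proof (induction k arbitrary: f)
  case 0 then show ?case by (auto intro: continuous_intros)
next
  case (Suc k)
  have d: "((\<lambda>x. cnj (f x)) has_derivative (\<lambda>h. cnj (frechet_derivative f (at x) h))) (at x)" for x
    using Suc.prems by (intro bounded_linear.has_derivative[OF bounded_linear_cnj]) (auto simp: frechet_derivative_works[symmetric])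
  have "frechet_derivative (\<lambda>x. cnj (f x)) (at x) = (\<lambda>h. cnj (frechet_derivative f (at x) h))" for x
    by (rule frechet_derivative_at[symmetric, OF d])
  moreover have "(\<lambda>x. cnj (f x)) differentiable at x" for x using d by (auto simp: differentiable_def)
  ultimately show ?case using Suc by simp
qed

lemma Ck_const: "Ck k (\<lambda>x::'a::euclidean_space. c)"
proof (induction k arbitrary: c)
  case (Suc k) then show ?case using Suc[of 0] by simp
qed simp

lemma test_functions_zero: "(\<lambda>x. 0) \<in> test_functions \<Omega>"
  by (simp add: test_functions_def Ck_const)

lemma compact_closure_subset:
  assumes "compact (closure B)" "A \<subseteq> B" shows "compact (closure A)"
  using assms compact_Int_closed[of "closure B" "closure A"] closure_mono[of A B] by (simp add: Int_absorb1)

lemma test_functions_linear: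
  assumes f: "f \<in> test_functions \<Omega>" and g: "g \<in> test_functions \<Omega>"
  shows "(\<lambda>x. f x + c * g x) \<in> test_functions \<Omega>"
proof -
  have sub: "{x. f x + c * g x \<noteq> 0} \<subseteq> {x. f x \<noteq> 0} \<union> {x. g x \<noteq> 0}" by auto
  have "compact (closure ({x. f x \<noteq> 0} \<union> {x. g x \<noteq> 0}))"
    using f g unfolding closure_Un test_functions_def by (intro compact_Un) auto
  from compact_closure_subset[OF this sub] have "compact (closure {x. f x + c * g x \<noteq> 0})" .
  moreover have "closure {x. f x + c * g x \<noteq> 0} \<subseteq> \<Omega>"
    using closure_mono[OF sub] f g unfolding closure_Un test_functions_def by blast
  ultimately show ?thesis using f g by (simp add: test_functions_def Ck_linear)
qed

lemma test_functions_cnj: "f \<in> test_functions \<Omega> \<Longrightarrow> (\<lambda>x. cnj (f x)) \<in> test_functions \<Omega>"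
  by (simp add: test_functions_def Ck_cnj)

lemma test_functions_has_derivative:
  "f \<in> test_functions \<Omega> \<Longrightarrow> (f has_derivative frechet_derivative f (at x)) (at x)"
proof -
  assume "f \<in> test_functions \<Omega>"
  then have "Ck (Suc 0) f" unfolding test_functions_def by blast
  then show ?thesis by (simp add: frechet_derivative_works)
qed

lemma test_functions_derivative:
  assumes f: "f \<in> test_functions \<Omega>" and b: "b \<in> Basis"
  shows "(\<lambda>x. frechet_derivative f (at x) b) \<in> test_functions \<Omega>"
proof -
  have "Ck k (\<lambda>x. frechet_derivative f (at x) b)" for k
  proof -
    have "Ck (Suc k) f" using f unfolding test_functions_def by blast
    with b show ?thesis by simp
  qed
  moreover have sub: "{x. frechet_derivative f (at x) b \<noteq> 0} \<subseteq> closure {x. f x \<noteq> 0}"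
  proof (intro subsetI, rule ccontr)
    fix x assume x: "x \<in> {x. frechet_derivative f (at x) b \<noteq> 0}" "x \<notin> closure {x. f x \<noteq> 0}"
    have "frechet_derivative f (at x) = frechet_derivative (\<lambda>x. 0) (at x)"
    proof (rule frechet_derivative_transform_within_open[where X = "- closure {x. f x \<noteq> 0}"])
      show "f differentiable at x" using test_functions_has_derivative[OF f] by (auto simp: differentiable_def)
      show "f y = 0" if "y \<in> - closure {x. f x \<noteq> 0}" for y
        using that closure_subset[of "{x. f x \<noteq> 0}"] by auto
    qed (use x in auto)
    with x show False by simp
  qed
  moreover have "closure {x. frechet_derivative f (at x) b \<noteq> 0} \<subseteq> closure {x. f x \<noteq> 0}"
    using sub by (simp add: closure_minimal)
  moreover have "compact (closure {x. frechet_derivative f (at x) b \<noteq> 0})"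
    by (rule compact_closure_subset[OF _ sub]) (use f in \<open>simp add: test_functions_def\<close>)
  ultimately show ?thesis using f unfolding test_functions_def by blast
qed

lemma test_functions_continuous: "f \<in> test_functions \<Omega> \<Longrightarrow> continuous_on UNIV f"
proof -
  assume "f \<in> test_functions \<Omega>"
  then have "Ck 0 f" unfolding test_functions_def by blast
  then show ?thesis by simp
qed

lemma test_functions_outside: "f \<in> test_functions \<Omega> \<Longrightarrow> x \<notin> \<Omega> \<Longrightarrow> f x = 0"
  unfolding test_functions_def using closure_subset[of "{x. f x \<noteq> 0}"] by blast

lemma test_functions_bounded_support:
  assumes "f \<in> test_functions \<Omega>" obtains R where "\<And>x. norm x > R \<Longrightarrow> f x = 0"
proof -
  have "bounded (closure {x. f x \<noteq> 0})" using assms by (auto simp: test_functions_def compact_imp_bounded)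
  then obtain R where "\<forall>x\<in>closure {x. f x \<noteq> 0}. norm x \<le> R" by (auto simp: bounded_iff)
  then have "f x = 0" if "norm x > R" for x
    using that closure_subset[of "{x. f x \<noteq> 0}"] by force
  then show ?thesis by (rule that)
qed

lemma test_functions_L2: "f \<in> test_functions \<Omega> \<Longrightarrow> f \<in> L2 lborel"
  and test_functions_integrable: "f \<in> test_functions \<Omega> \<Longrightarrow> integrable lborel f"
  and test_functions_Plancherel: "f \<in> test_functions \<Omega> \<Longrightarrow> L2_norm lborel (fourier f) = L2_norm lborel f"
  by (metis test_functions_bounded_support test_functions_continuous Plancherel_continuous)+

lemma test_functions_bounded:
  assumes f: "f \<in> test_functions \<Omega>" obtains N where "\<And>x. norm (f x) \<le> N"
proof -
  obtain R where R: "\<And>x. norm x > R \<Longrightarrow> f x = 0" using test_functions_bounded_support[OF f] by blast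
  have "compact (f ` cball 0 R)"
    by (rule compact_continuous_image[OF continuous_on_subset[OF test_functions_continuous[OF f]]]) auto
  then obtain N where N: "\<forall>x\<in>cball 0 R. norm (f x) \<le> N"
    by (auto dest!: compact_imp_bounded simp: bounded_iff)
  have "norm (f x) \<le> max N 0" for x
    using bspec[OF N, of x] R[of x] by (cases "norm x \<le> R") auto
  then show ?thesis by (rule that)
qed

text \<open>The derivative of \<open>cis (- (x \<bullet> \<xi>)) * f x\<close> in the direction \<open>b\<close> has integral zero.\<close>

lemma fourier_derivative:
  fixes f :: "'a::euclidean_space \<Rightarrow> complex"
  assumes f: "f \<in> test_functions \<Omega>" and b: "b \<in> Basis"
  shows "fourier (\<lambda>x. frechet_derivative f (at x) b) \<xi> = \<i> * of_real (b \<bullet> \<xi>) * fourier f \<xi>"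
proof -
  define f' where "f' x = frechet_derivative f (at x) b" for x
  have f': "f' \<in> test_functions \<Omega>" unfolding f'_def by (rule test_functions_derivative[OF f b])
  define D where "D x h = cis (- (x \<bullet> \<xi>)) * frechet_derivative f (at x) h + ((- (h \<bullet> \<xi>)) *\<^sub>R (\<i> * cis (- (x \<bullet> \<xi>)))) * f x" for x h
  obtain N N' where N: "\<And>x. norm (f x) \<le> N" "\<And>x. norm (f' x) \<le> N'"
    using test_functions_bounded[OF f] test_functions_bounded[OF f'] by metis
  obtain R R' where R: "\<And>x. norm x > R \<Longrightarrow> f x = 0" "\<And>x. norm x > R' \<Longrightarrow> f' x = 0"
    using test_functions_bounded_support[OF f] test_functions_bounded_support[OF f'] by metis
  define \<rho> where "\<rho> = max R R' + 1"
  define C where "C = N' + \<bar>b \<bullet> \<xi>\<bar> * N"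
  have Db: "D x b = cis (- (x \<bullet> \<xi>)) * f' x - \<i> * of_real (b \<bullet> \<xi>) * (cis (- (x \<bullet> \<xi>)) * f x)" for x
    by (simp add: D_def f'_def scaleR_conv_of_real)
  have [measurable]: "f \<in> borel_measurable borel" "f' \<in> borel_measurable borel"
    using test_functions_continuous[OF f] test_functions_continuous[OF f'] by (auto intro: borel_measurable_continuous_onI)
  have "0 = (LINT x|lborel. D x b)"
  proof (rule integral_directional_derivative_eq_0[symmetric])
    show "integrable lborel (\<lambda>x. cis (- (x \<bullet> \<xi>)) * f x)"
      by (rule integrable_cis_mult[OF test_functions_integrable[OF f]]) measurable
    show "((\<lambda>x. cis (- (x \<bullet> \<xi>)) * f x) has_derivative D x) (at x)" for x
    proof -
      have "((\<lambda>x. cis (- (x \<bullet> \<xi>))) has_derivative (\<lambda>h. (- (h \<bullet> \<xi>)) *\<^sub>R (\<i> * cis (- (x \<bullet> \<xi>))))) (at x)"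
        by (auto intro!: derivative_eq_intros has_derivative_compose[OF _ has_derivative_cis[unfolded has_vector_derivative_def]])
      from has_derivative_mult[OF this test_functions_has_derivative[OF f]] show ?thesis
        unfolding D_def by simp
    qed
    show "(\<lambda>x. D x b) \<in> borel_measurable borel" unfolding Db by measurable
    show "integrable lborel (\<lambda>x::'a. C * indicator (cball 0 \<rho>) x)"
      by (rule integrable_mult_right) (auto intro!: integrable_real_indicator emeasure_bounded_finite)
    fix x \<tau> assume \<tau>: "0 \<le> \<tau>" "\<tau> \<le> (1::real)"
    have *: "norm (D y b) \<le> C" for y
    proof -
      have "norm (D y b) \<le> norm (f' y) + \<bar>b \<bullet> \<xi>\<bar> * norm (f y)"
        unfolding Db by (rule order_trans[OF norm_triangle_ineq4]) (simp add: norm_mult abs_mult)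
      also have "\<dots> \<le> C" unfolding C_def by (intro add_mono mult_left_mono N) auto
      finally show ?thesis .
    qed
    show "norm (D (x + \<tau> *\<^sub>R b) b) \<le> C * indicator (cball 0 \<rho>) x"
    proof (cases "norm x \<le> \<rho>")
      case False
      have "norm (\<tau> *\<^sub>R b) \<le> 1" using b \<tau> by simp
      moreover have "norm x \<le> norm (x + \<tau> *\<^sub>R b) + norm (\<tau> *\<^sub>R b)"
        using norm_triangle_ineq4[of "x + \<tau> *\<^sub>R b" "\<tau> *\<^sub>R b"] by simp
      ultimately have "norm (x + \<tau> *\<^sub>R b) > max R R'" using False unfolding \<rho>_def by linarith
      then show ?thesis using R False by (simp add: Db)
    qed (use * in simp)
  qed
  also have "\<dots> = (LINT x|lborel. cis (- (x \<bullet> \<xi>)) * f' x) - \<i> * of_real (b \<bullet> \<xi>) * (LINT x|lborel. cis (- (x \<bullet> \<xi>)) * f x)"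
    unfolding Db
    by (subst Bochner_Integration.integral_diff) (auto intro!: integrable_cis_mult test_functions_integrable[OF f] test_functions_integrable[OF f'] integrable_mult_right)
  finally have "(LINT x|lborel. cis (- (x \<bullet> \<xi>)) * f' x) = \<i> * of_real (b \<bullet> \<xi>) * (LINT x|lborel. cis (- (x \<bullet> \<xi>)) * f x)" by simp
  then show ?thesis unfolding fourier_def f'_def[symmetric] by (simp add: mult.left_commute)
qed

text \<open>The factor \<open>(norm \<xi>)\<^sup>2\<close> turns the transform of \<open>f\<close> into that of minus its Laplacian, again a test function.\<close>

lemma test_functions_fourier_decay:
  fixes f :: "'a::euclidean_space \<Rightarrow> complex"
  assumes f: "f \<in> test_functions \<Omega>"
  shows "(\<lambda>\<xi>. of_real (1 + (norm \<xi>)\<^sup>2) * fourier f \<xi>) \<in> L2 lborel"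
proof -
  define d2 where "d2 b x = frechet_derivative (\<lambda>y. frechet_derivative f (at y) b) (at x) b" for b x
  have d2: "d2 b \<in> test_functions \<Omega>" if "b \<in> Basis" for b
    unfolding d2_def by (intro test_functions_derivative f that)
  have "of_real (1 + (norm \<xi>)\<^sup>2) * fourier f \<xi> = fourier f \<xi> - (\<Sum>b\<in>Basis. fourier (d2 b) \<xi>)" for \<xi>
  proof -
    have "fourier (d2 b) \<xi> = - (of_real ((\<xi> \<bullet> b)\<^sup>2) * fourier f \<xi>)" if "b \<in> Basis" for b
      unfolding d2_def using f that
      by (simp add: fourier_derivative[OF test_functions_derivative[OF f that] that] fourier_derivative[OF f that] inner_commute power2_eq_square) (simp add: algebra_simps)
    then show ?thesis
      by (simp add: norm_power2_Basis[of \<xi>] sum_negf sum_distrib_right distrib_right)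
  qed
  moreover have "(\<lambda>\<xi>. fourier f \<xi> - (\<Sum>b\<in>Basis. fourier (d2 b) \<xi>)) \<in> L2 lborel"
    using f d2 by (intro L2_diff L2_sum fourier_in_L2) (auto intro: test_functions_integrable test_functions_L2)
  ultimately show ?thesis by simp
qed

lemma powr_le_one_plus_square:
  fixes r :: real assumes "0 \<le> r" "0 \<le> a" "a \<le> 2" shows "r powr a \<le> 1 + r\<^sup>2"
proof (cases "r \<le> 1")
  case True
  then have "r powr a \<le> 1" using assms by (intro powr_le1) auto
  then show ?thesis by (simp add: add_increasing2)
next
  case False
  then have "r powr a \<le> r powr 2" using assms by (intro powr_mono) auto
  then show ?thesis using False by simp
qed

lemma test_functions_fourier_weighted:
  fixes f :: "'a::euclidean_space \<Rightarrow> complex"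
  assumes f: "f \<in> test_functions \<Omega>" and a: "0 \<le> a" "a \<le> 2"
  shows "(\<lambda>\<xi>. of_real (norm \<xi> powr a) * fourier f \<xi>) \<in> L2 lborel"
    "(\<lambda>\<xi>. of_real (norm \<xi> powr a) * fourier f (- \<xi>)) \<in> L2 lborel"
proof -
  have *: "(\<lambda>\<xi>. of_real (norm \<xi> powr a) * fourier f \<xi>) \<in> L2 lborel" if "f \<in> test_functions \<Omega>" for f :: "'a \<Rightarrow> complex"
  proof (rule L2_dominated_norm[OF _ test_functions_fourier_decay[OF that], of _ 1])
    note [measurable] = fourier_measurable[OF test_functions_integrable[OF that]]
    show "(\<lambda>\<xi>. of_real (norm \<xi> powr a) * fourier f \<xi>) \<in> borel_measurable lborel" by measurable
    show "norm (of_real (norm \<xi> powr a) * fourier f \<xi>) \<le> 1 * norm (of_real (1 + (norm \<xi>)\<^sup>2) * fourier f \<xi>)" for \<xi>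
      unfolding norm_mult norm_of_real mult_1 using a powr_le_one_plus_square[of "norm \<xi>" a]
      by (intro mult_right_mono) auto
  qed
  show "(\<lambda>\<xi>. of_real (norm \<xi> powr a) * fourier f \<xi>) \<in> L2 lborel" by (rule *[OF f])
  have "fourier f (- \<xi>) = cnj (fourier (\<lambda>x. cnj (f x)) \<xi>)" for \<xi>
    using fourier_cnj[of "\<lambda>x. cnj (f x)" \<xi>] by simp
  then show "(\<lambda>\<xi>. of_real (norm \<xi> powr a) * fourier f (- \<xi>)) \<in> L2 lborel"
    using L2_cnj[OF *[OF test_functions_cnj[OF f]]] by simp
qed


section \<open>The energy space\<close>

text \<open>The \<open>L\<^sup>2\<close> norm of this function is the energy of \<open>f\<close>, the homogeneous Sobolev seminorm. Keeping the weight
  in the function lets the Hilbert space arguments take place in unweighted \<open>L\<^sup>2\<close>.\<close>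

definition energy_transform :: "real \<Rightarrow> ('a::euclidean_space \<Rightarrow> complex) \<Rightarrow> 'a \<Rightarrow> complex" where
  "energy_transform s f \<xi> = of_real (norm \<xi> powr s) * fourier f \<xi>"

lemma energy_transform_L2:
  "f \<in> test_functions \<Omega> \<Longrightarrow> 0 \<le> s \<Longrightarrow> s \<le> 2 \<Longrightarrow> energy_transform s f \<in> L2 lborel"
  unfolding energy_transform_def[abs_def] by (rule test_functions_fourier_weighted)

lemma energy_transform_linear:
  assumes "f \<in> test_functions \<Omega>" "g \<in> test_functions \<Omega>"
  shows "energy_transform s (\<lambda>x. f x + c * g x) \<xi> = energy_transform s f \<xi> + c * energy_transform s g \<xi>"
  using assms by (simp add: energy_transform_def fourier_add_cmult test_functions_integrable algebra_simps)

lemma energy_transform_diff: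
  assumes "f \<in> test_functions \<Omega>" "g \<in> test_functions \<Omega>"
  shows "energy_transform s (\<lambda>x. f x - g x) \<xi> = energy_transform s f \<xi> - energy_transform s g \<xi>"
  using energy_transform_linear[OF assms, of s "-1"] by simp

lemma test_functions_diff:
  assumes "f \<in> test_functions \<Omega>" "g \<in> test_functions \<Omega>"
  shows "(\<lambda>x. f x - g x) \<in> test_functions \<Omega>"
  using test_functions_linear[OF assms, of "-1"] by simp

lemma test_functions_L1_le_L2:
  assumes f: "f \<in> test_functions (ball (0::'a::euclidean_space) 1)"
  shows "(LINT x|lborel. norm (f x)) \<le> sqrt (measure lborel (ball (0::'a) 1)) * L2_norm lborel f"
proof -
  define B where "B x = (indicator (ball 0 1) x :: complex)" for x :: 'a
  have B: "B \<in> L2 lborel"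
    unfolding B_def by (rule L2_bounded_support[of _ 1 1]) (auto split: split_indicator)
  have "(L2_norm lborel B)\<^sup>2 = (LINT x|lborel. indicator (ball 0 1) (x::'a))"
    unfolding L2_norm_power2 B_def by (rule Bochner_Integration.integral_cong) (auto split: split_indicator)
  then have nB: "L2_norm lborel B = sqrt (measure lborel (ball (0::'a) 1))"
    using L2_norm_nonneg[of lborel B] by (simp add: real_sqrt_unique[symmetric])
  have "(LINT x|lborel. norm (f x)) = (LINT x|lborel. norm (B x) * norm (f x))"
    by (rule Bochner_Integration.integral_cong) (use test_functions_outside[OF f] in \<open>auto simp: B_def split: split_indicator\<close>)
  then show ?thesis using L2_Cauchy_Schwarz_abs[OF B test_functions_L2[OF f]] by (simp add: nB)
qed

text \<open>Functions supported in the ball have \<open>L\<^sup>1\<close> norm, and hence transform, bounded by a multiple of their \<open>L\<^sup>2\<close>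
  norm. So the frequencies in a small ball about the origin carry at most half of the square of the norm, and
  outside that ball the weight \<open>norm \<xi> powr s\<close> is bounded below.\<close>

lemma fractional_Poincare:
  assumes s: "0 < s" "s < 1"
  shows "\<exists>C>0. \<forall>f\<in>test_functions (ball (0::'a::euclidean_space) 1). L2_norm lborel f \<le> C * L2_norm lborel (energy_transform s f)"
proof -
  define K where "K = fourier_const TYPE('a) * sqrt (measure lborel (ball (0::'a) 1))"
  define V where "V = unit_ball_vol (real DIM('a))"
  \<comment> \<open>The volume of the \<open>\<delta>\<close>-ball is at most \<open>V * \<delta>\<close>, and \<open>K\<^sup>2 * (V * \<delta>) \<le> 1/2\<close>.\<close>
  define \<delta> where "\<delta> = min 1 (1 / (2 * K\<^sup>2 * V + 1))"
  have V: "V > 0" by (simp add: V_def)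
  have q: "2 * K\<^sup>2 * V \<ge> 0" using V by simp
  have q': "2 * K\<^sup>2 * V + 1 > 0" using q by linarith
  have \<delta>: "0 < \<delta>" "\<delta> \<le> 1" unfolding \<delta>_def using divide_pos_pos[OF zero_less_one q'] by linarith+
  have "\<delta> ^ DIM('a) \<le> \<delta>" using power_decreasing[of 1 "DIM('a)" \<delta>] \<delta> DIM_positive[where 'a='a] by simp
  then have vol: "measure lborel (ball (0::'a) \<delta>) \<le> V * \<delta>"
    using content_ball[of \<delta> "0::'a"] \<delta> V by (simp add: V_def)
  have "K\<^sup>2 * (V * \<delta>) \<le> 1 / 2"
  proof -
    have "2 * K\<^sup>2 * V * \<delta> \<le> 2 * K\<^sup>2 * V * (1 / (2 * K\<^sup>2 * V + 1))"
      unfolding \<delta>_def by (rule mult_left_mono[OF min.cobounded2 q])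
    also have "\<dots> \<le> 1" using q' by (simp add: divide_le_eq)
    finally show ?thesis by simp
  qed
  with mult_left_mono[OF vol, of "K\<^sup>2"] have small: "K\<^sup>2 * measure lborel (ball (0::'a) \<delta>) \<le> 1 / 2" by simp
  define C where "C = sqrt 2 * \<delta> powr (- s)"
  have C: "C > 0" using \<delta> by (simp add: C_def)
  have "L2_norm lborel f \<le> C * L2_norm lborel (energy_transform s f)" if f: "f \<in> test_functions (ball (0::'a) 1)" for f
  proof -
    define T where "T = energy_transform s f"
    define n where "n = L2_norm lborel f"
    have T: "T \<in> L2 lborel" unfolding T_def by (rule energy_transform_L2[OF f]) (use s in auto)
    have fc: "fourier_const TYPE('a) \<ge> 0" by (simp add: fourier_const_def)
    have F: "norm (fourier f \<xi>) \<le> K * n" for \<xi>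
      using order_trans[OF fourier_bound[of f \<xi>] mult_left_mono[OF test_functions_L1_le_L2[OF f] fc]]
      by (simp add: K_def n_def mult.assoc)
    have "n\<^sup>2 = (LINT \<xi>|lborel. (norm (fourier f \<xi>))\<^sup>2)"
      unfolding n_def test_functions_Plancherel[OF f, symmetric] L2_norm_power2 ..
    also have "\<dots> \<le> (LINT \<xi>|lborel. (K * n)\<^sup>2 * indicator (ball 0 \<delta>) \<xi> + (\<delta> powr (- s))\<^sup>2 * (norm (T \<xi>))\<^sup>2)"
    proof (rule integral_mono)
      show "integrable lborel (\<lambda>\<xi>. (norm (fourier f \<xi>))\<^sup>2)"
        by (intro L2_integrable fourier_in_L2 test_functions_integrable[OF f] test_functions_L2[OF f])
      show "integrable lborel (\<lambda>\<xi>. (K * n)\<^sup>2 * indicator (ball 0 \<delta>) \<xi> + (\<delta> powr (- s))\<^sup>2 * (norm (T \<xi>))\<^sup>2)"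
        using L2_integrable[OF T] emeasure_bounded_finite[OF bounded_ball, of "0::'a" \<delta>]
        by (intro Bochner_Integration.integrable_add integrable_mult_right integrable_real_indicator) auto
      fix \<xi> :: 'a
      show "(norm (fourier f \<xi>))\<^sup>2 \<le> (K * n)\<^sup>2 * indicator (ball 0 \<delta>) \<xi> + (\<delta> powr (- s))\<^sup>2 * (norm (T \<xi>))\<^sup>2"
      proof (cases "norm \<xi> < \<delta>")
        case True then show ?thesis using power_mono[OF F[of \<xi>], of 2] by (simp add: add_increasing2)
      next
        case False
        have "\<delta> powr s \<le> norm \<xi> powr s" using False \<delta> s by (intro powr_mono2) auto
        then have "1 \<le> \<delta> powr (- s) * norm \<xi> powr s" using \<delta> by (simp add: powr_minus field_simps)
        then have "1 * norm (fourier f \<xi>) \<le> (\<delta> powr (- s) * norm \<xi> powr s) * norm (fourier f \<xi>)"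
          by (intro mult_right_mono) auto
        then have "norm (fourier f \<xi>) \<le> \<delta> powr (- s) * norm (T \<xi>)"
          by (simp add: T_def energy_transform_def norm_mult mult.assoc)
        from power_mono[OF this, of 2] show ?thesis by (simp add: power_mult_distrib add_increasing)
      qed
    qed
    also have "\<dots> = (LINT \<xi>|lborel. (K * n)\<^sup>2 * indicator (ball (0::'a) \<delta>) \<xi>) + (LINT \<xi>|lborel. (\<delta> powr (- s))\<^sup>2 * (norm (T \<xi>))\<^sup>2)"
      using L2_integrable[OF T] emeasure_bounded_finite[OF bounded_ball, of "0::'a" \<delta>]
      by (intro Bochner_Integration.integral_add integrable_mult_right integrable_real_indicator) auto
    also have "\<dots> = (K * n)\<^sup>2 * measure lborel (ball (0::'a) \<delta>) + (\<delta> powr (- s))\<^sup>2 * (L2_norm lborel T)\<^sup>2"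
      unfolding L2_norm_power2 by simp
    also have "(K * n)\<^sup>2 * measure lborel (ball (0::'a) \<delta>) = n\<^sup>2 * (K\<^sup>2 * measure lborel (ball (0::'a) \<delta>))"
      by (simp add: power_mult_distrib)
    also have "\<dots> \<le> n\<^sup>2 * (1/2)" by (rule mult_left_mono[OF small]) simp
    finally have "n\<^sup>2 \<le> 2 * ((\<delta> powr (- s))\<^sup>2 * (L2_norm lborel T)\<^sup>2)" by simp
    also have "\<dots> = (C * L2_norm lborel T)\<^sup>2" by (simp add: C_def power_mult_distrib)
    finally show ?thesis unfolding n_def T_def
      by (rule power2_le_imp_le) (use C in \<open>simp add: L2_norm_nonneg\<close>)
  qed
  with C show ?thesis by blast
qed

section \<open>Weak solutions\<close>

lemma norm_powr_double: "norm \<xi> powr (2 * s) = norm \<xi> powr s * norm \<xi> powr s"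
  by (simp add: powr_add[symmetric])

text \<open>The pairing of the fractional Laplacian is bilinear; conjugating the test function turns it into the inner
  product of the energy space.\<close>

lemma frac_laplacian_energy:
  fixes \<phi> :: "'a::euclidean_space \<Rightarrow> complex"
  shows "frac_laplacian s w (\<lambda>x. cnj (\<phi> x)) = L2_inner lborel (\<lambda>\<xi>. of_real (norm \<xi> powr s) * fourier_L2 w \<xi>) (energy_transform s \<phi>)"
  unfolding frac_laplacian_def L2_inner_def energy_transform_def fourier_cnj
    norm_powr_double of_real_mult complex_cnj_mult complex_cnj_complex_of_real
  by (simp only: mult_ac)

lemma frac_laplacian_linear:
  assumes w: "w \<in> L2 lborel" and f: "f \<in> test_functions \<Omega>" and g: "g \<in> test_functions \<Omega>" and s: "0 < s" "s < 1"
  shows "frac_laplacian s w (\<lambda>x. f x + c * g x) = frac_laplacian s w f + c * frac_laplacian s w g"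
proof -
  have i: "integrable lborel (\<lambda>\<xi>. of_real (norm \<xi> powr (2 * s)) * fourier_L2 w \<xi> * fourier f (- \<xi>))"
    if f: "f \<in> test_functions \<Omega>" for f
    using L2_mult_integrable(1)[OF fourier_L2_in_L2[OF w] test_functions_fourier_weighted(2)[OF f, of "2 * s"]] s
    by (simp add: mult_ac)
  have "frac_laplacian s w (\<lambda>x. f x + c * g x) = (LINT \<xi>|lborel. of_real (norm \<xi> powr (2 * s)) * fourier_L2 w \<xi> * fourier f (- \<xi>)
      + c * (of_real (norm \<xi> powr (2 * s)) * fourier_L2 w \<xi> * fourier g (- \<xi>)))"
    unfolding frac_laplacian_def using f g
    by (intro Bochner_Integration.integral_cong) (simp_all add: fourier_add_cmult test_functions_integrable algebra_simps)
  then show ?thesis using i[OF f] i[OF g] by (simp add: frac_laplacian_def)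
qed

text \<open>Approximation by test functions in \<open>H\<^sup>s\<close> is approximation both in \<open>L\<^sup>2\<close> and in energy.\<close>

lemma Hs_norm_test_bounds:
  fixes v :: "'a::euclidean_space \<Rightarrow> complex"
  assumes s: "0 < s" "s < 1" and v: "v \<in> Hs s" and f: "f \<in> test_functions \<Omega>"
  shows "L2_norm lborel (\<lambda>x. v x - f x) \<le> Hs_norm s (\<lambda>x. v x - f x)"
    "L2_norm lborel (\<lambda>\<xi>. of_real (norm \<xi> powr s) * fourier_L2 v \<xi> - energy_transform s f \<xi>) \<le> Hs_norm s (\<lambda>x. v x - f x)"
proof -
  have vL: "v \<in> L2 lborel" using v by (simp add: Hs_def)
  note fL = test_functions_integrable[OF f] test_functions_L2[OF f]
  define W where "W \<xi> = fourier_L2 (\<lambda>x. v x - f x) \<xi>" for \<xi>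
  have W_AE: "AE \<xi> in lborel. W \<xi> = fourier_L2 v \<xi> - fourier f \<xi>"
    unfolding W_def by (rule fourier_L2_diff_fourier[OF vL fL])
  have dL: "(\<lambda>x. v x - f x) \<in> L2 lborel" by (rule L2_diff[OF vL fL(2)])
  have WL: "W \<in> L2 lborel" unfolding W_def[abs_def] by (rule fourier_L2_in_L2[OF dL])
  have [measurable]: "W \<in> borel_measurable borel" using L2_measurable[OF WL] by simp
  have [measurable]: "fourier_L2 v \<in> borel_measurable borel" using L2_measurable[OF fourier_L2_in_L2[OF vL]] by simp
  note [measurable] = fourier_measurable[OF fL(1)]
  let ?w = "\<lambda>\<xi>::'a. (1 + (norm \<xi>)\<^sup>2) powr s"
  have w1: "1 \<le> ?w \<xi>" for \<xi> using s by (intro ge_one_powr_ge_zero) auto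
  have w2: "(norm \<xi> powr s)\<^sup>2 \<le> ?w \<xi>" for \<xi>
  proof -
    have "(norm \<xi> powr s)\<^sup>2 = ((norm \<xi>)\<^sup>2) powr s"
      by (cases "\<xi> = 0") (simp_all add: powr_powr powr_numeral[symmetric] mult.commute powr_power del: powr_numeral)
    also have "\<dots> \<le> ?w \<xi>" using s by (intro powr_mono2) auto
    finally show ?thesis .
  qed
  have decay: "integrable lborel (\<lambda>\<xi>. ?w \<xi> * (norm (fourier f \<xi>))\<^sup>2)"
  proof (rule Bochner_Integration.integrable_bound[OF L2_integrable[OF test_functions_fourier_decay[OF f]]])
    show "AE \<xi> in lborel. norm (?w \<xi> * (norm (fourier f \<xi>))\<^sup>2) \<le> norm ((norm (of_real (1 + (norm \<xi>)\<^sup>2) * fourier f \<xi>))\<^sup>2)"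
    proof (rule AE_I2)
      fix \<xi> :: 'a
      have "?w \<xi> \<le> (1 + (norm \<xi>)\<^sup>2) powr 2" using s by (intro powr_mono) auto
      also have "\<dots> = (1 + (norm \<xi>)\<^sup>2)\<^sup>2" by (simp add: add_pos_nonneg)
      finally show "norm (?w \<xi> * (norm (fourier f \<xi>))\<^sup>2) \<le> norm ((norm (of_real (1 + (norm \<xi>)\<^sup>2) * fourier f \<xi>))\<^sup>2)"
        unfolding norm_mult power_mult_distrib norm_of_real by (simp add: mult_right_mono del: of_real_add)
    qed
  qed measurable
  have i: "integrable lborel (\<lambda>\<xi>. ?w \<xi> * (norm (W \<xi>))\<^sup>2)"
  proof (rule Bochner_Integration.integrable_bound)
    show "integrable lborel (\<lambda>\<xi>. 2 * (?w \<xi> * (norm (fourier_L2 v \<xi>))\<^sup>2) + 2 * (?w \<xi> * (norm (fourier f \<xi>))\<^sup>2))"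
      using v decay by (simp add: Hs_def)
    show "AE \<xi> in lborel. norm (?w \<xi> * (norm (W \<xi>))\<^sup>2) \<le> norm (2 * (?w \<xi> * (norm (fourier_L2 v \<xi>))\<^sup>2) + 2 * (?w \<xi> * (norm (fourier f \<xi>))\<^sup>2))"
      using W_AE
    proof eventually_elim
      case (elim \<xi>)
      have "(norm (W \<xi>))\<^sup>2 \<le> (norm (fourier_L2 v \<xi>) + norm (fourier f \<xi>))\<^sup>2"
        unfolding elim by (intro power_mono norm_triangle_ineq4) simp
      also have "\<dots> \<le> 2 * (norm (fourier_L2 v \<xi>))\<^sup>2 + 2 * (norm (fourier f \<xi>))\<^sup>2"
        using sum_squares_bound[of "norm (fourier_L2 v \<xi>)" "norm (fourier f \<xi>)"] by (simp add: power2_sum)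
      finally have "?w \<xi> * (norm (W \<xi>))\<^sup>2 \<le> ?w \<xi> * (2 * (norm (fourier_L2 v \<xi>))\<^sup>2 + 2 * (norm (fourier f \<xi>))\<^sup>2)"
        by (rule mult_left_mono) simp
      then show ?case by (simp add: algebra_simps)
    qed
  qed measurable
  have "L2_norm lborel W \<le> Hs_norm s (\<lambda>x. v x - f x)"
    unfolding L2_norm_def Hs_norm_def W_def[symmetric]
    using i L2_integrable[OF WL] by (intro real_sqrt_le_mono integral_mono) (auto intro!: mult_right_mono[OF w1, of "_\<^sup>2", simplified])
  then show "L2_norm lborel (\<lambda>x. v x - f x) \<le> Hs_norm s (\<lambda>x. v x - f x)"
    using Plancherel[OF dL] by (simp add: W_def[abs_def])
  define U where "U \<xi> = complex_of_real (norm \<xi> powr s) * W \<xi>" for \<xi>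
  have "L2_norm lborel (\<lambda>\<xi>. of_real (norm \<xi> powr s) * fourier_L2 v \<xi> - energy_transform s f \<xi>) = L2_norm lborel U"
  proof (rule L2_norm_cong_AE)
    show "AE \<xi> in lborel. of_real (norm \<xi> powr s) * fourier_L2 v \<xi> - energy_transform s f \<xi> = U \<xi>"
      using W_AE by eventually_elim (simp add: U_def energy_transform_def right_diff_distrib)
  qed (simp_all add: U_def[abs_def] energy_transform_def[abs_def])
  also have "\<dots> \<le> Hs_norm s (\<lambda>x. v x - f x)"
    unfolding L2_norm_def Hs_norm_def W_def[symmetric]
  proof (rule real_sqrt_le_mono, rule integral_mono_AE'[OF i])
    show "AE \<xi> in lborel. (norm (U \<xi>))\<^sup>2 \<le> ?w \<xi> * (norm (W \<xi>))\<^sup>2"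
      using w2 by (intro AE_I2) (simp add: U_def norm_mult power_mult_distrib mult_right_mono)
  qed simp
  finally show "L2_norm lborel (\<lambda>\<xi>. of_real (norm \<xi> powr s) * fourier_L2 v \<xi> - energy_transform s f \<xi>) \<le> Hs_norm s (\<lambda>x. v x - f x)" .
qed


lemma Hs_energy_L2:
  assumes s: "0 < s" "s < 1" and v: "v \<in> Hs s"
  shows "(\<lambda>\<xi>. of_real (norm \<xi> powr s) * fourier_L2 v \<xi>) \<in> L2 lborel"
proof (rule L2_dominated)
  have vL: "v \<in> L2 lborel" using v by (simp add: Hs_def)
  have [measurable]: "fourier_L2 v \<in> borel_measurable borel" using L2_measurable[OF fourier_L2_in_L2[OF vL]] by simp
  show "(\<lambda>\<xi>. of_real (norm \<xi> powr s) * fourier_L2 v \<xi>) \<in> borel_measurable lborel" by measurable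
  show "integrable lborel (\<lambda>\<xi>. (1 + (norm \<xi>)\<^sup>2) powr s * (norm (fourier_L2 v \<xi>))\<^sup>2)" using v by (simp add: Hs_def)
  show "(norm (of_real (norm \<xi> powr s) * fourier_L2 v \<xi>))\<^sup>2 \<le> (1 + (norm \<xi>)\<^sup>2) powr s * (norm (fourier_L2 v \<xi>))\<^sup>2" for \<xi>
  proof -
    have "(norm \<xi> powr s)\<^sup>2 = ((norm \<xi>)\<^sup>2) powr s"
      by (cases "\<xi> = 0") (simp_all add: powr_powr powr_numeral[symmetric] mult.commute powr_power del: powr_numeral)
    also have "\<dots> \<le> (1 + (norm \<xi>)\<^sup>2) powr s" using s by (intro powr_mono2) auto
    finally show ?thesis by (simp add: norm_mult power_mult_distrib mult_right_mono)
  qed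
qed

text \<open>The factor \<open>1 / (1 + w)\<close> makes the weight bounded, so that the two limits can be compared inside \<open>L\<^sup>2\<close>
  without passing to subsequences that converge almost everywhere.\<close>

lemma L2_limits_eq_AE_weighted:
  assumes "\<And>n. f n \<in> L2 M" "u \<in> L2 M" "V \<in> L2 M" and [measurable]: "w \<in> borel_measurable M"
    and w: "\<And>x. w x \<ge> (0::real)"
    and wf: "\<And>n. (\<lambda>x. of_real (w x) * f n x) \<in> L2 M"
    and "(\<lambda>n. L2_norm M (\<lambda>x. f n x - V x)) \<longlonglongrightarrow> 0"
    and "(\<lambda>n. L2_norm M (\<lambda>x. of_real (w x) * f n x - u x)) \<longlonglongrightarrow> 0"
  shows "AE x in M. u x = of_real (w x) * V x"
proof -
  define k where "k x = 1 / (1 + w x)" for x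
  have k: "0 < k x" "k x \<le> 1" "k x * w x \<le> 1" for x using w[of x] by (auto simp: k_def add_nonneg_pos add_pos_nonneg)
  have kn: "\<bar>k x\<bar> = k x" "\<bar>w x\<bar> = w x" "0 \<le> k x * w x" "0 \<le> k x" for x using k[of x] w[of x] by auto
  have [measurable]: "k \<in> borel_measurable M" unfolding k_def[abs_def] by measurable
  note [measurable] = assms(1-3)[THEN L2_measurable]
  define D where "D x = of_real (k x) * (u x - of_real (w x) * V x)" for x
  have d1: "(\<lambda>x. of_real (k x * w x) * (f n x - V x)) \<in> L2 M" for n
    by (rule L2_dominated_norm[OF _ L2_diff[OF assms(1)[of n] assms(3)], where C = 1])
      (simp_all add: norm_mult abs_mult kn mult_left_le_one_le k(2) mult_left_le_one_le[OF _ _ k(3), OF _ kn(3)])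
  have d2: "(\<lambda>x. of_real (k x) * (of_real (w x) * f n x - u x)) \<in> L2 M" for n
    by (rule L2_dominated_norm[OF _ L2_diff[OF wf[of n] assms(2)], where C = 1])
      (simp_all add: norm_mult abs_mult kn mult_left_le_one_le k(2) mult_left_le_one_le[OF _ _ k(3), OF _ kn(3)])
  have D: "D x = of_real (k x * w x) * (f n x - V x) - of_real (k x) * (of_real (w x) * f n x - u x)" for x n
    by (simp add: D_def algebra_simps)
  have DL: "D \<in> L2 M" using L2_diff[OF d1 d2, of 0 0] unfolding D[symmetric] .
  have bound: "L2_norm M D \<le> L2_norm M (\<lambda>x. f n x - V x) + L2_norm M (\<lambda>x. of_real (w x) * f n x - u x)" for n
  proof -
    have "L2_norm M D \<le> L2_norm M (\<lambda>x. of_real (k x * w x) * (f n x - V x)) + L2_norm M (\<lambda>x. of_real (k x) * (of_real (w x) * f n x - u x))"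
      using L2_norm_triangle[OF d1 L2_cmult[OF d2], of n "-1" n] L2_norm_cmult[of M "-1"] D[symmetric]
      by simp
    also have "\<dots> \<le> L2_norm M (\<lambda>x. f n x - V x) + L2_norm M (\<lambda>x. of_real (w x) * f n x - u x)"
      using k w
      by (intro add_mono L2_norm_mono L2_diff assms(1-3) wf L2_measurable[OF d1] L2_measurable[OF d2])
        (simp_all add: norm_mult abs_mult kn mult_left_le_one_le k(2) mult_left_le_one_le[OF _ _ k(3), OF _ kn(3)])
    finally show ?thesis .
  qed
  have "L2_norm M D \<le> 0 + 0"
    by (rule LIMSEQ_le_const[OF tendsto_add[OF assms(7,8)]]) (use bound in blast)
  with L2_norm_nonneg[of M D] have "L2_norm M D = 0" by simp
  from L2_norm_eq_0[OF DL this] show ?thesis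
  proof eventually_elim
    case (elim x)
    with k(1)[of x] show ?case by (simp add: D_def)
  qed
qed

lemma one_plus_square_powr_le:
  fixes r s :: real
  assumes "0 < s" "s < 1" "0 \<le> r"
  shows "(1 + r\<^sup>2) powr s \<le> 2 + 2 * (r powr s)\<^sup>2"
proof -
  have 2: "(2::real) powr s \<le> 2" using powr_mono[of s 1 "2::real"] assms by simp
  show ?thesis
  proof (cases "r \<le> 1")
    case True
    then have "(1 + r\<^sup>2) powr s \<le> 2 powr s" using assms by (intro powr_mono2) (auto simp: power_le_one)
    with 2 show ?thesis by (simp add: add_increasing2)
  next
    case False
    then have "1 + r\<^sup>2 \<le> 2 * r\<^sup>2" using one_le_power[of r 2] by simp
    then have "(1 + r\<^sup>2) powr s \<le> (2 * r\<^sup>2) powr s" using assms by (intro powr_mono2) auto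
    also have "\<dots> = 2 powr s * (r\<^sup>2) powr s" by (rule powr_mult)
    also have "(r\<^sup>2) powr s = (r powr s)\<^sup>2"
      using False by (simp add: powr_powr powr_numeral[symmetric] mult.commute powr_power del: powr_numeral)
    also have "2 powr s * (r powr s)\<^sup>2 \<le> 2 * (r powr s)\<^sup>2" using 2 by (intro mult_right_mono) auto
    finally show ?thesis by simp
  qed
qed

text \<open>The converse of the preceding bounds: convergence in \<open>L\<^sup>2\<close> and in energy is convergence in \<open>H\<^sup>s\<close>, since
  \<open>(1 + (norm \<xi>)\<^sup>2) powr s\<close> is at most a constant times \<open>1 + (norm \<xi> powr s)\<^sup>2\<close>.\<close>

lemma energy_limit_Hs_tilde:
  fixes v :: "'a::euclidean_space \<Rightarrow> complex"
  assumes s: "0 < s" "s < 1" and v: "v \<in> L2 lborel" and f: "\<And>n. f n \<in> test_functions \<Omega>"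
    and lim: "(\<lambda>n. L2_norm lborel (\<lambda>x. f n x - v x)) \<longlonglongrightarrow> 0"
    and u: "u \<in> L2 lborel" "(\<lambda>n. L2_norm lborel (\<lambda>\<xi>. energy_transform s (f n) \<xi> - u \<xi>)) \<longlonglongrightarrow> 0"
  shows "AE \<xi> in lborel. u \<xi> = of_real (norm \<xi> powr s) * fourier_L2 v \<xi>" "v \<in> Hs_tilde s \<Omega>"
proof -
  define V where "V = fourier_L2 v"
  note fL = test_functions_integrable[OF f] test_functions_L2[OF f]
  have VL: "V \<in> L2 lborel" unfolding V_def by (rule fourier_L2_in_L2[OF v])
  have limF: "(\<lambda>n. L2_norm lborel (\<lambda>\<xi>. fourier (f n) \<xi> - V \<xi>)) \<longlonglongrightarrow> 0"
    unfolding V_def L2_norm_minus_commute[of lborel "fourier (f _)"] fourier_L2_fourier_isometry[OF v fL]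
    using lim unfolding L2_norm_minus_commute[of lborel "f _"] .
  show uV: "AE \<xi> in lborel. u \<xi> = of_real (norm \<xi> powr s) * fourier_L2 v \<xi>"
    unfolding V_def[symmetric]
  proof (rule L2_limits_eq_AE_weighted[OF fourier_in_L2[OF fL] u(1) VL _ _ _ limF])
    show "(\<lambda>\<xi>. of_real (norm \<xi> powr s) * fourier (f n) \<xi>) \<in> L2 lborel" for n
      by (rule test_functions_fourier_weighted[OF f]) (use s in auto)
    show "(\<lambda>n. L2_norm lborel (\<lambda>\<xi>. of_real (norm \<xi> powr s) * fourier (f n) \<xi> - u \<xi>)) \<longlonglongrightarrow> 0"
      using u(2) by (simp add: energy_transform_def)
  qed auto
  have [measurable]: "V \<in> borel_measurable borel" "u \<in> borel_measurable borel" using L2_measurable[OF VL] L2_measurable[OF u(1)] by auto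
  let ?w = "\<lambda>\<xi>::'a. (1 + (norm \<xi>)\<^sup>2) powr s"
  have vH: "v \<in> Hs s" unfolding Hs_def
  proof (intro CollectI conjI v)
    show "integrable lborel (\<lambda>\<xi>. ?w \<xi> * (norm (fourier_L2 v \<xi>))\<^sup>2)"
      unfolding V_def[symmetric]
    proof (rule Bochner_Integration.integrable_bound)
      show "integrable lborel (\<lambda>\<xi>. 2 * (norm (V \<xi>))\<^sup>2 + 2 * (norm (u \<xi>))\<^sup>2)"
        using L2_integrable[OF VL] L2_integrable[OF u(1)] by simp
      show "AE \<xi> in lborel. norm (?w \<xi> * (norm (V \<xi>))\<^sup>2) \<le> norm (2 * (norm (V \<xi>))\<^sup>2 + 2 * (norm (u \<xi>))\<^sup>2)"
        using uV
      proof eventually_elim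
        case (elim \<xi>)
        have "?w \<xi> * (norm (V \<xi>))\<^sup>2 \<le> (2 + 2 * (norm \<xi> powr s)\<^sup>2) * (norm (V \<xi>))\<^sup>2"
          by (intro mult_right_mono one_plus_square_powr_le s) auto
        then show ?case by (simp add: elim V_def norm_mult power_mult_distrib algebra_simps)
      qed
    qed measurable
  qed
  have bound: "Hs_norm s (\<lambda>x. v x - f n x) \<le> 2 * (L2_norm lborel (\<lambda>\<xi>. fourier (f n) \<xi> - V \<xi>) + L2_norm lborel (\<lambda>\<xi>. energy_transform s (f n) \<xi> - u \<xi>))" for n
  proof -
    define a b where "a = L2_norm lborel (\<lambda>\<xi>. fourier (f n) \<xi> - V \<xi>)" and "b = L2_norm lborel (\<lambda>\<xi>. energy_transform s (f n) \<xi> - u \<xi>)"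
    have L: "(\<lambda>\<xi>. fourier (f n) \<xi> - V \<xi>) \<in> L2 lborel" "(\<lambda>\<xi>. energy_transform s (f n) \<xi> - u \<xi>) \<in> L2 lborel"
      using s by (intro L2_diff fourier_in_L2 fL VL u energy_transform_L2[OF f]; simp)+
    have "(LINT \<xi>|lborel. ?w \<xi> * (norm (fourier_L2 (\<lambda>x. v x - f n x) \<xi>))\<^sup>2)
        \<le> (LINT \<xi>|lborel. 2 * (norm (fourier (f n) \<xi> - V \<xi>))\<^sup>2 + 2 * (norm (energy_transform s (f n) \<xi> - u \<xi>))\<^sup>2)"
    proof (rule integral_mono_AE')
      show "integrable lborel (\<lambda>\<xi>. 2 * (norm (fourier (f n) \<xi> - V \<xi>))\<^sup>2 + 2 * (norm (energy_transform s (f n) \<xi> - u \<xi>))\<^sup>2)"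
        using L[THEN L2_integrable] by simp
      show "AE \<xi> in lborel. ?w \<xi> * (norm (fourier_L2 (\<lambda>x. v x - f n x) \<xi>))\<^sup>2
         \<le> 2 * (norm (fourier (f n) \<xi> - V \<xi>))\<^sup>2 + 2 * (norm (energy_transform s (f n) \<xi> - u \<xi>))\<^sup>2"
        using uV fourier_L2_diff_fourier[OF v fL, of n]
      proof eventually_elim
        case (elim \<xi>)
        have "energy_transform s (f n) \<xi> - u \<xi> = of_real (norm \<xi> powr s) * (fourier (f n) \<xi> - V \<xi>)"
          by (simp add: elim V_def energy_transform_def right_diff_distrib)
        then have e: "(norm (energy_transform s (f n) \<xi> - u \<xi>))\<^sup>2 = (norm \<xi> powr s)\<^sup>2 * (norm (fourier (f n) \<xi> - V \<xi>))\<^sup>2"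
          by (simp add: norm_mult power_mult_distrib)
        have "?w \<xi> * (norm (fourier (f n) \<xi> - V \<xi>))\<^sup>2 \<le> (2 + 2 * (norm \<xi> powr s)\<^sup>2) * (norm (fourier (f n) \<xi> - V \<xi>))\<^sup>2"
          by (intro mult_right_mono one_plus_square_powr_le s) auto
        then show ?case unfolding e elim(2) V_def[symmetric] by (simp add: norm_minus_commute algebra_simps)
      qed
    qed simp
    also have "\<dots> = 2 * a\<^sup>2 + 2 * b\<^sup>2" using L[THEN L2_integrable] by (simp add: a_def b_def L2_norm_power2)
    also have "\<dots> \<le> (2 * (a + b))\<^sup>2"
    proof -
      have "0 \<le> a * b" by (simp add: a_def b_def L2_norm_nonneg)
      then show ?thesis by (simp add: power2_eq_square algebra_simps)
    qed
    finally have "Hs_norm s (\<lambda>x. v x - f n x) \<le> sqrt ((2 * (a + b))\<^sup>2)"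
      unfolding Hs_norm_def by (rule real_sqrt_le_mono)
    then have "Hs_norm s (\<lambda>x. v x - f n x) \<le> \<bar>2 * (a + b)\<bar>" by (simp only: real_sqrt_abs)
    then show ?thesis by (simp add: a_def b_def L2_norm_nonneg)
  qed
  have "(\<lambda>n. 2 * (L2_norm lborel (\<lambda>\<xi>. fourier (f n) \<xi> - V \<xi>) + L2_norm lborel (\<lambda>\<xi>. energy_transform s (f n) \<xi> - u \<xi>))) \<longlonglongrightarrow> 2 * (0 + 0)"
    by (intro tendsto_intros limF u)
  then have "\<exists>\<phi>\<in>test_functions \<Omega>. Hs_norm s (\<lambda>x. v x - \<phi> x) < \<epsilon>" if "\<epsilon> > 0" for \<epsilon>
  proof -
    assume "(\<lambda>n. 2 * (L2_norm lborel (\<lambda>\<xi>. fourier (f n) \<xi> - V \<xi>) + L2_norm lborel (\<lambda>\<xi>. energy_transform s (f n) \<xi> - u \<xi>))) \<longlonglongrightarrow> 2 * (0 + 0)"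
    from order_tendstoD(2)[OF this, of \<epsilon>] that obtain n where
      "2 * (L2_norm lborel (\<lambda>\<xi>. fourier (f n) \<xi> - V \<xi>) + L2_norm lborel (\<lambda>\<xi>. energy_transform s (f n) \<xi> - u \<xi>)) < \<epsilon>"
      by (auto simp: eventually_sequentially)
    with bound[of n] f[of n] show ?thesis by force
  qed
  with vH show "v \<in> Hs_tilde s \<Omega>" unfolding Hs_tilde_def by blast
qed

text \<open>If the right-hand side is a functional of \<open>L\<^sup>2\<close> norm at most \<open>\<epsilon>\<close>, the Poincare inequality makes it bounded on
  the energy space, and the representing vector is the weighted transform of a correction. Testing the equation with the
  correction itself bounds its energy, hence its norm; this applies to every correction, in particular to
  the one selected by the definition of the solution.\<close>

theorem correction_exists_and_bounded:
  assumes s: "0 < s" "s < 1"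
  shows "\<exists>C>0. \<forall>(f :: 'a::euclidean_space \<Rightarrow> complex) \<epsilon>. 0 \<le> \<epsilon> \<longrightarrow> extend_zero f \<in> L2 lborel \<longrightarrow>
     (\<forall>\<phi>\<in>test_functions (ball 0 1). norm (frac_laplacian s (extend_zero f) \<phi>) \<le> \<epsilon> * L2_norm lborel \<phi>) \<longrightarrow>
     (\<exists>v. is_correction s f v) \<and> (\<forall>v. is_correction s f v \<longrightarrow> v \<in> L2 lborel \<and> L2_norm lborel v \<le> C * \<epsilon>)"
proof -
  let ?X = "test_functions (ball (0::'a) 1)"
  obtain C where C: "C > 0" and P: "\<And>f. f \<in> ?X \<Longrightarrow> L2_norm lborel f \<le> C * L2_norm lborel (energy_transform s f)"
    using fractional_Poincare[OF s, where 'a='a] by blast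
  have TL: "f \<in> ?X \<Longrightarrow> energy_transform s f \<in> L2 lborel" for f using s by (intro energy_transform_L2) auto
  have "(\<exists>v. is_correction s f v) \<and> (\<forall>v. is_correction s f v \<longrightarrow> v \<in> L2 lborel \<and> L2_norm lborel v \<le> C\<^sup>2 * \<epsilon>)"
    if w: "extend_zero f \<in> L2 lborel" and L: "\<And>\<phi>. \<phi> \<in> ?X \<Longrightarrow> norm (frac_laplacian s (extend_zero f) \<phi>) \<le> \<epsilon> * L2_norm lborel \<phi>"
      and "\<epsilon> \<ge> 0"
    for f :: "'a \<Rightarrow> complex" and \<epsilon>
  proof
    define l where "l \<phi> = - frac_laplacian s (extend_zero f) (\<lambda>x. cnj (\<phi> x))" for \<phi>
    have lb: "norm (l \<phi>) \<le> (\<epsilon> * C) * L2_norm lborel (energy_transform s \<phi>)" if "\<phi> \<in> ?X" for \<phi>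
    proof -
      have "norm (l \<phi>) \<le> \<epsilon> * L2_norm lborel (\<lambda>x. cnj (\<phi> x))"
        using L[OF test_functions_cnj[OF that]] by (simp add: l_def)
      also have "L2_norm lborel (\<lambda>x. cnj (\<phi> x)) = L2_norm lborel \<phi>" by (rule L2_norm_cong) simp
      also have "\<epsilon> * L2_norm lborel \<phi> \<le> \<epsilon> * (C * L2_norm lborel (energy_transform s \<phi>))"
        by (intro mult_left_mono P that \<open>\<epsilon> \<ge> 0\<close>)
      finally show ?thesis by (simp add: mult.assoc)
    qed
    have "\<exists>u\<in>L2 lborel. (\<exists>\<phi>. (\<forall>n. \<phi> n \<in> ?X) \<and> (\<lambda>n. L2_norm lborel (\<lambda>x. energy_transform s (\<phi> n) x - u x)) \<longlonglongrightarrow> 0)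
            \<and> (\<forall>\<psi>\<in>?X. L2_inner lborel u (energy_transform s \<psi>) = l \<psi>)"
    proof (rule L2_Riesz_representation)
      show "l (\<lambda>x. g x + c * h x) = l g + cnj c * l h" if "g \<in> ?X" "h \<in> ?X" for g h c
        unfolding l_def using frac_laplacian_linear[OF w test_functions_cnj[OF that(1)] test_functions_cnj[OF that(2)] s, of "cnj c"]
        by simp
    qed (auto intro: test_functions_zero test_functions_linear TL energy_transform_linear lb)
    then obtain u \<phi> where u: "u \<in> L2 lborel" and \<phi>: "\<And>n. \<phi> n \<in> ?X"
      and lim: "(\<lambda>n. L2_norm lborel (\<lambda>x. energy_transform s (\<phi> n) x - u x)) \<longlonglongrightarrow> 0"
      and rep: "\<And>\<psi>. \<psi> \<in> ?X \<Longrightarrow> L2_inner lborel u (energy_transform s \<psi>) = l \<psi>" by blast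
    have "\<exists>v\<in>L2 lborel. (\<lambda>n. L2_norm lborel (\<lambda>x. \<phi> n x - v x)) \<longlonglongrightarrow> 0"
    proof (rule L2_complete)
      show "\<phi> n \<in> L2 lborel" for n by (rule test_functions_L2[OF \<phi>])
      fix e :: real assume "e > 0"
      then obtain N where N: "\<And>m n. m \<ge> N \<Longrightarrow> n \<ge> N \<Longrightarrow> L2_norm lborel (\<lambda>x. energy_transform s (\<phi> m) x - energy_transform s (\<phi> n) x) < e / C"
        using L2_norm_convergent_imp_Cauchy[OF TL[OF \<phi>] u lim, of "e / C"] C by auto
      have "L2_norm lborel (\<lambda>x. \<phi> m x - \<phi> n x) < e" if "m \<ge> N" "n \<ge> N" for m n
      proof -
        have "L2_norm lborel (\<lambda>x. \<phi> m x - \<phi> n x) \<le> C * L2_norm lborel (energy_transform s (\<lambda>x. \<phi> m x - \<phi> n x))"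
          by (rule P[OF test_functions_diff[OF \<phi> \<phi>]])
        also have "energy_transform s (\<lambda>x. \<phi> m x - \<phi> n x) = (\<lambda>x. energy_transform s (\<phi> m) x - energy_transform s (\<phi> n) x)"
          using energy_transform_diff[OF \<phi> \<phi>] by blast
        also have "C * L2_norm lborel \<dots> < C * (e / C)" using N[OF that] C by (intro mult_strict_left_mono) auto
        finally show ?thesis using C by simp
      qed
      then show "\<exists>N. \<forall>m\<ge>N. \<forall>n\<ge>N. L2_norm lborel (\<lambda>x. \<phi> m x - \<phi> n x) < e" by blast
    qed
    then obtain v where v: "v \<in> L2 lborel" "(\<lambda>n. L2_norm lborel (\<lambda>x. \<phi> n x - v x)) \<longlonglongrightarrow> 0" by blast
    note E = energy_limit_Hs_tilde[OF s v(1) \<phi> v(2) u lim]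
    have "frac_laplacian s v \<psi> = - frac_laplacian s (extend_zero f) \<psi>" if \<psi>: "\<psi> \<in> ?X" for \<psi>
    proof -
      note \<psi>' = test_functions_cnj[OF \<psi>]
      have "frac_laplacian s v \<psi> = L2_inner lborel (\<lambda>\<xi>. of_real (norm \<xi> powr s) * fourier_L2 v \<xi>) (energy_transform s (\<lambda>x. cnj (\<psi> x)))"
        using frac_laplacian_energy[of s v "\<lambda>x. cnj (\<psi> x)"] by simp
      also have "\<dots> = L2_inner lborel u (energy_transform s (\<lambda>x. cnj (\<psi> x)))"
        unfolding L2_inner_def
      proof (rule integral_cong_AE)
        have [measurable]: "fourier_L2 v \<in> borel_measurable borel" "u \<in> borel_measurable borel"
          "energy_transform s (\<lambda>x. cnj (\<psi> x)) \<in> borel_measurable borel"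
          using L2_measurable[OF fourier_L2_in_L2[OF v(1)]] L2_measurable[OF u] L2_measurable[OF TL[OF \<psi>']] by auto
        show "(\<lambda>\<xi>. of_real (norm \<xi> powr s) * fourier_L2 v \<xi> * cnj (energy_transform s (\<lambda>x. cnj (\<psi> x)) \<xi>)) \<in> borel_measurable lborel"
          "(\<lambda>\<xi>. u \<xi> * cnj (energy_transform s (\<lambda>x. cnj (\<psi> x)) \<xi>)) \<in> borel_measurable lborel" by measurable
        show "AE \<xi> in lborel. of_real (norm \<xi> powr s) * fourier_L2 v \<xi> * cnj (energy_transform s (\<lambda>x. cnj (\<psi> x)) \<xi>) = u \<xi> * cnj (energy_transform s (\<lambda>x. cnj (\<psi> x)) \<xi>)"
          using E(1) by eventually_elim simp
      qed
      also have "\<dots> = l (\<lambda>x. cnj (\<psi> x))" by (rule rep[OF \<psi>'])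
      finally show ?thesis by (simp add: l_def)
    qed
    with E(2) have "is_correction s f v" by (simp add: is_correction_def)
    then show "\<exists>v. is_correction s f v" by blast
    show "\<forall>v. is_correction s f v \<longrightarrow> v \<in> L2 lborel \<and> L2_norm lborel v \<le> C\<^sup>2 * \<epsilon>"
    proof (intro allI impI)
      fix v assume "is_correction s f v"
      then have vH: "v \<in> Hs s" and app: "\<And>\<epsilon>. \<epsilon> > 0 \<Longrightarrow> \<exists>\<phi>\<in>?X. Hs_norm s (\<lambda>x. v x - \<phi> x) < \<epsilon>"
        and eq: "\<And>\<psi>. \<psi> \<in> ?X \<Longrightarrow> frac_laplacian s v \<psi> = - frac_laplacian s (extend_zero f) \<psi>"
        by (auto simp: is_correction_def Hs_tilde_def)
      have vL: "v \<in> L2 lborel" using vH by (simp add: Hs_def)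
      define u where "u \<xi> = of_real (norm \<xi> powr s) * fourier_L2 v \<xi>" for \<xi>
      have u: "u \<in> L2 lborel" unfolding u_def[abs_def] by (rule Hs_energy_L2[OF s vH])
      have "\<forall>n. \<exists>\<phi>\<in>?X. Hs_norm s (\<lambda>x. v x - \<phi> x) < inverse (real (Suc n))" using app by simp
      then obtain \<phi> where \<phi>: "\<And>n. \<phi> n \<in> ?X" and small: "\<And>n. Hs_norm s (\<lambda>x. v x - \<phi> n x) < inverse (real (Suc n))" by metis
      have lim1: "(\<lambda>n. L2_norm lborel (\<lambda>x. \<phi> n x - v x)) \<longlonglongrightarrow> 0"
      proof (rule tendsto_sandwich[OF _ _ tendsto_const LIMSEQ_inverse_real_of_nat])
        show "\<forall>\<^sub>F n in sequentially. L2_norm lborel (\<lambda>x. \<phi> n x - v x) \<le> inverse (real (Suc n))"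
          using Hs_norm_test_bounds(1)[OF s vH \<phi>] small unfolding L2_norm_minus_commute[of _ "\<phi> _"]
          by (intro always_eventually allI) (meson less_imp_le order_trans)
      qed (simp add: L2_norm_nonneg)
      have lim2: "(\<lambda>n. L2_norm lborel (\<lambda>x. energy_transform s (\<phi> n) x - u x)) \<longlonglongrightarrow> 0"
      proof (rule tendsto_sandwich[OF _ _ tendsto_const LIMSEQ_inverse_real_of_nat])
        show "\<forall>\<^sub>F n in sequentially. L2_norm lborel (\<lambda>x. energy_transform s (\<phi> n) x - u x) \<le> inverse (real (Suc n))"
          using Hs_norm_test_bounds(2)[OF s vH \<phi>] small unfolding L2_norm_minus_commute[of _ "energy_transform s (\<phi> _)"] u_def
          by (intro always_eventually allI) (meson less_imp_le order_trans)
      qed (simp add: L2_norm_nonneg)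
      have norms: "(\<lambda>n. L2_norm lborel (\<phi> n)) \<longlonglongrightarrow> L2_norm lborel v"
        "(\<lambda>n. L2_norm lborel (energy_transform s (\<phi> n))) \<longlonglongrightarrow> L2_norm lborel u"
        by (rule L2_norm_tendsto[OF test_functions_L2[OF \<phi>] vL lim1] L2_norm_tendsto[OF TL[OF \<phi>] u lim2])+
      have "norm (L2_inner lborel u u) \<le> (\<epsilon> * C) * L2_norm lborel u"
      proof (rule LIMSEQ_le)
        show "(\<lambda>n. norm (L2_inner lborel (energy_transform s (\<phi> n)) u)) \<longlonglongrightarrow> norm (L2_inner lborel u u)"
          by (intro tendsto_norm L2_inner_tendsto_left TL \<phi> u lim2)
        show "(\<lambda>n. (\<epsilon> * C) * L2_norm lborel (energy_transform s (\<phi> n))) \<longlonglongrightarrow> (\<epsilon> * C) * L2_norm lborel u"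
          by (intro tendsto_intros norms)
        have "norm (L2_inner lborel (energy_transform s (\<phi> n)) u) \<le> (\<epsilon> * C) * L2_norm lborel (energy_transform s (\<phi> n))" for n
        proof -
          have "norm (L2_inner lborel (energy_transform s (\<phi> n)) u) = norm (L2_inner lborel u (energy_transform s (\<phi> n)))"
            using L2_inner_cnj[of lborel u] by simp
          also have "\<dots> = norm (l (\<phi> n))"
            unfolding u_def[abs_def] frac_laplacian_energy[symmetric] eq[OF test_functions_cnj[OF \<phi>]] l_def ..
          also have "\<dots> \<le> (\<epsilon> * C) * L2_norm lborel (energy_transform s (\<phi> n))" by (rule lb[OF \<phi>])
          finally show ?thesis .
        qed
        then show "\<exists>N. \<forall>n\<ge>N. norm (L2_inner lborel (energy_transform s (\<phi> n)) u) \<le> (\<epsilon> * C) * L2_norm lborel (energy_transform s (\<phi> n))" by blast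
      qed
      then have "L2_norm lborel u * L2_norm lborel u \<le> (\<epsilon> * C) * L2_norm lborel u"
        unfolding L2_inner_self norm_of_real by (simp add: power2_eq_square)
      then have un: "L2_norm lborel u \<le> \<epsilon> * C"
        using L2_norm_nonneg[of lborel u] \<open>\<epsilon> \<ge> 0\<close> C by (cases "L2_norm lborel u = 0") (auto simp: mult_le_cancel_right)
      have "L2_norm lborel v \<le> C * L2_norm lborel u"
        by (rule LIMSEQ_le[OF norms(1) tendsto_mult_left[OF norms(2)]]) (use P[OF \<phi>] in blast)
      also have "\<dots> \<le> C * (\<epsilon> * C)" using un C by (intro mult_left_mono) auto
      finally show "v \<in> L2 lborel \<and> L2_norm lborel v \<le> C\<^sup>2 * \<epsilon>" using vL by (simp add: power2_eq_square mult_ac)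
    qed
  qed
  moreover have "C\<^sup>2 > 0" using C by simp
  ultimately show ?thesis by blast
qed


section \<open>Two subordination integrals\<close>

lemma integrable_powr_pieces:
  "a > -1 \<Longrightarrow> integrable lborel (\<lambda>t::real. indicator {0..1} t * t powr a)"
  "e < -1 \<Longrightarrow> integrable lborel (\<lambda>t::real. indicator {1..} t * t powr e)"
proof -
  have *: "integrable lborel (\<lambda>t::real. indicator S t * t powr b)"
    if I: "((\<lambda>t. t powr b) has_integral I) S" and [measurable]: "S \<in> sets borel" for S b I
  proof -
    have "((\<lambda>t. indicator S t * t powr b) has_integral I) UNIV"
    proof -
      have "(\<lambda>t. indicator S t * t powr b) = (\<lambda>t. if t \<in> S then t powr b else 0)" by auto
      then show ?thesis using I by (simp only: has_integral_restrict_UNIV)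
    qed
    then have "(\<integral>\<^sup>+t. ennreal (indicator S t * t powr b) \<partial>lborel) = ennreal I"
      by (intro nn_integral_has_integral_lborel) auto
    then show ?thesis by (intro integrableI_nonneg) auto
  qed
  show "a > -1 \<Longrightarrow> integrable lborel (\<lambda>t::real. indicator {0..1} t * t powr a)"
    using *[OF has_integral_powr_from_0[of a 1]] by simp
  show "e < -1 \<Longrightarrow> integrable lborel (\<lambda>t::real. indicator {1..} t * t powr e)"
    using *[OF has_integral_powr_to_inf[of e 1]] by simp
qed

lemma integral_rescale_positive:
  fixes f :: "real \<Rightarrow> real"
  assumes f: "integrable lborel f" and c: "c > 0"
  shows "has_bochner_integral lborel (\<lambda>t. f (c * t)) ((LINT t|lborel. f t) / c)"
  unfolding has_bochner_integral_iff
  using lborel_integrable_real_affine[OF f, of c 0] lborel_integral_real_affine[of c f 0] c by simp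

text \<open>The value \<open>0\<close> on the negative half line lets the subordination integrals run over all of \<open>\<real>\<close>.\<close>

definition subord_weight :: "real \<Rightarrow> real \<Rightarrow> real" where
  "subord_weight s t = (if t > 0 then t powr (-1 - s) else 0)"

lemma subord_weight_measurable [measurable]: "subord_weight s \<in> borel_measurable borel"
  unfolding subord_weight_def[abs_def] by measurable

lemma subord_weight_scale: "c > 0 \<Longrightarrow> subord_weight s (c * t) = c powr (-1 - s) * subord_weight s t"
  by (auto simp: subord_weight_def powr_mult zero_less_mult_iff)

text \<open>Substituting \<open>t / r\<^sup>2\<close> for \<open>t\<close> reduces to \<open>r = 1\<close>. There the integrand is at most \<open>t powr (- s)\<close> near zero and
  \<open>t powr (-1 - s)\<close> near infinity, which is where \<open>0 < s < 1\<close> enters.\<close>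

lemma subordination_symbol:
  assumes s: "0 < s" "s < 1"
  shows "\<exists>a>0. \<forall>r\<ge>0. has_bochner_integral lborel (\<lambda>t. subord_weight s t * (1 - exp (- (t * r\<^sup>2)))) (a * r powr (2 * s))"
proof -
  define f where "f t = subord_weight s t * (1 - exp (- t))" for t
  have f0: "f t \<ge> 0" for t by (simp add: f_def subord_weight_def)
  have [measurable]: "f \<in> borel_measurable borel" unfolding f_def[abs_def] by measurable
  have bound: "f t \<le> indicator {0..1} t * t powr (- s) + indicator {1..} t * t powr (-1 - s)" for t
  proof -
    consider "t \<le> 0" | "0 < t" "t < 1" | "1 \<le> t" by linarith
    then show ?thesis
    proof cases
      case 2
      have "1 - exp (- t) \<le> t" using exp_ge_add_one_self[of "- t"] by simp
      then have "t powr (-1 - s) * (1 - exp (- t)) \<le> t powr (-1 - s) * t" by (intro mult_left_mono) auto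
      also have "\<dots> = t powr (-1 - s) * t powr 1" using 2 by simp
      also have "\<dots> = t powr (- s)" unfolding powr_add[symmetric] by simp
      finally show ?thesis using 2 by (simp add: f_def subord_weight_def)
    next
      case 3
      then have "t powr (-1 - s) * (1 - exp (- t)) \<le> t powr (-1 - s) * 1" by (intro mult_left_mono) auto
      then show ?thesis using 3 by (simp add: f_def subord_weight_def add_increasing)
    qed (auto simp: f_def subord_weight_def)
  qed
  have f: "integrable lborel f"
  proof (rule Bochner_Integration.integrable_bound)
    show "integrable lborel (\<lambda>t. indicator {0..1} t * t powr (- s) + indicator {1..} t * t powr (-1 - s))"
      using s by (intro Bochner_Integration.integrable_add integrable_powr_pieces) auto
  qed (use bound f0 in \<open>auto intro!: AE_I2 intro: order_trans[OF bound abs_ge_self]\<close>)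
  define a where "a = (LINT t|lborel. f t)"
  have "0 \<le> a" unfolding a_def using f0 by (simp add: integral_nonneg_AE)
  moreover have "a \<noteq> 0"
  proof
    assume "a = 0"
    then have AE0: "AE t in lborel. f t = 0" using integral_nonneg_eq_0_iff_AE[OF f] f0 by (simp add: a_def)
    have "f t \<noteq> 0" if "t > 0" for t using that by (simp add: f_def subord_weight_def)
    then have "AE t in lborel. \<not> (t::real) > 0" by (intro eventually_mono[OF AE0]) blast
    then have "AE t in lborel. t \<notin> {0<..<1::real}" by (rule eventually_mono) auto
    then have "{0<..<1::real} \<in> null_sets lborel" by (subst AE_iff_null_sets) auto
    then have "emeasure lborel {0<..<1::real} = 0" by auto
    then show False by simp
  qed
  ultimately have a: "a > 0" by simp
  have "has_bochner_integral lborel (\<lambda>t. subord_weight s t * (1 - exp (- (t * r\<^sup>2)))) (a * r powr (2 * s))" if r: "r \<ge> 0" for r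
  proof (cases "r = 0")
    case True then show ?thesis by (simp add: has_bochner_integral_iff)
  next
    case False
    with r have r: "r > 0" by simp
    have "has_bochner_integral lborel (\<lambda>t. f (r\<^sup>2 * t)) (a / r\<^sup>2)"
      unfolding a_def by (rule integral_rescale_positive[OF f]) (use r in simp)
    then have "has_bochner_integral lborel (\<lambda>t. (r\<^sup>2) powr (1 + s) * f (r\<^sup>2 * t)) ((r\<^sup>2) powr (1 + s) * (a / r\<^sup>2))"
      by (rule has_bochner_integral_mult_right)
    also have "(\<lambda>t. (r\<^sup>2) powr (1 + s) * f (r\<^sup>2 * t)) = (\<lambda>t. subord_weight s t * (1 - exp (- (t * r\<^sup>2))))"
    proof
      fix t
      have "(r\<^sup>2) powr (1 + s) * (r\<^sup>2) powr (-1 - s) = 1" unfolding powr_add[symmetric] using r by simp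
      then show "(r\<^sup>2) powr (1 + s) * f (r\<^sup>2 * t) = subord_weight s t * (1 - exp (- (t * r\<^sup>2)))"
        using r by (simp add: f_def subord_weight_scale mult.assoc[symmetric])
    qed
    also have "(r\<^sup>2) powr (1 + s) * (a / r\<^sup>2) = a * r powr (2 * s)"
    proof -
      have "(r\<^sup>2) powr (1 + s) = r\<^sup>2 * (r\<^sup>2) powr s" using r by (simp add: powr_add)
      also have "(r\<^sup>2) powr s = r powr (2 * s)"
        using r by (simp add: powr_powr powr_numeral[symmetric] del: powr_numeral)
      finally show ?thesis using r by simp
    qed
    finally show ?thesis .
  qed
  with a show ?thesis by blast
qed

lemma exp_minus_inverse_le:
  fixes t :: real assumes t: "t > 0" and N: "N > (0::nat)"
  shows "exp (- (1 / (4 * t))) \<le> (4 * real N * t) ^ N"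
proof -
  define y where "y = 1 / (4 * real N * t)"
  have y: "y > 0" using t N by (simp add: y_def)
  have "y \<le> exp y" using exp_ge_add_one_self[of y] by linarith
  then have "y ^ N \<le> exp y ^ N" using y by (intro power_mono) auto
  also have "exp y ^ N = exp (real N * y)" by (simp add: exp_of_nat_mult)
  also have "real N * y = 1 / (4 * t)" using N by (simp add: y_def)
  finally have "inverse (exp (1 / (4 * t))) \<le> inverse (y ^ N)" using y by (intro le_imp_inverse_le) auto
  then show ?thesis by (simp add: exp_minus y_def power_one_over inverse_eq_divide)
qed

text \<open>The heat kernel as a function of its time, at distance \<open>r\<close> from the origin of \<open>\<real>\<^sup>n\<close>.\<close>

definition heat_profile :: "nat \<Rightarrow> real \<Rightarrow> real \<Rightarrow> real" where
  "heat_profile n r t = (1 / sqrt (4 * pi * t)) ^ n * exp (- (r\<^sup>2 / (4 * t)))"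

lemma heat_kernel_profile: "heat_kernel t (z::'a::euclidean_space) = heat_profile DIM('a) (norm z) t"
  by (simp add: heat_kernel_def heat_profile_def)

text \<open>Substituting \<open>r\<^sup>2 * t\<close> for \<open>t\<close> reduces to \<open>r = 1\<close>, where the exponential beats every negative power of \<open>t\<close> near
  zero.\<close>

lemma subordination_kernel:
  assumes s: "0 < s" "s < 1"
  shows "\<exists>b\<ge>0. \<forall>r>0. has_bochner_integral lborel (\<lambda>t. subord_weight s t * heat_profile n r t) (b * r powr (- (real n + 2 * s)))"
proof -
  define f where "f t = subord_weight s t * heat_profile n 1 t" for t
  have f0: "f t \<ge> 0" for t
    by (cases "t > 0") (simp_all add: f_def subord_weight_def heat_profile_def)
  have [measurable]: "f \<in> borel_measurable borel" unfolding f_def[abs_def] heat_profile_def by measurable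
  \<comment> \<open>The exponent \<open>n + 2\<close> compensates the singularities \<open>t powr (-1 - s)\<close> and \<open>t\<close> to the power \<open>-n/2\<close> at zero.\<close>
  define N where "N = n + 2"
  have N0: "N > 0" by (simp add: N_def)
  define K where "K = (4 * real N) ^ N"
  have K: "K \<ge> 0" by (simp add: K_def)
  have bound: "f t \<le> K * (indicator {0..1} t * t powr 0) + indicator {1..} t * t powr (-1 - s)" for t
  proof -
    consider "t \<le> 0" | "0 < t" "t < 1" | "1 \<le> t" by linarith
    then show ?thesis
    proof cases
      case 2
      have "sqrt t \<le> sqrt (4 * pi * t)" using mult_right_mono[of 1 "4 * pi" t] 2 pi_gt3 by (intro real_sqrt_le_mono) simp
      moreover have "t \<le> sqrt t" using 2 by (intro real_le_rsqrt) (simp add: power2_eq_square mult_left_le)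
      ultimately have "t \<le> sqrt (4 * pi * t)" by (rule order_trans[rotated])
      then have "1 / sqrt (4 * pi * t) \<le> 1 / t" using 2 by (intro divide_left_mono mult_pos_pos) auto
      then have "(1 / sqrt (4 * pi * t)) ^ n \<le> (1 / t) ^ n" using 2 by (intro power_mono) auto
      moreover have "exp (- (1 / (4 * t))) \<le> K * t ^ N"
        using exp_minus_inverse_le[of t N] 2 N0 unfolding K_def power_mult_distrib[symmetric] by simp
      moreover have "t powr (-1 - s) \<le> t powr (-2)" using 2 s by (intro powr_mono') auto
      ultimately have "t powr (-1 - s) * ((1 / sqrt (4 * pi * t)) ^ n * exp (- (1 / (4 * t)))) \<le> t powr (-2) * ((1 / t) ^ n * (K * t ^ N))"
        using 2 K by (intro mult_mono) auto
      also have "\<dots> = K" using 2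
        by (simp add: powr_minus N_def power_add power_one_over field_simps power2_eq_square)
      finally show ?thesis using 2 by (simp add: f_def subord_weight_def heat_profile_def)
    next
      case 3
      have "1 \<le> 4 * pi * t" using 3 pi_gt3 by (smt (verit) mult_le_cancel_left1)
      then have "1 / sqrt (4 * pi * t) \<le> 1" by (simp add: divide_le_eq)
      then have "heat_profile n 1 t \<le> 1 * 1"
        unfolding heat_profile_def using 3 by (intro mult_mono power_le_one) auto
      then have "t powr (-1 - s) * heat_profile n 1 t \<le> t powr (-1 - s) * 1" by (intro mult_left_mono) auto
      then show ?thesis using 3 K by (simp add: f_def subord_weight_def add_increasing)
    qed (use K in \<open>auto simp: f_def subord_weight_def\<close>)
  qed
  have f: "integrable lborel f"
  proof (rule Bochner_Integration.integrable_bound)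
    show "integrable lborel (\<lambda>t. K * (indicator {0..1} t * t powr 0) + indicator {1..} t * t powr (-1 - s))"
      using s by (intro Bochner_Integration.integrable_add integrable_mult_right integrable_powr_pieces) auto
    show "AE t in lborel. norm (f t) \<le> norm (K * (indicator {0..1} t * t powr 0) + indicator {1..} t * t powr (-1 - s))"
      using order_trans[OF bound abs_ge_self] by (intro AE_I2) (simp only: real_norm_def abs_of_nonneg[OF f0])
  qed measurable
  define b where "b = (LINT t|lborel. f t)"
  have b: "0 \<le> b" unfolding b_def using f0 by (simp add: integral_nonneg_AE)
  have "has_bochner_integral lborel (\<lambda>t. subord_weight s t * heat_profile n r t) (b * r powr (- (real n + 2 * s)))" if r: "r > 0" for r
  proof -
    have "has_bochner_integral lborel (\<lambda>t. f ((1 / r\<^sup>2) * t)) (b / (1 / r\<^sup>2))"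
      unfolding b_def by (rule integral_rescale_positive[OF f]) (use r in simp)
    then have "has_bochner_integral lborel (\<lambda>t. ((r\<^sup>2) powr (-1 - s) * (1 / r) ^ n) * f ((1 / r\<^sup>2) * t)) (((r\<^sup>2) powr (-1 - s) * (1 / r) ^ n) * (b / (1 / r\<^sup>2)))"
      by (rule has_bochner_integral_mult_right)
    also have "(\<lambda>t. ((r\<^sup>2) powr (-1 - s) * (1 / r) ^ n) * f ((1 / r\<^sup>2) * t)) = (\<lambda>t. subord_weight s t * heat_profile n r t)"
    proof
      fix t
      have 1: "(r\<^sup>2) powr (-1 - s) * (1 / r\<^sup>2) powr (-1 - s) = 1" using r by (simp add: powr_mult[symmetric])
      have 2: "(1 / r) ^ n * heat_profile n 1 (1 / r\<^sup>2 * t) = heat_profile n r t"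
      proof -
        have "(1 / r) * (1 / sqrt (4 * pi * (1 / r\<^sup>2 * t))) = 1 / sqrt (4 * pi * t)"
          using r by (simp add: real_sqrt_divide)
        then have "(1 / r) ^ n * (1 / sqrt (4 * pi * (1 / r\<^sup>2 * t))) ^ n = (1 / sqrt (4 * pi * t)) ^ n"
          by (metis power_mult_distrib)
        then show ?thesis by (simp add: heat_profile_def mult.assoc[symmetric])
      qed
      have "((r\<^sup>2) powr (-1 - s) * (1 / r) ^ n) * f ((1 / r\<^sup>2) * t)
         = ((r\<^sup>2) powr (-1 - s) * (1 / r\<^sup>2) powr (-1 - s)) * subord_weight s t * ((1 / r) ^ n * heat_profile n 1 (1 / r\<^sup>2 * t))"
        using r subord_weight_scale[of "1 / r\<^sup>2" s t] by (simp add: f_def mult_ac)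
      then show "((r\<^sup>2) powr (-1 - s) * (1 / r) ^ n) * f ((1 / r\<^sup>2) * t) = subord_weight s t * heat_profile n r t"
        unfolding 1 2 by simp
    qed
    also have "((r\<^sup>2) powr (-1 - s) * (1 / r) ^ n) * (b / (1 / r\<^sup>2)) = b * r powr (- (real n + 2 * s))"
    proof -
      have 1: "(r\<^sup>2) powr (-1 - s) = r powr (- 2 - 2 * s)"
        using r by (simp add: powr_powr powr_numeral[symmetric] algebra_simps del: powr_numeral)
      have 2: "(1 / r) ^ n = r powr (- real n)" using r by (simp add: powr_minus powr_realpow power_one_over inverse_eq_divide)
      have 3: "r\<^sup>2 = r powr 2" using r by simp
      have 4: "- 2 - 2 * s + - real n + 2 = - (real n + 2 * s)" by simp
      have "((r\<^sup>2) powr (-1 - s) * (1 / r) ^ n) * r\<^sup>2 = r powr (- (real n + 2 * s))"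
        unfolding 1 2 unfolding 3 by (simp only: powr_add[symmetric] 4)
      then show ?thesis by (simp add: mult_ac)
    qed
    finally show ?thesis .
  qed
  with b show ?thesis by blast
qed

section \<open>The fractional Laplacian away from the support\<close>

text \<open>Polarisation of Plancherel's theorem.\<close>

lemma Parseval_L1_L2:
  fixes f g :: "'a::euclidean_space \<Rightarrow> complex"
  assumes f: "integrable lborel f" "f \<in> L2 lborel" and g: "integrable lborel g" "g \<in> L2 lborel"
  shows "L2_inner lborel (fourier f) (fourier g) = L2_inner lborel f g"
proof -
  have *: "Re (cnj c * L2_inner lborel (fourier f) (fourier g)) = Re (cnj c * L2_inner lborel f g)" for c
  proof -
    have i: "integrable lborel (\<lambda>x. f x + c * g x)" "(\<lambda>x. f x + c * g x) \<in> L2 lborel"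
      using f g by (auto intro: L2_add L2_cmult)
    have "L2_norm lborel (\<lambda>\<xi>. fourier f \<xi> + c * fourier g \<xi>) = L2_norm lborel (\<lambda>x. f x + c * g x)"
      using Plancherel_L1_L2[OF i] by (simp add: fourier_add_cmult[OF f(1) g(1), abs_def])
    then show ?thesis
      using L2_norm_add_cmult_power2[OF f(2) g(2), of c] L2_norm_add_cmult_power2[OF fourier_in_L2[OF f] fourier_in_L2[OF g], of c]
      by (simp add: Plancherel_L1_L2[OF f] Plancherel_L1_L2[OF g])
  qed
  show ?thesis using *[of 1] *[of \<i>] by (intro complex_eqI) auto
qed

lemma powr_le_1_of_ge_1: "1 \<le> r \<Longrightarrow> 0 \<le> e \<Longrightarrow> r powr (- e) \<le> (1::real)"
  using powr_mono[of "- e" 0 r] by simp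

text \<open>Insert the superposition of \<open>1 - exp (-t |\<xi>|\<^sup>2)\<close> for the multiplier and exchange integrals. The constant \<open>1\<close>
  contributes the integral of \<open>w * \<phi>\<close>, which is zero because the supports are disjoint; the
  Gaussian contributes the heat kernel, whose superposition is the power of \<open>norm (x - y)\<close>. The supports have
  distance at least one, so no singularity is met.\<close>

lemma frac_laplacian_kernel:
  assumes s: "0 < s" "s < 1"
  shows "\<exists>k. \<forall>(w :: 'a::euclidean_space \<Rightarrow> complex). \<forall>\<phi>\<in>test_functions (ball 0 1).
    integrable lborel w \<longrightarrow> w \<in> L2 lborel \<longrightarrow> (\<forall>y. norm y \<le> 2 \<longrightarrow> w y = 0) \<longrightarrow>
    frac_laplacian s w \<phi> = of_real k * (LINT x|lborel. \<phi> x * (LINT y|lborel. w y * of_real (norm (x - y) powr (- (real DIM('a) + 2 * s)))))"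
proof -
  let ?n = "DIM('a)"
  obtain a where a: "a > 0" and A: "\<And>r. r \<ge> 0 \<Longrightarrow> has_bochner_integral lborel (\<lambda>t. subord_weight s t * (1 - exp (- (t * r\<^sup>2)))) (a * r powr (2 * s))"
    using subordination_symbol[OF s] by blast
  obtain b where b: "b \<ge> 0" and B: "\<And>r. r > 0 \<Longrightarrow> has_bochner_integral lborel (\<lambda>t. subord_weight s t * heat_profile ?n r t) (b * r powr (- (real ?n + 2 * s)))"
    using subordination_kernel[OF s] by blast
  have "of_real a * frac_laplacian s w \<phi> = of_real (- b) * (LINT x|lborel. \<phi> x * (LINT y|lborel. w y * of_real (norm (x - y) powr (- (real ?n + 2 * s)))))"
    if \<phi>: "\<phi> \<in> test_functions (ball 0 1)" and w: "integrable lborel w" "w \<in> L2 lborel" and w0: "\<And>y. norm y \<le> 2 \<Longrightarrow> w y = 0"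
    for w \<phi> :: "'a \<Rightarrow> complex"
  proof -
    note \<phi>L = test_functions_integrable[OF \<phi>] test_functions_L2[OF \<phi>]
    define M where "M = (lborel \<Otimes>\<^sub>M lborel :: ('a \<times> 'a) measure)"
    interpret M: sigma_finite_measure M unfolding M_def by (rule sigma_finite_lborel_pair)
    interpret P: pair_sigma_finite "lborel :: real measure" M ..
    define G where "G \<xi> = fourier w \<xi> * fourier \<phi> (- \<xi>)" for \<xi>
    define K where "K p = \<phi> (fst p) * w (snd p)" for p :: "'a \<times> 'a"
    note [measurable] = fourier_measurable[OF w(1)] fourier_measurable[OF \<phi>L(1)]
    have [measurable]: "w \<in> borel_measurable borel" "\<phi> \<in> borel_measurable borel" using w \<phi>L by auto
    have [measurable]: "fst \<in> M \<rightarrow>\<^sub>M borel" "snd \<in> M \<rightarrow>\<^sub>M borel" unfolding M_def by measurable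
    have [measurable]: "G \<in> borel_measurable borel" "K \<in> borel_measurable M" unfolding G_def[abs_def] K_def[abs_def] by measurable
    have K: "integrable M K"
      unfolding M_def K_def[abs_def] by (rule integrable_pair_product) (auto simp: sigma_finite_lborel \<phi>L w)
    have K0: "K p = 0 \<or> norm (fst p - snd p) \<ge> 1" for p
    proof (cases "K p = 0")
      case False
      have "norm (fst p) < 1"
        using test_functions_outside[OF \<phi>, of "fst p"] False by (cases "norm (fst p) < 1") (auto simp: K_def)
      moreover have "norm (snd p) > 2"
        using w0[of "snd p"] False by (cases "norm (snd p) \<le> 2") (auto simp: K_def)
      ultimately
      show ?thesis using norm_triangle_ineq2[of "snd p" "fst p"] by (simp add: norm_minus_commute)
    qed simp
    have i2s: "integrable lborel (\<lambda>\<xi>. of_real (norm \<xi> powr (2 * s)) * G \<xi>)"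
      using L2_mult_integrable(1)[OF fourier_in_L2[OF w] test_functions_fourier_weighted(2)[OF \<phi>, of "2 * s"]] s
      by (simp add: G_def mult_ac)
    have iG: "integrable lborel G"
      using L2_mult_integrable(1)[OF fourier_in_L2[OF w] test_functions_fourier_weighted(2)[OF \<phi>, of 0]]
    proof (rule integrable_cong_AE_imp)
      show "AE \<xi> in lborel. fourier w \<xi> * (of_real (norm \<xi> powr 0) * fourier \<phi> (- \<xi>)) = G \<xi>"
        using AE_lborel_singleton[of 0] by eventually_elim (simp add: G_def)
    qed measurable
    \<comment> \<open>Disjoint supports make the constant term of the superposition vanish.\<close>
    have G_int: "(LINT \<xi>|lborel. G \<xi>) = 0"
    proof -
      have "(LINT \<xi>|lborel. G \<xi>) = L2_inner lborel (fourier w) (fourier (\<lambda>x. cnj (\<phi> x)))"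
        unfolding L2_inner_def G_def fourier_cnj[symmetric] by simp
      also have "\<dots> = L2_inner lborel w (\<lambda>x. cnj (\<phi> x))"
        by (intro Parseval_L1_L2 w test_functions_integrable[OF test_functions_cnj[OF \<phi>]] test_functions_L2[OF test_functions_cnj[OF \<phi>]])
      also have "\<dots> = (LINT x|(lborel :: 'a measure). 0)" unfolding L2_inner_def
      proof (rule Bochner_Integration.integral_cong[OF refl])
        show "w x * cnj (cnj (\<phi> x)) = 0" for x
          using w0[of x] test_functions_outside[OF \<phi>, of x] by (cases "norm x \<le> 2") auto
      qed
      finally show ?thesis by simp
    qed
    have frac: "frac_laplacian s w \<phi> = (LINT \<xi>|lborel. of_real (norm \<xi> powr (2 * s)) * G \<xi>)"
      unfolding frac_laplacian_def
    proof (rule integral_cong_AE)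
      have [measurable]: "fourier_L2 w \<in> borel_measurable borel" using L2_measurable[OF fourier_L2_in_L2[OF w(2)]] by simp
      show "(\<lambda>\<xi>. of_real (norm \<xi> powr (2 * s)) * fourier_L2 w \<xi> * fourier \<phi> (- \<xi>)) \<in> borel_measurable lborel" by measurable
      show "AE \<xi> in lborel. of_real (norm \<xi> powr (2 * s)) * fourier_L2 w \<xi> * fourier \<phi> (- \<xi>) = of_real (norm \<xi> powr (2 * s)) * G \<xi>"
        using fourier_L2_eq_fourier[OF w] by eventually_elim (simp add: G_def)
    qed measurable
    define H where "H \<xi> t = complex_of_real (subord_weight s t * (1 - exp (- (t * (norm \<xi>)\<^sup>2)))) * G \<xi>" for \<xi> t
    have h0: "0 \<le> subord_weight s t * (1 - exp (- (t * (norm \<xi>)\<^sup>2)))" for t and \<xi> :: 'a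
      by (simp add: subord_weight_def)
    have [measurable]: "case_prod H \<in> borel_measurable (lborel \<Otimes>\<^sub>M lborel)" unfolding H_def by measurable
    have iH: "integrable (lborel \<Otimes>\<^sub>M lborel) (case_prod H)"
      unfolding integrable_iff_bounded
    proof
      have "(\<integral>\<^sup>+z. ennreal (norm (case_prod H z)) \<partial>(lborel \<Otimes>\<^sub>M lborel)) = (\<integral>\<^sup>+\<xi>. \<integral>\<^sup>+t. ennreal (norm (H \<xi> t)) \<partial>lborel \<partial>lborel)"
        by (subst lborel.nn_integral_fst[symmetric]) (auto simp: H_def)
      also have "\<dots> = (\<integral>\<^sup>+\<xi>. ennreal (a * norm (of_real (norm \<xi> powr (2 * s)) * G \<xi>)) \<partial>lborel)"
      proof (rule nn_integral_cong)
        fix \<xi> :: 'a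
        have "(\<integral>\<^sup>+t. ennreal (norm (H \<xi> t)) \<partial>lborel) = (\<integral>\<^sup>+t. ennreal (subord_weight s t * (1 - exp (- (t * (norm \<xi>)\<^sup>2)))) \<partial>lborel) * ennreal (norm (G \<xi>))"
          using h0 by (subst nn_integral_multc[symmetric]) (auto simp: H_def norm_mult ennreal_mult simp del: of_real_mult of_real_diff)
        also have "\<dots> = ennreal (a * norm \<xi> powr (2 * s)) * ennreal (norm (G \<xi>))"
          using A[of "norm \<xi>"] h0 by (subst nn_integral_eq_integral) (auto simp: has_bochner_integral_iff)
        finally show "(\<integral>\<^sup>+t. ennreal (norm (H \<xi> t)) \<partial>lborel) = ennreal (a * norm (of_real (norm \<xi> powr (2 * s)) * G \<xi>))"
          using a by (simp add: norm_mult ennreal_mult[symmetric] mult.assoc)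
      qed
      also have "\<dots> < \<infinity>"
        using integrable_mult_right[OF integrable_norm[OF i2s], of a] a unfolding integrable_iff_bounded by (simp add: abs_mult)
      finally show "(\<integral>\<^sup>+z. ennreal (norm (case_prod H z)) \<partial>(lborel \<Otimes>\<^sub>M lborel)) < \<infinity>" .
    qed measurable
    have "of_real a * frac_laplacian s w \<phi> = (LINT \<xi>|lborel. LINT t|lborel. H \<xi> t)"
    proof -
      have "(LINT t|lborel. H \<xi> t) = of_real a * (of_real (norm \<xi> powr (2 * s)) * G \<xi>)" for \<xi>
        unfolding H_def integral_mult_left_zero integral_complex_of_real
        using A[of "norm \<xi>"] by (simp add: has_bochner_integral_iff)
      then show ?thesis unfolding frac by simp
    qed
    also have "\<dots> = (LINT t|lborel. LINT \<xi>|lborel. H \<xi> t)"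
      by (rule lborel_pair.Fubini_integral[OF iH, symmetric])
    also have "\<dots> = (LINT t|lborel. LINT p|M. - (of_real (subord_weight s t * heat_profile ?n (norm (fst p - snd p)) t) * K p))"
    proof (rule Bochner_Integration.integral_cong[OF refl])
      fix t :: real
      show "(LINT \<xi>|lborel. H \<xi> t) = (LINT p|M. - (of_real (subord_weight s t * heat_profile ?n (norm (fst p - snd p)) t) * K p))"
      proof (cases "t > 0")
        case False then show ?thesis by (simp add: H_def subord_weight_def)
      next
        case True
        have i: "integrable lborel (\<lambda>\<xi>. of_real (exp (- (t * (norm \<xi>)\<^sup>2))) * G \<xi>)"
          by (rule Bochner_Integration.integrable_bound[OF iG]) (use True in \<open>auto simp: norm_mult intro!: AE_I2 mult_left_le_one_le\<close>)
        have "(LINT \<xi>|lborel. H \<xi> t) = (LINT \<xi>|lborel. of_real (subord_weight s t) * (G \<xi> - of_real (exp (- (t * (norm \<xi>)\<^sup>2))) * G \<xi>))"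
          by (intro Bochner_Integration.integral_cong) (auto simp: H_def algebra_simps)
        also have "\<dots> = - (of_real (subord_weight s t) * (LINT \<xi>|lborel. of_real (exp (- (t * (norm \<xi>)\<^sup>2))) * G \<xi>))"
          using i iG G_int by simp
        also have "(LINT \<xi>|lborel. of_real (exp (- (t * (norm \<xi>)\<^sup>2))) * G \<xi>) = (LINT p|M. of_real (heat_kernel t (fst p - snd p)) * K p)"
          unfolding G_def K_def M_def by (rule gaussian_fourier_pairing[OF w(1) \<phi>L(1) True])
        finally show ?thesis by (simp add: heat_kernel_profile mult.assoc)
      qed
    qed
    also have "\<dots> = (LINT p|M. LINT t|lborel. - (of_real (subord_weight s t * heat_profile ?n (norm (fst p - snd p)) t) * K p))"
    proof (rule P.Fubini_integral[symmetric])
      define J where "J t p = - (complex_of_real (subord_weight s t * heat_profile ?n (norm (fst p - snd p)) t) * K p)" for t p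
      have g0: "0 \<le> subord_weight s t * heat_profile ?n r t" for t r
        by (cases "t > 0") (simp_all add: subord_weight_def heat_profile_def)
      have [measurable]: "(\<lambda>(t, p). J t p) \<in> borel_measurable (lborel \<Otimes>\<^sub>M M)" unfolding J_def heat_profile_def by measurable
      have le: "(\<integral>\<^sup>+t. ennreal (norm (J t p)) \<partial>lborel) \<le> ennreal (b * norm (K p))" for p
      proof (cases "K p = 0")
        case True then show ?thesis by (simp add: J_def)
      next
        case False
        with K0[of p] have r: "norm (fst p - snd p) \<ge> 1" by simp
        have "(\<integral>\<^sup>+t. ennreal (norm (J t p)) \<partial>lborel) = (\<integral>\<^sup>+t. ennreal (subord_weight s t * heat_profile ?n (norm (fst p - snd p)) t) \<partial>lborel) * ennreal (norm (K p))"
          using g0 by (subst nn_integral_multc[symmetric]) (auto simp: J_def heat_profile_def norm_mult ennreal_mult simp del: of_real_mult)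
        also have "\<dots> = ennreal (b * norm (fst p - snd p) powr (- (real ?n + 2 * s))) * ennreal (norm (K p))"
        proof -
          have "norm (fst p - snd p) > 0" using r by linarith
          from B[OF this] show ?thesis
            using g0 by (subst nn_integral_eq_integral) (auto simp only: has_bochner_integral_iff intro!: AE_I2)
        qed
        also have "\<dots> \<le> ennreal b * ennreal (norm (K p))"
          using b r s by (intro mult_right_mono ennreal_leI mult_left_le powr_le_1_of_ge_1) auto
        finally show ?thesis using b by (simp add: ennreal_mult)
      qed
      have "integrable (lborel \<Otimes>\<^sub>M M) (\<lambda>(t, p). J t p)"
        unfolding integrable_iff_bounded
      proof
        have "(\<integral>\<^sup>+z. ennreal (norm (case_prod J z)) \<partial>(lborel \<Otimes>\<^sub>M M)) = (\<integral>\<^sup>+p. \<integral>\<^sup>+t. ennreal (norm (J t p)) \<partial>lborel \<partial>M)"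
          by (subst P.nn_integral_snd[symmetric]) auto
        also have "\<dots> \<le> (\<integral>\<^sup>+p. ennreal (b * norm (K p)) \<partial>M)" by (intro nn_integral_mono le)
        also have "\<dots> < \<infinity>" using integrable_mult_right[OF integrable_norm[OF K], of b] b unfolding integrable_iff_bounded by (simp add: abs_mult)
        finally show "(\<integral>\<^sup>+z. ennreal (norm (case_prod J z)) \<partial>(lborel \<Otimes>\<^sub>M M)) < \<infinity>" .
      qed measurable
      then show "integrable (lborel \<Otimes>\<^sub>M M) (\<lambda>(t, p). - (complex_of_real (subord_weight s t * heat_profile ?n (norm (fst p - snd p)) t) * K p))"
        unfolding J_def .
    qed
    also have "\<dots> = (LINT p|M. of_real (- b) * (of_real (norm (fst p - snd p) powr (- (real ?n + 2 * s))) * K p))"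
    proof (rule Bochner_Integration.integral_cong[OF refl])
      fix p
      show "(LINT t|lborel. - (complex_of_real (subord_weight s t * heat_profile ?n (norm (fst p - snd p)) t) * K p))
        = of_real (- b) * (of_real (norm (fst p - snd p) powr (- (real ?n + 2 * s))) * K p)"
      proof (cases "K p = 0")
        case False
        with K0[of p] have r: "norm (fst p - snd p) > 0" by linarith
        show ?thesis unfolding Bochner_Integration.integral_minus integral_mult_left_zero integral_complex_of_real
          using B[OF r] by (simp add: has_bochner_integral_iff)
      qed simp
    qed
    also have "\<dots> = of_real (- b) * (LINT p|M. of_real (norm (fst p - snd p) powr (- (real ?n + 2 * s))) * K p)"
      by (rule integral_mult_right_zero)
    also have "(LINT p|M. of_real (norm (fst p - snd p) powr (- (real ?n + 2 * s))) * K p)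
      = (LINT x|lborel. LINT y|lborel. of_real (norm (x - y) powr (- (real ?n + 2 * s))) * (\<phi> x * w y))"
    proof -
      have "integrable M (\<lambda>p. of_real (norm (fst p - snd p) powr (- (real ?n + 2 * s))) * K p)"
      proof (rule Bochner_Integration.integrable_bound[OF K])
        show "AE p in M. norm (of_real (norm (fst p - snd p) powr (- (real ?n + 2 * s))) * K p) \<le> norm (K p)"
        proof (rule AE_I2)
          show "norm (of_real (norm (fst p - snd p) powr (- (real ?n + 2 * s))) * K p) \<le> norm (K p)" for p
          proof (cases "K p = 0")
            case False
            with K0[of p] have "norm (fst p - snd p) powr (- (real ?n + 2 * s)) \<le> 1"
              using s by (intro powr_le_1_of_ge_1) auto
            then show ?thesis by (simp add: norm_mult mult_left_le_one_le)
          qed simp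
        qed
      qed measurable
      from lborel_pair.integral_fst'[OF this[unfolded M_def], symmetric] show ?thesis
        by (simp add: M_def K_def)
    qed
    also have "\<dots> = (LINT x|lborel. \<phi> x * (LINT y|lborel. w y * of_real (norm (x - y) powr (- (real ?n + 2 * s)))))"
      unfolding integral_mult_right_zero[symmetric] by (simp add: mult_ac)
    finally show ?thesis .
  qed
  then have "frac_laplacian s w \<phi> = of_real (- b / a) * (LINT x|lborel. \<phi> x * (LINT y|lborel. w y * of_real (norm (x - y) powr (- (real ?n + 2 * s)))))"
    if "\<phi> \<in> test_functions (ball 0 1)" "integrable lborel w" "w \<in> L2 lborel" "\<And>y. norm y \<le> 2 \<Longrightarrow> w y = 0"
    for w \<phi> :: "'a \<Rightarrow> complex"
    using that a by (simp add: field_simps)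
  then show ?thesis by (intro exI[of _ "- b / a"]) blast
qed


section \<open>Homogeneous polynomials\<close>

definition pderiv_dir :: "'a::euclidean_space \<Rightarrow> ('a \<Rightarrow> 'b::real_normed_vector) \<Rightarrow> 'a \<Rightarrow> 'b" where
  "pderiv_dir b p x = frechet_derivative p (at x) b"

lemma pderiv_dirI: "(p has_derivative D) (at x) \<Longrightarrow> pderiv_dir b p x = D b"
  unfolding pderiv_dir_def by (metis frechet_derivative_at)

lemma laplacian_pderiv_dir: "laplacian p x = (\<Sum>b\<in>Basis. pderiv_dir b (pderiv_dir b p) x)"
  by (simp add: laplacian_def pderiv_dir_def[abs_def])

lemma polynomial_has_derivative:
  fixes p :: "'a::euclidean_space \<Rightarrow> 'b::euclidean_space"
  assumes "polynomial_function p"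
  shows "(p has_derivative frechet_derivative p (at x)) (at x)"
  using differentiable_at_polynomial_function[OF assms] by (simp add: frechet_derivative_works)

lemma real_polynomial_pderiv_dir:
  "real_polynomial_function p \<Longrightarrow> real_polynomial_function (pderiv_dir b p)"
proof (induction p rule: real_polynomial_function.induct)
  case (linear f)
  have "pderiv_dir b f = (\<lambda>x. f b)"
    using pderiv_dirI[OF bounded_linear_imp_has_derivative[OF linear]] by blast
  then show ?case by (simp add: real_polynomial_function.intros(2))
next
  case (const c)
  have "pderiv_dir b (\<lambda>x. c) = (\<lambda>x. 0)" by (simp add: fun_eq_iff pderiv_dir_def)
  then show ?case by (simp add: real_polynomial_function.intros(2))
next
  case (add f g)
  have d: "(f has_derivative frechet_derivative f (at x)) (at x)" "(g has_derivative frechet_derivative g (at x)) (at x)" for x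
    using add.hyps by (auto simp: real_polynomial_function_eq intro: polynomial_has_derivative)
  have "pderiv_dir b (\<lambda>x. f x + g x) = (\<lambda>x. pderiv_dir b f x + pderiv_dir b g x)"
    using pderiv_dirI[OF has_derivative_add[OF d]] by (simp add: fun_eq_iff pderiv_dir_def)
  then show ?case using add.IH by (simp add: real_polynomial_function.intros(3))
next
  case (mult f g)
  have d: "(f has_derivative frechet_derivative f (at x)) (at x)" "(g has_derivative frechet_derivative g (at x)) (at x)" for x
    using mult.hyps by (auto simp: real_polynomial_function_eq intro: polynomial_has_derivative)
  have "pderiv_dir b (\<lambda>x. f x * g x) = (\<lambda>x. f x * pderiv_dir b g x + pderiv_dir b f x * g x)"
    using pderiv_dirI[OF has_derivative_mult[OF d]] by (simp add: fun_eq_iff pderiv_dir_def)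
  then show ?case using mult by (simp add: real_polynomial_function.intros(3) real_polynomial_function.intros(4))
qed

lemma polynomial_pderiv_dir:
  fixes p :: "'a::euclidean_space \<Rightarrow> 'b::euclidean_space"
  assumes p: "polynomial_function p" shows "polynomial_function (pderiv_dir b p)"
  unfolding polynomial_function_def
proof (intro allI impI)
  fix f :: "'b \<Rightarrow> real" assume f: "bounded_linear f"
  have "pderiv_dir b (f \<circ> p) = f \<circ> pderiv_dir b p"
    using pderiv_dirI[OF bounded_linear.has_derivative[OF f polynomial_has_derivative[OF p]]]
    by (simp add: fun_eq_iff pderiv_dir_def o_def)
  then show "real_polynomial_function (f \<circ> pderiv_dir b p)"
    using real_polynomial_pderiv_dir[of "f \<circ> p" b] p f by (auto simp: polynomial_function_def)
qed

lemma polynomial_Re_Im: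
  assumes "polynomial_function p"
  shows "real_polynomial_function (\<lambda>x. Re (p x))" "real_polynomial_function (\<lambda>x. Im (p x))"
  using assms bounded_linear_Re bounded_linear_Im by (auto simp: polynomial_function_def o_def)

lemma polynomial_complexI:
  fixes p :: "'a::euclidean_space \<Rightarrow> complex"
  assumes "real_polynomial_function (\<lambda>x. Re (p x))" "real_polynomial_function (\<lambda>x. Im (p x))"
  shows "polynomial_function p"
  using assms by (subst polynomial_function_iff_Basis_inner) (auto simp: Basis_complex_def)

lemma polynomial_complex_mult:
  fixes p q :: "'a::euclidean_space \<Rightarrow> complex"
  assumes "polynomial_function p" "polynomial_function q"
  shows "polynomial_function (\<lambda>x. p x * q x)"
  using polynomial_Re_Im[OF assms(1)] polynomial_Re_Im[OF assms(2)]
  by (intro polynomial_complexI) (auto intro!: real_polynomial_function.intros(4) real_polynomial_function.intros(3) real_polynomial_function_diff)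

lemma polynomial_cnj:
  fixes p :: "'a::euclidean_space \<Rightarrow> complex"
  assumes "polynomial_function p" shows "polynomial_function (\<lambda>x. cnj (p x))"
  using polynomial_Re_Im[OF assms] by (intro polynomial_complexI) (auto intro: real_polynomial_function_minus)

lemma polynomial_of_real:
  "real_polynomial_function (p :: 'a::euclidean_space \<Rightarrow> real) \<Longrightarrow> polynomial_function (\<lambda>x. complex_of_real (p x))"
  by (intro polynomial_complexI) (auto intro: real_polynomial_function.intros(2))

lemma real_polynomial_norm_square: "real_polynomial_function (\<lambda>x::'a::euclidean_space. (norm x)\<^sup>2)"
  unfolding norm_power2_Basis unfolding power2_eq_square
  by (intro real_polynomial_function_sum real_polynomial_function.intros(4) real_polynomial_function.intros(1))
    (auto simp: bounded_linear_inner_left)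

lemma pderiv_dir_add:
  fixes p q :: "'a::euclidean_space \<Rightarrow> complex"
  assumes "polynomial_function p" "polynomial_function q"
  shows "pderiv_dir b (\<lambda>x. p x + q x) = (\<lambda>x. pderiv_dir b p x + pderiv_dir b q x)"
  using pderiv_dirI[OF has_derivative_add[OF assms[THEN polynomial_has_derivative]]]
  by (simp add: fun_eq_iff pderiv_dir_def)

lemma pderiv_dir_mult:
  fixes p q :: "'a::euclidean_space \<Rightarrow> complex"
  assumes "polynomial_function p" "polynomial_function q"
  shows "pderiv_dir b (\<lambda>x. p x * q x) = (\<lambda>x. p x * pderiv_dir b q x + pderiv_dir b p x * q x)"
  using pderiv_dirI[OF has_derivative_mult[OF assms[THEN polynomial_has_derivative]]]
  by (simp add: fun_eq_iff pderiv_dir_def)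

lemma pderiv_dir_const: "pderiv_dir b (\<lambda>x. c) = (\<lambda>x. 0)"
  by (simp add: fun_eq_iff pderiv_dir_def)

lemma pderiv_dir_cmult:
  fixes p :: "'a::euclidean_space \<Rightarrow> complex"
  assumes "polynomial_function p"
  shows "pderiv_dir b (\<lambda>x. c * p x) = (\<lambda>x. c * pderiv_dir b p x)"
  using pderiv_dir_mult[OF polynomial_function_const assms, of b c] by (simp add: pderiv_dir_const)

lemma polynomial_cmult:
  fixes p :: "'a::euclidean_space \<Rightarrow> complex"
  shows "polynomial_function p \<Longrightarrow> polynomial_function (\<lambda>x. c * p x)"
  by (rule polynomial_complex_mult) simp_all

lemma laplacian_add:
  fixes p q :: "'a::euclidean_space \<Rightarrow> complex"
  assumes "polynomial_function p" "polynomial_function q"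
  shows "laplacian (\<lambda>x. p x + q x) x = laplacian p x + laplacian q x"
  using assms by (simp add: laplacian_pderiv_dir pderiv_dir_add polynomial_pderiv_dir sum.distrib)

lemma laplacian_cmult:
  fixes p :: "'a::euclidean_space \<Rightarrow> complex"
  assumes "polynomial_function p"
  shows "laplacian (\<lambda>x. c * p x) x = c * laplacian p x"
  using assms by (simp add: laplacian_pderiv_dir pderiv_dir_cmult polynomial_pderiv_dir sum_distrib_left)

lemma polynomial_laplacian:
  fixes p :: "'a::euclidean_space \<Rightarrow> complex"
  assumes "polynomial_function p" shows "polynomial_function (laplacian p)"
  unfolding laplacian_pderiv_dir[abs_def] by (intro polynomial_function_sum polynomial_pderiv_dir assms) auto

definition hom_polys :: "nat \<Rightarrow> ('a::euclidean_space \<Rightarrow> complex) set" where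
  "hom_polys m = {p. polynomial_function p \<and> (\<forall>t x. p (t *\<^sub>R x) = t ^ m *\<^sub>R p x)}"

lemma hom_polys_polynomial: "p \<in> hom_polys m \<Longrightarrow> polynomial_function p"
  by (simp add: hom_polys_def)

lemma hom_polys_scale: "p \<in> hom_polys m \<Longrightarrow> p (t *\<^sub>R x) = of_real (t ^ m) * p x"
  by (simp add: hom_polys_def scaleR_conv_of_real)

lemma harmonic_homogeneous_polys_iff:
  "p \<in> harmonic_homogeneous_polys m \<longleftrightarrow> p \<in> hom_polys m \<and> (\<forall>x. laplacian p x = 0)"
  by (auto simp: harmonic_homogeneous_polys_def hom_polys_def)

lemma hom_polys_add: "p \<in> hom_polys m \<Longrightarrow> q \<in> hom_polys m \<Longrightarrow> (\<lambda>x. p x + q x) \<in> hom_polys m"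
  by (auto simp: hom_polys_def scaleR_add_right)

lemma hom_polys_cmult: "p \<in> hom_polys m \<Longrightarrow> (\<lambda>x. c * p x) \<in> hom_polys m"
  by (auto simp: hom_polys_def intro: polynomial_cmult)

lemma hom_polys_zero: "(\<lambda>x. 0) \<in> hom_polys m"
  by (simp add: hom_polys_def)

lemma hom_polys_sum: "finite A \<Longrightarrow> (\<And>i. i \<in> A \<Longrightarrow> p i \<in> hom_polys m) \<Longrightarrow> (\<lambda>x. \<Sum>i\<in>A. p i x) \<in> hom_polys m"
  by (induction A rule: finite_induct) (auto simp: hom_polys_zero intro: hom_polys_add)

lemma hom_polys_mult: "p \<in> hom_polys m \<Longrightarrow> q \<in> hom_polys k \<Longrightarrow> (\<lambda>x. p x * q x) \<in> hom_polys (m + k)"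
  by (auto simp: hom_polys_def power_add intro: polynomial_complex_mult)

lemma hom_polys_cnj: "p \<in> hom_polys m \<Longrightarrow> (\<lambda>x. cnj (p x)) \<in> hom_polys m"
  by (auto simp: hom_polys_def intro: polynomial_cnj)

lemma hom_polys_norm_square: "(\<lambda>x::'a::euclidean_space. complex_of_real ((norm x)\<^sup>2)) \<in> hom_polys 2"
proof -
  have "(norm (t *\<^sub>R x))\<^sup>2 = t\<^sup>2 * (norm x)\<^sup>2" for t and x :: 'a by (simp add: power_mult_distrib)
  then have "complex_of_real ((norm (t *\<^sub>R x))\<^sup>2) = t\<^sup>2 *\<^sub>R complex_of_real ((norm x)\<^sup>2)" for t and x :: 'a
    by (simp only: scaleR_conv_of_real of_real_mult)
  then show ?thesis unfolding hom_polys_def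
    using polynomial_of_real[OF real_polynomial_norm_square] by blast
qed

text \<open>Differentiating \<open>p (t *\<^sub>R x) = t ^ Suc m *\<^sub>R p x\<close> and cancelling \<open>t\<close> gives homogeneity for \<open>t \<noteq> 0\<close>; at \<open>t = 0\<close>
  it follows by continuity.\<close>

lemma pderiv_dir_hom_polys:
  fixes p :: "'a::euclidean_space \<Rightarrow> complex"
  assumes p: "p \<in> hom_polys (Suc m)" shows "pderiv_dir b p \<in> hom_polys m"
proof -
  have P: "polynomial_function p" and P': "polynomial_function (pderiv_dir b p)"
    using hom_polys_polynomial[OF p] by (auto intro: polynomial_pderiv_dir)
  note d = polynomial_has_derivative[OF P]
  have nz: "pderiv_dir b p (t *\<^sub>R x) = of_real (t ^ m) * pderiv_dir b p x" if t: "t \<noteq> 0" for t x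
  proof -
    have "((\<lambda>x. p (t *\<^sub>R x)) has_derivative (\<lambda>h. frechet_derivative p (at (t *\<^sub>R x)) (t *\<^sub>R h))) (at x)"
      by (rule has_derivative_compose[OF _ d]) (auto intro!: derivative_eq_intros)
    moreover have "((\<lambda>x. p (t *\<^sub>R x)) has_derivative (\<lambda>h. of_real (t ^ Suc m) * frechet_derivative p (at x) h)) (at x)"
      unfolding hom_polys_scale[OF p] by (intro has_derivative_mult_right d)
    ultimately have "(\<lambda>h. frechet_derivative p (at (t *\<^sub>R x)) (t *\<^sub>R h)) = (\<lambda>h. of_real (t ^ Suc m) * frechet_derivative p (at x) h)"
      by (rule has_derivative_unique)
    from fun_cong[OF this, of b] have "of_real t * pderiv_dir b p (t *\<^sub>R x) = of_real t * (of_real (t ^ m) * pderiv_dir b p x)"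
      by (simp add: pderiv_dir_def linear_scale[OF has_derivative_linear[OF d]] scaleR_conv_of_real mult.assoc)
    then show ?thesis using t by simp
  qed
  have "pderiv_dir b p (t *\<^sub>R x) = of_real (t ^ m) * pderiv_dir b p x" for t x
  proof (cases "t = 0")
    case True
    define \<phi> where "\<phi> t = pderiv_dir b p (t *\<^sub>R x) - of_real (t ^ m) * pderiv_dir b p x" for t
    have "continuous_on UNIV \<phi>"
    proof -
      have "continuous_on UNIV (\<lambda>t. pderiv_dir b p (t *\<^sub>R x))"
        by (rule continuous_on_compose2[OF continuous_on_polymonial_function[OF P', of UNIV]]) (auto intro!: continuous_intros)
      then show ?thesis unfolding \<phi>_def by (intro continuous_intros)
    qed
    then have "(\<phi> \<longlongrightarrow> \<phi> 0) (at 0)" by (simp add: continuous_on_def)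
    moreover have "(\<phi> \<longlongrightarrow> 0) (at 0)"
      by (rule tendsto_eventually) (auto simp: eventually_at_filter \<phi>_def nz)
    ultimately have "\<phi> 0 = 0" using tendsto_unique[of "at (0::real)" \<phi>] by simp
    then show ?thesis using True by (simp add: \<phi>_def)
  qed (rule nz)
  with P' show ?thesis by (simp add: hom_polys_def scaleR_conv_of_real)
qed

lemma pderiv_dir_hom_polys_0:
  assumes p: "p \<in> hom_polys 0" shows "pderiv_dir b p = (\<lambda>x. 0)"
proof -
  have "p = (\<lambda>x. p 0)" 
  proof
    show "p x = p 0" for x using hom_polys_scale[OF p, of 0 x] by simp
  qed
  then show ?thesis by (metis pderiv_dir_const)
qed

lemma laplacian_hom_polys: "p \<in> hom_polys (Suc (Suc m)) \<Longrightarrow> laplacian p \<in> hom_polys m"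
  unfolding laplacian_pderiv_dir[abs_def] by (intro hom_polys_sum pderiv_dir_hom_polys) auto

lemma laplacian_hom_polys_low: "p \<in> hom_polys m \<Longrightarrow> m < 2 \<Longrightarrow> laplacian p x = 0"
proof -
  assume p: "p \<in> hom_polys m" and "m < 2"
  then consider "m = 0" | "m = Suc 0" by linarith
  then show ?thesis
  proof cases
    case 1 then show ?thesis using pderiv_dir_hom_polys_0[of p] p by (simp add: laplacian_pderiv_dir pderiv_dir_const)
  next
    case 2
    with p have p: "p \<in> hom_polys (Suc 0)" by simp
    show ?thesis by (simp add: laplacian_pderiv_dir pderiv_dir_hom_polys_0[OF pderiv_dir_hom_polys[OF p]])
  qed
qed

lemma Euler_identity:
  fixes p :: "'a::euclidean_space \<Rightarrow> complex"
  assumes p: "p \<in> hom_polys m"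
  shows "(\<Sum>b\<in>Basis. of_real (x \<bullet> b) * pderiv_dir b p x) = of_nat m * p x"
proof -
  note d = polynomial_has_derivative[OF hom_polys_polynomial[OF p]]
  have "((\<lambda>t. p (t *\<^sub>R x)) has_derivative (\<lambda>h. frechet_derivative p (at (1 *\<^sub>R x)) (h *\<^sub>R x))) (at 1)"
    by (rule has_derivative_compose[OF _ d]) (auto intro!: derivative_eq_intros)
  moreover have "((\<lambda>t. p (t *\<^sub>R x)) has_derivative (\<lambda>h. of_real (of_nat m * 1 ^ (m - 1) * h) * p x)) (at 1)"
  proof -
    have "((\<lambda>t::real. t ^ m) has_derivative (\<lambda>h. of_nat m * 1 ^ (m - 1) * h)) (at 1)"
      using DERIV_pow[of m 1] by (simp add: has_field_derivative_def)
    then show ?thesis unfolding hom_polys_scale[OF p] by (intro has_derivative_mult_left has_derivative_of_real)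
  qed
  ultimately have "(\<lambda>h. frechet_derivative p (at (1 *\<^sub>R x)) (h *\<^sub>R x)) = (\<lambda>h. of_real (of_nat m * 1 ^ (m - 1) * h) * p x)"
    by (rule has_derivative_unique)
  from fun_cong[OF this, of 1] have "of_nat m * p x = frechet_derivative p (at x) x" by simp
  also have "frechet_derivative p (at x) x = frechet_derivative p (at x) (\<Sum>b\<in>Basis. (x \<bullet> b) *\<^sub>R b)"
    by (simp add: euclidean_representation)
  also have "\<dots> = (\<Sum>b\<in>Basis. of_real (x \<bullet> b) * pderiv_dir b p x)"
    by (simp add: linear_sum[OF has_derivative_linear[OF d]] linear_scale[OF has_derivative_linear[OF d]]
        pderiv_dir_def scaleR_conv_of_real)
  finally show ?thesis ..
qed

lemma pderiv_dir_norm_square: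
  assumes "b \<in> Basis"
  shows "pderiv_dir b (\<lambda>x::'a::euclidean_space. complex_of_real ((norm x)\<^sup>2)) = (\<lambda>x. of_real (2 * (x \<bullet> b)))"
proof
  fix x :: 'a
  have "((\<lambda>x::'a. complex_of_real ((norm x)\<^sup>2)) has_derivative (\<lambda>h. of_real (2 * (x \<bullet> h)))) (at x)"
    unfolding power2_norm_eq_inner
    by (intro has_derivative_of_real) (auto intro!: derivative_eq_intros simp: inner_commute)
  from pderiv_dirI[OF this] show "pderiv_dir b (\<lambda>x::'a. complex_of_real ((norm x)\<^sup>2)) x = of_real (2 * (x \<bullet> b))" .
qed

lemma polynomial_inner: "polynomial_function (\<lambda>x::'a::euclidean_space. complex_of_real (c * (x \<bullet> b)))"
  by (intro polynomial_of_real real_polynomial_function.intros(1) bounded_linear_intros)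

lemma pderiv_dir_inner: "pderiv_dir b (\<lambda>x::'a::euclidean_space. complex_of_real (c * (x \<bullet> b'))) = (\<lambda>x. of_real (c * (b \<bullet> b')))"
proof
  fix x :: 'a
  have "((\<lambda>x::'a. complex_of_real (c * (x \<bullet> b'))) has_derivative (\<lambda>h. of_real (c * (h \<bullet> b')))) (at x)"
    by (intro has_derivative_of_real) (auto intro!: derivative_eq_intros)
  from pderiv_dirI[OF this] show "pderiv_dir b (\<lambda>x::'a. complex_of_real (c * (x \<bullet> b'))) x = of_real (c * (b \<bullet> b'))" .
qed

lemma laplacian_norm_square_mult:
  fixes r :: "'a::euclidean_space \<Rightarrow> complex"
  assumes r: "r \<in> hom_polys d"
  shows "laplacian (\<lambda>x. of_real ((norm x)\<^sup>2) * r x) x = of_real ((norm x)\<^sup>2) * laplacian r x + of_nat (4 * d + 2 * DIM('a)) * r x"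
proof -
  let ?N = "\<lambda>x::'a. complex_of_real ((norm x)\<^sup>2)"
  have R: "polynomial_function r" by (rule hom_polys_polynomial[OF r])
  have N: "polynomial_function ?N" by (rule hom_polys_polynomial[OF hom_polys_norm_square])
  have "pderiv_dir b (pderiv_dir b (\<lambda>x. ?N x * r x)) x = ?N x * pderiv_dir b (pderiv_dir b r) x + 4 * (of_real (x \<bullet> b) * pderiv_dir b r x) + 2 * r x"
    if b: "b \<in> Basis" for b
  proof -
    have "pderiv_dir b (\<lambda>x. ?N x * r x) = (\<lambda>x. ?N x * pderiv_dir b r x + of_real (2 * (x \<bullet> b)) * r x)"
      by (simp only: pderiv_dir_mult[OF N R] pderiv_dir_norm_square[OF b])
    then have "pderiv_dir b (pderiv_dir b (\<lambda>x. ?N x * r x)) x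
       = (?N x * pderiv_dir b (pderiv_dir b r) x + of_real (2 * (x \<bullet> b)) * pderiv_dir b r x) + (of_real (2 * (x \<bullet> b)) * pderiv_dir b r x + of_real (2 * (b \<bullet> b)) * r x)"
      by (simp only: pderiv_dir_add[OF polynomial_complex_mult[OF N polynomial_pderiv_dir[OF R]] polynomial_complex_mult[OF polynomial_inner R]]
        pderiv_dir_mult[OF N polynomial_pderiv_dir[OF R]] pderiv_dir_mult[OF polynomial_inner R] pderiv_dir_norm_square[OF b] pderiv_dir_inner)
    then show ?thesis using b by (simp add: algebra_simps)
  qed
  then have "laplacian (\<lambda>x. ?N x * r x) x = ?N x * laplacian r x + 4 * (\<Sum>b\<in>Basis. of_real (x \<bullet> b) * pderiv_dir b r x) + of_nat DIM('a) * (2 * r x)"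
    by (simp add: laplacian_pderiv_dir sum.distrib sum_distrib_left)
  then show ?thesis unfolding Euler_identity[OF r] by (simp add: algebra_simps)
qed

text \<open>With the ansatz \<open>q = g / c + |x|\<^sup>2 r\<close> the equation for \<open>q\<close> becomes one of the same form for \<open>r\<close>, of degree
  \<open>d - 2\<close> and with a larger constant in place of \<open>c\<close>. Allowing every positive \<open>c\<close> is what makes the induction
  work.\<close>

lemma laplacian_norm_square_onto:
  fixes g :: "'a::euclidean_space \<Rightarrow> complex"
  assumes "g \<in> hom_polys d" "c > (0::real)"
  shows "\<exists>q\<in>hom_polys d. \<forall>x. of_real ((norm x)\<^sup>2) * laplacian q x + of_real c * q x = g x"
  using assms
proof (induction d arbitrary: g c rule: less_induct)
  case (less d)
  show ?case
  proof (cases "d < 2")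
    case True
    let ?q = "\<lambda>x. of_real (1 / c) * g x"
    have "?q \<in> hom_polys d" by (rule hom_polys_cmult[OF less.prems(1)])
    moreover have "of_real ((norm x)\<^sup>2) * laplacian ?q x + of_real c * ?q x = g x" for x
      using laplacian_hom_polys_low[OF \<open>?q \<in> hom_polys d\<close> True] less.prems(2) by simp
    ultimately show ?thesis by blast
  next
    case False
    define e where "e = d - 2"
    have d: "d = Suc (Suc e)" using False by (simp add: e_def)
    have G: "laplacian g \<in> hom_polys e" using less.prems(1) unfolding d by (rule laplacian_hom_polys)
    define c' where "c' = real (4 * e + 2 * DIM('a)) + c"
    have "c' > 0" using less.prems(2) by (simp add: c'_def)
    then have "\<exists>r\<in>hom_polys e. \<forall>x. of_real ((norm x)\<^sup>2) * laplacian r x + of_real c' * r x = of_real (- 1 / c) * laplacian g x"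
      by (intro less.IH hom_polys_cmult[OF G]) (simp_all add: d)
    then obtain r where r: "r \<in> hom_polys e" and req: "\<And>x. of_real ((norm x)\<^sup>2) * laplacian r x + of_real c' * r x = of_real (- 1 / c) * laplacian g x"
      by blast
    have R: "(\<lambda>x. of_real ((norm x)\<^sup>2) * r x) \<in> hom_polys d"
      using hom_polys_mult[OF hom_polys_norm_square r] by (simp add: d)
    let ?q = "\<lambda>x. of_real (1 / c) * g x + of_real ((norm x)\<^sup>2) * r x"
    have "?q \<in> hom_polys d" by (intro hom_polys_add hom_polys_cmult less.prems(1) R)
    moreover have "of_real ((norm x)\<^sup>2) * laplacian ?q x + of_real c * ?q x = g x" for x
    proof -
      have "laplacian ?q x = of_real (1 / c) * laplacian g x + (of_real ((norm x)\<^sup>2) * laplacian r x + of_nat (4 * e + 2 * DIM('a)) * r x)"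
        unfolding laplacian_add[OF polynomial_cmult[OF hom_polys_polynomial[OF less.prems(1)]] hom_polys_polynomial[OF R]]
          laplacian_cmult[OF hom_polys_polynomial[OF less.prems(1)]] laplacian_norm_square_mult[OF r] ..
      then have "laplacian ?q x + of_real c * r x = of_real (1 / c) * laplacian g x + (of_real ((norm x)\<^sup>2) * laplacian r x + of_real c' * r x)"
        by (simp add: c'_def algebra_simps)
      also have "\<dots> = 0" unfolding req by simp
      finally have "laplacian ?q x = - (of_real c * r x)" by (simp add: eq_neg_iff_add_eq_0)
      then show ?thesis using less.prems(2) by (simp add: algebra_simps)
    qed
    ultimately show ?thesis by blast
  qed
qed

text \<open>Choose \<open>q'\<close> such that \<open>|x|\<^sup>2 q'\<close> has the same Laplacian as \<open>q\<close>.\<close>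

lemma Fischer_decomposition:
  fixes q :: "'a::euclidean_space \<Rightarrow> complex"
  assumes q: "q \<in> hom_polys (Suc (Suc m))"
  shows "\<exists>p\<in>harmonic_homogeneous_polys (Suc (Suc m)). \<exists>q'\<in>hom_polys m. \<forall>x. q x = p x + of_real ((norm x)\<^sup>2) * q' x"
proof -
  have "real (4 * m + 2 * DIM('a)) > 0" by (simp add: add_nonneg_pos)
  then obtain q' where q': "q' \<in> hom_polys m" and eq: "\<And>x. of_real ((norm x)\<^sup>2) * laplacian q' x + of_real (real (4 * m + 2 * DIM('a))) * q' x = laplacian q x"
    using laplacian_norm_square_onto[OF laplacian_hom_polys[OF q]] by blast
  define N where "N x = of_real ((norm x)\<^sup>2) * q' x" for x
  have N: "N \<in> hom_polys (Suc (Suc m))"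
    using hom_polys_mult[OF hom_polys_norm_square q'] by (simp add: N_def[abs_def])
  define p where "p x = q x + (-1) * N x" for x
  have p: "p \<in> hom_polys (Suc (Suc m))" unfolding p_def[abs_def] by (intro hom_polys_add hom_polys_cmult q N)
  have lN: "laplacian N x = laplacian q x" for x
    using laplacian_norm_square_mult[OF q'] eq[of x] by (simp add: N_def[abs_def])
  have "laplacian p x = 0" for x
    using laplacian_add[OF hom_polys_polynomial[OF q] polynomial_cmult[OF hom_polys_polynomial[OF N]], of "-1" x]
      laplacian_cmult[OF hom_polys_polynomial[OF N], of "-1" x] lN[of x] by (simp add: p_def[abs_def])
  with p have "p \<in> harmonic_homogeneous_polys (Suc (Suc m))" by (simp add: harmonic_homogeneous_polys_iff)
  with q' show ?thesis by (intro bexI[of _ p] bexI[of _ q']) (auto simp: p_def N_def)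
qed

text \<open>Sums of homogeneous polynomials, generated inductively so that closure under products is a nested
  induction and no expansion into graded parts has to be carried along.\<close>

inductive_set hom_poly_sums :: "('a::euclidean_space \<Rightarrow> complex) set" where
  hom: "p \<in> hom_polys m \<Longrightarrow> p \<in> hom_poly_sums"
| add: "p \<in> hom_poly_sums \<Longrightarrow> q \<in> hom_poly_sums \<Longrightarrow> (\<lambda>x. p x + q x) \<in> hom_poly_sums"

lemma hom_poly_sums_mult_hom: "q \<in> hom_poly_sums \<Longrightarrow> p \<in> hom_polys m \<Longrightarrow> (\<lambda>x. p x * q x) \<in> hom_poly_sums"
  by (induction q rule: hom_poly_sums.induct)
    (auto simp: distrib_left intro: hom_poly_sums.intros hom_polys_mult)

lemma hom_poly_sums_mult: "p \<in> hom_poly_sums \<Longrightarrow> q \<in> hom_poly_sums \<Longrightarrow> (\<lambda>x. p x * q x) \<in> hom_poly_sums"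
  by (induction p rule: hom_poly_sums.induct)
    (auto simp: distrib_right intro: hom_poly_sums.add hom_poly_sums_mult_hom)

lemma hom_polys_const: "(\<lambda>x. c) \<in> hom_polys 0"
  by (simp add: hom_polys_def)

lemma real_polynomial_hom_poly_sums:
  "real_polynomial_function (p :: 'a::euclidean_space \<Rightarrow> real) \<Longrightarrow> (\<lambda>x. complex_of_real (p x)) \<in> hom_poly_sums"
proof (induction p rule: real_polynomial_function.induct)
  case (linear f)
  then have "polynomial_function (\<lambda>x. complex_of_real (f x))"
    by (intro polynomial_of_real real_polynomial_function.intros(1))
  moreover have "f (t *\<^sub>R x) = t * f x" for t x
    using linear_scale[OF bounded_linear.linear[OF linear]] by simp
  ultimately have "(\<lambda>x. complex_of_real (f x)) \<in> hom_polys 1" by (simp add: hom_polys_def scaleR_conv_of_real)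
  then show ?case by (rule hom_poly_sums.hom)
next
  case (const c) show ?case by (rule hom_poly_sums.hom[OF hom_polys_const])
next
  case (add f g) then show ?case using hom_poly_sums.add by simp
next
  case (mult f g) then show ?case using hom_poly_sums_mult by simp
qed

lemma polynomial_hom_poly_sums:
  fixes p :: "'a::euclidean_space \<Rightarrow> complex"
  assumes "polynomial_function p" shows "p \<in> hom_poly_sums"
proof -
  have "(\<lambda>x. of_real (Re (p x)) + \<i> * of_real (Im (p x))) \<in> hom_poly_sums"
    by (intro hom_poly_sums.add hom_poly_sums_mult[OF hom_poly_sums.hom[OF hom_polys_const]]
      real_polynomial_hom_poly_sums polynomial_Re_Im assms)
  then show ?thesis by (simp add: complex_eq[symmetric])
qed

section \<open>Gaussian integrals of polynomials\<close>

lemma real_polynomial_exp_bound: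
  "real_polynomial_function (p :: 'a::euclidean_space \<Rightarrow> real) \<Longrightarrow> \<exists>C K. 0 \<le> C \<and> 0 \<le> K \<and> (\<forall>x. \<bar>p x\<bar> \<le> C * exp (K * norm x))"
proof (induction p rule: real_polynomial_function.induct)
  case (linear f)
  then obtain C where C: "C \<ge> 0" "\<And>x. norm (f x) \<le> norm x * C" using bounded_linear.nonneg_bounded by blast
  have "\<bar>f x\<bar> \<le> C * exp (1 * norm x)" for x
  proof -
    have "norm x \<le> exp (norm x)" using exp_ge_add_one_self[of "norm x"] by linarith
    from mult_left_mono[OF this C(1)] C(2)[of x] show ?thesis by (simp add: mult.commute)
  qed
  with C(1) show ?case by (intro exI[of _ C] exI[of _ 1]) auto
next
  case (const c) then show ?case by (intro exI[of _ "\<bar>c\<bar>"] exI[of _ 0]) auto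
next
  case (add f g)
  then obtain C K C' K' where b: "0 \<le> C" "0 \<le> K" "\<And>x. \<bar>f x\<bar> \<le> C * exp (K * norm x)" "0 \<le> C'" "0 \<le> K'" "\<And>x. \<bar>g x\<bar> \<le> C' * exp (K' * norm x)"
    by blast
  have "\<bar>f x + g x\<bar> \<le> (C + C') * exp ((K + K') * norm x)" for x
  proof -
    have "\<bar>f x + g x\<bar> \<le> C * exp (K * norm x) + C' * exp (K' * norm x)"
      using b(3)[of x] b(6)[of x] by linarith
    also have "\<dots> \<le> C * exp ((K + K') * norm x) + C' * exp ((K + K') * norm x)"
      using b by (intro add_mono mult_left_mono) (auto intro!: mult_right_mono)
    finally show ?thesis by (simp add: distrib_right)
  qed
  with b show ?case by (intro exI[of _ "C + C'"] exI[of _ "K + K'"]) auto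
next
  case (mult f g)
  then obtain C K C' K' where b: "0 \<le> C" "0 \<le> K" "\<And>x. \<bar>f x\<bar> \<le> C * exp (K * norm x)" "0 \<le> C'" "0 \<le> K'" "\<And>x. \<bar>g x\<bar> \<le> C' * exp (K' * norm x)"
    by blast
  have "\<bar>f x * g x\<bar> \<le> (C * C') * exp ((K + K') * norm x)" for x
  proof -
    have "\<bar>f x * g x\<bar> \<le> (C * exp (K * norm x)) * (C' * exp (K' * norm x))"
      unfolding abs_mult using b by (intro mult_mono) auto
    also have "\<dots> = (C * C') * exp ((K + K') * norm x)" unfolding distrib_right exp_add by simp
    finally show ?thesis .
  qed
  with b show ?case by (intro exI[of _ "C * C'"] exI[of _ "K + K'"]) auto
qed

lemma polynomial_gaussian_bound:
  fixes p :: "'a::euclidean_space \<Rightarrow> complex"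
  assumes "polynomial_function p"
  shows "\<exists>C. \<forall>x. norm (p x) * exp (- (norm x)\<^sup>2) \<le> C * exp (- ((norm x)\<^sup>2 / 2))"
proof -
  obtain C K C' K' where b: "0 \<le> C" "0 \<le> K" "\<And>x. \<bar>Re (p x)\<bar> \<le> C * exp (K * norm x)" "0 \<le> C'" "0 \<le> K'" "\<And>x. \<bar>Im (p x)\<bar> \<le> C' * exp (K' * norm x)"
    using real_polynomial_exp_bound[OF polynomial_Re_Im(1)[OF assms]] real_polynomial_exp_bound[OF polynomial_Re_Im(2)[OF assms]] by blast
  define k where "k = K + K'"
  have le: "exp (c * norm x) * exp (- (norm x)\<^sup>2) \<le> exp (k\<^sup>2 / 2) * exp (- ((norm x)\<^sup>2 / 2))" if "0 \<le> c" "c \<le> k" for c and x :: 'a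
  proof -
    have "c * norm x \<le> k * norm x" using that by (intro mult_right_mono) auto
    also have "\<dots> \<le> k\<^sup>2 / 2 + (norm x)\<^sup>2 / 2" using sum_squares_bound[of k "norm x"] by simp
    finally show ?thesis unfolding mult_exp_exp by simp
  qed
  have "norm (p x) * exp (- (norm x)\<^sup>2) \<le> ((C + C') * exp (k\<^sup>2 / 2)) * exp (- ((norm x)\<^sup>2 / 2))" for x
  proof -
    have "norm (p x) * exp (- (norm x)\<^sup>2) \<le> (C * exp (K * norm x) + C' * exp (K' * norm x)) * exp (- (norm x)\<^sup>2)"
      using cmod_le[of "p x"] b(3)[of x] b(6)[of x] by (intro mult_right_mono) auto
    also have "\<dots> = C * (exp (K * norm x) * exp (- (norm x)\<^sup>2)) + C' * (exp (K' * norm x) * exp (- (norm x)\<^sup>2))"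
      by (simp add: algebra_simps)
    also have "\<dots> \<le> C * (exp (k\<^sup>2 / 2) * exp (- ((norm x)\<^sup>2 / 2))) + C' * (exp (k\<^sup>2 / 2) * exp (- ((norm x)\<^sup>2 / 2)))"
      using b by (intro add_mono mult_left_mono le) (auto simp: k_def)
    finally show ?thesis by (simp add: algebra_simps)
  qed
  then show ?thesis by blast
qed

lemma polynomial_gaussian_integrable:
  fixes p :: "'a::euclidean_space \<Rightarrow> complex"
  assumes "polynomial_function p"
  shows "integrable lborel (\<lambda>x. p x * of_real (exp (- (norm x)\<^sup>2)))"
proof -
  obtain C where C: "\<And>x. norm (p x) * exp (- (norm x)\<^sup>2) \<le> C * exp (- ((norm x)\<^sup>2 / 2))"
    using polynomial_gaussian_bound[OF assms] by blast
  have [measurable]: "p \<in> borel_measurable borel"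
    by (rule borel_measurable_continuous_onI[OF continuous_on_polymonial_function[OF assms]])
  show ?thesis
  proof (rule Bochner_Integration.integrable_bound)
    show "integrable lborel (\<lambda>x::'a. C * exp (- ((1/2) * (norm x)\<^sup>2)))"
      by (rule integrable_mult_right) (rule gaussian_integrable, simp)
    show "AE x in lborel. norm (p x * of_real (exp (- (norm x)\<^sup>2))) \<le> norm (C * exp (- ((1/2) * (norm x)\<^sup>2)))"
      using order_trans[OF C abs_ge_self] by (intro AE_I2) (simp add: norm_mult)
  qed measurable
qed

lemma polynomial_gaussian_by_parts:
  fixes p :: "'a::euclidean_space \<Rightarrow> complex"
  assumes p: "polynomial_function p" and b: "b \<in> Basis"
  shows "(LINT x|lborel. (pderiv_dir b p x - of_real (2 * (x \<bullet> b)) * p x) * of_real (exp (- (norm x)\<^sup>2))) = 0"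
proof -
  let ?g = "\<lambda>x::'a. complex_of_real (exp (- (norm x)\<^sup>2))"
  let ?q = "\<lambda>x. pderiv_dir b p x - of_real (2 * (x \<bullet> b)) * p x"
  have q: "polynomial_function ?q"
    by (intro polynomial_function_diff polynomial_pderiv_dir p polynomial_complex_mult[OF polynomial_inner p])
  obtain C where C: "\<And>x. norm (?q x) * exp (- (norm x)\<^sup>2) \<le> C * exp (- ((norm x)\<^sup>2 / 2))"
    using polynomial_gaussian_bound[OF q] by blast
  have C0: "C \<ge> 0"
  proof -
    have "0 \<le> norm (?q 0) * exp (- (norm (0::'a))\<^sup>2)" by simp
    also have "\<dots> \<le> C" using C[of 0] by simp
    finally show ?thesis .
  qed
  define D where "D x h = p x * of_real (- (2 * (x \<bullet> h)) * exp (- (norm x)\<^sup>2)) + frechet_derivative p (at x) h * ?g x" for x h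
  have Db: "D x b = ?q x * ?g x" for x by (simp add: D_def pderiv_dir_def algebra_simps)
  have [measurable]: "?q \<in> borel_measurable borel"
    by (rule borel_measurable_continuous_onI[OF continuous_on_polymonial_function[OF q]])
  have "(LINT x|lborel. D x b) = 0"
  proof (rule integral_directional_derivative_eq_0[OF polynomial_gaussian_integrable[OF p]])
    show "((\<lambda>x. p x * ?g x) has_derivative D x) (at x)" for x
    proof -
      have "((\<lambda>x::'a. exp (- (norm x)\<^sup>2)) has_derivative (\<lambda>h. - (2 * (x \<bullet> h)) * exp (- (norm x)\<^sup>2))) (at x)"
        unfolding power2_norm_eq_inner by (auto intro!: derivative_eq_intros simp: inner_commute)
      from has_derivative_mult[OF polynomial_has_derivative[OF p] has_derivative_of_real[OF this]]
      show ?thesis unfolding D_def .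
    qed
    show "(\<lambda>x. D x b) \<in> borel_measurable borel" unfolding Db by measurable
    show "integrable lborel (\<lambda>x::'a. (C * exp (1/2)) * exp (- ((1/4) * (norm x)\<^sup>2)))"
      by (rule integrable_mult_right) (rule gaussian_integrable, simp)
    fix x :: 'a and \<tau> :: real assume \<tau>: "0 \<le> \<tau>" "\<tau> \<le> 1"
    have "norm (D (x + \<tau> *\<^sub>R b) b) \<le> C * exp (- ((norm (x + \<tau> *\<^sub>R b))\<^sup>2 / 2))"
      using C[of "x + \<tau> *\<^sub>R b"] unfolding Db by (simp add: norm_mult)
    also have "\<dots> \<le> C * (exp (1/2) * exp (- ((1/4) * (norm x)\<^sup>2)))"
    proof (rule mult_left_mono[OF _ C0], unfold mult_exp_exp, subst exp_le_cancel_iff)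
      define y where "y = x + \<tau> *\<^sub>R b"
      have "norm x \<le> norm y + 1"
        using norm_triangle_ineq4[of y "\<tau> *\<^sub>R b"] b \<tau> by (simp add: y_def)
      then have "(norm x)\<^sup>2 \<le> (norm y + 1)\<^sup>2" by (intro power_mono) auto
      also have "\<dots> \<le> 2 * (norm y)\<^sup>2 + 2" using sum_squares_bound[of "norm y" 1] by (simp add: power2_sum)
      finally show "- ((norm (x + \<tau> *\<^sub>R b))\<^sup>2 / 2) \<le> 1/2 + - ((1/4) * (norm x)\<^sup>2)" by (simp add: y_def)
    qed
    finally show "norm (D (x + \<tau> *\<^sub>R b) b) \<le> (C * exp (1/2)) * exp (- ((1/4) * (norm x)\<^sup>2))" by (simp only: mult.assoc)
  qed
  then show ?thesis unfolding Db .
qed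

text \<open>The operator \<open>\<Delta> - 2 x \<bullet> \<nabla>\<close> is symmetric for the Gaussian weight, and by Euler's identity its first-order
  part acts on a homogeneous polynomial as minus twice the degree.\<close>

lemma gaussian_Green_identity:
  fixes p q :: "'a::euclidean_space \<Rightarrow> complex"
  assumes p: "p \<in> hom_polys m" and q: "q \<in> hom_polys j"
  shows "(LINT x|lborel. (laplacian p x * q x - p x * laplacian q x - of_real (2 * (real m - real j)) * (p x * q x)) * of_real (exp (- (norm x)\<^sup>2))) = 0"
proof -
  let ?g = "\<lambda>x::'a. complex_of_real (exp (- (norm x)\<^sup>2))"
  note P = hom_polys_polynomial[OF p] and Q = hom_polys_polynomial[OF q]
  define F where "F b x = pderiv_dir b p x * q x + (-1) * (p x * pderiv_dir b q x)" for b x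
  have F: "polynomial_function (F b)" for b
    unfolding F_def[abs_def] by (intro polynomial_function_add polynomial_cmult polynomial_complex_mult polynomial_pderiv_dir P Q)
  let ?t = "\<lambda>b x. (pderiv_dir b (F b) x - of_real (2 * (x \<bullet> b)) * F b x) * ?g x"
  have dF: "pderiv_dir b (F b) x = pderiv_dir b (pderiv_dir b p) x * q x - p x * pderiv_dir b (pderiv_dir b q) x" for b x
    unfolding F_def[abs_def]
    by (simp only: pderiv_dir_add[OF polynomial_complex_mult[OF polynomial_pderiv_dir[OF P] Q] polynomial_cmult[OF polynomial_complex_mult[OF P polynomial_pderiv_dir[OF Q]]]]
      pderiv_dir_cmult[OF polynomial_complex_mult[OF P polynomial_pderiv_dir[OF Q]]]
      pderiv_dir_mult[OF polynomial_pderiv_dir[OF P] Q] pderiv_dir_mult[OF P polynomial_pderiv_dir[OF Q]]) (simp add: algebra_simps)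
  have sum: "(\<Sum>b\<in>Basis. ?t b x) = (laplacian p x * q x - p x * laplacian q x - of_real (2 * (real m - real j)) * (p x * q x)) * ?g x" for x
  proof -
    have 1: "(\<Sum>b\<in>Basis. of_real (2 * (x \<bullet> b)) * F b x) = 2 * ((\<Sum>b\<in>Basis. of_real (x \<bullet> b) * pderiv_dir b p x) * q x) - 2 * (p x * (\<Sum>b\<in>Basis. of_real (x \<bullet> b) * pderiv_dir b q x))"
      unfolding F_def sum_distrib_left sum_distrib_right sum_subtractf[symmetric]
      by (rule sum.cong) (auto simp: algebra_simps)
    have 2: "(\<Sum>b\<in>Basis. pderiv_dir b (F b) x) = laplacian p x * q x - p x * laplacian q x"
      by (simp add: dF laplacian_pderiv_dir sum_subtractf sum_distrib_left sum_distrib_right)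
    have "(\<Sum>b\<in>Basis. ?t b x) = ((\<Sum>b\<in>Basis. pderiv_dir b (F b) x) - (\<Sum>b\<in>Basis. of_real (2 * (x \<bullet> b)) * F b x)) * ?g x"
      unfolding sum_subtractf[symmetric] sum_distrib_right[symmetric] ..
    then show ?thesis unfolding 1 2 Euler_identity[OF p] Euler_identity[OF q] by (simp add: algebra_simps)
  qed
  have i: "integrable lborel (?t b)" for b
    by (intro polynomial_gaussian_integrable polynomial_function_diff polynomial_pderiv_dir polynomial_complex_mult[OF polynomial_inner] F)
  have "(LINT x|lborel. (\<Sum>b\<in>Basis. ?t b x)) = (\<Sum>b\<in>Basis. LINT x|lborel. ?t b x)"
    by (rule Bochner_Integration.integral_sum) (rule i)
  also have "\<dots> = 0" by (intro sum.neutral ballI polynomial_gaussian_by_parts F)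
  finally show ?thesis unfolding sum .
qed

text \<open>For harmonic \<open>p\<close> the Green identity replaces \<open>q\<close> by its Laplacian, at the cost of the nonzero factor
  \<open>2 * (m - j)\<close>.\<close>

lemma gaussian_orthogonal_lower_degree:
  fixes p q :: "'a::euclidean_space \<Rightarrow> complex"
  assumes p: "p \<in> harmonic_homogeneous_polys m" and q: "q \<in> hom_polys j" and "j < m"
  shows "(LINT x|lborel. (p x * q x) * of_real (exp (- (norm x)\<^sup>2))) = 0"
  using q \<open>j < m\<close>
proof (induction j arbitrary: q rule: less_induct)
  case (less j)
  let ?g = "\<lambda>x::'a. complex_of_real (exp (- (norm x)\<^sup>2))"
  have ph: "p \<in> hom_polys m" and lp: "\<And>x. laplacian p x = 0" using p by (auto simp: harmonic_homogeneous_polys_iff)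
  note P = hom_polys_polynomial[OF ph] and Q = hom_polys_polynomial[OF less.prems(1)]
  have z: "(LINT x|lborel. (p x * laplacian q x) * ?g x) = 0"
  proof (cases "j < 2")
    case True then show ?thesis using laplacian_hom_polys_low[OF less.prems(1)] by simp
  next
    case False
    then obtain e where e: "j = Suc (Suc e)" by (metis add_2_eq_Suc le_Suc_ex not_le)
    show ?thesis
      by (rule less.IH[of e]) (use e less.prems laplacian_hom_polys[of q e] in auto)
  qed
  have i1: "integrable lborel (\<lambda>x. (p x * laplacian q x) * ?g x)"
    by (intro polynomial_gaussian_integrable polynomial_complex_mult P polynomial_laplacian Q)
  have i2: "integrable lborel (\<lambda>x. of_real (2 * (real m - real j)) * ((p x * q x) * ?g x))"
    by (intro integrable_mult_right polynomial_gaussian_integrable polynomial_complex_mult P Q)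
  have "0 = (LINT x|lborel. - ((p x * laplacian q x) * ?g x) - of_real (2 * (real m - real j)) * ((p x * q x) * ?g x))"
    using gaussian_Green_identity[OF ph less.prems(1)] unfolding lp by (simp add: algebra_simps)
  also have "\<dots> = - of_real (2 * (real m - real j)) * (LINT x|lborel. (p x * q x) * ?g x)"
    using i1 i2 z by (subst Bochner_Integration.integral_diff) (auto simp only: Bochner_Integration.integral_minus integral_mult_right_zero Bochner_Integration.integrable_minus mult_minus_left diff_0_right minus_zero diff_0)
  finally show ?case using less.prems(2) by simp
qed


section \<open>Polar coordinates\<close>

lemma sgn_borel [measurable]: "(sgn :: 'a::euclidean_space \<Rightarrow> 'a) \<in> borel_measurable borel"
  unfolding sgn_div_norm[abs_def] by measurable

definition radial_measure :: "nat \<Rightarrow> real measure" where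
  "radial_measure n = density lborel (\<lambda>r. ennreal (indicator {0<..} r * r ^ (n - 1)))"

lemma sets_radial_measure: "sets (radial_measure n) = sets borel"
  by (simp add: radial_measure_def)

lemma space_sphere_measure [simp]: "space (sphere_measure :: 'a::euclidean_space measure) = sphere 0 1"
  and sets_sphere_measure: "sets (sphere_measure :: 'a::euclidean_space measure) = sets (restrict_space borel (sphere 0 1))"
  by (simp_all add: sphere_measure_def space_restrict_space space_scale_measure)

lemma sets_sphere_measure_iff: "B \<in> sets (sphere_measure :: 'a::euclidean_space measure) \<longleftrightarrow> B \<in> sets borel \<and> B \<subseteq> sphere 0 1"
  unfolding sets_sphere_measure by (subst sets_restrict_space_iff) auto

lemma sgn_measurable_sphere: "sgn \<in> restrict_space lborel (- {0}) \<rightarrow>\<^sub>M (sphere_measure :: 'a::euclidean_space measure)"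
proof -
  have "sgn \<in> restrict_space lborel (- {0}) \<rightarrow>\<^sub>M restrict_space borel (sphere (0::'a) 1)"
    by (intro measurable_restrict_space2 measurable_restrict_space1) (auto simp: space_restrict_space norm_sgn)
  then show ?thesis by (subst measurable_cong_sets[OF refl sets_sphere_measure])
qed

definition open_cone :: "'a::euclidean_space set \<Rightarrow> real \<Rightarrow> 'a set" where
  "open_cone B a = {x. x \<noteq> 0 \<and> norm x < a \<and> sgn x \<in> B}"

lemma open_cone_borel [measurable]: "B \<in> sets borel \<Longrightarrow> open_cone B a \<in> sets borel"
proof -
  assume B: "B \<in> sets borel"
  have "open_cone B a = (ball 0 a - {0}) \<inter> (sgn -` B \<inter> space borel)" by (auto simp: open_cone_def)
  then show ?thesis using measurable_sets[OF sgn_borel B] by auto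
qed

lemma emeasure_sphere_measure:
  assumes B: "B \<in> sets (sphere_measure :: 'a::euclidean_space measure)"
  shows "emeasure sphere_measure B = of_nat DIM('a) * emeasure lborel (open_cone B 1)"
proof -
  have Bb [measurable]: "B \<in> sets borel" using B by (simp add: sets_sphere_measure_iff)
  have Bs: "B \<in> sets (restrict_space borel (sphere 0 1))" using B by (simp add: sets_sphere_measure)
  have m: "sgn \<in> restrict_space lborel (ball 0 1 - {0}) \<rightarrow>\<^sub>M restrict_space borel (sphere (0::'a) 1)"
    by (intro measurable_restrict_space2 measurable_restrict_space1) (auto simp: space_restrict_space norm_sgn)
  have "emeasure sphere_measure B = of_nat DIM('a) * emeasure (restrict_space lborel (ball 0 1 - {0})) (sgn -` B \<inter> (ball 0 1 - {0}))"
    unfolding sphere_measure_def by (simp add: emeasure_distr[OF m Bs] space_restrict_space)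
  also have "emeasure (restrict_space lborel (ball 0 1 - {0})) (sgn -` B \<inter> (ball 0 1 - {0})) = emeasure lborel (open_cone B 1)"
  proof (subst emeasure_restrict_space)
    show "emeasure lborel (sgn -` B \<inter> (ball 0 1 - {0})) = emeasure lborel (open_cone B 1)"
      by (rule arg_cong[where f = "emeasure lborel"]) (auto simp: open_cone_def)
  qed auto
  finally show ?thesis .
qed

lemma open_cone_finite: "emeasure lborel (open_cone B 1) < \<infinity>"
  by (rule emeasure_bounded_finite, rule bounded_subset[OF bounded_ball[of 0 1]]) (auto simp: open_cone_def)

lemma sphere_measure_finite: "finite_measure (sphere_measure :: 'a::euclidean_space measure)"
proof
  have "sphere 0 1 \<in> sets (sphere_measure :: 'a measure)" by (auto simp: sets_sphere_measure_iff)
  then show "emeasure (sphere_measure :: 'a measure) (space sphere_measure) \<noteq> \<infinity>"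
    using emeasure_sphere_measure[of "sphere (0::'a) 1"] open_cone_finite[of "sphere (0::'a) 1"]
    by (simp add: ennreal_mult_eq_top_iff)
qed

interpretation sphere: finite_measure "sphere_measure :: 'a::euclidean_space measure"
  by (rule sphere_measure_finite)

lemma emeasure_open_cone_scale:
  fixes B :: "'a::euclidean_space set"
  assumes [measurable]: "B \<in> sets borel" and a: "a > 0"
  shows "emeasure lborel (open_cone B a) = ennreal (a ^ DIM('a)) * emeasure lborel (open_cone B 1)"
proof -
  have s: "sgn (a *\<^sub>R x) = sgn x" for x :: 'a using a by (simp add: sgn_scaleR)
  have "emeasure lborel (open_cone B a) = emeasure (density (distr lborel borel (\<lambda>x. 0 + a *\<^sub>R x)) (\<lambda>_. ennreal (\<bar>a\<bar> ^ DIM('a)))) (open_cone B a)"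
    using lborel_affine[of a "0::'a"] a by simp
  also have "\<dots> = ennreal (a ^ DIM('a)) * emeasure (distr lborel borel (\<lambda>x. 0 + a *\<^sub>R x)) (open_cone B a)"
    using a by (simp add: emeasure_density_const)
  also have "emeasure (distr lborel borel (\<lambda>x. 0 + a *\<^sub>R x)) (open_cone B a) = emeasure lborel ((\<lambda>x. 0 + a *\<^sub>R x) -` open_cone B a)"
    by (subst emeasure_distr) auto
  also have "(\<lambda>x. 0 + a *\<^sub>R x) -` open_cone B a = open_cone B 1"
    using a by (auto simp: open_cone_def s)
  finally show ?thesis .
qed

lemma radial_measure_lessThan:
  assumes n: "n > 0"
  shows "emeasure (radial_measure n) {..<a} = ennreal (max 0 a ^ n / real n)"
proof (cases "a > 0")
  case False
  then have "emeasure (radial_measure n) {..<a} = (\<integral>\<^sup>+r. 0 \<partial>(lborel :: real measure))"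
    unfolding radial_measure_def by (subst emeasure_density, simp, simp, intro nn_integral_cong) (auto split: split_indicator)
  then show ?thesis using False n by (simp add: max_absorb1)
next
  case True
  have "emeasure (radial_measure n) {..<a} = (\<integral>\<^sup>+r. ennreal (indicator {0<..} r * r ^ (n - 1)) * indicator {..<a} r \<partial>lborel)"
    unfolding radial_measure_def by (subst emeasure_density) auto
  also have "\<dots> = (\<integral>\<^sup>+r. ennreal (r ^ (n - 1)) * indicator {0..a} r \<partial>lborel)"
  proof (rule nn_integral_cong_AE)
    show "AE r in lborel. ennreal (indicator {0<..} r * r ^ (n - 1)) * indicator {..<a} r = ennreal (r ^ (n - 1)) * indicator {0..a} r"
      using AE_lborel_singleton[of 0] AE_lborel_singleton[of a]
      by eventually_elim (auto split: split_indicator)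
  qed
  also have "\<dots> = ennreal (a ^ n / real n - 0 ^ n / real n)"
  proof (rule nn_integral_FTC_Icc)
    show "((\<lambda>r. r ^ n / real n) has_real_derivative x ^ (n - 1)) (at x)" for x
      using n by (auto intro!: derivative_eq_intros)
  qed (use True in auto)
  finally show ?thesis using True n by (simp add: max_absorb2 zero_power)
qed

text \<open>As measures in \<open>A\<close>, both sides are finite on the generating half lines \<open>{..<a}\<close>, where they agree because the
  volume of a cone scales with the power \<open>DIM('a)\<close> of its height.\<close>

lemma polar_slice:
  fixes B :: "'a::euclidean_space set"
  assumes B: "B \<in> sets (sphere_measure :: 'a measure)" and A: "A \<in> sets borel"
  shows "emeasure lborel {x. x \<noteq> 0 \<and> norm x \<in> A \<and> sgn x \<in> B} = emeasure (radial_measure DIM('a)) A * emeasure sphere_measure B"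
proof -
  have [measurable]: "B \<in> sets borel" using B by (simp add: sets_sphere_measure_iff)
  define S where "S = {x::'a. x \<noteq> 0 \<and> sgn x \<in> B}"
  have "S = - {0} \<inter> (sgn -` B \<inter> space borel)" by (auto simp: S_def)
  then have [measurable]: "S \<in> sets borel" using measurable_sets[OF sgn_borel \<open>B \<in> sets borel\<close>] by auto
  define \<mu> where "\<mu> = distr (restrict_space lborel S) borel norm"
  define \<nu> where "\<nu> = scale_measure (emeasure sphere_measure B) (radial_measure DIM('a))"
  have nm: "norm \<in> restrict_space lborel S \<rightarrow>\<^sub>M borel" by (intro measurable_restrict_space1) simp
  have mu: "emeasure \<mu> A = emeasure lborel {x. x \<noteq> 0 \<and> norm x \<in> A \<and> sgn x \<in> B}" if A: "A \<in> sets borel" for A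
  proof -
    have "emeasure \<mu> A = emeasure (restrict_space lborel S) (norm -` A \<inter> S)"
      unfolding \<mu>_def by (simp add: emeasure_distr[OF nm A] space_restrict_space)
    also have "\<dots> = emeasure lborel (norm -` A \<inter> S)" by (rule emeasure_restrict_space) auto
    also have "norm -` A \<inter> S = {x. x \<noteq> 0 \<and> norm x \<in> A \<and> sgn x \<in> B}" by (auto simp: S_def)
    finally show ?thesis .
  qed
  have c: "emeasure \<mu> {..<a} = ennreal (max 0 a ^ DIM('a)) * emeasure lborel (open_cone B 1)" for a
  proof (cases "a > 0")
    case True
    have "{x. x \<noteq> 0 \<and> norm x \<in> {..<a} \<and> sgn x \<in> B} = open_cone B a" by (auto simp: open_cone_def)
    then show ?thesis using mu[of "{..<a}"] emeasure_open_cone_scale[of B a] True by (simp add: max_absorb2)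
  next
    case False
    then have E: "{x. x \<noteq> 0 \<and> norm x \<in> {..<a} \<and> sgn x \<in> B} = {}" by (auto dest: le_less_trans[OF norm_ge_zero])
    then show ?thesis using mu[of "{..<a}", unfolded E] False by (simp add: max_absorb1)
  qed
  have "\<mu> = \<nu>"
  proof (rule measure_eqI_generator_eq[where E = "range lessThan" and \<Omega> = UNIV and A = "\<lambda>i. {..<real i}"])
    show "Int_stable (range (lessThan :: real \<Rightarrow> _))" 
    proof -
      have "{..<a} \<inter> {..<b} = {..<min a b}" for a b :: real by auto
      then show ?thesis by (auto simp: Int_stable_def)
    qed
    show "sets \<mu> = sigma_sets UNIV (range (lessThan :: real \<Rightarrow> _))" "sets \<nu> = sigma_sets UNIV (range (lessThan :: real \<Rightarrow> _))"
      by (simp_all add: \<mu>_def \<nu>_def radial_measure_def borel_Iio)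
    show "(\<Union>i. {..<real i}) = UNIV" by (auto intro: reals_Archimedean2)
    show "emeasure \<mu> {..<real i} \<noteq> \<infinity>" for i unfolding c using open_cone_finite[of B] by (simp add: ennreal_mult_eq_top_iff)
    fix X :: "real set" assume "X \<in> range lessThan"
    then obtain a where X: "X = {..<a}" by blast
    have "real DIM('a) * (max 0 a ^ DIM('a) / real DIM('a)) = max 0 a ^ DIM('a)" by simp
    then have "ennreal (max 0 a ^ DIM('a)) = of_nat DIM('a) * ennreal (max 0 a ^ DIM('a) / real DIM('a))"
      by (metis ennreal_mult' ennreal_of_nat_eq_real_of_nat of_nat_0_le_iff)
    then show "emeasure \<mu> X = emeasure \<nu> X"
      unfolding X c \<nu>_def using emeasure_sphere_measure[OF B] radial_measure_lessThan[of "DIM('a)" a]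
      by (simp add: mult_ac)
  qed auto
  then show ?thesis using mu[OF A] by (simp add: \<nu>_def mult.commute)
qed

lemma radial_measure_sigma_finite: "sigma_finite_measure (radial_measure n)"
  unfolding radial_measure_def by (subst sigma_finite_measure.sigma_finite_iff_density_finite[OF sigma_finite_lborel]) auto

lemma polar_measure:
  "distr (restrict_space lborel (- {0})) (radial_measure DIM('a) \<Otimes>\<^sub>M sphere_measure) (\<lambda>x::'a::euclidean_space. (norm x, sgn x))
    = radial_measure DIM('a) \<Otimes>\<^sub>M sphere_measure"
proof (rule pair_measure_eqI[symmetric, OF radial_measure_sigma_finite sphere.sigma_finite_measure_axioms])
  let ?M = "radial_measure DIM('a) \<Otimes>\<^sub>M (sphere_measure :: 'a measure)"
  have m: "(\<lambda>x::'a. (norm x, sgn x)) \<in> restrict_space lborel (- {0}) \<rightarrow>\<^sub>M ?M"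
  proof (rule measurable_Pair[OF _ sgn_measurable_sphere])
    have "norm \<in> restrict_space lborel (- {0::'a}) \<rightarrow>\<^sub>M borel" by (intro measurable_restrict_space1) simp
    then show "norm \<in> restrict_space lborel (- {0::'a}) \<rightarrow>\<^sub>M radial_measure DIM('a)"
      by (subst measurable_cong_sets[OF refl sets_radial_measure])
  qed
  fix A B assume A: "A \<in> sets (radial_measure DIM('a))" and B: "B \<in> sets (sphere_measure :: 'a measure)"
  have "emeasure (distr (restrict_space lborel (- {0})) ?M (\<lambda>x. (norm x, sgn x))) (A \<times> B)
     = emeasure (restrict_space lborel (- {0})) ((\<lambda>x. (norm x, sgn x)) -` (A \<times> B) \<inter> (- {0}))"
    using A B by (subst emeasure_distr[OF m]) (auto simp: space_restrict_space)
  also have "\<dots> = emeasure lborel ((\<lambda>x::'a. (norm x, sgn x)) -` (A \<times> B) \<inter> (- {0}))"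
    by (rule emeasure_restrict_space) auto
  also have "(\<lambda>x::'a. (norm x, sgn x)) -` (A \<times> B) \<inter> (- {0}) = {x. x \<noteq> 0 \<and> norm x \<in> A \<and> sgn x \<in> B}" by auto
  also have "emeasure lborel \<dots> = emeasure (radial_measure DIM('a)) A * emeasure sphere_measure B"
    by (rule polar_slice[OF B]) (use A in \<open>simp add: radial_measure_def\<close>)
  finally show "emeasure (radial_measure DIM('a)) A * emeasure sphere_measure B = emeasure (distr (restrict_space lborel (- {0})) ?M (\<lambda>x. (norm x, sgn x))) (A \<times> B)" ..
qed simp

text \<open>The radial measure lives on the whole real line but is concentrated on positive radii, where \<open>max 0 r = r\<close>;
  the maximum fixes the value of the integrand on the remaining null set.\<close>

lemma polar_integral:
  fixes F :: "'a::euclidean_space \<Rightarrow> complex"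
  assumes [measurable]: "F \<in> borel_measurable borel"
  shows "integrable lborel F \<longleftrightarrow> integrable (radial_measure DIM('a) \<Otimes>\<^sub>M sphere_measure) (\<lambda>p. F (max 0 (fst p) *\<^sub>R snd p))"
    "(LINT x|lborel. F x) = (LINT p|(radial_measure DIM('a) \<Otimes>\<^sub>M sphere_measure). F (max 0 (fst p) *\<^sub>R snd p))"
proof -
  let ?M = "radial_measure DIM('a) \<Otimes>\<^sub>M (sphere_measure :: 'a measure)"
  let ?T = "\<lambda>x::'a. (norm x, sgn x)"
  let ?f = "\<lambda>p::real \<times> 'a. F (max 0 (fst p) *\<^sub>R snd p)"
  have m: "?T \<in> restrict_space lborel (- {0}) \<rightarrow>\<^sub>M ?M"
  proof (rule measurable_Pair[OF _ sgn_measurable_sphere])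
    have "norm \<in> restrict_space lborel (- {0::'a}) \<rightarrow>\<^sub>M borel" by (intro measurable_restrict_space1) simp
    then show "norm \<in> restrict_space lborel (- {0::'a}) \<rightarrow>\<^sub>M radial_measure DIM('a)"
      by (subst measurable_cong_sets[OF refl sets_radial_measure])
  qed
  have [measurable]: "fst \<in> ?M \<rightarrow>\<^sub>M borel"
    using measurable_fst[of "radial_measure DIM('a)" "sphere_measure :: 'a measure"]
    by (subst (asm) measurable_cong_sets[OF refl sets_radial_measure])
  have id: "(\<lambda>x. x) \<in> (sphere_measure :: 'a measure) \<rightarrow>\<^sub>M borel"
    by (subst measurable_cong_sets[OF sets_sphere_measure refl]) (auto intro: measurable_restrict_space1)
  have [measurable]: "snd \<in> ?M \<rightarrow>\<^sub>M borel"
    by (rule measurable_compose[OF measurable_snd id])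
  have f: "?f \<in> borel_measurable ?M" by measurable
  have eq: "?f (?T x) = F x" for x by (cases "x = 0") (simp_all add: sgn_div_norm)
  have AE: "AE x in lborel. indicator (- {0}) x *\<^sub>R F x = F x"
    using AE_lborel_singleton[of 0] by eventually_elim auto
  have i: "integrable lborel F \<longleftrightarrow> integrable (restrict_space lborel (- {0})) F"
    by (subst integrable_restrict_space, simp, rule integrable_cong_AE) (use AE in auto)
  have I: "(LINT x|lborel. F x) = (LINT x|restrict_space lborel (- {0}). F x)"
    by (subst integral_restrict_space, simp, rule integral_cong_AE) (use AE in auto)
  show "integrable lborel F \<longleftrightarrow> integrable ?M ?f"
    unfolding i using integrable_distr_eq[OF m f] unfolding polar_measure eq by simp
  show "(LINT x|lborel. F x) = (LINT p|?M. ?f p)"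
    unfolding I using integral_distr[OF m f] unfolding polar_measure eq by simp
qed

lemma annulus_iff: "x \<in> annulus \<longleftrightarrow> 2 < norm x \<and> norm x < 3"
  by (auto simp: annulus_def)

lemma annulus_borel [measurable]: "annulus \<in> sets borel"
  unfolding annulus_def by measurable

text \<open>In polar coordinates, Lebesgue measure on the annulus is the product of this measure and the surface measure.\<close>

definition shell_measure :: "nat \<Rightarrow> real measure" where
  "shell_measure n = density lborel (\<lambda>r. ennreal (indicator {2<..<3} r * r ^ (n - 1)))"

lemma integral_shell_measure:
  fixes g :: "real \<Rightarrow> complex"
  assumes [measurable]: "g \<in> borel_measurable borel"
  shows "integrable (shell_measure n) g \<longleftrightarrow> integrable (radial_measure n) (\<lambda>r. indicator {2<..<3} r * g r)"
    "(LINT r|shell_measure n. g r) = (LINT r|radial_measure n. indicator {2<..<3} r * g r)"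
proof -
  have e: "(indicator {2<..<3} r * r ^ (n - 1)) *\<^sub>R g r = (indicator {0<..} r * r ^ (n - 1)) *\<^sub>R (indicator {2<..<3} r * g r)" for r :: real
    by (auto split: split_indicator)
  show "integrable (shell_measure n) g \<longleftrightarrow> integrable (radial_measure n) (\<lambda>r. indicator {2<..<3} r * g r)"
    unfolding shell_measure_def radial_measure_def
    by (subst integrable_density, simp, simp, simp split: split_indicator, subst integrable_density, simp, simp, simp split: split_indicator, simp only: e)
  show "(LINT r|shell_measure n. g r) = (LINT r|radial_measure n. indicator {2<..<3} r * g r)"
    unfolding shell_measure_def radial_measure_def
    by (subst integral_density, simp, simp, simp split: split_indicator, subst integral_density, simp, simp, simp split: split_indicator, simp only: e)
qed

lemma annulus_integral_product:
  fixes g :: "real \<Rightarrow> complex" and h :: "'a::euclidean_space \<Rightarrow> complex"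
  assumes [measurable]: "g \<in> borel_measurable borel" "h \<in> borel_measurable borel"
    and g: "integrable (shell_measure DIM('a)) g" and h: "integrable sphere_measure h"
  shows "integrable (restrict_space lborel annulus) (\<lambda>x. g (norm x) * h (sgn x))"
    "(LINT x|restrict_space lborel annulus. g (norm x) * h (sgn x)) = (LINT r|shell_measure DIM('a). g r) * (LINT \<omega>|sphere_measure. h \<omega>)"
proof -
  let ?M = "radial_measure DIM('a) \<Otimes>\<^sub>M (sphere_measure :: 'a measure)"
  define F where "F x = indicator annulus x *\<^sub>R (g (norm x) * h (sgn x))" for x
  have [measurable]: "F \<in> borel_measurable borel" unfolding F_def[abs_def] by measurable
  have F: "F (max 0 (fst p) *\<^sub>R snd p) = (indicator {2<..<3} (fst p) * g (fst p)) * h (snd p)" if "p \<in> space ?M" for p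
  proof -
    have n: "norm (snd p) = 1" using that by (auto simp: space_pair_measure)
    show ?thesis
    proof (cases "fst p > 0")
      case True
      then have "sgn (fst p *\<^sub>R snd p) = snd p" using n by (simp add: sgn_div_norm)
      then show ?thesis using True n by (auto simp: F_def annulus_iff max_absorb2 split: split_indicator)
    qed (use n in \<open>auto simp: F_def annulus_iff max_absorb1 split: split_indicator\<close>)
  qed
  note P = integrable_pair_product[OF radial_measure_sigma_finite sphere.sigma_finite_measure_axioms
    g[unfolded integral_shell_measure(1)[OF assms(1)]] h]
  have "integrable ?M (\<lambda>p. F (max 0 (fst p) *\<^sub>R snd p))"
    using P(1) by (subst Bochner_Integration.integrable_cong[OF refl F])
  then have i: "integrable lborel F" by (simp add: polar_integral(1))
  have I: "(LINT x|lborel. F x) = (LINT r|shell_measure DIM('a). g r) * (LINT \<omega>|sphere_measure. h \<omega>)"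
    using P(2) by (simp add: polar_integral(2) F integral_shell_measure(2) cong: Bochner_Integration.integral_cong)
  show "integrable (restrict_space lborel annulus) (\<lambda>x. g (norm x) * h (sgn x))"
    using i unfolding F_def by (subst integrable_restrict_space) auto
  show "(LINT x|restrict_space lborel annulus. g (norm x) * h (sgn x)) = (LINT r|shell_measure DIM('a). g r) * (LINT \<omega>|sphere_measure. h \<omega>)"
    using I unfolding F_def by (subst integral_restrict_space) auto
qed

section \<open>Orthogonality of spherical harmonics\<close>

lemma sphere_integrable_continuous:
  fixes h :: "'a::euclidean_space \<Rightarrow> complex"
  assumes "continuous_on UNIV h" shows "integrable sphere_measure h"
proof -
  have [measurable]: "h \<in> borel_measurable borel" by (rule borel_measurable_continuous_onI[OF assms])
  have m: "h \<in> borel_measurable sphere_measure"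
    by (subst measurable_cong_sets[OF sets_sphere_measure refl]) (auto intro: measurable_restrict_space1)
  have "compact (h ` sphere 0 1)" by (rule compact_continuous_image[OF continuous_on_subset[OF assms]]) auto
  then obtain N where N: "\<forall>x\<in>sphere 0 1. norm (h x) \<le> N" by (auto dest!: compact_imp_bounded simp: bounded_iff)
  show ?thesis by (rule sphere.integrable_const_bound[OF _ m, of N]) (use N in auto)
qed

lemma polynomial_continuous:
  fixes p :: "'a::euclidean_space \<Rightarrow> complex"
  shows "polynomial_function p \<Longrightarrow> continuous_on UNIV p"
  by (rule continuous_on_polymonial_function)

text \<open>In polar coordinates the Gaussian integral of \<open>p * q\<close>, which vanishes, is the integral over the sphere times
  a positive radial integral.\<close>

lemma sphere_orthogonal_lower_degree:
  fixes p q :: "'a::euclidean_space \<Rightarrow> complex"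
  assumes p: "p \<in> harmonic_homogeneous_polys m" and q: "q \<in> hom_polys j" and jm: "j < m"
  shows "(LINT \<omega>|sphere_measure. p \<omega> * q \<omega>) = 0"
proof (rule ccontr)
  let ?R = "radial_measure DIM('a)"
  interpret R: sigma_finite_measure ?R by (rule radial_measure_sigma_finite)
  interpret P: pair_sigma_finite ?R "sphere_measure :: 'a measure" ..
  define c where "c = (LINT \<omega>|sphere_measure. p \<omega> * q \<omega>)"
  assume "\<not> ?thesis"
  then have c: "c \<noteq> 0" by (simp add: c_def)
  have ph: "p \<in> hom_polys m" using p by (simp add: harmonic_homogeneous_polys_iff)
  define F where "F x = (p x * q x) * of_real (exp (- (norm x)\<^sup>2))" for x
  have pq: "polynomial_function (\<lambda>x. p x * q x)"
    by (intro polynomial_complex_mult hom_polys_polynomial[OF ph] hom_polys_polynomial[OF q])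
  have F: "integrable lborel F" unfolding F_def[abs_def] by (rule polynomial_gaussian_integrable[OF pq])
  have [measurable]: "F \<in> borel_measurable borel" using F by auto
  define \<rho> where "\<rho> r = max 0 r ^ (m + j) * exp (- (max 0 r)\<^sup>2)" for r :: real
  have \<rho>0: "\<rho> r \<ge> 0" for r by (simp add: \<rho>_def)
  have Fp: "F (max 0 r *\<^sub>R \<omega>) = of_real (\<rho> r) * (p \<omega> * q \<omega>)" if "\<omega> \<in> space sphere_measure" for r and \<omega> :: 'a
    using that by (simp add: F_def \<rho>_def hom_polys_scale[OF ph] hom_polys_scale[OF q] power_add mult_ac)
  have i: "integrable (?R \<Otimes>\<^sub>M sphere_measure) (\<lambda>p. F (max 0 (fst p) *\<^sub>R snd p))"
    using F by (simp add: polar_integral(1))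
  have inner: "(LINT \<omega>|sphere_measure. F (max 0 r *\<^sub>R \<omega>)) = of_real (\<rho> r) * c" for r
  proof -
    have "(LINT \<omega>|sphere_measure. F (max 0 r *\<^sub>R \<omega>)) = (LINT \<omega>|sphere_measure. of_real (\<rho> r) * (p \<omega> * q \<omega>))"
      by (rule Bochner_Integration.integral_cong[OF refl Fp])
    then show ?thesis by (simp add: c_def)
  qed
  have "(LINT r|?R. of_real (\<rho> r) * c) = (LINT x|lborel. F x)"
    using P.integral_fst'[OF i] by (simp add: inner polar_integral(2))
  also have "\<dots> = 0" unfolding F_def by (rule gaussian_orthogonal_lower_degree[OF p q jm])
  finally have "of_real (LINT r|?R. \<rho> r) * c = 0" by simp
  then have z: "(LINT r|?R. \<rho> r) = 0" using c by simp
  have "integrable ?R (\<lambda>r. of_real (\<rho> r) * c)"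
    using P.integrable_fst'[OF i] by (simp add: inner)
  then have "integrable ?R (\<lambda>r. (of_real (\<rho> r) * c) * (1 / c))" by (rule integrable_mult_left)
  then have "integrable ?R (\<lambda>r. complex_of_real (\<rho> r))" using c by simp
  then have i\<rho>: "integrable ?R \<rho>" by (simp add: complex_of_real_integrable_eq)
  have "AE r in ?R. \<rho> r = 0" using integral_nonneg_eq_0_iff_AE[OF i\<rho>] \<rho>0 z by simp
  then have "AE r in lborel. 0 < ennreal (indicator {0<..} r * r ^ (DIM('a) - 1)) \<longrightarrow> \<rho> r = 0"
    unfolding radial_measure_def by (subst (asm) AE_density) auto
  then have "AE r in lborel. r \<notin> {0<..<1::real}"
    by (rule eventually_mono) (auto simp: \<rho>_def max_absorb2 split: split_indicator_asm)
  then have "{0<..<1::real} \<in> null_sets lborel" by (subst AE_iff_null_sets) auto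
  then have "emeasure lborel {0<..<1::real} = 0" by auto
  then show False by simp
qed

lemma sphere_orthogonal_harmonics:
  fixes p q :: "'a::euclidean_space \<Rightarrow> complex"
  assumes p: "p \<in> harmonic_homogeneous_polys m" and q: "q \<in> harmonic_homogeneous_polys j" and "j \<noteq> m"
  shows "(LINT \<omega>|sphere_measure. p \<omega> * cnj (q \<omega>)) = 0"
proof (cases "j < m")
  case True
  then show ?thesis using sphere_orthogonal_lower_degree[OF p hom_polys_cnj[of q j]] q
    by (simp add: harmonic_homogeneous_polys_iff)
next
  case False
  then have "m < j" using assms by simp
  then have "(LINT \<omega>|sphere_measure. q \<omega> * cnj (p \<omega>)) = 0"
    using sphere_orthogonal_lower_degree[OF q hom_polys_cnj[of p m]] p by (simp add: harmonic_homogeneous_polys_iff)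
  moreover have "(LINT \<omega>|sphere_measure. p \<omega> * cnj (q \<omega>)) = (LINT \<omega>|sphere_measure. cnj (q \<omega> * cnj (p \<omega>)))"
    by (simp add: mult.commute)
  ultimately show ?thesis by (simp only: Bochner_Integration.integral_cnj) simp
qed


section \<open>Orthonormal polynomials on the shell\<close>

lemma sets_shell_measure: "sets (shell_measure n) = sets borel"
  by (simp add: shell_measure_def)

lemma shell_measure_AE: "AE r in shell_measure n. 2 < r \<and> r < 3"
  unfolding shell_measure_def by (subst AE_density) (auto split: split_indicator)

lemma shell_measure_AE_pos:
  assumes "AE r in shell_measure n. P r"
  shows "AE r in lborel. 2 < r \<and> r < 3 \<longrightarrow> P r"
  using assms unfolding shell_measure_def by (subst (asm) AE_density) (auto elim!: eventually_mono)

lemma shell_measure_finite: "finite_measure (shell_measure n)"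
proof
  have "emeasure (shell_measure n) (space (shell_measure n)) = (\<integral>\<^sup>+r. ennreal (indicator {2<..<3} r * r ^ (n - 1)) \<partial>lborel)"
    unfolding shell_measure_def by (subst emeasure_density) auto
  also have "\<dots> \<le> (\<integral>\<^sup>+r. ennreal (3 ^ (n - 1)) * indicator {2<..<3::real} r \<partial>lborel)"
    by (intro nn_integral_mono) (auto split: split_indicator intro!: ennreal_leI power_mono)
  also have "\<dots> = ennreal (3 ^ (n - 1)) * emeasure lborel {2<..<3::real}" by (subst nn_integral_cmult_indicator) auto
  also have "\<dots> < \<infinity>" by (simp add: ennreal_mult_less_top)
  finally show "emeasure (shell_measure n) (space (shell_measure n)) \<noteq> \<infinity>" by simp
qed

lemma shell_integrable_continuous:
  fixes g :: "real \<Rightarrow> 'b::{banach,second_countable_topology}"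
  assumes g: "continuous_on UNIV g"
  shows "integrable (shell_measure n) g"
proof -
  interpret finite_measure "shell_measure n" by (rule shell_measure_finite)
  have m: "g \<in> borel_measurable (shell_measure n)"
    by (subst measurable_cong_sets[OF sets_shell_measure refl]) (rule borel_measurable_continuous_onI[OF g])
  have "compact (g ` {2..3})" by (rule compact_continuous_image[OF continuous_on_subset[OF g]]) auto
  then obtain N where N: "\<forall>x\<in>{2..3}. norm (g x) \<le> N" by (auto dest!: compact_imp_bounded simp: bounded_iff)
  have "AE r in shell_measure n. norm (g r) \<le> N"
    using shell_measure_AE by eventually_elim (use N in auto)
  from integrable_const_bound[OF this m] show ?thesis .
qed

definition shell_inner :: "nat \<Rightarrow> real poly \<Rightarrow> real poly \<Rightarrow> real" where
  "shell_inner n p q = (LINT r|shell_measure n. poly p r * poly q r)"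

lemma shell_inner_integrable: "integrable (shell_measure n) (\<lambda>r. poly p r * poly q r)"
  by (rule shell_integrable_continuous) (intro continuous_intros)

lemma shell_inner_simps:
  "shell_inner n (p + p') q = shell_inner n p q + shell_inner n p' q"
  "shell_inner n (p - p') q = shell_inner n p q - shell_inner n p' q"
  "shell_inner n (smult c p) q = c * shell_inner n p q"
  "shell_inner n 0 q = 0"
  using shell_inner_integrable by (simp_all add: shell_inner_def algebra_simps)

lemma shell_inner_commute: "shell_inner n p q = shell_inner n q p"
  by (simp add: shell_inner_def mult.commute)

lemma shell_inner_sum_left: "finite A \<Longrightarrow> shell_inner n (\<Sum>i\<in>A. p i) q = (\<Sum>i\<in>A. shell_inner n (p i) q)"
  by (induction A rule: finite_induct) (simp_all add: shell_inner_simps)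

lemma shell_inner_pos:
  assumes "p \<noteq> 0" shows "shell_inner n p p > 0"
proof -
  have nn: "shell_inner n p p \<ge> 0" unfolding shell_inner_def by (intro integral_nonneg_AE) simp
  moreover have "shell_inner n p p \<noteq> 0"
  proof
    assume "shell_inner n p p = 0"
    then have "AE r in shell_measure n. poly p r * poly p r = 0"
      using integral_nonneg_eq_0_iff_AE[OF shell_inner_integrable[of n p p]] by (simp add: shell_inner_def)
    then have AE: "AE r in lborel. 2 < r \<and> r < 3 \<longrightarrow> poly p r * poly p r = 0"
      by (rule shell_measure_AE_pos)
    have fin: "finite {r. poly p r = 0}" by (rule poly_roots_finite[OF assms])
    have "AE r in lborel. r \<notin> {r. poly p r = 0}"
      by (intro AE_not_in finite_imp_null_set_lborel fin)
    with AE have "AE r in lborel. r \<notin> {2<..<3::real}" by eventually_elim auto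
    then have "{2<..<3::real} \<in> null_sets lborel" by (subst AE_iff_null_sets) auto
    then have "emeasure lborel {2<..<3::real} = 0" by auto
    then show False by simp
  qed
  ultimately show ?thesis by simp
qed

text \<open>Gram-Schmidt orthonormalisation of the monomials.\<close>

fun shell_poly :: "nat \<Rightarrow> nat \<Rightarrow> real poly" where
  "shell_poly n k = (let u = monom 1 k - (\<Sum>i<k. smult (shell_inner n (monom 1 k) (shell_poly n i)) (shell_poly n i))
     in smult (1 / sqrt (shell_inner n u u)) u)"

declare shell_poly.simps [simp del]

text \<open>The component of the monomial orthogonal to its predecessors, before normalisation.\<close>

definition shell_residual :: "nat \<Rightarrow> nat \<Rightarrow> real poly" where
  "shell_residual n k = monom 1 k - (\<Sum>i<k. smult (shell_inner n (monom 1 k) (shell_poly n i)) (shell_poly n i))"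

lemma shell_poly_residual:
  "shell_poly n k = smult (1 / sqrt (shell_inner n (shell_residual n k) (shell_residual n k))) (shell_residual n k)"
  by (subst shell_poly.simps) (simp add: shell_residual_def Let_def)

lemma shell_poly_coeff: "j > k \<Longrightarrow> coeff (shell_poly n k) j = 0"
proof (induction k arbitrary: j rule: less_induct)
  case (less k)
  then have "coeff (shell_residual n k) j = 0"
    by (simp add: shell_residual_def coeff_sum)
  then show ?case by (simp add: shell_poly_residual)
qed

lemma shell_residual_nonzero: "shell_residual n k \<noteq> 0"
proof
  assume "shell_residual n k = 0"
  then have "coeff (shell_residual n k) k = 0" by simp
  moreover have "coeff (shell_residual n k) k = 1" by (simp add: shell_residual_def coeff_sum shell_poly_coeff)
  ultimately show False by simp
qed

lemma shell_poly_norm: "shell_inner n (shell_poly n k) (shell_poly n k) = 1"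
proof -
  have "shell_inner n (shell_residual n k) (shell_residual n k) > 0"
    by (rule shell_inner_pos[OF shell_residual_nonzero])
  then show ?thesis
    by (simp add: shell_poly_residual shell_inner_simps shell_inner_commute[of n _ "smult _ _"])
qed

lemma shell_poly_orthogonal_less: "j < k \<Longrightarrow> shell_inner n (shell_poly n k) (shell_poly n j) = 0"
proof (induction k arbitrary: j rule: less_induct)
  case (less k)
  have "shell_inner n (shell_poly n i) (shell_poly n j) = (if i = j then 1 else 0)" if "i < k" for i
  proof (cases i j rule: linorder_cases)
    case less show ?thesis using less.IH[of j i] less \<open>j < k\<close> shell_inner_commute[of n "shell_poly n i"] by simp
  next
    case greater then show ?thesis using less.IH[of i j] that by simp
  qed (simp add: shell_poly_norm)
  then have "shell_inner n (shell_residual n k) (shell_poly n j) = 0"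
    using less.prems by (simp add: shell_residual_def shell_inner_simps shell_inner_sum_left if_distrib[of "(*) _"] cong: if_cong)
  then show ?case by (subst shell_poly_residual) (simp add: shell_inner_simps)
qed

lemma shell_poly_orthonormal: "shell_inner n (shell_poly n j) (shell_poly n k) = (if j = k then 1 else 0)"
  using shell_poly_orthogonal_less[of j k n] shell_poly_orthogonal_less[of k j n] shell_inner_commute[of n]
  by (cases j k rule: linorder_cases) (auto simp: shell_poly_norm)

lemma monom_shell_poly: "\<exists>c. monom 1 k = (\<Sum>i\<le>k. smult (c i) (shell_poly n i))"
proof -
  let ?u = "shell_residual n k"
  have pos: "shell_inner n ?u ?u > 0" by (rule shell_inner_pos[OF shell_residual_nonzero])
  define c where "c i = (if i = k then sqrt (shell_inner n ?u ?u) else shell_inner n (monom 1 k) (shell_poly n i))" for i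
  have "smult (c k) (shell_poly n k) = ?u" using pos by (simp add: c_def shell_poly_residual)
  then have "monom 1 k = smult (c k) (shell_poly n k) + (\<Sum>i<k. smult (c i) (shell_poly n i))"
    by (simp add: shell_residual_def c_def)
  also have "\<dots> = (\<Sum>i\<le>k. smult (c i) (shell_poly n i))"
    by (simp add: lessThan_Suc_atMost[symmetric] add.commute)
  finally show ?thesis by blast
qed

lemma shell_poly_orthogonal_power:
  assumes "i < k" shows "(LINT r|shell_measure n. poly (shell_poly n k) r * r ^ i) = 0"
proof -
  obtain c where c: "monom 1 i = (\<Sum>j\<le>i. smult (c j) (shell_poly n j))" using monom_shell_poly by blast
  have "shell_inner n (monom 1 i) (shell_poly n k) = 0"
    unfolding c using assms by (simp add: shell_inner_sum_left shell_inner_simps shell_poly_orthonormal)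
  then show ?thesis by (simp add: shell_inner_def poly_monom mult.commute)
qed

section \<open>Density criteria\<close>

text \<open>Completeness of a family says that this set is all of \<open>L\<^sup>2\<close>. Its closure under sums and limits lets a
  completeness proof climb from the family to ever larger classes of functions.\<close>

definition L2_closed_span :: "'a measure \<Rightarrow> 'i set \<Rightarrow> ('i \<Rightarrow> 'a \<Rightarrow> complex) \<Rightarrow> ('a \<Rightarrow> complex) set" where
  "L2_closed_span M I e = {F \<in> L2 M. \<forall>\<epsilon>>0. \<exists>J c. finite J \<and> J \<subseteq> I \<and> L2_norm M (\<lambda>x. F x - (\<Sum>j\<in>J. c j * e j x)) < \<epsilon>}"

lemma L2_closed_spanD:
  assumes "F \<in> L2_closed_span M I e" "\<epsilon> > 0"
  obtains J c where "finite J" "J \<subseteq> I" "L2_norm M (\<lambda>x. F x - (\<Sum>j\<in>J. c j * e j x)) < \<epsilon>"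
  using assms unfolding L2_closed_span_def by blast

context
  fixes M :: "'a measure" and I :: "'i set" and e :: "'i \<Rightarrow> 'a \<Rightarrow> complex"
  assumes e: "\<And>i. i \<in> I \<Longrightarrow> e i \<in> L2 M"
begin

lemma L2_finite_span: "finite J \<Longrightarrow> J \<subseteq> I \<Longrightarrow> (\<lambda>x. \<Sum>j\<in>J. c j * e j x) \<in> L2 M"
  by (intro L2_sum L2_cmult e) auto

lemma L2_closed_span_base: assumes "i \<in> I" shows "e i \<in> L2_closed_span M I e"
  unfolding L2_closed_span_def
proof (intro CollectI conjI allI impI)
  fix \<epsilon> :: real assume "\<epsilon> > 0"
  then show "\<exists>J c. finite J \<and> J \<subseteq> I \<and> L2_norm M (\<lambda>x. e i x - (\<Sum>j\<in>J. c j * e j x)) < \<epsilon>"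
    using assms by (intro exI[of _ "{i}"] exI[of _ "\<lambda>_. 1"]) (simp add: L2_norm_zero)
qed (rule e[OF assms])

lemma L2_closed_span_limit:
  assumes F: "F \<in> L2 M" and lim: "\<And>\<epsilon>. \<epsilon> > 0 \<Longrightarrow> \<exists>G\<in>L2_closed_span M I e. L2_norm M (\<lambda>x. F x - G x) < \<epsilon>"
  shows "F \<in> L2_closed_span M I e"
  unfolding L2_closed_span_def
proof (intro CollectI conjI allI impI F)
  fix \<epsilon> :: real assume \<epsilon>: "\<epsilon> > 0"
  then obtain G where G: "G \<in> L2_closed_span M I e" "L2_norm M (\<lambda>x. F x - G x) < \<epsilon> / 2" using lim[of "\<epsilon>/2"] by auto
  obtain J c where J: "finite J" "J \<subseteq> I" "L2_norm M (\<lambda>x. G x - (\<Sum>j\<in>J. c j * e j x)) < \<epsilon> / 2"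
    using L2_closed_spanD[OF G(1), of "\<epsilon>/2"] \<epsilon> by auto
  have GL: "G \<in> L2 M" using G(1) by (simp add: L2_closed_span_def)
  have "L2_norm M (\<lambda>x. F x - (\<Sum>j\<in>J. c j * e j x)) < \<epsilon>"
    using L2_norm_diff_triangle[OF F GL L2_finite_span[OF J(1,2), of c]] G(2) J(3) by simp
  with J show "\<exists>J c. finite J \<and> J \<subseteq> I \<and> L2_norm M (\<lambda>x. F x - (\<Sum>j\<in>J. c j * e j x)) < \<epsilon>" by blast
qed

lemma L2_closed_span_add_cmult:
  assumes F: "F \<in> L2_closed_span M I e" and G: "G \<in> L2_closed_span M I e"
  shows "(\<lambda>x. F x + a * G x) \<in> L2_closed_span M I e"
  unfolding L2_closed_span_def
proof (intro CollectI conjI allI impI)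
  have FL: "F \<in> L2 M" and GL: "G \<in> L2 M" using F G by (auto simp: L2_closed_span_def)
  then show "(\<lambda>x. F x + a * G x) \<in> L2 M" by (intro L2_add L2_cmult)
  fix \<epsilon> :: real assume \<epsilon>: "\<epsilon> > 0"
  define \<delta> where "\<delta> = \<epsilon> / (2 + norm a)"
  have \<delta>: "\<delta> > 0" "(1 + norm a) * \<delta> < \<epsilon>" 
  proof -
    have a: "2 + norm a > 0" by (simp add: add_pos_nonneg)
    show "\<delta> > 0" using \<epsilon> a by (simp add: \<delta>_def)
    then have "(1 + norm a) * \<delta> < (2 + norm a) * \<delta>" by simp
    also have "\<dots> = \<epsilon>" using a by (simp add: \<delta>_def)
    finally show "(1 + norm a) * \<delta> < \<epsilon>" .
  qed
  obtain J c where J: "finite J" "J \<subseteq> I" "L2_norm M (\<lambda>x. F x - (\<Sum>j\<in>J. c j * e j x)) < \<delta>"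
    using L2_closed_spanD[OF F \<delta>(1)] by blast
  obtain K d where K: "finite K" "K \<subseteq> I" "L2_norm M (\<lambda>x. G x - (\<Sum>j\<in>K. d j * e j x)) < \<delta>"
    using L2_closed_spanD[OF G \<delta>(1)] by blast
  define b where "b j = (if j \<in> J then c j else 0) + a * (if j \<in> K then d j else 0)" for j
  have "(\<Sum>j\<in>J \<union> K. b j * e j x) = (\<Sum>j\<in>J. c j * e j x) + a * (\<Sum>j\<in>K. d j * e j x)" for x
  proof -
    have "(\<Sum>j\<in>J \<union> K. b j * e j x) = (\<Sum>j\<in>J \<union> K. if j \<in> J then c j * e j x else 0) + a * (\<Sum>j\<in>J \<union> K. if j \<in> K then d j * e j x else 0)"
      unfolding sum_distrib_left sum.distrib[symmetric] by (rule sum.cong) (auto simp: b_def algebra_simps)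
    then show ?thesis using J(1) K(1) by (simp add: sum.inter_restrict[symmetric] Int_absorb1 Int_absorb2)
  qed
  then have eq: "F x + a * G x - (\<Sum>j\<in>J \<union> K. b j * e j x) = (F x - (\<Sum>j\<in>J. c j * e j x)) + a * (G x - (\<Sum>j\<in>K. d j * e j x))" for x
    by (simp add: algebra_simps)
  have "L2_norm M (\<lambda>x. F x + a * G x - (\<Sum>j\<in>J \<union> K. b j * e j x)) \<le> L2_norm M (\<lambda>x. F x - (\<Sum>j\<in>J. c j * e j x)) + norm a * L2_norm M (\<lambda>x. G x - (\<Sum>j\<in>K. d j * e j x))"
    unfolding eq L2_norm_cmult[symmetric]
    by (intro L2_norm_triangle L2_cmult L2_diff FL GL L2_finite_span J K)
  also have "\<dots> \<le> \<delta> + norm a * \<delta>" using J(3) K(3) by (intro add_mono mult_left_mono) auto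
  also have "\<dots> < \<epsilon>" using \<delta>(2) by (simp add: algebra_simps)
  finally show "\<exists>J c. finite J \<and> J \<subseteq> I \<and> L2_norm M (\<lambda>x. F x + a * G x - (\<Sum>j\<in>J. c j * e j x)) < \<epsilon>"
    using J K by (intro exI[of _ "J \<union> K"] exI[of _ b]) auto
qed

lemma L2_closed_span_zero: "(\<lambda>x. 0) \<in> L2_closed_span M I e"
  unfolding L2_closed_span_def by (auto simp: L2_zero L2_norm_zero intro!: exI[of _ "{}"])

lemma L2_closed_span_sum:
  "finite A \<Longrightarrow> (\<And>i. i \<in> A \<Longrightarrow> F i \<in> L2_closed_span M I e) \<Longrightarrow> (\<lambda>x. \<Sum>i\<in>A. a i * F i x) \<in> L2_closed_span M I e"
proof (induction A rule: finite_induct)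
  case (insert i A)
  then show ?case using L2_closed_span_add_cmult[of "\<lambda>x. \<Sum>i\<in>A. a i * F i x" "F i" "a i"] by (simp add: add.commute)
qed (simp add: L2_closed_span_zero)

lemma L2_closed_span_cong:
  assumes F: "F \<in> L2_closed_span M I e" and eq: "\<And>x. x \<in> space M \<Longrightarrow> F x = G x"
  shows "G \<in> L2_closed_span M I e"
proof (rule L2_closed_span_limit)
  show "G \<in> L2 M" using F eq by (auto simp: L2_closed_span_def intro: L2_cong)
  show "\<exists>F\<in>L2_closed_span M I e. L2_norm M (\<lambda>x. G x - F x) < \<epsilon>" if "\<epsilon> > 0" for \<epsilon>
  proof (rule bexI[OF _ F])
    have "L2_norm M (\<lambda>x. G x - F x) = L2_norm M (\<lambda>x. 0)" by (rule L2_norm_cong) (simp add: eq)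
    with that show "L2_norm M (\<lambda>x. G x - F x) < \<epsilon>" by (simp add: L2_norm_zero)
  qed
qed

end

section \<open>The product basis of the annulus\<close>

abbreviation annulus_measure :: "'a::euclidean_space measure" where
  "annulus_measure \<equiv> restrict_space lborel annulus"

lemma space_annulus_measure: "space annulus_measure = annulus"
  by (simp add: space_restrict_space)

lemma annulus_L2_product:
  fixes g :: "real \<Rightarrow> complex" and h :: "'a::euclidean_space \<Rightarrow> complex"
  assumes g: "continuous_on UNIV g" and h: "continuous_on UNIV h"
  shows "(\<lambda>x. g (norm x) * h (sgn x)) \<in> L2 annulus_measure"
    "(L2_norm annulus_measure (\<lambda>x. g (norm x) * h (sgn x)))\<^sup>2 = (LINT r|shell_measure DIM('a). (norm (g r))\<^sup>2) * (L2_norm sphere_measure h)\<^sup>2"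
proof -
  have [measurable]: "g \<in> borel_measurable borel" "h \<in> borel_measurable borel"
    using g h by (auto intro: borel_measurable_continuous_onI)
  define g2 where "g2 r = complex_of_real ((norm (g r))\<^sup>2)" for r
  define h2 where "h2 x = complex_of_real ((norm (h x))\<^sup>2)" for x
  have c: "continuous_on UNIV g2" "continuous_on UNIV h2"
    unfolding g2_def h2_def by (intro continuous_intros g h)+
  have [measurable]: "g2 \<in> borel_measurable borel" "h2 \<in> borel_measurable borel"
    using c by (auto intro: borel_measurable_continuous_onI)
  note P = annulus_integral_product[of g2 h2, OF _ _ shell_integrable_continuous[OF c(1)] sphere_integrable_continuous[OF c(2)], simplified]
  have eq: "g2 (norm x) * h2 (sgn x) = complex_of_real ((norm (g (norm x) * h (sgn x)))\<^sup>2)" for x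
    by (simp add: g2_def h2_def norm_mult power_mult_distrib)
  have m: "(\<lambda>x. g (norm x) * h (sgn x)) \<in> borel_measurable annulus_measure"
    by (intro measurable_restrict_space1) measurable
  show "(\<lambda>x. g (norm x) * h (sgn x)) \<in> L2 annulus_measure"
    unfolding L2_def using m P(1) unfolding eq complex_of_real_integrable_eq by simp
  have "complex_of_real ((L2_norm annulus_measure (\<lambda>x. g (norm x) * h (sgn x)))\<^sup>2) = (LINT r|shell_measure DIM('a). g2 r) * (LINT \<omega>|sphere_measure. h2 \<omega>)"
    using P(2) by (simp only: eq integral_complex_of_real L2_norm_power2)
  also have "\<dots> = of_real ((LINT r|shell_measure DIM('a). (norm (g r))\<^sup>2) * (L2_norm sphere_measure h)\<^sup>2)"
    unfolding g2_def h2_def L2_norm_power2 integral_complex_of_real of_real_mult ..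
  finally show "(L2_norm annulus_measure (\<lambda>x. g (norm x) * h (sgn x)))\<^sup>2 = (LINT r|shell_measure DIM('a). (norm (g r))\<^sup>2) * (L2_norm sphere_measure h)\<^sup>2"
    by (simp only: of_real_eq_iff)
qed

lemma annulus_L2_bounded:
  fixes F :: "'a::euclidean_space \<Rightarrow> complex"
  assumes m: "F \<in> borel_measurable annulus_measure" and b: "\<And>x. x \<in> annulus \<Longrightarrow> norm (F x) \<le> B" and B: "B \<ge> 0"
  shows "F \<in> L2 annulus_measure" "L2_norm annulus_measure F \<le> B * sqrt (measure lborel (annulus :: 'a set))"
proof -
  have fin: "emeasure lborel (annulus :: 'a set) < \<infinity>"
    by (rule emeasure_bounded_finite, rule bounded_subset[OF bounded_ball[of 0 3]]) (auto simp: annulus_def)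
  interpret finite_measure "annulus_measure :: 'a measure"
    by standard (use fin in \<open>simp add: space_annulus_measure emeasure_restrict_space\<close>)
  have i: "integrable annulus_measure (\<lambda>x::'a. B\<^sup>2)" by simp
  have le: "(norm (F x))\<^sup>2 \<le> B\<^sup>2" if "x \<in> space annulus_measure" for x
    using that b[of x] by (intro power_mono) (auto simp: space_annulus_measure)
  show L: "F \<in> L2 annulus_measure" by (rule L2_dominated[OF m i le])
  have "(L2_norm annulus_measure F)\<^sup>2 \<le> (LINT x|(annulus_measure :: 'a measure). B\<^sup>2)"
    unfolding L2_norm_power2 by (rule integral_mono[OF L2_integrable[OF L] i le])
  also have "\<dots> = measure annulus_measure (annulus :: 'a set) * B\<^sup>2" by (simp add: space_annulus_measure)
  also have "\<dots> = (B * sqrt (measure lborel (annulus :: 'a set)))\<^sup>2"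
    by (simp add: power_mult_distrib measure_restrict_space)
  finally show "L2_norm annulus_measure F \<le> B * sqrt (measure lborel (annulus :: 'a set))"
    by (rule power2_le_imp_le) (use B in simp)
qed


lemma L2_norm_restrict_le:
  fixes G :: "'a::euclidean_space \<Rightarrow> complex"
  assumes G: "G \<in> L2 lborel" and [measurable]: "S \<in> sets borel"
  shows "G \<in> L2 (restrict_space lborel S)" "L2_norm (restrict_space lborel S) G \<le> L2_norm lborel G"
proof -
  have S: "S \<inter> space lborel \<in> sets lborel" by simp
  have i: "integrable lborel (\<lambda>x. indicator S x *\<^sub>R (norm (G x))\<^sup>2)"
    by (rule Bochner_Integration.integrable_bound[OF L2_integrable[OF G]])
      (use L2_measurable[OF G] in \<open>auto split: split_indicator\<close>)
  show "G \<in> L2 (restrict_space lborel S)"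
    unfolding L2_def using i L2_measurable[OF G] S by (auto simp: integrable_restrict_space intro: measurable_restrict_space1)
  show "L2_norm (restrict_space lborel S) G \<le> L2_norm lborel G"
    unfolding L2_norm_def integral_restrict_space[OF S]
    by (intro real_sqrt_le_mono integral_mono[OF i L2_integrable[OF G]]) (auto split: split_indicator)
qed

lemma extend_zero_L2:
  fixes F :: "'a::euclidean_space \<Rightarrow> complex"
  assumes F: "F \<in> L2 annulus_measure" shows "extend_zero F \<in> L2 lborel"
proof -
  have S: "annulus \<inter> space (lborel :: 'a measure) \<in> sets lborel" by simp
  have e: "extend_zero F = (\<lambda>x. indicator annulus x *\<^sub>R F x)" by (auto simp: extend_zero_def fun_eq_iff)
  have m: "(\<lambda>x. indicator annulus x *\<^sub>R F x) \<in> borel_measurable lborel"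
    using L2_measurable[OF F] borel_measurable_restrict_space_iff[OF S, of F] by simp
  have "integrable lborel (\<lambda>x. indicator annulus x *\<^sub>R (norm (F x))\<^sup>2)"
    using L2_integrable[OF F] integrable_restrict_space[OF S, of "\<lambda>x. (norm (F x))\<^sup>2"] by simp
  also have "(\<lambda>x. indicator annulus x *\<^sub>R (norm (F x))\<^sup>2) = (\<lambda>x. (norm (indicator annulus x *\<^sub>R F x))\<^sup>2)"
    by (auto split: split_indicator simp: fun_eq_iff)
  finally show ?thesis unfolding e L2_def using m by simp
qed

lemma sgn_in_sphere: "x \<in> annulus \<Longrightarrow> sgn x \<in> sphere 0 1"
  by (auto simp: annulus_iff norm_sgn)

lemma norm_scaleR_sgn: "norm x *\<^sub>R sgn x = (x :: 'a::real_normed_vector)"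
  by (cases "x = 0") (simp_all add: sgn_div_norm)

text \<open>On the unit sphere the factor \<open>|x|\<^sup>2\<close> in the Fischer decomposition is one, so a homogeneous polynomial there
  reduces step by step to harmonic ones; homogeneity then supplies the power of \<open>norm x\<close>.\<close>

lemma polynomial_annulus_decomposition:
  fixes S :: "('a::euclidean_space \<Rightarrow> complex) set"
  assumes add: "\<And>F G. F \<in> S \<Longrightarrow> G \<in> S \<Longrightarrow> (\<lambda>x. F x + G x) \<in> S"
    and cong: "\<And>F G. F \<in> S \<Longrightarrow> (\<And>x. x \<in> annulus \<Longrightarrow> F x = G x) \<Longrightarrow> G \<in> S"
    and harmonic: "\<And>m j p. p \<in> harmonic_homogeneous_polys m \<Longrightarrow> (\<lambda>x. of_real (norm x ^ j) * p (sgn x)) \<in> S"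
    and q: "polynomial_function q"
  shows "q \<in> S"
proof -
  have hom: "(\<lambda>x. of_real (norm x ^ j) * q (sgn x)) \<in> S" if "q \<in> hom_polys i" for q i j
    using that
  proof (induction i arbitrary: q rule: less_induct)
    case (less i)
    show ?case
    proof (cases "i < 2")
      case True
      then have "q \<in> harmonic_homogeneous_polys i"
        using less.prems laplacian_hom_polys_low by (auto simp: harmonic_homogeneous_polys_iff)
      then show ?thesis by (rule harmonic)
    next
      case False
      then obtain e where i: "i = Suc (Suc e)" by (metis add_2_eq_Suc le_Suc_ex not_le)
      obtain p q' where p: "p \<in> harmonic_homogeneous_polys i" and q': "q' \<in> hom_polys e"
        and eq: "\<And>x. q x = p x + of_real ((norm x)\<^sup>2) * q' x"
        using Fischer_decomposition[of q e] less.prems unfolding i by blast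
      show ?thesis
      proof (rule cong[OF add[OF harmonic[OF p, of j] less.IH[OF _ q']]])
        show "of_real (norm x ^ j) * p (sgn x) + of_real (norm x ^ j) * q' (sgn x) = of_real (norm x ^ j) * q (sgn x)" if "x \<in> annulus" for x
          using sgn_in_sphere[OF that] eq[of "sgn x"] by (simp add: distrib_left)
      qed (simp add: i)
    qed
  qed
  have "q \<in> S" if "q \<in> hom_polys i" for q i
  proof (rule cong[OF hom[OF that, of i]])
    show "of_real (norm x ^ i) * q (sgn x) = q x" if "x \<in> annulus" for x
    proof -
      show ?thesis using hom_polys_scale[OF \<open>q \<in> hom_polys i\<close>, of "norm x" "sgn x"] by (simp add: norm_scaleR_sgn)
    qed
  qed
  moreover have "q \<in> hom_poly_sums" by (rule polynomial_hom_poly_sums[OF q])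
  ultimately show ?thesis by (induction rule: hom_poly_sums.induct[consumes 1, OF \<open>q \<in> hom_poly_sums\<close>]) (auto intro: add)
qed

text \<open>Extend by zero, approximate by a continuous function, and that one uniformly by a polynomial.\<close>

lemma annulus_closed_span_UNIV:
  fixes e :: "'i \<Rightarrow> 'a::euclidean_space \<Rightarrow> complex"
  assumes e: "\<And>i. i \<in> I \<Longrightarrow> e i \<in> L2 annulus_measure"
    and poly: "\<And>q. polynomial_function q \<Longrightarrow> q \<in> L2_closed_span annulus_measure I e"
    and F: "F \<in> L2 annulus_measure"
  shows "F \<in> L2_closed_span annulus_measure I e"
proof (rule L2_closed_span_limit[OF e F])
  fix \<epsilon> :: real assume \<epsilon>: "\<epsilon> > 0"
  note E = extend_zero_L2[OF F]
  define V where "V = sqrt (measure lborel (annulus :: 'a set))"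
  have V: "V \<ge> 0" by (simp add: V_def)
  define \<delta> where "\<delta> = \<epsilon> / (2 * (V + 1))"
  have \<delta>: "\<delta> > 0" "\<delta> * V < \<epsilon> / 2"
  proof -
    show "\<delta> > 0" using \<epsilon> V by (simp add: \<delta>_def)
    then have "\<delta> * V < \<delta> * (V + 1)" by simp
    also have "\<dots> = \<epsilon> / 2" using V by (simp add: \<delta>_def field_simps)
    finally show "\<delta> * V < \<epsilon> / 2" .
  qed
  obtain \<phi> R where \<phi>: "continuous_on UNIV \<phi>" "\<And>x. norm x > R \<Longrightarrow> \<phi> x = 0" and close: "L2_norm lborel (\<lambda>x. extend_zero F x - \<phi> x) < \<epsilon> / 2"
    using L2_continuous_approx[OF E, of "\<epsilon>/2"] \<epsilon> by auto
  have \<phi>L: "\<phi> \<in> L2 lborel" using Plancherel_continuous(1)[of \<phi> R] \<phi> by blast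
  obtain q where q: "polynomial_function q" and qc: "\<And>x. x \<in> cball 0 3 \<Longrightarrow> norm (\<phi> x - q x) < \<delta>"
    using Stone_Weierstrass_polynomial_function[OF compact_cball continuous_on_subset[OF \<phi>(1) subset_UNIV] \<delta>(1), of 0 3] by auto
  have [measurable]: "q \<in> borel_measurable borel" "\<phi> \<in> borel_measurable borel"
    using polynomial_continuous[OF q] \<phi>(1) by (auto intro: borel_measurable_continuous_onI)
  have m: "(\<lambda>x. \<phi> x - q x) \<in> borel_measurable annulus_measure"
    by (intro measurable_restrict_space1) measurable
  have b: "norm (\<phi> x - q x) \<le> \<delta>" if "x \<in> annulus" for x
    using qc[of x] that by (auto simp: annulus_iff)
  have B: "(\<lambda>x. \<phi> x - q x) \<in> L2 annulus_measure" "L2_norm annulus_measure (\<lambda>x. \<phi> x - q x) \<le> \<delta> * V"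
    using annulus_L2_bounded[OF m b less_imp_le[OF \<delta>(1)]] by (simp_all add: V_def)
  have "L2_norm annulus_measure (\<lambda>x. F x - \<phi> x) = L2_norm annulus_measure (\<lambda>x. extend_zero F x - \<phi> x)"
    by (rule L2_norm_cong) (simp add: space_annulus_measure extend_zero_def)
  also have "\<dots> \<le> L2_norm lborel (\<lambda>x. extend_zero F x - \<phi> x)"
    by (rule L2_norm_restrict_le(2)[OF L2_diff[OF E \<phi>L]]) simp
  finally have A: "L2_norm annulus_measure (\<lambda>x. F x - \<phi> x) < \<epsilon> / 2" using close by simp
  have \<phi>A: "\<phi> \<in> L2 annulus_measure" by (rule L2_norm_restrict_le(1)[OF \<phi>L]) simp
  have qA: "q \<in> L2 annulus_measure" using poly[OF q] by (simp add: L2_closed_span_def)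
  have "L2_norm annulus_measure (\<lambda>x. F x - q x) < \<epsilon>"
    using L2_norm_diff_triangle[OF F \<phi>A qA] A B(2) \<delta>(2) by linarith
  with poly[OF q] show "\<exists>G\<in>L2_closed_span annulus_measure I e. L2_norm annulus_measure (\<lambda>x. F x - G x) < \<epsilon>" by blast
qed

text \<open>Inner products factor into a radial and an angular integral. For completeness, the span of the radial
  polynomials contains all powers of \<open>norm x\<close>, and every harmonic polynomial is approximated on the sphere by
  the given basis; together they exhaust the polynomials on the annulus.\<close>

theorem annulus_product_basis:
  fixes h :: "nat \<Rightarrow> nat \<Rightarrow> 'a::euclidean_space \<Rightarrow> complex" and N :: "nat \<Rightarrow> nat"
  assumes h: "\<And>m. orthonormal_basis sphere_measure (spherical_harmonics m) {..<N m} (h m)"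
    and f: "\<And>m k l x. f (m, k, l) x = of_real (poly (shell_poly DIM('a) k) (norm x)) * h m l (sgn x)"
  shows "orthonormal_basis annulus_measure (L2 annulus_measure) {(m, k, l). l < N m} f"
proof -
  let ?I = "{(m, k, l). l < N m} :: (nat \<times> nat \<times> nat) set"
  let ?n = "DIM('a)"
  have ex: "\<exists>p. p \<in> harmonic_homogeneous_polys m \<and> (\<forall>x\<in>sphere 0 1. h m l x = p x)" if "l < N m" for m l
    using h[of m] that unfolding orthonormal_basis_def spherical_harmonics_def by blast
  define P where "P m l = (SOME p. p \<in> harmonic_homogeneous_polys m \<and> (\<forall>x\<in>sphere 0 1. h m l x = p x))" for m l
  have P: "P m l \<in> harmonic_homogeneous_polys m" and hP: "x \<in> sphere 0 1 \<Longrightarrow> h m l x = P m l x"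
    if "l < N m" for m l x
    using someI_ex[OF ex[OF that]] unfolding P_def by blast+
  have Pc: "continuous_on UNIV (P m l)" if "l < N m" for m l
    using P[OF that] by (intro polynomial_continuous hom_polys_polynomial) (auto simp: harmonic_homogeneous_polys_iff)
  define g where "g k r = complex_of_real (poly (shell_poly ?n k) r)" for k r
  have gc: "continuous_on UNIV (g k)" for k unfolding g_def by (intro continuous_intros)
  have fP: "f (m, k, l) x = g k (norm x) * P m l (sgn x)" if "l < N m" "x \<in> annulus" for m k l x
    using hP[OF that(1) sgn_in_sphere[OF that(2)]] by (simp add: f g_def)
  have fL: "f (m, k, l) \<in> L2 annulus_measure" if "l < N m" for m k l
    by (rule L2_cong[OF annulus_L2_product(1)[OF gc[of k] Pc[OF that]]]) (simp add: space_annulus_measure fP that)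
  have PP: "(LINT \<omega>|sphere_measure. P m l \<omega> * cnj (P m' l' \<omega>)) = (if m = m' \<and> l = l' then 1 else 0)" if l: "l < N m" "l' < N m'" for m l m' l'
  proof (cases "m' = m")
    case True
    have "(LINT \<omega>|sphere_measure. P m l \<omega> * cnj (P m l' \<omega>)) = L2_inner sphere_measure (h m l) (h m l')"
      unfolding L2_inner_def by (rule Bochner_Integration.integral_cong[OF refl]) (use hP l True in auto)
    then show ?thesis using h[of m] l True unfolding orthonormal_basis_def by auto
  qed (use sphere_orthogonal_harmonics[OF P[OF l(1)] P[OF l(2)]] in simp)
  have inner: "L2_inner annulus_measure (f (m, k, l)) (f (m', k', l')) = (if (m, k, l) = (m', k', l') then 1 else 0)"
    if l: "l < N m" "l' < N m'" for m k l m' k' l'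
  proof -
    define G where "G r = g k r * g k' r" for r
    define H where "H x = P m l x * cnj (P m' l' x)" for x
    have Gc: "continuous_on UNIV G" unfolding G_def by (intro continuous_intros gc)
    have Hc: "continuous_on UNIV H" unfolding H_def by (intro continuous_intros Pc l)
    have [measurable]: "G \<in> borel_measurable borel" "H \<in> borel_measurable borel"
      using Gc Hc by (auto intro: borel_measurable_continuous_onI)
    have "L2_inner annulus_measure (f (m, k, l)) (f (m', k', l')) = (LINT x|annulus_measure. G (norm x) * H (sgn x))"
      unfolding L2_inner_def
      by (rule Bochner_Integration.integral_cong[OF refl]) (simp add: space_annulus_measure fP l G_def H_def g_def)
    also have "\<dots> = (LINT r|shell_measure ?n. G r) * (LINT \<omega>|sphere_measure. H \<omega>)"
      by (rule annulus_integral_product(2)) (auto intro: shell_integrable_continuous[OF Gc] sphere_integrable_continuous[OF Hc])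
    also have "(LINT r|shell_measure ?n. G r) = of_real (shell_inner ?n (shell_poly ?n k) (shell_poly ?n k'))"
      unfolding G_def g_def shell_inner_def of_real_mult[symmetric] integral_complex_of_real ..
    finally show ?thesis unfolding H_def PP[OF l] by (auto simp: shell_poly_orthonormal)
  qed
  let ?S = "L2_closed_span annulus_measure ?I f"
  have e: "i \<in> ?I \<Longrightarrow> f i \<in> L2 annulus_measure" for i using fL by auto
  have cong: "G \<in> ?S" if "F \<in> ?S" "\<And>x. x \<in> annulus \<Longrightarrow> F x = G x" for F G
    by (rule L2_closed_span_cong[OF e that(1)]) (auto simp: space_annulus_measure that(2))
  have powers: "(\<lambda>x. of_real (norm x ^ j) * P m l (sgn x)) \<in> ?S" if l: "l < N m" for m l j
  proof -
    obtain c where c: "monom 1 j = (\<Sum>i\<le>j. smult (c i) (shell_poly ?n i))" using monom_shell_poly by blast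
    have "(\<lambda>x. \<Sum>i\<le>j. of_real (c i) * f (m, i, l) x) \<in> ?S"
      by (rule L2_closed_span_sum[OF e]) (auto intro!: L2_closed_span_base[OF e] l)
    then show ?thesis
    proof (rule cong)
      fix x :: 'a assume x: "x \<in> annulus"
      have "norm x ^ j = poly (monom 1 j) (norm x)" by (simp add: poly_monom)
      also have "\<dots> = (\<Sum>i\<le>j. c i * poly (shell_poly ?n i) (norm x))" unfolding c by (simp add: poly_sum)
      finally show "(\<Sum>i\<le>j. of_real (c i) * f (m, i, l) x) = of_real (norm x ^ j) * P m l (sgn x)"
        using x by (simp add: fP l g_def sum_distrib_right mult.assoc)
    qed
  qed
  have harmonic: "(\<lambda>x. of_real (norm x ^ j) * p (sgn x)) \<in> ?S" if p: "p \<in> harmonic_homogeneous_polys m" for m j p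
  proof (rule L2_closed_span_limit[OF e])
    have pc: "continuous_on UNIV p"
      using p by (intro polynomial_continuous hom_polys_polynomial) (auto simp: harmonic_homogeneous_polys_iff)
    define R where "R r = complex_of_real (r ^ j)" for r
    have Rc: "continuous_on UNIV R" unfolding R_def by (intro continuous_intros)
    show "(\<lambda>x. of_real (norm x ^ j) * p (sgn x)) \<in> L2 annulus_measure"
      using annulus_L2_product(1)[OF Rc pc] by (simp add: R_def)
    fix \<epsilon> :: real assume \<epsilon>: "\<epsilon> > 0"
    define A where "A = sqrt (LINT r|shell_measure ?n. (norm (R r))\<^sup>2)"
    have A: "A \<ge> 0" "A\<^sup>2 = (LINT r|shell_measure ?n. (norm (R r))\<^sup>2)" by (simp_all add: A_def integral_nonneg_AE)
    have "p \<in> spherical_harmonics m" using p by (auto simp: spherical_harmonics_def)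
    moreover have "\<epsilon> / (A + 1) > 0" using \<epsilon> A by simp
    ultimately obtain J c where J: "finite J" "J \<subseteq> {..<N m}" and near: "L2_norm sphere_measure (\<lambda>x. p x - (\<Sum>l\<in>J. c l * h m l x)) < \<epsilon> / (A + 1)"
      using h[of m] unfolding orthonormal_basis_def by blast
    define D where "D x = p x - (\<Sum>l\<in>J. c l * P m l x)" for x
    have Dc: "continuous_on UNIV D" unfolding D_def by (intro continuous_intros pc Pc) (use J in auto)
    have Dn: "L2_norm sphere_measure D < \<epsilon> / (A + 1)"
    proof -
      have "L2_norm sphere_measure D = L2_norm sphere_measure (\<lambda>x. p x - (\<Sum>l\<in>J. c l * h m l x))"
      proof (rule L2_norm_cong)
        fix x :: 'a assume x: "x \<in> space sphere_measure"
        have "(\<Sum>l\<in>J. c l * h m l x) = (\<Sum>l\<in>J. c l * P m l x)"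
          using J(2) x by (intro sum.cong refl arg_cong2[where f = "(*)"] hP) auto
        then show "norm (D x) = norm (p x - (\<Sum>l\<in>J. c l * h m l x))" by (simp add: D_def)
      qed
      with near show ?thesis by simp
    qed
    define G where "G x = (\<Sum>l\<in>J. c l * (of_real (norm x ^ j) * P m l (sgn x)))" for x
    have "G \<in> ?S" unfolding G_def[abs_def]
      by (rule L2_closed_span_sum[OF e _ powers]) (use J in auto)
    moreover have "L2_norm annulus_measure (\<lambda>x. of_real (norm x ^ j) * p (sgn x) - G x) < \<epsilon>"
    proof -
      have "(\<lambda>x. of_real (norm x ^ j) * p (sgn x) - G x) = (\<lambda>x. R (norm x) * D (sgn x))"
        by (simp add: fun_eq_iff G_def R_def D_def right_diff_distrib sum_distrib_left mult.left_commute)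
      then have "(L2_norm annulus_measure (\<lambda>x. of_real (norm x ^ j) * p (sgn x) - G x))\<^sup>2 = (A * L2_norm sphere_measure D)\<^sup>2"
        using annulus_L2_product(2)[OF Rc Dc] A(2) by (simp add: power_mult_distrib)
      then have "L2_norm annulus_measure (\<lambda>x. of_real (norm x ^ j) * p (sgn x) - G x) = A * L2_norm sphere_measure D"
        by (rule power2_eq_imp_eq) (simp_all add: L2_norm_nonneg A(1))
      also have "\<dots> \<le> A * (\<epsilon> / (A + 1))" using Dn A(1) by (intro mult_left_mono) auto
      also have "\<dots> < \<epsilon>" using A(1) \<epsilon> by (simp add: field_simps)
      finally show ?thesis .
    qed
    ultimately show "\<exists>G\<in>?S. L2_norm annulus_measure (\<lambda>x. of_real (norm x ^ j) * p (sgn x) - G x) < \<epsilon>" by blast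
  qed
  have poly: "q \<in> ?S" if "polynomial_function q" for q
  proof (rule polynomial_annulus_decomposition[OF _ _ harmonic that])
    show "(\<lambda>x. F x + G x) \<in> ?S" if "F \<in> ?S" "G \<in> ?S" for F G
      using L2_closed_span_add_cmult[OF e that, of 1] by simp
    show "G \<in> ?S" if "F \<in> ?S" "\<And>x. x \<in> annulus \<Longrightarrow> F x = G x" for F G
      by (rule cong[OF that])
  qed
  have "F \<in> ?S" if "F \<in> L2 annulus_measure" for F
    by (rule annulus_closed_span_UNIV[OF e poly that])
  then show ?thesis
    unfolding orthonormal_basis_def using fL inner by (auto simp: L2_closed_span_def)
qed

section \<open>Polynomial approximation of the kernel\<close>

text \<open>Since \<open>4/5 = 9/10 * 8/9\<close>, the coefficients are summable against \<open>(9/10) ^ i\<close> and the remaining factor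
  \<open>(8/9) ^ i\<close> gives the decay.\<close>

lemma binomial_series_tail:
  fixes a :: real
  shows "\<exists>C\<ge>0. \<forall>M w. \<bar>w\<bar> \<le> 4/5 \<longrightarrow> \<bar>(1 + w) powr a - (\<Sum>i<M. (a gchoose i) * w ^ i)\<bar> \<le> C * (8/9) ^ M"
proof -
  define c where "c i = \<bar>a gchoose i\<bar> * (9/10) ^ i" for i
  have "summable (\<lambda>i. (a gchoose i) * (19/20) ^ i)"
    using gen_binomial_real[of "19/20" a] by (auto simp: sums_iff)
  from powser_insidea[OF this, of "9/10"] have c: "summable c" by (simp add: c_def[abs_def] abs_mult)
  have c0: "c i \<ge> 0" for i by (simp add: c_def)
  have "\<bar>(1 + w) powr a - (\<Sum>i<M. (a gchoose i) * w ^ i)\<bar> \<le> suminf c * (8/9) ^ M" if w: "\<bar>w\<bar> \<le> 4/5" for M w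
  proof -
    have s: "(\<lambda>i. (a gchoose i) * w ^ i) sums (1 + w) powr a" using w by (intro gen_binomial_real) simp
    then have "(1 + w) powr a - (\<Sum>i<M. (a gchoose i) * w ^ i) = (\<Sum>i. (a gchoose (i + M)) * w ^ (i + M))"
      using suminf_minus_initial_segment[of "\<lambda>i. (a gchoose i) * w ^ i" M] by (simp add: sums_iff)
    moreover have bound: "norm ((a gchoose (i + M)) * w ^ (i + M)) \<le> c (i + M) * (8/9) ^ M" for i
    proof -
      have "\<bar>w\<bar> ^ (i + M) \<le> (9/10 * (8/9)) ^ (i + M)" using w by (intro power_mono) auto
      also have "\<dots> \<le> (9/10) ^ (i + M) * (8/9) ^ M"
        unfolding power_mult_distrib by (intro mult_left_mono power_decreasing) auto
      finally have "\<bar>a gchoose (i + M)\<bar> * \<bar>w\<bar> ^ (i + M) \<le> \<bar>a gchoose (i + M)\<bar> * ((9/10) ^ (i + M) * (8/9) ^ M)"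
        by (rule mult_left_mono) simp
      then show ?thesis by (simp add: c_def abs_mult power_abs mult.assoc)
    qed
    moreover have sc: "summable (\<lambda>i. c (i + M) * (8/9) ^ M)"
      using summable_ignore_initial_segment[OF c, of M] by (rule summable_mult2)
    ultimately have "\<bar>(1 + w) powr a - (\<Sum>i<M. (a gchoose i) * w ^ i)\<bar> \<le> (\<Sum>i. c (i + M) * (8/9) ^ M)"
      using norm_suminf_le[OF bound sc] by simp
    also have "\<dots> = (\<Sum>i. c (i + M)) * (8/9) ^ M"
      using suminf_mult2[OF summable_ignore_initial_segment[OF c, of M]] by simp
    also have "\<dots> \<le> suminf c * (8/9) ^ M"
      using suminf_minus_initial_segment[OF c, of M] sum_nonneg[of "{..<M}" c] c0 by (intro mult_right_mono) auto
    finally show ?thesis .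
  qed
  moreover have "suminf c \<ge> 0" by (rule suminf_nonneg[OF c c0])
  ultimately show ?thesis by blast
qed

lemma binomial_approximation:
  fixes a :: real
  assumes "0 \<le> a"
  shows "\<exists>C\<ge>0. \<forall>M A w. 1 \<le> A \<longrightarrow> \<bar>w\<bar> \<le> 4/5 \<longrightarrow>
    \<bar>(A * (1 + w)) powr (- a) - A powr (- a) * (\<Sum>i<M. ((- a) gchoose i) * w ^ i)\<bar> \<le> C * (8/9) ^ M"
proof -
  obtain C where C: "C \<ge> 0" "\<And>M w. \<bar>w\<bar> \<le> 4/5 \<Longrightarrow> \<bar>(1 + w) powr (- a) - (\<Sum>i<M. ((- a) gchoose i) * w ^ i)\<bar> \<le> C * (8/9) ^ M"
    using binomial_series_tail[of "- a"] by blast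
  have "\<bar>(A * (1 + w)) powr (- a) - A powr (- a) * (\<Sum>i<M. ((- a) gchoose i) * w ^ i)\<bar> \<le> C * (8/9) ^ M"
    if A: "1 \<le> A" and w: "\<bar>w\<bar> \<le> 4/5" for M A w
  proof -
    have "(A * (1 + w)) powr (- a) - A powr (- a) * (\<Sum>i<M. ((- a) gchoose i) * w ^ i)
       = A powr (- a) * ((1 + w) powr (- a) - (\<Sum>i<M. ((- a) gchoose i) * w ^ i))"
      by (simp add: powr_mult right_diff_distrib)
    also have "\<bar>\<dots>\<bar> \<le> 1 * (C * (8/9) ^ M)"
      unfolding abs_mult using A assms C(2)[OF w] by (intro mult_mono) (auto intro: powr_le_1_of_ge_1)
    finally show ?thesis by simp
  qed
  with C(1) show ?thesis by blast
qed


text \<open>In polar coordinates the integral of each summand factors, and \<open>zero\<close> kills one of the two factors.\<close>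

lemma annulus_integral_sum_of_products:
  fixes g :: "real \<Rightarrow> complex" and p :: "'a::euclidean_space \<Rightarrow> complex"
  assumes g: "continuous_on UNIV g" and p: "continuous_on UNIV p" and J: "finite J"
    and a: "\<And>j. j \<in> J \<Longrightarrow> continuous_on UNIV (a j :: real \<Rightarrow> complex)"
    and b: "\<And>j. j \<in> J \<Longrightarrow> continuous_on UNIV (b j :: 'a \<Rightarrow> complex)"
    and zero: "\<And>j. j \<in> J \<Longrightarrow> (LINT r|shell_measure DIM('a). g r * a j r) = 0 \<or> (LINT \<omega>|sphere_measure. p \<omega> * b j \<omega>) = 0"
  shows "integrable annulus_measure (\<lambda>x. (g (norm x) * p (sgn x)) * (\<Sum>j\<in>J. a j (norm x) * b j (sgn x)))"
    "(LINT x|annulus_measure. (g (norm x) * p (sgn x)) * (\<Sum>j\<in>J. a j (norm x) * b j (sgn x))) = 0"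
proof -
  have eq: "(g (norm x) * p (sgn x)) * (\<Sum>j\<in>J. a j (norm x) * b j (sgn x)) = (\<Sum>j\<in>J. (g (norm x) * a j (norm x)) * (p (sgn x) * b j (sgn x)))" for x
    by (simp add: sum_distrib_left mult_ac)
  have P: "integrable annulus_measure (\<lambda>x. (g (norm x) * a j (norm x)) * (p (sgn x) * b j (sgn x)))"
    "(LINT x|annulus_measure. (g (norm x) * a j (norm x)) * (p (sgn x) * b j (sgn x))) = 0" if j: "j \<in> J" for j
  proof -
    have c: "continuous_on UNIV (\<lambda>r. g r * a j r)" "continuous_on UNIV (\<lambda>x. p x * b j x)"
      by (intro continuous_intros g p a b j)+
    have m: "(\<lambda>r. g r * a j r) \<in> borel_measurable borel" "(\<lambda>x. p x * b j x) \<in> borel_measurable borel"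
      using c by (auto intro: borel_measurable_continuous_onI)
    note Q = annulus_integral_product[OF m shell_integrable_continuous[OF c(1)] sphere_integrable_continuous[OF c(2)]]
    show "integrable annulus_measure (\<lambda>x. (g (norm x) * a j (norm x)) * (p (sgn x) * b j (sgn x)))" by (rule Q(1))
    show "(LINT x|annulus_measure. (g (norm x) * a j (norm x)) * (p (sgn x) * b j (sgn x))) = 0"
      unfolding Q(2) using zero[OF j] by auto
  qed
  show "integrable annulus_measure (\<lambda>x. (g (norm x) * p (sgn x)) * (\<Sum>j\<in>J. a j (norm x) * b j (sgn x)))"
    unfolding eq by (intro Bochner_Integration.integrable_sum P)
  show "(LINT x|annulus_measure. (g (norm x) * p (sgn x)) * (\<Sum>j\<in>J. a j (norm x) * b j (sgn x))) = 0"
    unfolding eq by (subst Bochner_Integration.integral_sum) (auto intro!: P sum.neutral)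
qed

lemma annulus_L1_le_L2:
  fixes F :: "'a::euclidean_space \<Rightarrow> complex"
  assumes F: "F \<in> L2 annulus_measure"
  shows "integrable annulus_measure F"
    "(LINT x|annulus_measure. norm (F x)) \<le> sqrt (measure lborel (annulus :: 'a set)) * L2_norm annulus_measure F"
proof -
  have one: "(\<lambda>x. 1) \<in> L2 (annulus_measure :: 'a measure)" "L2_norm annulus_measure (\<lambda>x::'a. 1) \<le> 1 * sqrt (measure lborel (annulus :: 'a set))"
    using annulus_L2_bounded[of "\<lambda>x::'a. 1" 1] by simp_all
  show "integrable annulus_measure F" using L2_mult_integrable(1)[OF F one(1)] by simp
  have "(LINT x|annulus_measure. norm (F x)) \<le> L2_norm annulus_measure (\<lambda>x::'a. 1) * L2_norm annulus_measure F"
    using L2_Cauchy_Schwarz_abs[OF one(1) F] by simp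
  also have "\<dots> \<le> sqrt (measure lborel (annulus :: 'a set)) * L2_norm annulus_measure F"
    using one(2) by (intro mult_right_mono) (auto simp: L2_norm_nonneg)
  finally show "(LINT x|annulus_measure. norm (F x)) \<le> sqrt (measure lborel (annulus :: 'a set)) * L2_norm annulus_measure F" .
qed

text \<open>If \<open>F\<close> is orthogonal to the approximation of \<open>K\<close>, only the error of the approximation contributes.\<close>

lemma annulus_integral_approx:
  fixes g :: "real \<Rightarrow> complex" and p :: "'a::euclidean_space \<Rightarrow> complex"
  assumes g: "continuous_on UNIV g" and p: "continuous_on UNIV p" and J: "finite J"
    and a: "\<And>j. j \<in> J \<Longrightarrow> continuous_on UNIV (a j :: real \<Rightarrow> complex)"
    and b: "\<And>j. j \<in> J \<Longrightarrow> continuous_on UNIV (b j :: 'a \<Rightarrow> complex)"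
    and zero: "\<And>j. j \<in> J \<Longrightarrow> (LINT r|shell_measure DIM('a). g r * a j r) = 0 \<or> (LINT \<omega>|sphere_measure. p \<omega> * b j \<omega>) = 0"
    and K: "K \<in> borel_measurable borel"
    and close: "\<And>x. x \<in> annulus \<Longrightarrow> norm (K x - (\<Sum>j\<in>J. a j (norm x) * b j (sgn x))) \<le> \<epsilon>" and \<epsilon>: "\<epsilon> \<ge> 0"
    and F: "\<And>x. x \<in> annulus \<Longrightarrow> F x = g (norm x) * p (sgn x)"
  shows "norm (LINT x|annulus_measure. F x * K x) \<le> \<epsilon> * (sqrt (measure lborel (annulus :: 'a set)) * L2_norm annulus_measure F)"
proof -
  define f where "f x = g (norm x) * p (sgn x)" for x
  define Q where "Q x = (\<Sum>j\<in>J. a j (norm x) * b j (sgn x))" for x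
  have fL: "f \<in> L2 annulus_measure" unfolding f_def[abs_def] by (rule annulus_L2_product(1)[OF g p])
  note f1 = annulus_L1_le_L2[OF fL]
  have fF: "L2_norm annulus_measure F = L2_norm annulus_measure f"
    by (rule L2_norm_cong) (simp add: F f_def space_annulus_measure)
  have Q: "integrable annulus_measure (\<lambda>x. f x * Q x)" "(LINT x|annulus_measure. f x * Q x) = 0"
    unfolding f_def Q_def
    by (rule annulus_integral_sum_of_products(1)[OF g p J], erule a, erule b, erule zero)
      (rule annulus_integral_sum_of_products(2)[OF g p J], erule a, erule b, erule zero)
  have [measurable]: "g \<in> borel_measurable borel" "p \<in> borel_measurable borel"
    using g p by (auto intro: borel_measurable_continuous_onI)
  have [measurable]: "a j \<in> borel_measurable borel" "b j \<in> borel_measurable borel" if "j \<in> J" for j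
    using a[OF that] b[OF that] by (auto intro: borel_measurable_continuous_onI)
  note [measurable] = K
  have Qm [measurable]: "Q \<in> borel_measurable borel" unfolding Q_def[abs_def] by (intro borel_measurable_sum) measurable
  have fm [measurable]: "f \<in> borel_measurable borel" unfolding f_def[abs_def] by measurable
  have D: "integrable annulus_measure (\<lambda>x. f x * (K x - Q x))"
  proof (rule Bochner_Integration.integrable_bound)
    show "integrable annulus_measure (\<lambda>x. \<epsilon> * norm (f x))" using f1(1) by simp
    show "(\<lambda>x. f x * (K x - Q x)) \<in> borel_measurable annulus_measure"
      by (intro measurable_restrict_space1) measurable
    show "AE x in annulus_measure. norm (f x * (K x - Q x)) \<le> norm (\<epsilon> * norm (f x))"
      using close \<epsilon> by (intro AE_I2) (auto simp: norm_mult Q_def space_annulus_measure mult.commute[of \<epsilon>] intro!: mult_left_mono)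
  qed
  have "(LINT x|annulus_measure. F x * K x) = (LINT x|annulus_measure. f x * Q x + f x * (K x - Q x))"
    by (rule Bochner_Integration.integral_cong[OF refl]) (simp add: F f_def space_annulus_measure algebra_simps)
  also have "\<dots> = (LINT x|annulus_measure. f x * (K x - Q x))"
    using Q D by simp
  also have "norm \<dots> \<le> (LINT x|annulus_measure. norm (f x * (K x - Q x)))" by (rule integral_norm_bound)
  also have "\<dots> \<le> (LINT x|annulus_measure. \<epsilon> * norm (f x))"
  proof (rule integral_mono)
    show "norm (f x * (K x - Q x)) \<le> \<epsilon> * norm (f x)" if "x \<in> space annulus_measure" for x
      using close[of x] that by (auto simp: norm_mult Q_def space_annulus_measure mult.commute[of \<epsilon>] intro!: mult_left_mono)
  qed (use D f1(1) in auto)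
  also have "\<dots> = \<epsilon> * (LINT x|annulus_measure. norm (f x))" by simp
  also have "\<dots> \<le> \<epsilon> * (sqrt (measure lborel (annulus :: 'a set)) * L2_norm annulus_measure F)"
    unfolding fF by (rule mult_left_mono[OF f1(2) \<epsilon>])
  finally show ?thesis .
qed

lemma polynomial_inner_power: "(\<lambda>\<omega>::'a::euclidean_space. complex_of_real ((x \<bullet> \<omega>) ^ i)) \<in> hom_polys i"
proof -
  have "real_polynomial_function (\<lambda>\<omega>. (x \<bullet> \<omega>) ^ i)"
    by (intro real_polynomial_function_power real_polynomial_function.intros(1) bounded_linear_inner_right)
  from polynomial_of_real[OF this] show ?thesis unfolding hom_polys_def
    by (simp add: power_mult_distrib scaleR_conv_of_real)
qed

lemma norm_powr_square: "norm (z::'a::real_normed_vector) powr (- (2 * a)) = ((norm z)\<^sup>2) powr (- a)"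
  by (cases "z = 0") (simp_all add: powr_powr powr_numeral[symmetric] del: powr_numeral)

text \<open>Here \<open>w = - 2 (x \<bullet> y) / (|x|\<^sup>2 + |y|\<^sup>2)\<close>, which is at most \<open>4/5\<close> in modulus when \<open>|x| \<le> 1\<close> and \<open>|y| \<ge> 2\<close>. Its
  \<open>i\<close>-th power is a homogeneous polynomial of degree \<open>i\<close> in the direction of \<open>y\<close>.\<close>

lemma kernel_decay_degree:
  assumes a: "0 \<le> a"
  shows "\<exists>C\<ge>0. \<forall>(x :: 'a::euclidean_space) m p g F. norm x < 1 \<longrightarrow> p \<in> harmonic_homogeneous_polys m \<longrightarrow> continuous_on UNIV g \<longrightarrow>
     (\<forall>y\<in>annulus. F y = g (norm y) * p (sgn y)) \<longrightarrow>
     norm (LINT y|annulus_measure. F y * complex_of_real (norm (x - y) powr (- (2 * a)))) \<le> C * (8/9) ^ m * L2_norm annulus_measure F"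
proof -
  obtain C where C: "C \<ge> 0" and approx: "\<And>M A w. 1 \<le> A \<Longrightarrow> \<bar>w\<bar> \<le> 4/5 \<Longrightarrow>
    \<bar>(A * (1 + w)) powr (- a) - A powr (- a) * (\<Sum>i<M. ((- a) gchoose i) * w ^ i)\<bar> \<le> C * (8/9) ^ M"
    using binomial_approximation[OF a] by blast
  have "norm (LINT y|annulus_measure. F y * complex_of_real (norm (x - y) powr (- (2 * a)))) \<le> (C * (8/9) ^ m) * (sqrt (measure lborel (annulus :: 'a set)) * L2_norm annulus_measure F)"
    if x: "norm x < 1" and p: "p \<in> harmonic_homogeneous_polys m" and g: "continuous_on UNIV g"
      and F: "\<And>y. y \<in> annulus \<Longrightarrow> F y = g (norm y) * p (sgn y)" for x :: 'a and m p g F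
  proof -
    \<comment> \<open>On the annulus \<open>max 2 r = r\<close>; the maximum keeps the radial coefficients continuous on the whole line.\<close>
    define S where "S r = (norm x)\<^sup>2 + (max 2 r)\<^sup>2" for r
    have S: "S r \<ge> 4" for r
    proof -
      have "(2::real)\<^sup>2 \<le> (max 2 r)\<^sup>2" by (intro power_mono) auto
      then show ?thesis by (simp add: S_def add_increasing)
    qed
    have S0: "S r \<noteq> 0" for r using S[of r] by auto
    define A where "A i r = complex_of_real (S r powr (- a) * ((- a) gchoose i) * (- 2 * max 2 r / S r) ^ i)" for i r
    define B where "B i \<omega> = complex_of_real ((x \<bullet> \<omega>) ^ i)" for i \<omega>
    have pc: "continuous_on UNIV p"
      using p by (intro polynomial_continuous hom_polys_polynomial) (auto simp: harmonic_homogeneous_polys_iff)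
    have Sc: "continuous_on UNIV S" unfolding S_def by (intro continuous_intros)
    show ?thesis
    proof (rule annulus_integral_approx[where g = g and p = p and J = "{..<m}" and a = A and b = B])
      show "continuous_on UNIV (A i)" for i
        unfolding A_def using S S0 by (intro continuous_intros Sc) auto
      show "continuous_on UNIV (B i)" for i unfolding B_def by (intro continuous_intros)
      show "(LINT r|shell_measure DIM('a). g r * A i r) = 0 \<or> (LINT \<omega>|sphere_measure. p \<omega> * B i \<omega>) = 0" if "i \<in> {..<m}" for i
        using sphere_orthogonal_lower_degree[OF p polynomial_inner_power[of x i]] that by (simp add: B_def)
      show "(\<lambda>y. complex_of_real (norm (x - y) powr (- (2 * a)))) \<in> borel_measurable borel" by measurable
      fix y :: 'a assume y: "y \<in> annulus"
      then have ny: "2 < norm y" by (simp add: annulus_iff)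
      define T where "T = S (norm y)"
      have T: "T = (norm x)\<^sup>2 + (norm y)\<^sup>2" using ny by (simp add: T_def S_def max_absorb2)
      have T4: "T \<ge> 4" using S by (simp add: T_def)
      define w where "w = - 2 * (x \<bullet> y) / T"
      have "\<bar>x \<bullet> y\<bar> \<le> norm x * norm y" by (rule Cauchy_Schwarz_ineq2)
      moreover have "5 * (norm x * norm y) \<le> 2 * T"
      proof -
        have "0 \<le> (norm y - 2 * norm x) * (2 * norm y - norm x)"
          using x ny norm_ge_zero[of x] by (intro mult_nonneg_nonneg) linarith+
        then show ?thesis by (simp add: T power2_eq_square algebra_simps)
      qed
      ultimately have "\<bar>2 * (x \<bullet> y)\<bar> \<le> 4/5 * T" by linarith
      then have w: "\<bar>w\<bar> \<le> 4/5" using T4 by (simp add: w_def abs_mult divide_le_eq)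
      have "(norm (x - y))\<^sup>2 = T * (1 + w)"
        using T4 by (simp add: w_def T power2_norm_eq_inner inner_diff_left inner_diff_right inner_commute field_simps)
      then have k: "norm (x - y) powr (- (2 * a)) = (T * (1 + w)) powr (- a)" by (simp only: norm_powr_square)
      have "w ^ i = (- 2 * max 2 (norm y) / T) ^ i * (x \<bullet> sgn y) ^ i" for i
      proof -
        have "x \<bullet> y = x \<bullet> (norm y *\<^sub>R sgn y)" by (simp only: norm_scaleR_sgn)
        then have "x \<bullet> y = norm y * (x \<bullet> sgn y)" by simp
        then have "w = (- 2 * max 2 (norm y) / T) * (x \<bullet> sgn y)" using ny by (simp add: w_def max_absorb2)
        then show ?thesis by (simp only: power_mult_distrib)
      qed
      then have "(\<Sum>i<m. A i (norm y) * B i (sgn y)) = complex_of_real (T powr (- a) * (\<Sum>i<m. ((- a) gchoose i) * w ^ i))"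
        by (simp add: A_def B_def T_def sum_distrib_left mult_ac)
      then have "norm (complex_of_real (norm (x - y) powr (- (2 * a))) - (\<Sum>i<m. A i (norm y) * B i (sgn y)))
         = \<bar>(T * (1 + w)) powr (- a) - T powr (- a) * (\<Sum>i<m. ((- a) gchoose i) * w ^ i)\<bar>"
        unfolding k by (simp only: of_real_diff[symmetric] norm_of_real)
      then show "norm (complex_of_real (norm (x - y) powr (- (2 * a))) - (\<Sum>i<m. A i (norm y) * B i (sgn y))) \<le> C * (8/9) ^ m"
        using approx[OF _ w, of T m] T4 by simp
    qed (use C F in \<open>auto intro: g pc\<close>)
  qed
  then show ?thesis using C
    by (intro exI[of _ "C * sqrt (measure lborel (annulus :: 'a set))"]) (auto simp: mult_ac)
qed

lemma shell_poly_orthogonal_shifted_power: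
  assumes "d < k" shows "(LINT r|shell_measure n. poly (shell_poly n k) r * (r - c) ^ d) = 0"
proof -
  have i: "integrable (shell_measure n) (\<lambda>r. poly (shell_poly n k) r * r ^ i)" for i
    by (rule shell_integrable_continuous) (intro continuous_intros)
  have "(LINT r|shell_measure n. poly (shell_poly n k) r * (r - c) ^ d)
      = (LINT r|shell_measure n. (\<Sum>i\<le>d. (of_nat (d choose i) * (- c) ^ (d - i)) * (poly (shell_poly n k) r * r ^ i)))"
  proof (rule Bochner_Integration.integral_cong[OF refl])
    show "poly (shell_poly n k) r * (r - c) ^ d = (\<Sum>i\<le>d. (of_nat (d choose i) * (- c) ^ (d - i)) * (poly (shell_poly n k) r * r ^ i))" for r
      using binomial_ring[of r "- c" d] by (simp add: sum_distrib_left mult_ac)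
  qed
  also have "\<dots> = (\<Sum>i\<le>d. (of_nat (d choose i) * (- c) ^ (d - i)) * (LINT r|shell_measure n. poly (shell_poly n k) r * r ^ i))"
    using i by (subst Bochner_Integration.integral_sum) auto
  also have "\<dots> = 0" using assms by (simp add: shell_poly_orthogonal_power)
  finally show ?thesis .
qed

text \<open>Write \<open>\<omega>\<close> for the direction of \<open>y\<close>, \<open>t = |y| - 5/2\<close> and \<open>z = (5/2) \<omega> - x\<close>. Then \<open>|x - y|\<^sup>2 = |z|\<^sup>2 (1 + w)\<close> with
  \<open>w = t (2 \<omega> \<bullet> z + t) / |z|\<^sup>2\<close>; as \<open>|t| \<le> 1/2\<close> and \<open>|z| \<ge> 3/2\<close>, in fact \<open>|w| \<le> 7/9\<close>. Each power of \<open>w\<close> has twice its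
  degree in \<open>t\<close>, so \<open>(k + 1) div 2\<close> terms stay below degree \<open>k\<close>.\<close>

lemma kernel_decay_radial:
  assumes a: "0 \<le> a"
  shows "\<exists>C\<ge>0. \<forall>(x :: 'a::euclidean_space) k p F. norm x < 1 \<longrightarrow> continuous_on UNIV p \<longrightarrow>
     (\<forall>y\<in>annulus. F y = complex_of_real (poly (shell_poly DIM('a) k) (norm y)) * p (sgn y)) \<longrightarrow>
     norm (LINT y|annulus_measure. F y * complex_of_real (norm (x - y) powr (- (2 * a)))) \<le> C * (8/9) ^ ((k + 1) div 2) * L2_norm annulus_measure F"
proof -
  obtain C where C: "C \<ge> 0" and approx: "\<And>M A w. 1 \<le> A \<Longrightarrow> \<bar>w\<bar> \<le> 4/5 \<Longrightarrow>
    \<bar>(A * (1 + w)) powr (- a) - A powr (- a) * (\<Sum>i<M. ((- a) gchoose i) * w ^ i)\<bar> \<le> C * (8/9) ^ M"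
    using binomial_approximation[OF a] by blast
  have "norm (LINT y|annulus_measure. F y * complex_of_real (norm (x - y) powr (- (2 * a)))) \<le> (C * (8/9) ^ ((k + 1) div 2)) * (sqrt (measure lborel (annulus :: 'a set)) * L2_norm annulus_measure F)"
    if x: "norm x < 1" and p: "continuous_on UNIV p"
      and F: "\<And>y. y \<in> annulus \<Longrightarrow> F y = complex_of_real (poly (shell_poly DIM('a) k) (norm y)) * p (sgn y)" for x :: 'a and k p F
  proof -
    define M where "M = (k + 1) div 2"
    define g where "g r = complex_of_real (poly (shell_poly DIM('a) k) r)" for r
    \<comment> \<open>On the sphere the maximum is the second entry; it keeps the angular coefficients continuous everywhere.\<close>
    define A where "A \<omega> = max (9/4) ((norm (x - (5/2) *\<^sub>R \<omega>))\<^sup>2)" for \<omega>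
    define b where "b \<omega> = \<omega> \<bullet> ((5/2) *\<^sub>R \<omega> - x)" for \<omega>
    have A: "A \<omega> \<ge> 9/4" for \<omega> by (simp add: A_def)
    have A0: "A \<omega> \<noteq> 0" "A \<omega> > 0" for \<omega> using A[of \<omega>] by linarith+
    define J where "J = (SIGMA i:{..<M}. {..i})"
    define R where "R ij r = complex_of_real ((r - 5/2) ^ (fst ij + snd ij))" for ij :: "nat \<times> nat" and r
    define H where "H ij \<omega> = complex_of_real (A \<omega> powr (- a) * ((- a) gchoose fst ij) * (of_nat (fst ij choose snd ij) * (2 * b \<omega>) ^ (fst ij - snd ij)) / A \<omega> ^ fst ij)" for ij :: "nat \<times> nat" and \<omega>
    have Ac: "continuous_on UNIV A" unfolding A_def by (intro continuous_intros)
    have bc: "continuous_on UNIV b" unfolding b_def by (intro continuous_intros)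
    have "norm (LINT y|annulus_measure. F y * complex_of_real (norm (x - y) powr (- (2 * a)))) \<le> (C * (8/9) ^ M) * (sqrt (measure lborel (annulus :: 'a set)) * L2_norm annulus_measure F)"
    proof (rule annulus_integral_approx[where g = g and p = p and J = J and a = R and b = H])
      show "continuous_on UNIV g" unfolding g_def by (intro continuous_intros)
      show "continuous_on UNIV (R ij)" for ij unfolding R_def by (intro continuous_intros)
      show "continuous_on UNIV (H ij)" for ij
        unfolding H_def using A0 by (intro continuous_intros Ac bc) (auto simp: less_imp_neq)
      show "(LINT r|shell_measure DIM('a). g r * R ij r) = 0 \<or> (LINT \<omega>|sphere_measure. p \<omega> * H ij \<omega>) = 0" if "ij \<in> J" for ij
      proof -
        have "fst ij + snd ij < k" using that by (auto simp: J_def M_def)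
        from shell_poly_orthogonal_shifted_power[OF this, of "DIM('a)" "5/2"]
        have "(LINT r|shell_measure DIM('a). g r * R ij r) = 0"
          unfolding g_def R_def of_real_mult[symmetric] integral_complex_of_real by simp
        then show ?thesis ..
      qed
      show "(\<lambda>y. complex_of_real (norm (x - y) powr (- (2 * a)))) \<in> borel_measurable borel" by measurable
      fix y :: 'a assume y: "y \<in> annulus"
      then have ny: "2 < norm y" "norm y < 3" by (simp_all add: annulus_iff)
      define \<omega> where "\<omega> = sgn y"
      have \<omega>: "norm \<omega> = 1" using sgn_in_sphere[OF y] by (simp add: \<omega>_def)
      have y\<omega>: "y = norm y *\<^sub>R \<omega>" unfolding \<omega>_def by (simp only: norm_scaleR_sgn)
      define t where "t = norm y - 5/2"
      have t: "\<bar>t\<bar> \<le> 1/2" using ny unfolding t_def by linarith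
      define z where "z = (5/2) *\<^sub>R \<omega> - x"
      have z: "norm z \<ge> 3/2" using norm_triangle_ineq2[of "(5/2) *\<^sub>R \<omega>" x] x \<omega> by (simp add: z_def)
      have z2: "(norm z)\<^sup>2 \<ge> 9/4" using power_mono[OF z, of 2] by (simp add: power2_eq_square)
      then have Az: "A \<omega> = (norm z)\<^sup>2" by (simp add: A_def z_def norm_minus_commute max_absorb2)
      have bz: "\<bar>b \<omega>\<bar> \<le> norm z" using Cauchy_Schwarz_ineq2[of \<omega> z] \<omega> by (simp add: b_def z_def)
      define w where "w = (t * (2 * b \<omega> + t)) / A \<omega>"
      have w: "\<bar>w\<bar> \<le> 4/5"
      proof -
        have "\<bar>t * (2 * b \<omega> + t)\<bar> \<le> (1/2) * (2 * norm z + 1/2)"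
          unfolding abs_mult using t bz by (intro mult_mono) linarith+
        also have "\<dots> \<le> 4/5 * (norm z)\<^sup>2"
        proof -
          have "3/2 * norm z \<le> norm z * norm z" using z by (intro mult_right_mono) auto
          then show ?thesis using z2 by (simp add: power2_eq_square)
        qed
        finally show ?thesis using A0(2)[of \<omega>] by (simp add: w_def Az[symmetric] abs_mult pos_divide_le_eq)
      qed
      have "(norm (x - y))\<^sup>2 = (norm (z + t *\<^sub>R \<omega>))\<^sup>2"
      proof -
        have "x - y = - (z + t *\<^sub>R \<omega>)" by (subst y\<omega>) (simp add: z_def t_def algebra_simps)
        then show ?thesis by (simp only: norm_minus_cancel)
      qed
      also have "\<dots> = (norm z)\<^sup>2 + 2 * t * b \<omega> + t\<^sup>2"
        using \<omega> unfolding power2_norm_eq_inner b_def z_def[symmetric]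
        by (simp add: inner_add_left inner_add_right inner_commute power2_eq_square norm_eq_1 algebra_simps)
      also have "\<dots> = A \<omega> * (1 + w)" unfolding Az[symmetric] using A0(1)[of \<omega>] by (simp add: w_def field_simps power2_eq_square)
      finally have k: "norm (x - y) powr (- (2 * a)) = (A \<omega> * (1 + w)) powr (- a)" by (simp only: norm_powr_square)
      have "(\<Sum>ij\<in>J. R ij (norm y) * H ij (sgn y)) = (\<Sum>i<M. \<Sum>j\<le>i. R (i, j) (norm y) * H (i, j) \<omega>)"
        unfolding J_def \<omega>_def by (subst sum.Sigma) auto
      also have "\<dots> = complex_of_real (\<Sum>i<M. \<Sum>j\<le>i. A \<omega> powr (- a) * ((- a) gchoose i) * (t ^ (i + j) * (of_nat (i choose j) * (2 * b \<omega>) ^ (i - j))) / A \<omega> ^ i)"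
        unfolding of_real_sum by (intro sum.cong refl) (simp add: R_def H_def t_def mult_ac)
      also have "(\<Sum>i<M. \<Sum>j\<le>i. A \<omega> powr (- a) * ((- a) gchoose i) * (t ^ (i + j) * (of_nat (i choose j) * (2 * b \<omega>) ^ (i - j))) / A \<omega> ^ i)
         = A \<omega> powr (- a) * (\<Sum>i<M. ((- a) gchoose i) * w ^ i)"
        unfolding sum_distrib_left
      proof (rule sum.cong[OF refl])
        fix i
        have "(t + 2 * b \<omega>) ^ i = (\<Sum>j\<le>i. of_nat (i choose j) * t ^ j * (2 * b \<omega>) ^ (i - j))" by (rule binomial_ring)
        then have "w ^ i = t ^ i * (\<Sum>j\<le>i. of_nat (i choose j) * t ^ j * (2 * b \<omega>) ^ (i - j)) / A \<omega> ^ i"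
          by (simp add: w_def power_mult_distrib power_divide add.commute)
        then show "(\<Sum>j\<le>i. A \<omega> powr (- a) * ((- a) gchoose i) * (t ^ (i + j) * (of_nat (i choose j) * (2 * b \<omega>) ^ (i - j))) / A \<omega> ^ i)
          = A \<omega> powr (- a) * (((- a) gchoose i) * w ^ i)"
          by (simp add: sum_distrib_left sum_divide_distrib power_add mult_ac)
      qed
      finally have "norm (complex_of_real (norm (x - y) powr (- (2 * a))) - (\<Sum>ij\<in>J. R ij (norm y) * H ij (sgn y)))
         = \<bar>(A \<omega> * (1 + w)) powr (- a) - A \<omega> powr (- a) * (\<Sum>i<M. ((- a) gchoose i) * w ^ i)\<bar>"
        unfolding k by (simp only: of_real_diff[symmetric] norm_of_real)
      then show "norm (complex_of_real (norm (x - y) powr (- (2 * a))) - (\<Sum>ij\<in>J. R ij (norm y) * H ij (sgn y))) \<le> C * (8/9) ^ M"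
        using approx[OF _ w, of "A \<omega>" M] A[of \<omega>] by simp
    qed (use C F in \<open>auto intro: p simp: J_def g_def\<close>)
    then show ?thesis by (simp add: M_def)
  qed
  then show ?thesis using C
    by (intro exI[of _ "C * sqrt (measure lborel (annulus :: 'a set))"]) (auto simp: mult_ac)
qed


section \<open>Exponential decay\<close>

text \<open>One of \<open>m\<close> and \<open>(k + 1) div 2\<close> is at least a third of \<open>m + k\<close>.\<close>

lemma min_decay_imp_sum_decay:
  fixes m k :: nat and t :: real
  assumes "t \<le> B * (8/9) ^ m" "t \<le> B * (8/9) ^ ((k + 1) div 2)" "B \<ge> 0"
  shows "t \<le> B * exp (- (ln (9/8) / 3) * real (m + k))"
proof -
  have pow: "(8/9 :: real) ^ j = exp (- ln (9/8) * real j)" for j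
  proof -
    have "(8/9 :: real) = exp (- ln (9/8))" by (simp add: exp_minus)
    then have "(8/9 :: real) ^ j = exp (- ln (9/8)) ^ j" by (rule arg_cong)
    also have "\<dots> = exp (real j * (- ln (9/8)))" by (rule exp_of_nat_mult[symmetric])
    finally show ?thesis by (simp add: mult.commute)
  qed
  have *: "B * (8/9) ^ j \<le> B * exp (- (ln (9/8) / 3) * real (m + k))" if "m + k \<le> 3 * j" for j
  proof (rule mult_left_mono[OF _ assms(3)])
    have "ln (9/8) * (real (m + k) / 3) \<le> ln (9/8) * real j" using that by (intro mult_left_mono) auto
    then show "(8/9) ^ j \<le> exp (- (ln (9/8) / 3) * real (m + k))" unfolding pow by simp
  qed
  show ?thesis
  proof (cases "m + k \<le> 3 * m")
    case True from order_trans[OF assms(1) *[OF this]] show ?thesis .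
  next
    case False
    then have "m + k \<le> 3 * ((k + 1) div 2)" by linarith
    from order_trans[OF assms(2) *[OF this]] show ?thesis .
  qed
qed

lemma annulus_disjoint_ball: "x \<in> ball 0 1 \<Longrightarrow> x \<notin> annulus"
  by (auto simp: annulus_iff)

text \<open>The kernel integral is, up to a constant, the right-hand side of the problem for the correction, and the
  measure of the ball converts its supremum into a bound in \<open>L\<^sup>2\<close>.\<close>

lemma A0_bound:
  assumes s: "0 < s" "s < 1"
  shows "\<exists>C\<ge>0. \<forall>(f :: 'a::euclidean_space \<Rightarrow> complex) E. f \<in> L2 annulus_measure \<longrightarrow> 0 \<le> E \<longrightarrow>
     (\<forall>x. norm x < 1 \<longrightarrow> norm (LINT y|annulus_measure. f y * complex_of_real (norm (x - y) powr (- (real DIM('a) + 2 * s)))) \<le> E) \<longrightarrow>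
     A0 s f \<in> L2 (restrict_space lborel (ball 0 1)) \<and> L2_norm (restrict_space lborel (ball 0 1)) (A0 s f) \<le> C * E"
proof -
  let ?e = "- (real DIM('a) + 2 * s)"
  obtain \<kappa> where \<kappa>: "\<And>(w :: 'a \<Rightarrow> complex) \<phi>. \<phi> \<in> test_functions (ball 0 1) \<Longrightarrow> integrable lborel w \<Longrightarrow> w \<in> L2 lborel \<Longrightarrow>
      (\<And>y. norm y \<le> 2 \<Longrightarrow> w y = 0) \<Longrightarrow>
      frac_laplacian s w \<phi> = of_real \<kappa> * (LINT x|lborel. \<phi> x * (LINT y|lborel. w y * of_real (norm (x - y) powr ?e)))"
    using frac_laplacian_kernel[OF s, where 'a='a] by blast
  obtain D where D: "D > 0" and corr: "\<forall>(f :: 'a \<Rightarrow> complex) \<epsilon>. 0 \<le> \<epsilon> \<longrightarrow> extend_zero f \<in> L2 lborel \<longrightarrow>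
     (\<forall>\<phi>\<in>test_functions (ball 0 1). norm (frac_laplacian s (extend_zero f) \<phi>) \<le> \<epsilon> * L2_norm lborel \<phi>) \<longrightarrow>
     (\<exists>v. is_correction s f v) \<and> (\<forall>v. is_correction s f v \<longrightarrow> v \<in> L2 lborel \<and> L2_norm lborel v \<le> D * \<epsilon>)"
    using correction_exists_and_bounded[OF s, where 'a='a] by (elim exE conjE) (rule that)
  define V where "V = sqrt (measure lborel (ball (0::'a) 1))"
  have V: "V \<ge> 0" by (simp add: V_def)
  have "A0 s f \<in> L2 (restrict_space lborel (ball 0 1)) \<and> L2_norm (restrict_space lborel (ball 0 1)) (A0 s f) \<le> D * (\<bar>\<kappa>\<bar> * V) * E"
    if f: "f \<in> L2 annulus_measure" and E: "0 \<le> E"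
      and K: "\<And>x. norm x < 1 \<Longrightarrow> norm (LINT y|annulus_measure. f y * complex_of_real (norm (x - y) powr ?e)) \<le> E"
    for f :: "'a \<Rightarrow> complex" and E
  proof -
    note wL = extend_zero_L2[OF f]
    have S: "annulus \<inter> space (lborel :: 'a measure) \<in> sets lborel" by simp
    have w1: "integrable lborel (extend_zero f)"
    proof -
      have "integrable lborel (\<lambda>x. indicator annulus x *\<^sub>R f x)"
        using annulus_L1_le_L2(1)[OF f] integrable_restrict_space[OF S, of f] by simp
      also have "(\<lambda>x. indicator annulus x *\<^sub>R f x) = extend_zero f" by (auto simp: extend_zero_def fun_eq_iff)
      finally show ?thesis .
    qed
    have w0: "extend_zero f y = 0" if "norm y \<le> 2" for y using that by (auto simp: extend_zero_def annulus_iff)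
    define \<Phi> where "\<Phi> x = (LINT y|lborel. extend_zero f y * of_real (norm (x - y) powr ?e))" for x
    have \<Phi>: "\<Phi> x = (LINT y|annulus_measure. f y * complex_of_real (norm (x - y) powr ?e))" for x
      unfolding \<Phi>_def integral_restrict_space[OF S]
      by (rule Bochner_Integration.integral_cong) (auto simp: extend_zero_def)
    have bound: "norm (frac_laplacian s (extend_zero f) \<phi>) \<le> (\<bar>\<kappa>\<bar> * V * E) * L2_norm lborel \<phi>"
      if \<phi>: "\<phi> \<in> test_functions (ball 0 1)" for \<phi>
    proof -
      have "norm (LINT x|lborel. \<phi> x * \<Phi> x) \<le> (LINT x|lborel. norm (\<phi> x * \<Phi> x))" by (rule integral_norm_bound)
      also have "\<dots> \<le> (LINT x|lborel. E * norm (\<phi> x))"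
      proof (rule integral_mono_AE')
        show "integrable lborel (\<lambda>x. E * norm (\<phi> x))" using test_functions_integrable[OF \<phi>] by simp
        show "AE x in lborel. norm (\<phi> x * \<Phi> x) \<le> E * norm (\<phi> x)"
        proof (rule AE_I2)
          show "norm (\<phi> x * \<Phi> x) \<le> E * norm (\<phi> x)" for x
            using K[of x] test_functions_outside[OF \<phi>, of x] unfolding \<Phi>[symmetric]
            by (cases "norm x < 1") (auto simp: norm_mult mult.commute[of E] intro!: mult_left_mono)
        qed
      qed (use E in auto)
      also have "\<dots> = E * (LINT x|lborel. norm (\<phi> x))" by simp
      also have "\<dots> \<le> E * (V * L2_norm lborel \<phi>)"
        using test_functions_L1_le_L2[OF \<phi>] E unfolding V_def by (intro mult_left_mono)
      finally have "\<bar>\<kappa>\<bar> * norm (LINT x|lborel. \<phi> x * \<Phi> x) \<le> \<bar>\<kappa>\<bar> * (E * (V * L2_norm lborel \<phi>))"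
        by (rule mult_left_mono) simp
      moreover have "frac_laplacian s (extend_zero f) \<phi> = of_real \<kappa> * (LINT x|lborel. \<phi> x * \<Phi> x)"
        unfolding \<Phi>_def by (rule \<kappa>[OF \<phi> w1 wL]) (rule w0)
      ultimately show ?thesis by (simp add: norm_mult mult_ac)
    qed
    have "0 \<le> \<bar>\<kappa>\<bar> * V * E" using V E by simp
    note C = corr[rule_format, OF this wL bound]
    define v where "v = (SOME v. is_correction s f v)"
    have "is_correction s f v" unfolding v_def using C by (metis someI_ex)
    with C have v: "v \<in> L2 lborel" "L2_norm lborel v \<le> D * (\<bar>\<kappa>\<bar> * V * E)" by blast+
    have A0: "v x = A0 s f x" if "x \<in> space (restrict_space lborel (ball 0 1))" for x
    proof -
      have "x \<in> ball 0 1" using that by (simp add: space_restrict_space)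
      then show ?thesis using annulus_disjoint_ball[of x]
        by (simp add: A0_def solution_def Let_def v_def[symmetric] extend_zero_def)
    qed
    have "A0 s f \<in> L2 (restrict_space lborel (ball 0 1))"
      by (rule L2_cong[OF L2_norm_restrict_le(1)[OF v(1)] A0]) auto
    moreover have "L2_norm (restrict_space lborel (ball 0 1)) (A0 s f) = L2_norm (restrict_space lborel (ball 0 1)) v"
      by (rule L2_norm_cong) (simp only: A0)
    moreover have "L2_norm (restrict_space lborel (ball 0 1)) v \<le> L2_norm lborel v"
      by (rule L2_norm_restrict_le(2)[OF v(1)]) auto
    ultimately show ?thesis using v(2) by (simp add: mult.assoc)
  qed
  moreover have "D * (\<bar>\<kappa>\<bar> * V) \<ge> 0" using D V by simp
  ultimately show ?thesis by blast
qed

theorem lemma2p1: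
  fixes s :: real
  assumes "0 < s" and "s < 1"
  shows "\<exists>C>0. \<exists>c>0.
    \<forall>(N :: nat \<Rightarrow> nat) (h :: nat \<Rightarrow> nat \<Rightarrow> real ^ 'n \<Rightarrow> complex).
      (\<forall>m. orthonormal_basis sphere_measure (spherical_harmonics m) {..<N m} (h m)) \<longrightarrow>
      (\<exists>(g :: nat \<Rightarrow> nat \<Rightarrow> real \<Rightarrow> real) (f :: nat \<times> nat \<times> nat \<Rightarrow> real ^ 'n \<Rightarrow> complex).
        (\<forall>m k l. l < N m \<longrightarrow>
          (\<forall>x \<in> annulus. f (m, k, l) x = of_real (g m k (norm x)) * h m l (sgn x))) \<and>
        orthonormal_basis (restrict_space lborel annulus) (L2 (restrict_space lborel annulus))
          {(m, k, l). l < N m} f \<and>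
        (\<forall>m k l. l < N m \<longrightarrow>
          A0 s (f (m, k, l)) \<in> L2 (restrict_space lborel (ball 0 1)) \<and>
          L2_norm (restrict_space lborel (ball 0 1)) (A0 s (f (m, k, l)))
            \<le> C * exp (- c * real (m + k))))"
proof -
  define n where "n = DIM(real ^ 'n)"
  define a where "a = real n / 2 + s"
  have a: "0 \<le> a" using assms by (simp add: a_def)
  have 2: "- (2 * a) = - (real DIM(real ^ 'n) + 2 * s)" by (simp add: a_def n_def)
  obtain C0 where C0: "C0 \<ge> 0" and bound: "\<And>(f :: real ^ 'n \<Rightarrow> complex) E. f \<in> L2 annulus_measure \<Longrightarrow> 0 \<le> E \<Longrightarrow>
     (\<And>x. norm x < 1 \<Longrightarrow> norm (LINT y|annulus_measure. f y * complex_of_real (norm (x - y) powr (- (2 * a)))) \<le> E) \<Longrightarrow>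
     A0 s f \<in> L2 (restrict_space lborel (ball 0 1)) \<and> L2_norm (restrict_space lborel (ball 0 1)) (A0 s f) \<le> C0 * E"
    using A0_bound[OF assms, where 'a = "real ^ 'n"] unfolding 2 by blast
  obtain C1 where C1: "C1 \<ge> 0" and deg: "\<And>(x :: real ^ 'n) m p g F. norm x < 1 \<Longrightarrow> p \<in> harmonic_homogeneous_polys m \<Longrightarrow> continuous_on UNIV g \<Longrightarrow>
     (\<And>y. y \<in> annulus \<Longrightarrow> F y = g (norm y) * p (sgn y)) \<Longrightarrow>
     norm (LINT y|annulus_measure. F y * complex_of_real (norm (x - y) powr (- (2 * a)))) \<le> C1 * (8/9) ^ m * L2_norm annulus_measure F"
    using kernel_decay_degree[OF a, where 'a = "real ^ 'n"] by blast
  obtain C2 where C2: "C2 \<ge> 0" and rad: "\<And>(x :: real ^ 'n) k p F. norm x < 1 \<Longrightarrow> continuous_on UNIV p \<Longrightarrow>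
     (\<And>y. y \<in> annulus \<Longrightarrow> F y = complex_of_real (poly (shell_poly DIM(real ^ 'n) k) (norm y)) * p (sgn y)) \<Longrightarrow>
     norm (LINT y|annulus_measure. F y * complex_of_real (norm (x - y) powr (- (2 * a)))) \<le> C2 * (8/9) ^ ((k + 1) div 2) * L2_norm annulus_measure F"
    using kernel_decay_radial[OF a, where 'a = "real ^ 'n"] by blast
  define C where "C = max C1 C2"
  define c where "c = ln (9/8) / (3::real)"
  define C' where "C' = C0 * C + 1"
  have C: "C \<ge> 0" "C1 \<le> C" "C2 \<le> C" using C1 by (auto simp: C_def)
  have C': "C' > 0" using C0 C by (simp add: C'_def add_nonneg_pos)
  have c: "c > 0" by (simp add: c_def)
  have main: "\<exists>(g :: nat \<Rightarrow> nat \<Rightarrow> real \<Rightarrow> real) (f :: nat \<times> nat \<times> nat \<Rightarrow> real ^ 'n \<Rightarrow> complex).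
        (\<forall>m k l. l < N m \<longrightarrow> (\<forall>x \<in> annulus. f (m, k, l) x = of_real (g m k (norm x)) * h m l (sgn x))) \<and>
        orthonormal_basis annulus_measure (L2 annulus_measure) {(m, k, l). l < N m} f \<and>
        (\<forall>m k l. l < N m \<longrightarrow>
          A0 s (f (m, k, l)) \<in> L2 (restrict_space lborel (ball 0 1)) \<and>
          L2_norm (restrict_space lborel (ball 0 1)) (A0 s (f (m, k, l))) \<le> C' * exp (- c * real (m + k)))"
    if h: "\<forall>m. orthonormal_basis sphere_measure (spherical_harmonics m) {..<N m} (h m)"
    for N :: "nat \<Rightarrow> nat" and h :: "nat \<Rightarrow> nat \<Rightarrow> real ^ 'n \<Rightarrow> complex"
  proof -
    define g where "g m k = poly (shell_poly DIM(real ^ 'n) k)" for m k :: nat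
    define f where "f = (\<lambda>(m, k, l) x. complex_of_real (poly (shell_poly DIM(real ^ 'n) k) (norm x)) * h m l (sgn x))"
    have f: "f (m, k, l) x = of_real (poly (shell_poly DIM(real ^ 'n) k) (norm x)) * h m l (sgn x)" for m k l x
      by (simp add: f_def)
    have basis: "orthonormal_basis annulus_measure (L2 annulus_measure) {(m, k, l). l < N m} f"
      using h f by (intro annulus_product_basis) auto
    have decay: "A0 s (f (m, k, l)) \<in> L2 (restrict_space lborel (ball 0 1)) \<and>
          L2_norm (restrict_space lborel (ball 0 1)) (A0 s (f (m, k, l))) \<le> C' * exp (- c * real (m + k))"
      if l: "l < N m" for m k l
    proof -
      let ?f = "f (m, k, l)"
      have fL: "?f \<in> L2 annulus_measure" and "L2_inner annulus_measure ?f ?f = 1"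
        using basis l unfolding orthonormal_basis_def by auto
      then have "complex_of_real ((L2_norm annulus_measure ?f)\<^sup>2) = of_real 1" by (simp only: L2_inner_self of_real_1)
      then have "(L2_norm annulus_measure ?f)\<^sup>2 = 1" by (simp only: of_real_eq_iff)
      then have norm1: "L2_norm annulus_measure ?f = 1"
        using L2_norm_nonneg[of annulus_measure ?f] by (simp add: power2_eq_1_iff)
      have "h m l \<in> spherical_harmonics m" using h l unfolding orthonormal_basis_def by auto
      then obtain p where p: "p \<in> harmonic_homogeneous_polys m" and hp: "\<And>x. x \<in> sphere 0 1 \<Longrightarrow> h m l x = p x"
        by (auto simp: spherical_harmonics_def)
      have fp: "?f y = complex_of_real (poly (shell_poly DIM(real ^ 'n) k) (norm y)) * p (sgn y)" if "y \<in> annulus" for y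
        using hp[OF sgn_in_sphere[OF that]] by (simp add: f)
      have pc: "continuous_on UNIV p"
        using p by (intro polynomial_continuous hom_polys_polynomial) (auto simp: harmonic_homogeneous_polys_iff)
      have gc: "continuous_on UNIV (\<lambda>r. complex_of_real (poly (shell_poly DIM(real ^ 'n) k) r))"
        by (intro continuous_intros)
      have "norm (LINT y|annulus_measure. ?f y * complex_of_real (norm (x - y) powr (- (2 * a)))) \<le> C * exp (- c * real (m + k))"
        if x: "norm x < 1" for x
        unfolding c_def
      proof (rule min_decay_imp_sum_decay[OF _ _ C(1)])
        have "norm (LINT y|annulus_measure. ?f y * complex_of_real (norm (x - y) powr (- (2 * a)))) \<le> C1 * (8/9) ^ m"
          using deg[OF x p gc fp] by (simp add: norm1)
        also have "\<dots> \<le> C * (8/9) ^ m" using C by (intro mult_right_mono) auto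
        finally show "norm (LINT y|annulus_measure. ?f y * complex_of_real (norm (x - y) powr (- (2 * a)))) \<le> C * (8/9) ^ m" .
        have "norm (LINT y|annulus_measure. ?f y * complex_of_real (norm (x - y) powr (- (2 * a)))) \<le> C2 * (8/9) ^ ((k + 1) div 2)"
          using rad[OF x pc fp] by (simp add: norm1)
        also have "\<dots> \<le> C * (8/9) ^ ((k + 1) div 2)" using C by (intro mult_right_mono) auto
        finally show "norm (LINT y|annulus_measure. ?f y * complex_of_real (norm (x - y) powr (- (2 * a)))) \<le> C * (8/9) ^ ((k + 1) div 2)" .
      qed
      moreover have "0 \<le> C * exp (- c * real (m + k))" using C by simp
      ultimately have B: "A0 s ?f \<in> L2 (restrict_space lborel (ball 0 1)) \<and>
          L2_norm (restrict_space lborel (ball 0 1)) (A0 s ?f) \<le> C0 * (C * exp (- c * real (m + k)))"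
        by (intro bound fL)
      have "C0 * (C * exp (- c * real (m + k))) \<le> C' * exp (- c * real (m + k))"
        unfolding mult.assoc[symmetric] by (intro mult_right_mono) (auto simp: C'_def)
      with B show ?thesis by linarith
    qed
    show ?thesis
      by (intro exI[of _ g] exI[of _ f] conjI allI impI ballI basis) (use decay in \<open>auto simp: f g_def\<close>)
  qed
  show ?thesis
    by (rule exI[of _ C'], rule conjI[OF C'], rule exI[of _ c], rule conjI[OF c]) (intro allI impI, rule main)
qed

end
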